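(* Let $c_0>1$ and $\tau_0\in\mathbb{R}$. For every $\varepsilon>0$ there exist $\delta>0$ and $C>0$ such that the following holds for every $v_0\in l^2$ with $\|v_0\|_{l^2}<\delta$. Let $u(t)$ be the solution of the Toda lattice equation $\frac{du}{dt}=JH'(u)$ with $u(0)=u_{c_0}(\tau_0)+v_0$. Then there exist constants $c_+>1$ and $\sigma\in(1,c_+)$ and $C^1$-functions $x(t)$ and $c(t)$ of $t\in\mathbb{R}$ such that $$\|u(t)-\tilde u_{c_0}(\cdot-x(t))\|_{l^2}<\varepsilon\quad\text{for all }t\in\mathbb{R},$$ $$\lim_{t\to\infty}\left\|u(t)-\tilde u_{c_+}(\cdot-x(t))\right\|_{l^2(n\ge\sigma t)}=0,$$ $$\sup_{t\in\mathbb{R}}\left(|c(t)-c_0|+|\dot x(t)-c_0|\right)\le C\|v_0\|_{l^2},$$ $$\lim_{t\to\infty}c(t)=c_+,\qquad \lim_{t\to\infty}\dot x(t)=c_+.$$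
   Context: Unknowns are $\mathbb{R}^2$-valued sequences $u(t,n)=(r(t,n),p(t,n))$, $n\in\mathbb{Z}$. $l^2$ is the space of $\mathbb{R}^2$-valued sequences on $\mathbb{Z}$ with $\|u\|_{l^2}=(\sum_{n\in\mathbb{Z}}|u(n)|^2)^{1/2}$, and $\|u\|_{l^2(n\ge m)}=(\sum_{n\ge m}|u(n)|^2)^{1/2}$. Toda lattice: let $V(r)=e^{-r}-1+r$ and $H(u)=\sum_{n\in\mathbb{Z}}\left(\frac12p(n)^2+V(r(n))\right)$. $H'$ is the Fréchet derivative of $H$ in $l^2$, i.e. $H'(u)=(V'(r),p)$, and $J=\begin{pmatrix}0&e^{\partial}-1\\1-e^{-\partial}&0\end{pmatrix}$ with shifts $(e^{\pm\partial}f)(n)=f(n\pm1)$. Thus $\frac{du}{dt}=JH'(u)$ reads $\dot r(t,n)=p(t,n+1)-p(t,n)$, $\dot p(t,n)=V'(r(t,n))-V'(r(t,n-1))$. 1-solitons: for $c>1$ let $\kappa=\kappa(c)$ be the unique positive solution of $c=\sinh\kappa/\kappa$, and for $x\in\mathbb{R}$ set $\tilde q_c(x)=\log\frac{\cosh\{\kappa(x-1)\}}{\cosh\kappa x}$, $\tilde p_c(x)=-c\,\partial_x\tilde q_c(x)$, $\tilde r_c(x)=\tilde q_c(x+1)-\tilde q_c(x)$, $\tilde u_c(x)=(\tilde r_c(x),\tilde p_c(x))$. Then $u_c(t)$ is the sequence $u_c(t,n)=\tilde u_c(n-ct)$, a solution of the Toda lattice equation; $\tilde u_c(\cdot-x)$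 denotes the sequence $n\mapsto\tilde u_c(n-x)$. *)

theory Defs
  imports "HOL-Analysis.Analysis"
begin

type_synonym state = "int \<Rightarrow> real \<times> real"

text \<open>The norm on \<^typ>\<open>real \<times> real\<close> is the Euclidean one.\<close>

definition l2 :: "state set" where
  "l2 = {u. (\<lambda>n. (norm (u n))\<^sup>2) summable_on UNIV}"

text \<open>
  The norm of the restriction of \<open>u\<close> to \<open>A\<close>. An \<^const>\<open>infsum\<close> that does not converge is \<open>0\<close>, so the
  value is meaningful only for states in \<^const>\<open>l2\<close>. Lemmas \<open>l2_diff\<close>, \<open>l2_scaleR\<close>, \<open>toda_J_l2\<close>,
  \<open>toda_H'_l2\<close> and \<open>u_tilde_l2\<close> put into \<^const>\<open>l2\<close> every state whose norm is taken below.
\<close>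

definition l2_norm_on :: "int set \<Rightarrow> state \<Rightarrow> real" where
  "l2_norm_on A u = sqrt (\<Sum>\<^sub>\<infinity>n\<in>A. (norm (u n))\<^sup>2)"

abbreviation l2_norm :: "state \<Rightarrow> real" where
  "l2_norm \<equiv> l2_norm_on UNIV"

lemma l2_I:
  assumes "f summable_on UNIV" "\<And>n. (norm (u n))\<^sup>2 \<le> f n"
  shows "u \<in> l2"
  unfolding l2_def mem_Collect_eq
  by (rule summable_on_comparison_test[OF assms(1)]) (use assms(2) in auto)

lemma l2_D: "u \<in> l2 \<Longrightarrow> (\<lambda>n. (norm (u n))\<^sup>2) summable_on UNIV"
  by (simp add: l2_def)

lemma l2_add:
  assumes "u \<in> l2" "v \<in> l2"
  shows "(\<lambda>n. u n + v n) \<in> l2"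
proof (rule l2_I)
  show "(\<lambda>n. 2 * (norm (u n))\<^sup>2 + 2 * (norm (v n))\<^sup>2) summable_on UNIV"
    using assms by (intro summable_on_add summable_on_cmult_right l2_D)
  fix n
  have "(norm (u n + v n))\<^sup>2 \<le> (norm (u n) + norm (v n))\<^sup>2"
    by (intro power_mono norm_triangle_ineq norm_ge_zero)
  also have "\<dots> \<le> 2 * (norm (u n))\<^sup>2 + 2 * (norm (v n))\<^sup>2"
    using sum_squares_bound[of "norm (u n)" "norm (v n)"] by (simp add: power2_sum)
  finally show "(norm (u n + v n))\<^sup>2 \<le> 2 * (norm (u n))\<^sup>2 + 2 * (norm (v n))\<^sup>2" .
qed

lemma l2_scaleR:
  assumes "u \<in> l2"
  shows "(\<lambda>n. a *\<^sub>R u n) \<in> l2"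
proof (rule l2_I)
  show "(\<lambda>n. a\<^sup>2 * (norm (u n))\<^sup>2) summable_on UNIV"
    using assms by (intro summable_on_cmult_right l2_D)
qed (simp add: power_mult_distrib)

lemma l2_diff:
  assumes "u \<in> l2" "v \<in> l2"
  shows "(\<lambda>n. u n - v n) \<in> l2"
  using l2_add[OF assms(1) l2_scaleR[OF assms(2), of "-1"]] by simp

lemma l2_shift:
  assumes "u \<in> l2"
  shows "(\<lambda>n. u (n + k)) \<in> l2"
proof -
  have "bij (\<lambda>n::int. n + k)"
    by (rule bij_betwI[of _ _ _ "\<lambda>n. n - k"]) auto
  from summable_on_reindex_bij_betw[OF this, of "\<lambda>n. (norm (u n))\<^sup>2"] l2_D[OF assms]
  show ?thesis by (simp add: l2_def)
qed

lemma l2_norm_square: "(l2_norm u)\<^sup>2 = (\<Sum>\<^sub>\<infinity>n. (norm (u n))\<^sup>2)"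
  by (simp add: l2_norm_on_def infsum_nonneg)

lemma l2_norm_nonneg: "0 \<le> l2_norm u"
  by (simp add: l2_norm_on_def infsum_nonneg)

lemma norm_le_l2_norm:
  assumes "u \<in> l2"
  shows "norm (u n) \<le> l2_norm u"
proof -
  have "(norm (u n))\<^sup>2 \<le> (l2_norm u)\<^sup>2"
    using finite_sum_le_infsum[OF l2_D[OF assms], of "{n}"] by (simp add: l2_norm_square)
  thus ?thesis by (meson l2_norm_nonneg power2_le_imp_le)
qed

definition toda_V :: "real \<Rightarrow> real" where
  "toda_V r = exp (- r) - 1 + r"

definition toda_H :: "state \<Rightarrow> real" where
  "toda_H u = (\<Sum>\<^sub>\<infinity>n. (snd (u n))\<^sup>2 / 2 + toda_V (fst (u n)))"

text \<open>
  The gradient of \<^const>\<open>toda_H\<close> for the \<open>l\<^sup>2\<close> inner product; lemma \<open>toda_H_frechet\<close> below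
  shows that it represents the Frechet derivative.
\<close>

definition toda_H' :: "state \<Rightarrow> state" where
  "toda_H' u = (\<lambda>n. (deriv toda_V (fst (u n)), snd (u n)))"

definition toda_J :: "state \<Rightarrow> state" where
  "toda_J u = (\<lambda>n. (snd (u (n + 1)) - snd (u n), fst (u n) - fst (u (n - 1))))"

lemma deriv_toda_V: "deriv toda_V r = 1 - exp (- r)"
  unfolding toda_V_def[abs_def]
  by (rule DERIV_imp_deriv) (auto intro!: derivative_eq_intros)

lemma toda_V_bounds:
  shows "0 \<le> toda_V s" and "toda_V s \<le> exp \<bar>s\<bar> * s\<^sup>2"
proof -
  show "0 \<le> toda_V s"
    using exp_ge_add_one_self[of "- s"] by (simp add: toda_V_def)
  obtain t where t: "\<bar>t\<bar> \<le> \<bar>-s\<bar>"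
      "exp (-s) = (\<Sum>m<2. ((-s) ^ m) / fact m) + (exp t / fact 2) * (-s) ^ 2"
    using Maclaurin_exp_le[of "-s" 2] by blast
  have "toda_V s = exp t / 2 * s\<^sup>2"
    using t(2) by (simp add: toda_V_def lessThan_nat_numeral)
  also have "\<dots> \<le> exp \<bar>s\<bar> * s\<^sup>2"
  proof (intro mult_right_mono)
    have "exp t \<le> exp \<bar>s\<bar>" using t(1) by simp
    thus "exp t / 2 \<le> exp \<bar>s\<bar>" using exp_ge_zero[of t] by linarith
  qed simp
  finally show "toda_V s \<le> exp \<bar>s\<bar> * s\<^sup>2" .
qed

lemma norm_prod_square: "(norm (z :: real \<times> real))\<^sup>2 = (fst z)\<^sup>2 + (snd z)\<^sup>2"
  by (simp add: norm_prod_def)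

lemma abs_fst_le: "\<bar>fst (z :: real \<times> real)\<bar> \<le> norm z"
  using norm_fst_le[of "fst z" "snd z"] by simp

lemma toda_H_summable:
  assumes "u \<in> l2"
  shows "(\<lambda>n. (snd (u n))\<^sup>2 / 2 + toda_V (fst (u n))) summable_on UNIV"
proof (rule summable_on_comparison_test)
  let ?K = "1 + exp (l2_norm u)"
  show "(\<lambda>n. ?K * (norm (u n))\<^sup>2) summable_on UNIV"
    using assms by (intro summable_on_cmult_right l2_D)
  fix n
  have "exp \<bar>fst (u n)\<bar> \<le> exp (l2_norm u)"
    using order_trans[OF abs_fst_le norm_le_l2_norm[OF assms]] by simp
  hence "toda_V (fst (u n)) \<le> exp (l2_norm u) * (fst (u n))\<^sup>2"
    by (meson toda_V_bounds(2) order_trans mult_right_mono zero_le_power2)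
  moreover have "0 \<le> (fst (u n))\<^sup>2" "0 \<le> exp (l2_norm u) * (snd (u n))\<^sup>2" "0 \<le> (snd (u n))\<^sup>2" by auto
  ultimately show "(snd (u n))\<^sup>2 / 2 + toda_V (fst (u n)) \<le> ?K * (norm (u n))\<^sup>2"
    unfolding norm_prod_square by (simp only: distrib_left distrib_right)
  show "0 \<le> (snd (u n))\<^sup>2 / 2 + toda_V (fst (u n))"
    using toda_V_bounds(1) by simp
qed

lemma toda_H'_l2:
  assumes "u \<in> l2"
  shows "toda_H' u \<in> l2"
proof (rule l2_I)
  let ?K = "exp (l2_norm u)"
  show "(\<lambda>n. ?K\<^sup>2 * (norm (u n))\<^sup>2) summable_on UNIV"
    using assms by (intro summable_on_cmult_right l2_D)
  fix n
  define r where "r = fst (u n)"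
  have r: "\<bar>r\<bar> \<le> l2_norm u"
    unfolding r_def using order_trans[OF abs_fst_le norm_le_l2_norm[OF assms]] .
  have "\<exists>t. \<bar>t\<bar> \<le> \<bar>-r\<bar> \<and> exp (-r) = (\<Sum>m<1. ((-r) ^ m) / fact m) + (exp t / fact 1) * (-r) ^ 1"
    by (rule Maclaurin_exp_le)
  then obtain t where t: "\<bar>t\<bar> \<le> \<bar>r\<bar>" "exp (-r) = 1 - exp t * r" by auto
  have "\<bar>1 - exp (-r)\<bar> = exp t * \<bar>r\<bar>" using t(2) by (simp add: abs_mult)
  also have "\<dots> \<le> ?K * \<bar>r\<bar>" using t(1) r by (intro mult_right_mono) auto
  finally have "\<bar>1 - exp (-r)\<bar>\<^sup>2 \<le> (?K * \<bar>r\<bar>)\<^sup>2" by (intro power_mono) auto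
  hence 1: "(1 - exp (-r))\<^sup>2 \<le> ?K\<^sup>2 * r\<^sup>2" by (simp add: power_mult_distrib)
  have "1 \<le> ?K\<^sup>2" using l2_norm_nonneg[of u] by simp
  hence 2: "1 * (snd (u n))\<^sup>2 \<le> ?K\<^sup>2 * (snd (u n))\<^sup>2" by (intro mult_right_mono) auto
  show "(norm (toda_H' u n))\<^sup>2 \<le> ?K\<^sup>2 * (norm (u n))\<^sup>2"
    using 1 2 by (simp add: toda_H'_def norm_prod_square deriv_toda_V r_def distrib_left del: exp_ge_zero)
qed

lemma toda_J_l2:
  assumes "u \<in> l2"
  shows "toda_J u \<in> l2"
proof (rule l2_I)
  let ?f = "\<lambda>n. 2 * (norm (u (n + 1)))\<^sup>2 + 4 * (norm (u n))\<^sup>2 + 2 * (norm (u (n + (-1))))\<^sup>2"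
  show "?f summable_on UNIV"
    using assms by (intro summable_on_add summable_on_cmult_right l2_D l2_shift)
  fix n
  have *: "(a - b)\<^sup>2 \<le> 2 * a\<^sup>2 + 2 * b\<^sup>2" for a b :: real
    using zero_le_power2[of "a + b"] by (simp add: power2_sum power2_diff)
  show "(norm (toda_J u n))\<^sup>2 \<le> ?f n"
    using *[of "snd (u (n + 1))" "snd (u n)"] *[of "fst (u n)" "fst (u (n - 1))"]
      zero_le_power2[of "fst (u (n + 1))"] zero_le_power2[of "snd (u (n - 1))"]
      zero_le_power2[of "fst (u n)"] zero_le_power2[of "snd (u n)"]
    unfolding toda_J_def norm_prod_square fst_conv snd_conv distrib_left add_uminus_conv_diff
    by linarith
qed

lemma toda_H_frechet:
  assumes u: "u \<in> l2" and e: "0 < e"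
  shows "\<exists>d>0. \<forall>h\<in>l2. l2_norm h < d \<longrightarrow>
    \<bar>toda_H (\<lambda>n. u n + h n) - toda_H u - (\<Sum>\<^sub>\<infinity>n. inner (toda_H' u n) (h n))\<bar> \<le> e * l2_norm h"
proof -
  define K where "K = 1 + exp (l2_norm u + 1)"
  have K: "K > 0" by (simp add: K_def add_pos_pos)
  show ?thesis
  proof (intro exI[of _ "min 1 (e / K)"] conjI ballI impI)
    show "0 < min 1 (e / K)" using e K by simp
    fix h assume h: "h \<in> l2" and hd: "l2_norm h < min 1 (e / K)"
    define E where "E = (\<lambda>(v :: state) n. (snd (v n))\<^sup>2 / 2 + toda_V (fst (v n)))"
    define R where "R = (\<lambda>n. exp (- fst (u n)) * toda_V (fst (h n)) + (snd (h n))\<^sup>2 / 2)"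
    have Es: "E v summable_on UNIV" if "v \<in> l2" for v
      using toda_H_summable[OF that] by (simp add: E_def)
    have bd: "0 \<le> R n \<and> R n \<le> K * (norm (h n))\<^sup>2" for n
    proof
      show "0 \<le> R n" by (simp add: R_def toda_V_bounds(1))
      have a: "\<bar>fst (h n)\<bar> \<le> 1"
        using order_trans[OF abs_fst_le norm_le_l2_norm[OF h], of n] hd by linarith
      have b: "\<bar>fst (u n)\<bar> \<le> l2_norm u"
        by (rule order_trans[OF abs_fst_le norm_le_l2_norm[OF u]])
      have "exp (- fst (u n)) * toda_V (fst (h n)) \<le> exp (- fst (u n)) * (exp \<bar>fst (h n)\<bar> * (fst (h n))\<^sup>2)"
        by (intro mult_left_mono toda_V_bounds) auto
      also have "\<dots> = exp (- fst (u n) + \<bar>fst (h n)\<bar>) * (fst (h n))\<^sup>2"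
        by (simp only: exp_add mult.assoc)
      also have "\<dots> \<le> exp (l2_norm u + 1) * (fst (h n))\<^sup>2"
        using a b by (intro mult_right_mono) (auto simp: abs_le_iff)
      finally have "R n \<le> exp (l2_norm u + 1) * (fst (h n))\<^sup>2 + (snd (h n))\<^sup>2 / 2"
        by (simp add: R_def)
      moreover have "0 \<le> (fst (h n))\<^sup>2" "0 \<le> exp (l2_norm u + 1) * (snd (h n))\<^sup>2" "0 \<le> (snd (h n))\<^sup>2"
        by auto
      ultimately show "R n \<le> K * (norm (h n))\<^sup>2"
        unfolding norm_prod_square K_def by (simp only: distrib_left distrib_right)
    qed
    have Ks: "(\<lambda>n. K * (norm (h n))\<^sup>2) summable_on UNIV"
      using h by (intro summable_on_cmult_right l2_D)
    have Rs: "R summable_on UNIV"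
      by (rule summable_on_comparison_test[OF Ks]) (use bd in auto)
    have eq: "inner (toda_H' u n) (h n) = E (\<lambda>n. u n + h n) n + (- E u n + - R n)" for n
      by (simp add: E_def R_def toda_H'_def deriv_toda_V toda_V_def inner_prod_def exp_add exp_minus
          power2_sum field_simps)
    have H: "toda_H v = infsum (E v) UNIV" for v
      by (simp add: toda_H_def E_def)
    have s1: "(\<lambda>n. - E u n) summable_on UNIV" "(\<lambda>n. - R n) summable_on UNIV"
      using Es[OF u] Rs by (simp_all add: summable_on_uminus)
    have "(\<Sum>\<^sub>\<infinity>n. inner (toda_H' u n) (h n))
        = toda_H (\<lambda>n. u n + h n) + (- toda_H u + - infsum R UNIV)"
      unfolding eq H using s1 Es[OF l2_add[OF u h]]
      by (simp only: infsum_add summable_on_add infsum_uminus)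
    hence "\<bar>toda_H (\<lambda>n. u n + h n) - toda_H u - (\<Sum>\<^sub>\<infinity>n. inner (toda_H' u n) (h n))\<bar>
        = \<bar>infsum R UNIV\<bar>" by simp
    also have "\<dots> = infsum R UNIV" using bd by (simp add: infsum_nonneg)
    also have "\<dots> \<le> (\<Sum>\<^sub>\<infinity>n. K * (norm (h n))\<^sup>2)"
      by (rule infsum_mono[OF Rs Ks]) (use bd in auto)
    also have "\<dots> = (K * l2_norm h) * l2_norm h"
      unfolding infsum_cmult_right' l2_norm_square[symmetric] by (simp add: power2_eq_square)
    also have "\<dots> \<le> e * l2_norm h"
      using hd K l2_norm_nonneg[of h] by (intro mult_right_mono) (auto simp: field_simps)
    finally show "\<bar>toda_H (\<lambda>n. u n + h n) - toda_H u - (\<Sum>\<^sub>\<infinity>n. inner (toda_H' u n) (h n))\<bar> \<le> e * l2_norm h" .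
  qed
qed

text \<open>The time derivative is taken in \<open>l\<^sup>2\<close>, that is, the difference quotients converge in norm.\<close>

definition toda_solution :: "(real \<Rightarrow> state) \<Rightarrow> bool" where
  "toda_solution u \<longleftrightarrow>
     (\<forall>t. u t \<in> l2) \<and>
     (\<forall>t. ((\<lambda>h. l2_norm (\<lambda>n. (u (t + h) n - u t n) /\<^sub>R h - toda_J (toda_H' (u t)) n)) \<longlongrightarrow> 0) (at 0))"

definition kappa :: "real \<Rightarrow> real" where
  "kappa c = (THE k. k > 0 \<and> c = sinh k / k)"

lemma sinh_div_strict_mono:
  fixes a b :: real
  assumes "0 < a" "a < b"
  shows "sinh a / a < sinh b / b"
proof -
  have pos: "0 < x * cosh x - sinh x" if "0 < x" for x :: real
  proof -
    have "0 * cosh 0 - sinh 0 < x * cosh x - sinh (x::real)"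
    proof (rule DERIV_pos_imp_increasing_open[OF that])
      fix y :: real assume "0 < y" "y < x"
      thus "\<exists>d. ((\<lambda>x. x * cosh x - sinh x) has_real_derivative d) (at y) \<and> 0 < d"
        by (intro exI[of _ "y * sinh y"] conjI) (auto intro!: derivative_eq_intros)
    qed (intro continuous_intros)
    thus ?thesis by simp
  qed
  show ?thesis
  proof (rule DERIV_pos_imp_increasing[OF assms(2)])
    fix y assume "a \<le> y" "y \<le> b"
    hence y: "0 < y" using assms(1) by simp
    have "((\<lambda>x. sinh x / x) has_real_derivative (y * cosh y - sinh y) / (y * y)) (at y)"
      using y by (auto intro!: derivative_eq_intros simp: field_simps)
    thus "\<exists>d. ((\<lambda>x. sinh x / x) has_real_derivative d) (at y) \<and> 0 < d"
      using pos[OF y] y by auto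
  qed
qed

lemma kappa_ex1:
  assumes "1 < c"
  shows "\<exists>!k::real. k > 0 \<and> c = sinh k / k"
proof (rule ex_ex1I)
  show "k = l" if "k > 0 \<and> c = sinh k / k" "l > 0 \<and> c = sinh l / l" for k l :: real
    using that sinh_div_strict_mono[of k l] sinh_div_strict_mono[of l k]
    by (cases k l rule: linorder_cases) auto
  have "((\<lambda>k::real. sinh k - c * k) has_real_derivative (1 - c)) (at 0)"
    by (auto intro!: derivative_eq_intros)
  from DERIV_neg_dec_right[OF this] assms
  obtain d where d: "d > 0" "\<And>h. 0 < h \<Longrightarrow> h < d \<Longrightarrow> sinh h - c * h < (0::real)" by auto
  define a where "a = d / 2"
  have a: "a > 0" "sinh a - c * a < 0" using d(1) d(2)[of a] by (auto simp: a_def)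
  define m where "m = max a (4 * c)"
  have m: "m > 0" "m \<ge> a" "m \<ge> 4 * c" using a by (auto simp: m_def)
  have "1 + m + m\<^sup>2 / 2 \<le> exp m" using m by (intro exp_lower_Taylor_quadratic) simp
  moreover have "exp (-m) \<le> 1" using m by simp
  moreover have "2 * sinh m = exp m - exp (-m)" by (simp add: sinh_def)
  ultimately have "m + m\<^sup>2 / 2 \<le> 2 * sinh m" by linarith
  moreover have "4 * c * m \<le> m * m" using m by (intro mult_right_mono) auto
  ultimately have "0 \<le> sinh m - c * m" using m(1) unfolding power2_eq_square by linarith
  with a m have "\<exists>x\<ge>a. x \<le> m \<and> sinh x - c * x = 0"
    by (intro IVT' continuous_intros) auto
  then obtain x where "x \<ge> a" "sinh x = c * x" by auto
  thus "\<exists>k::real. k > 0 \<and> c = sinh k / k" using a by (intro exI[of _ x]) auto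
qed

lemma kappa:
  assumes "1 < c"
  shows "kappa c > 0" and "c = sinh (kappa c) / kappa c"
  using theI'[OF kappa_ex1[OF assms]] unfolding kappa_def by auto

definition q_tilde :: "real \<Rightarrow> real \<Rightarrow> real" where
  "q_tilde c x = ln (cosh (kappa c * (x - 1)) / cosh (kappa c * x))"

definition p_tilde :: "real \<Rightarrow> real \<Rightarrow> real" where
  "p_tilde c x = - c * deriv (q_tilde c) x"

definition r_tilde :: "real \<Rightarrow> real \<Rightarrow> real" where
  "r_tilde c x = q_tilde c (x + 1) - q_tilde c x"

definition u_tilde :: "real \<Rightarrow> real \<Rightarrow> real \<times> real" where
  "u_tilde c x = (r_tilde c x, p_tilde c x)"

definition soliton :: "real \<Rightarrow> real \<Rightarrow> state" where
  "soliton c t = (\<lambda>n. u_tilde c (real_of_int n - c * t))"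

lemma deriv_q_tilde:
  "deriv (q_tilde c) x = kappa c * (tanh (kappa c * (x - 1)) - tanh (kappa c * x))"
proof (rule DERIV_imp_deriv)
  have "(\<lambda>x. ln (cosh (kappa c * (x - 1))) - ln (cosh (kappa c * x))) = q_tilde c"
    by (auto simp: q_tilde_def ln_div)
  moreover have "((\<lambda>x. ln (cosh (kappa c * (x - 1))) - ln (cosh (kappa c * x))) has_real_derivative
      kappa c * (tanh (kappa c * (x - 1)) - tanh (kappa c * x))) (at x)"
    by (auto intro!: derivative_eq_intros simp: tanh_def field_simps)
  ultimately show "(q_tilde c has_real_derivative
      kappa c * (tanh (kappa c * (x - 1)) - tanh (kappa c * x))) (at x)" by simp
qed

lemma p_tilde_eq:
  "p_tilde c x = c * kappa c * sinh (kappa c) / (cosh (kappa c * (x - 1)) * cosh (kappa c * x))"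
proof -
  have "kappa c = kappa c * x - kappa c * (x - 1)" by (simp add: algebra_simps)
  hence "sinh (kappa c) = sinh (kappa c * x) * cosh (kappa c * (x - 1))
      - cosh (kappa c * x) * sinh (kappa c * (x - 1))"
    by (metis sinh_diff)
  thus ?thesis
    by (simp add: p_tilde_def deriv_q_tilde tanh_def divide_simps) (simp add: algebra_simps)
qed

lemma r_tilde_eq:
  "r_tilde c x = - ln (1 + (sinh (kappa c))\<^sup>2 / (cosh (kappa c * x))\<^sup>2)"
proof -
  let ?k = "kappa c"
  have "cosh (?k * (x - 1)) * cosh (?k * (x + 1)) = (cosh (?k * x))\<^sup>2 + (sinh ?k)\<^sup>2"
  proof -
    have "cosh (?k * (x - 1)) * cosh (?k * (x + 1))
        = (cosh (?k * x))\<^sup>2 * (cosh ?k)\<^sup>2 - (sinh (?k * x))\<^sup>2 * (sinh ?k)\<^sup>2"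
      unfolding distrib_left right_diff_distrib mult_1_right cosh_add cosh_diff
      by (simp add: power2_eq_square algebra_simps)
    thus ?thesis
      unfolding cosh_square_eq[of ?k] sinh_square_eq[of "?k * x"] by (simp add: algebra_simps)
  qed
  hence "1 + (sinh ?k)\<^sup>2 / (cosh (?k * x))\<^sup>2
      = cosh (?k * (x - 1)) * cosh (?k * (x + 1)) / (cosh (?k * x))\<^sup>2"
    by (simp add: add_divide_distrib)
  thus ?thesis
    by (simp add: r_tilde_def q_tilde_def ln_div ln_mult ln_realpow)
qed

lemma u_tilde_square_bound:
  assumes "1 < c"
  shows "(norm (u_tilde c x))\<^sup>2
    \<le> ((sinh (kappa c)) ^ 4 + (c * kappa c * sinh (kappa c))\<^sup>2) / (1 + (kappa c * x)\<^sup>2)"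
proof -
  let ?k = "kappa c" and ?C = "(cosh (kappa c * x))\<^sup>2"
  have C: "1 + (?k * x)\<^sup>2 \<le> ?C"
  proof -
    have le: "y \<le> sinh y" if "0 \<le> y" for y :: real
    proof -
      have "sinh 0 - 0 \<le> sinh y - y"
      proof (rule DERIV_nonneg_imp_nondecreasing[OF that])
        fix z :: real
        have "((\<lambda>x. sinh x - x) has_real_derivative cosh z - 1) (at z)"
          by (auto intro!: derivative_eq_intros)
        thus "\<exists>d. ((\<lambda>x. sinh x - x) has_real_derivative d) (at z) \<and> 0 \<le> d"
          using cosh_real_ge_1[of z] by (intro exI[of _ "cosh z - 1"]) simp
      qed
      thus ?thesis by simp
    qed
    have "\<bar>y\<bar> \<le> \<bar>sinh y\<bar>" for y :: real
      using le[of y] le[of "- y"] by (cases "0 \<le> y") auto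
    hence "(?k * x)\<^sup>2 \<le> (sinh (?k * x))\<^sup>2" by (simp only: abs_le_square_iff)
    thus ?thesis by (simp add: cosh_square_eq)
  qed
  have C1: "1 \<le> ?C" using C zero_le_power2[of "?k * x"] by linarith
  have "0 \<le> ln (1 + (sinh ?k)\<^sup>2 / ?C)" "ln (1 + (sinh ?k)\<^sup>2 / ?C) \<le> (sinh ?k)\<^sup>2 / ?C"
    by (auto intro!: ln_ge_zero ln_add_one_self_le_self)
  hence "(r_tilde c x)\<^sup>2 \<le> ((sinh ?k)\<^sup>2 / ?C)\<^sup>2"
    unfolding r_tilde_eq power2_minus by (intro power_mono)
  also have "\<dots> = sinh ?k ^ 4 / (?C * ?C)" by (simp add: power_divide power2_eq_square eval_nat_numeral)
  also have "\<dots> \<le> sinh ?k ^ 4 / ((1 + (?k * x)\<^sup>2) * 1)"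
    using C C1 by (intro divide_left_mono mult_mono mult_pos_pos)
      (auto simp: add_pos_nonneg)
  finally have r: "(r_tilde c x)\<^sup>2 \<le> sinh ?k ^ 4 / (1 + (?k * x)\<^sup>2)" by simp
  have "(p_tilde c x)\<^sup>2 = (c * ?k * sinh ?k)\<^sup>2 / (?C * (cosh (?k * (x - 1)))\<^sup>2)"
    by (simp add: p_tilde_eq power_divide power_mult_distrib mult.commute)
  also have "\<dots> \<le> (c * ?k * sinh ?k)\<^sup>2 / ((1 + (?k * x)\<^sup>2) * 1)"
    using C cosh_real_ge_1[of "?k * (x - 1)"]
    by (intro divide_left_mono mult_mono mult_pos_pos)
      (auto simp: add_pos_nonneg)
  finally have p: "(p_tilde c x)\<^sup>2 \<le> (c * ?k * sinh ?k)\<^sup>2 / (1 + (?k * x)\<^sup>2)" by simp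
  show ?thesis using r p by (simp add: norm_prod_square u_tilde_def add_divide_distrib)
qed

lemma summable_on_int_inverse_square:
  "(\<lambda>n::int. 1 / (1 + (real_of_int n)\<^sup>2)) summable_on UNIV"
proof -
  have s: "(\<lambda>n::nat. 1 / (1 + (real n)\<^sup>2)) summable_on UNIV"
  proof (rule norm_summable_imp_summable_on, rule summable_comparison_test')
    show "summable (\<lambda>n. inverse ((real n)\<^sup>2))" by (rule inverse_power_summable) simp
    show "norm (norm (1 / (1 + (real n)\<^sup>2))) \<le> inverse ((real n)\<^sup>2)" if "1 \<le> n" for n
      using that by (simp add: field_simps add_pos_nonneg)
  qed
  let ?f = "\<lambda>n::int. 1 / (1 + (real_of_int n)\<^sup>2)"
  have 1: "?f summable_on (range int)"
    by (subst summable_on_reindex) (use s in \<open>auto simp: o_def\<close>)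
  have 2: "?f summable_on (range (\<lambda>n. - int n))"
    by (subst summable_on_reindex) (use s in \<open>auto simp: o_def inj_on_def\<close>)
  have "range int \<union> range (\<lambda>n. - int n) = UNIV"
    by (auto) (metis int_cases2 rangeI)
  thus ?thesis using summable_on_union[OF 1 2] by simp
qed

lemma u_tilde_l2:
  assumes "1 < c"
  shows "(\<lambda>n. u_tilde c (real_of_int n - x)) \<in> l2"
proof (rule l2_I)
  define M where "M = sinh (kappa c) ^ 4 + (c * kappa c * sinh (kappa c))\<^sup>2"
  define L where "L = 1 + 2 * x\<^sup>2 + 2 / (kappa c)\<^sup>2"
  have M: "0 \<le> M" by (simp add: M_def)
  have k: "0 < kappa c" using kappa[OF assms] by simp
  show "(\<lambda>n. (M * L) * (1 / (1 + (real_of_int n)\<^sup>2))) summable_on UNIV"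
    by (intro summable_on_cmult_right summable_on_int_inverse_square)
  fix n :: int
  let ?y = "real_of_int n - x"
  have "0 \<le> (real_of_int n - 2 * x)\<^sup>2" by simp
  hence "1 + (real_of_int n)\<^sup>2 \<le> (1 + 2 * x\<^sup>2) * 1 + 2 * ?y\<^sup>2"
    by (simp add: power2_diff power_mult_distrib)
  also have "\<dots> = (1 + 2 * x\<^sup>2) * 1 + 2 / (kappa c)\<^sup>2 * (kappa c * ?y)\<^sup>2"
    using k by (simp add: power_mult_distrib)
  also have "\<dots> \<le> L * (1 + (kappa c * ?y)\<^sup>2)"
    by (simp add: L_def distrib_left distrib_right)
  finally have "1 / (1 + (kappa c * ?y)\<^sup>2) \<le> L / (1 + (real_of_int n)\<^sup>2)"
    by (simp add: divide_simps add_pos_nonneg mult.commute)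
  hence "M * (1 / (1 + (kappa c * ?y)\<^sup>2)) \<le> M * (L / (1 + (real_of_int n)\<^sup>2))"
    using M by (rule mult_left_mono)
  thus "(norm (u_tilde c ?y))\<^sup>2 \<le> (M * L) * (1 / (1 + (real_of_int n)\<^sup>2))"
    using u_tilde_square_bound[OF assms, of ?y] by (simp add: M_def)
qed

end

theory Submission
  imports Defs
begin

text \<open>
  The stability of the soliton is reduced to the stability of the state \<open>0\<close> by a Darboux transformation.

  A state \<open>(r, p)\<close> is factorised as \<open>a n + b n = \<alpha> - p n\<close>, \<open>a n * b (n + 1) = exp (- r n)\<close> with positive \<open>a\<close> and \<open>b\<close>,
  where \<open>\<alpha> = 2 * cosh k\<close>. Exchanging the factors gives a new state \<open>(r', p')\<close> by \<open>a n + b (n + 1) = \<alpha> - p' n\<close> and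
  \<open>a (n + 1) * b (n + 1) = exp (- r' n)\<close>. If \<open>(r, p)\<close> solves the Toda lattice equation, then the factors
  can be continued for all times with the same \<open>\<alpha>\<close>, and \<open>(r', p')\<close> is a solution as well
  (\<open>darboux_transformation\<close>, \<open>transformed_toda_flow\<close>). For the soliton of rate \<open>k\<close> the factor \<open>a\<close> is a kink, \<open>b\<close> is its
  reciprocal, and the new state is \<open>0\<close> (\<open>kink_step\<close>).

  A perturbed soliton has such a factorisation for a rate \<open>k\<close> near that of the soliton, and the new
  state is then small (\<open>near_soliton_factorization\<close>). Conservation of energy keeps it small for all times
  (\<open>toda_small_data\<close>). Moreover a small solution moves with speed at most slightly above \<open>1\<close>, whereas the soliton is
  faster; a virial estimate shows that the small solution falls behind (\<open>small_toda_solution_left_behind\<close>).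

  It remains to go back. Given the small state \<open>(r', p')\<close>, the factor \<open>a\<close> satisfies a first order recursion in \<open>n\<close>
  that contracts away from the place where \<open>a\<close> crosses \<open>1\<close>. Hence \<open>a\<close> is close to a kink that is centred there, with
  an error bounded by \<open>(r', p')\<close> (\<open>perturbed_kink\<close>), and the position of this kink moves with speed \<open>sinh k / k\<close> up
  to such an error (\<open>kink_trajectory\<close>). Recovering \<open>(r, p)\<close> from the factors (\<open>soliton_from_kink\<close>) shows that it is close
  to a soliton at that position. Both estimates are local: on a half line that contains the position they
  only involve \<open>(r', p')\<close> on this half line, and it tends to \<open>0\<close> on a half line that moves ahead of the radiation.
  The limiting speed is \<open>sinh k / k\<close>; since \<open>k\<close> does not depend on time, the function
  \<open>c\<close> can be taken constant, and smoothing the position gives \<open>x\<close>.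

  Square summability is expressed throughout by bounds on all finite sums.
\<close>

section \<open>Differential inequalities\<close>

lemma deriv_compare:
  fixes f g :: "real \<Rightarrow> real"
  assumes "a \<le> b"
    and "\<And>s. a \<le> s \<Longrightarrow> s \<le> b \<Longrightarrow> (f has_real_derivative f' s) (at s)"
    and "\<And>s. a \<le> s \<Longrightarrow> s \<le> b \<Longrightarrow> (g has_real_derivative g' s) (at s)"
    and "\<And>s. a \<le> s \<Longrightarrow> s \<le> b \<Longrightarrow> f' s \<le> g' s"
    and "f a \<le> g a"
  shows "f b \<le> g b"
proof -
  have "(\<lambda>s. g s - f s) a \<le> (\<lambda>s. g s - f s) b"
  proof (rule DERIV_nonneg_imp_nondecreasing[OF assms(1)])
    fix x assume "a \<le> x" "x \<le> b"
    thus "\<exists>y. ((\<lambda>s. g s - f s) has_real_derivative y) (at x) \<and> 0 \<le> y"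
      using assms(2-4)[of x] by (intro exI[of _ "g' x - f' x"]) (auto intro!: derivative_intros)
  qed
  thus ?thesis using assms(5) by simp
qed

lemma DERIV_power_over_fact:
  "((\<lambda>t. (D * t) ^ Suc k / fact (Suc k)) has_real_derivative D * ((D * t) ^ k / fact k)) (at t)"
proof -
  have "((\<lambda>t. (D * t) ^ Suc k) has_real_derivative real (Suc k) * D * (D * t) ^ k) (at t)"
    by (rule derivative_eq_intros refl)+ simp
  from DERIV_cdivide[OF this, of "fact (Suc k)"] show ?thesis
    by (simp add: fact_Suc field_simps del: of_nat_Suc power_Suc)
qed

lemma power_over_fact_tendsto_0: "(\<lambda>k. (x::real) ^ k / fact k) \<longlonglongrightarrow> 0"
  using summable_LIMSEQ_zero[OF summable_exp[of x]] by (simp add: divide_inverse mult.commute)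

text \<open>
  Integrating a differential inequality \<open>k\<close> times leaves a remainder of the form \<open>M * x ^ k / fact k\<close>;
  this lemma removes it.
\<close>

lemma le_of_power_over_fact:
  fixes a b :: real
  assumes "\<And>k. a \<le> b + M * (x ^ k / fact k)"
  shows "a \<le> b"
proof (rule LIMSEQ_le_const)
  show "(\<lambda>k. b + M * (x ^ k / fact k)) \<longlonglongrightarrow> b"
    by (rule tendsto_eq_intros tendsto_mult_right_zero power_over_fact_tendsto_0 refl)+ simp
qed (use assms in auto)

text \<open>
  Each \<open>S N\<close> is controlled by the next one only, in the way in which a sum over a finite window of the
  lattice is controlled by the sum over a slightly larger window. Since the dependence on \<open>N\<close> is at most
  geometric, \<open>k\<close> integrations leave a remainder of size \<open>(K * C * t) ^ k / fact k\<close>, and the bound at time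
  \<open>0\<close> survives with an exponential factor.
\<close>

lemma cascade_bound:
  fixes S S' :: "nat \<Rightarrow> real \<Rightarrow> real"
  assumes der: "\<And>N t. 0 \<le> t \<Longrightarrow> t \<le> T \<Longrightarrow> (S N has_real_derivative S' N t) (at t)"
    and le: "\<And>N t. 0 \<le> t \<Longrightarrow> t \<le> T \<Longrightarrow> S' N t \<le> C * S (Suc N) t"
    and init: "\<And>N. S N 0 \<le> A"
    and growth: "\<And>N t. 0 \<le> t \<Longrightarrow> t \<le> T \<Longrightarrow> S N t \<le> M * K ^ N"
    and C: "0 \<le> C" and A: "0 \<le> A"
    and t: "0 \<le> t" "t \<le> T"
  shows "S N t \<le> A * exp (C * t)"
proof -
  have step: "S N t \<le> A * exp (C * t) + M * K ^ N * ((K * C * t) ^ k / fact k)"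
    if "0 \<le> t" "t \<le> T" for N t k
    using that
  proof (induction k arbitrary: N t)
    case 0
    have "0 \<le> A * exp (C * t)" using A by simp
    moreover have "S N t \<le> M * K ^ N" using growth 0 by simp
    ultimately show ?case by simp
  next
    case (Suc k)
    let ?g = "\<lambda>t. A * exp (C * t) + M * K ^ N * ((K * C * t) ^ Suc k / fact (Suc k))"
    let ?g' = "\<lambda>t. A * (C * exp (C * t)) + M * K ^ N * (K * C * ((K * C * t) ^ k / fact k))"
    show ?case
    proof (rule deriv_compare[where f = "S N" and g = ?g and g' = ?g' and a = 0])
      show "0 \<le> t" by fact
      fix s assume s: "0 \<le> s" "s \<le> t"
      with Suc.prems have sT: "s \<le> T" by simp
      show "(S N has_real_derivative S' N s) (at s)" using der s sT by simp
      have "((\<lambda>t. A * exp (C * t)) has_real_derivative A * (C * exp (C * s))) (at s)"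
        by (auto intro!: derivative_eq_intros)
      thus "(?g has_real_derivative ?g' s) (at s)"
        by (rule DERIV_add) (intro DERIV_cmult DERIV_power_over_fact)
      have "S' N s \<le> C * S (Suc N) s" using le s sT by simp
      also have "\<dots> \<le> C * (A * exp (C * s) + M * K ^ Suc N * ((K * C * s) ^ k / fact k))"
        by (intro mult_left_mono Suc.IH s sT C)
      also have "\<dots> = ?g' s" by (simp add: algebra_simps)
      finally show "S' N s \<le> ?g' s" .
    qed (use init in simp)
  qed
  have "S N t \<le> A * exp (C * t) + M * K ^ N * ((K * C * t) ^ k / fact k)" for k
    by (rule step[OF t])
  thus ?thesis by (rule le_of_power_over_fact)
qed

text \<open>
  An infinite linear system in which \<open>g N\<close> is driven by \<open>g (Suc N)\<close> with a nonnegative coefficient keeps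
  positive data positive. After multiplication by \<open>exp (R * t)\<close> both coefficients are nonnegative, so the
  negative part obeys a cascade inequality that starts from \<open>0\<close>. The growth bound excludes contributions
  that enter from \<open>N = \<infinity>\<close>.
\<close>

lemma cascade_positive:
  fixes g g' \<rho> \<mu> :: "nat \<Rightarrow> real \<Rightarrow> real"
  assumes der: "\<And>N t. 0 \<le> t \<Longrightarrow> t \<le> T \<Longrightarrow>
      (g N has_real_derivative \<rho> N t * g (Suc N) t + \<mu> N t * g N t) (at t)"
    and coef: "\<And>N t. 0 \<le> t \<Longrightarrow> t \<le> T \<Longrightarrow> 0 \<le> \<rho> N t \<and> \<rho> N t \<le> R \<and> \<bar>\<mu> N t\<bar> \<le> R"
    and init: "\<And>N. 0 < g N 0"
    and growth: "\<And>N t. 0 \<le> t \<Longrightarrow> t \<le> T \<Longrightarrow> \<bar>g N t\<bar> \<le> M * K ^ N"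
    and t: "0 \<le> t" "t \<le> T"
  shows "0 < g N t"
proof -
  have R: "0 \<le> R" using coef[of 0 0] t by linarith
  define h where "h = (\<lambda>N t. exp (R * t) * g N t)"
  define h' where "h' = (\<lambda>N t. \<rho> N t * h (Suc N) t + (\<mu> N t + R) * h N t)"
  have hder: "(h N has_real_derivative h' N t) (at t)" if "0 \<le> t" "t \<le> T" for N t
    unfolding h_def h'_def
    by (rule derivative_eq_intros der that refl)+ (simp add: algebra_simps)
  define M' where "M' = exp (R * T) * M"
  have hgrowth: "\<bar>h N t\<bar> \<le> M' * K ^ N" if "0 \<le> t" "t \<le> T" for N t
  proof -
    have "\<bar>h N t\<bar> = exp (R * t) * \<bar>g N t\<bar>" by (simp add: h_def abs_mult)
    also have "\<dots> \<le> exp (R * T) * (M * K ^ N)"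
      using that R growth[OF that, of N] by (intro mult_mono) (auto intro: mult_left_mono)
    finally show ?thesis by (simp add: M'_def)
  qed
  (* R bounds the coefficient of h (Suc N), where the growth bound is larger by the factor K,
     and 2 * R that of h N. *)
  define D where "D = K * R + 2 * R"
  have low: "- h N t \<le> M' * K ^ N * ((D * t) ^ k / fact k)"
    if "0 \<le> t" "t \<le> T" for N t k
    using that
  proof (induction k arbitrary: N t)
    case 0
    thus ?case using hgrowth[of t N] by simp
  next
    case (Suc k)
    let ?u = "\<lambda>t. M' * K ^ N * ((D * t) ^ Suc k / fact (Suc k))"
    let ?u' = "\<lambda>t. M' * K ^ N * (D * ((D * t) ^ k / fact k))"
    show ?case
    proof (rule deriv_compare[where f = "\<lambda>t. - h N t" and g = ?u and g' = ?u' and a = 0])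
      show "0 \<le> t" by fact
      fix s assume s: "0 \<le> s" "s \<le> t"
      with Suc.prems have sT: "s \<le> T" by simp
      show "((\<lambda>t. - h N t) has_real_derivative - h' N s) (at s)"
        using hder[OF s(1) sT] by (rule DERIV_minus)
      show "(?u has_real_derivative ?u' s) (at s)"
        by (intro DERIV_cmult DERIV_power_over_fact)
      let ?P = "\<lambda>N. M' * K ^ N * ((D * s) ^ k / fact k)"
      have P0: "0 \<le> ?P N" for N
      proof -
        have "0 \<le> M' * K ^ N" using hgrowth[OF s(1) sT, of N] by linarith
        moreover have "0 \<le> D"
        proof (cases "K < 0")
          case True
          have "0 \<le> M' * K ^ 0" "0 \<le> M' * K ^ 1" "0 < \<bar>h 0 0\<bar>"
            using hgrowth[OF s(1) sT, of 0] hgrowth[OF s(1) sT, of 1] init[of 0]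
            by (auto simp: h_def)
          moreover have "\<bar>h 0 0\<bar> \<le> M' * K ^ 0" using hgrowth[of 0 0] s sT by simp
          ultimately show ?thesis using True by (simp add: zero_le_mult_iff)
        qed (use R in \<open>simp add: D_def\<close>)
        ultimately show ?thesis using s by simp
      qed
      have c: "0 \<le> \<rho> N s" "\<rho> N s \<le> R" "0 \<le> \<mu> N s + R" "\<mu> N s + R \<le> 2 * R"
        using coef[OF s(1) sT, of N] by auto
      have "- h' N s = \<rho> N s * - h (Suc N) s + (\<mu> N s + R) * - h N s"
        by (simp add: h'_def algebra_simps)
      also have "\<dots> \<le> \<rho> N s * ?P (Suc N) + (\<mu> N s + R) * ?P N"
        using c s sT by (intro add_mono mult_left_mono Suc.IH) auto
      also have "\<dots> \<le> R * ?P (Suc N) + (2 * R) * ?P N"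
        by (intro add_mono mult_right_mono c P0)
      also have "\<dots> = ?u' s" by (simp only: D_def power_Suc distrib_right distrib_left ac_simps)
      finally show "- h' N s \<le> ?u' s" .
    qed (use init in \<open>simp add: h_def less_imp_le\<close>)
  qed
  have h0: "0 \<le> h N t" if "0 \<le> t" "t \<le> T" for N t
  proof -
    have "- h N t \<le> 0 + M' * K ^ N * ((D * t) ^ k / fact k)" for k using low[OF that] by simp
    from le_of_power_over_fact[of "- h N t" 0, OF this] show ?thesis by simp
  qed
  have "h N 0 \<le> h N t"
  proof (rule DERIV_nonneg_imp_nondecreasing[OF t(1)])
    fix s assume s: "0 \<le> s" "s \<le> t"
    hence sT: "s \<le> T" using t by simp
    have "0 \<le> \<rho> N s" "0 \<le> \<mu> N s + R" using coef[OF s(1) sT, of N] by linarith+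
    hence "0 \<le> h' N s" unfolding h'_def using h0[OF s(1) sT]
      by (simp add: mult_nonneg_nonneg)
    thus "\<exists>y. (h N has_real_derivative y) (at s) \<and> 0 \<le> y" using hder[OF s(1) sT] by blast
  qed
  with init[of N] have "0 < h N t" by (simp add: h_def)
  thus ?thesis by (simp add: h_def zero_less_mult_iff)
qed

text \<open>
  The argument runs on the square of \<open>e\<close>, because \<open>\<bar>e\<bar>\<close> need not be differentiable where \<open>e\<close> vanishes.
\<close>

lemma scalar_gronwall:
  fixes e e' :: "real \<Rightarrow> real"
  assumes der: "\<And>s. 0 \<le> s \<Longrightarrow> s \<le> T \<Longrightarrow> (e has_real_derivative e' s) (at s)"
    and bd: "\<And>s. 0 \<le> s \<Longrightarrow> s \<le> T \<Longrightarrow> \<bar>e' s\<bar> \<le> L * \<bar>e s\<bar> + D"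
    and e0: "e 0 = 0" and D: "0 \<le> D" and L: "0 \<le> L" and T: "0 \<le> T" "T \<le> 1"
  shows "\<bar>e T\<bar> \<le> D * exp (L + 1)"
proof -
  define P where "P = 2 * L + 1"
  have "exp (- P * T) * (e T)\<^sup>2 \<le> D\<^sup>2 * T"
  proof (rule deriv_compare[where f = "\<lambda>s. exp (- P * s) * (e s)\<^sup>2" and a = 0 and g = "\<lambda>s. D\<^sup>2 * s"])
    fix s assume s: "0 \<le> s" "s \<le> T"
    show "((\<lambda>s. exp (- P * s) * (e s)\<^sup>2) has_real_derivative
        exp (- P * s) * (2 * e s * e' s - P * (e s)\<^sup>2)) (at s)"
      by (rule derivative_eq_intros der s refl)+ (simp add: algebra_simps)
    show "((\<lambda>s. D\<^sup>2 * s) has_real_derivative D\<^sup>2) (at s)"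
      by (auto intro!: derivative_eq_intros)
    have "2 * e s * e' s \<le> 2 * \<bar>e s\<bar> * \<bar>e' s\<bar>"
      by (metis abs_ge_self abs_mult abs_numeral)
    also have "\<dots> \<le> 2 * \<bar>e s\<bar> * (L * \<bar>e s\<bar> + D)" using bd[OF s] by (intro mult_left_mono) auto
    also have "\<dots> = 2 * L * (e s)\<^sup>2 + 2 * \<bar>e s\<bar> * D" by (simp add: algebra_simps power2_eq_square)
    also have "\<dots> \<le> 2 * L * (e s)\<^sup>2 + ((e s)\<^sup>2 + D\<^sup>2)"
      using sum_squares_bound[of "\<bar>e s\<bar>" D] by simp
    finally have *: "2 * e s * e' s - P * (e s)\<^sup>2 \<le> D\<^sup>2" by (simp add: P_def algebra_simps)
    have "exp (- P * s) * (2 * e s * e' s - P * (e s)\<^sup>2) \<le> exp (- P * s) * D\<^sup>2"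
      using * by (intro mult_left_mono) auto
    also have "\<dots> \<le> 1 * D\<^sup>2" using s L by (intro mult_right_mono) (auto simp: P_def mult_le_0_iff)
    finally show "exp (- P * s) * (2 * e s * e' s - P * (e s)\<^sup>2) \<le> D\<^sup>2" by simp
  qed (use T e0 in auto)
  also have "\<dots> \<le> D\<^sup>2 * 1" using T by (intro mult_left_mono) auto
  finally have "(e T)\<^sup>2 \<le> D\<^sup>2 * exp (P * T)" by (simp add: exp_minus field_simps)
  also have "\<dots> \<le> D\<^sup>2 * exp (2 * (L + 1))"
  proof -
    have "P * T \<le> P * 1" using T L by (intro mult_left_mono) (auto simp: P_def)
    hence "P * T \<le> 2 * (L + 1)" by (simp add: P_def)
    thus ?thesis by (intro mult_left_mono) auto
  qed
  also have "\<dots> = (D * exp (L + 1))\<^sup>2" by (simp only: power_mult_distrib exp_double)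
  finally show ?thesis using D by (simp add: abs_le_square_iff[symmetric])
qed

section \<open>Planar linear differential equations\<close>

lemma antiderivative_on_line:
  fixes f :: "real \<Rightarrow> real"
  assumes "continuous_on UNIV f"
  shows "\<exists>F. F 0 = 0 \<and> (\<forall>t. (F has_real_derivative f t) (at t))"
proof -
  define F where "F = (\<lambda>t::real. LBINT y=ereal 0..ereal t. f y)"
  have "(F has_real_derivative f t) (at t)" for t
  proof -
    define c where "c = \<bar>t\<bar> + 1"
    have "(F has_vector_derivative f t) (at t within {-c..c})"
      unfolding F_def
    proof (rule interval_integral_FTC2)
      show "continuous_on {-c..c} f" by (rule continuous_on_subset[OF assms]) simp
      show "- c \<le> 0" "0 \<le> c" "- c \<le> t" "t \<le> c" unfolding c_def by linarith+
    qed
    moreover have "t \<in> interior {-c..c}" unfolding c_def by (simp add: abs_if)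
    hence "at t within {-c..c} = at t" by (rule at_within_interior)
    ultimately show ?thesis
      unfolding has_real_derivative_iff_has_vector_derivative by metis
  qed
  moreover have "F 0 = 0" unfolding F_def by (rule interval_integral_endpoints_same)
  ultimately show ?thesis by (intro exI[of _ F] conjI allI)
qed

text \<open>
  One Picard step, for both signs of time: a term of order \<open>k\<close> in the exponential series integrates to the
  term of order \<open>k + 1\<close>.
\<close>

lemma abs_deriv_power_bound:
  fixes F f :: "real \<Rightarrow> real"
  assumes F: "F 0 = 0" "\<And>t. (F has_real_derivative f t) (at t)"
    and f: "\<And>t. \<bar>t\<bar> \<le> T \<Longrightarrow> \<bar>f t\<bar> \<le> M * (D * ((D * \<bar>t\<bar>) ^ k / fact k))"
    and t: "\<bar>t\<bar> \<le> T"
  shows "\<bar>F t\<bar> \<le> M * ((D * \<bar>t\<bar>) ^ Suc k / fact (Suc k))"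
proof -
  let ?b = "\<lambda>s. M * (D * ((D * s) ^ k / fact k))"
  let ?B = "\<lambda>s. M * ((D * s) ^ Suc k / fact (Suc k))"
  have B0: "?B 0 = 0" by simp
  have aux: "G s \<le> ?B s"
    if G: "G 0 = 0" "\<And>t. (G has_real_derivative g t) (at t)"
      and g: "\<And>t. 0 \<le> t \<Longrightarrow> t \<le> T \<Longrightarrow> g t \<le> ?b t" and s: "0 \<le> s" "s \<le> T" for G g s
  proof (rule deriv_compare[where a = 0 and f = G and f' = g and g = ?B and g' = ?b, OF s(1)])
    show "(?B has_real_derivative ?b r) (at r)" for r
      by (intro DERIV_cmult DERIV_power_over_fact)
    show "g r \<le> ?b r" if "0 \<le> r" "r \<le> s" for r using g[of r] that s by simp
    show "G 0 \<le> ?B 0" unfolding B0 G(1) by simp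
  qed (rule G(2))
  have bd: "f s \<le> ?b \<bar>s\<bar>" "- f s \<le> ?b \<bar>s\<bar>" if "\<bar>s\<bar> \<le> T" for s
    using f[OF that] by linarith+
  have b1: "f s \<le> ?b s" "- f s \<le> ?b s" "f (- s) \<le> ?b s" "- f (- s) \<le> ?b s" if "0 \<le> s" "s \<le> T" for s
    using bd[of s] bd[of "-s"] that unfolding abs_minus by (simp_all only: abs_of_nonneg)
  have rev: "((\<lambda>t. F (- t)) has_real_derivative - f (- s)) (at s)" for s
  proof -
    have "(uminus has_real_derivative - 1) (at s)" by (auto intro!: derivative_eq_intros)
    from DERIV_chain2[OF F(2) this] show ?thesis by simp
  qed
  show ?thesis
  proof (cases "0 \<le> t")
    case True
    with t have T: "t \<le> T" by simp
    have "F t \<le> ?B t" by (rule aux[OF F(1,2) b1(1) True T])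
    moreover have "- F t \<le> ?B t"
      by (rule aux[of "\<lambda>t. - F t", OF _ DERIV_minus[OF F(2)] b1(2) True T]) (simp add: F(1))
    ultimately show ?thesis unfolding abs_of_nonneg[OF True] by (rule abs_leI)
  next
    case False
    hence T: "0 \<le> - t" "- t \<le> T" and a: "\<bar>t\<bar> = - t" using t by auto
    have "F (- (- t)) \<le> ?B (- t)"
      by (rule aux[of "\<lambda>t. F (- t)", OF _ rev b1(4) T]) (simp add: F(1))
    moreover have "- F (- (- t)) \<le> ?B (- t)"
      by (rule aux[of "\<lambda>t. - F (- t)" "\<lambda>t. - (- f (- t))", OF _ DERIV_minus[OF rev] _ T])
         (use b1(3) in \<open>auto simp: F(1)\<close>)
    ultimately show ?thesis unfolding a minus_minus by (rule abs_leI)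
  qed
qed

text \<open>
  Global existence for a linear system: \<open>X k\<close> and \<open>Y k\<close> are the differences of successive Picard iterates.
  On every bounded interval they are dominated by the terms of an exponential series, so that the series
  may be differentiated term by term.
\<close>

lemma planar_linear_ode:
  fixes \<alpha> \<beta> \<gamma> \<delta> :: "real \<Rightarrow> real"
  assumes cont: "continuous_on UNIV \<alpha>" "continuous_on UNIV \<beta>" "continuous_on UNIV \<gamma>" "continuous_on UNIV \<delta>"
  shows "\<exists>x y. x 0 = x0 \<and> y 0 = y0 \<and>
    (\<forall>t. (x has_real_derivative \<alpha> t * x t + \<beta> t * y t) (at t)) \<and>
    (\<forall>t. (y has_real_derivative \<gamma> t * x t + \<delta> t * y t) (at t))"
proof -
  define anti where "anti = (\<lambda>f :: real \<Rightarrow> real. SOME F. F 0 = 0 \<and> (\<forall>t. (F has_real_derivative f t) (at t)))"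
  have anti: "anti f 0 = 0" "(anti f has_real_derivative f t) (at t)" if "continuous_on UNIV f" for f t
    using someI_ex[OF antiderivative_on_line[OF that]] by (auto simp: anti_def)
  define Z where "Z = rec_nat ((\<lambda>_. x0), (\<lambda>_. y0))
      (\<lambda>_ (X, Y). (anti (\<lambda>t. \<alpha> t * X t + \<beta> t * Y t), anti (\<lambda>t. \<gamma> t * X t + \<delta> t * Y t)))"
  define X Y where "X = (\<lambda>k. fst (Z k))" and "Y = (\<lambda>k. snd (Z k))"
  define X' Y' where "X' = (\<lambda>k t. if k = 0 then 0 else \<alpha> t * X (k - 1) t + \<beta> t * Y (k - 1) t)"
    and "Y' = (\<lambda>k t. if k = 0 then 0 else \<gamma> t * X (k - 1) t + \<delta> t * Y (k - 1) t)"
  have Z0: "X 0 = (\<lambda>_. x0)" "Y 0 = (\<lambda>_. y0)" by (simp_all add: X_def Y_def Z_def)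
  have ZS: "X (Suc k) = anti (\<lambda>t. \<alpha> t * X k t + \<beta> t * Y k t)"
     "Y (Suc k) = anti (\<lambda>t. \<gamma> t * X k t + \<delta> t * Y k t)" for k
    by (simp_all add: X_def Y_def Z_def case_prod_beta)
  have c: "continuous_on UNIV (X k) \<and> continuous_on UNIV (Y k)" for k
  proof (induction k)
    case (Suc k)
    have "continuous_on UNIV (\<lambda>t. \<alpha> t * X k t + \<beta> t * Y k t)"
         "continuous_on UNIV (\<lambda>t. \<gamma> t * X k t + \<delta> t * Y k t)"
      using Suc cont by (auto intro!: continuous_intros)
    from anti(2)[OF this(1)] anti(2)[OF this(2)] show ?case
      unfolding ZS by (meson DERIV_isCont continuous_at_imp_continuous_on)
  qed (simp add: Z0)
  have c': "continuous_on UNIV (\<lambda>t. \<alpha> t * X k t + \<beta> t * Y k t)"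
         "continuous_on UNIV (\<lambda>t. \<gamma> t * X k t + \<delta> t * Y k t)" for k
      using c[of k] cont by (auto intro!: continuous_intros)
  have d: "(X k has_real_derivative X' k t) (at t)" "(Y k has_real_derivative Y' k t) (at t)" for k t
    by (cases k; simp add: Z0 X'_def Y'_def ZS anti(2)[OF c'(1)] anti(2)[OF c'(2)])+
  have i0: "X (Suc k) 0 = 0" "Y (Suc k) 0 = 0" for k
    by (simp_all add: ZS anti(1)[OF c'(1)] anti(1)[OF c'(2)])
  define x y where "x = (\<lambda>t. \<Sum>k. X k t)" and "y = (\<lambda>t. \<Sum>k. Y k t)"
  have main: "(x has_real_derivative \<alpha> t * x t + \<beta> t * y t) (at t) \<and>
      (y has_real_derivative \<gamma> t * x t + \<delta> t * y t) (at t)" for t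
  proof -
    define T where "T = \<bar>t\<bar> + 1"
    have "\<exists>R. \<forall>s\<in>{-T..T}. \<bar>f s\<bar> \<le> R" if "continuous_on UNIV f" for f :: "real \<Rightarrow> real"
    proof -
      have "compact (f ` {-T..T})"
        by (intro compact_continuous_image continuous_on_subset[OF that]) auto
      from compact_imp_bounded[OF this] show ?thesis by (auto simp: bounded_iff)
    qed
    with cont obtain R1 R2 R3 R4 where R: "\<forall>s\<in>{-T..T}. \<bar>\<alpha> s\<bar> \<le> R1" "\<forall>s\<in>{-T..T}. \<bar>\<beta> s\<bar> \<le> R2"
      "\<forall>s\<in>{-T..T}. \<bar>\<gamma> s\<bar> \<le> R3" "\<forall>s\<in>{-T..T}. \<bar>\<delta> s\<bar> \<le> R4" by metis
    define R where "R = max (max R1 R2) (max R3 R4)"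
    have Rb: "\<bar>\<alpha> s\<bar> \<le> R \<and> \<bar>\<beta> s\<bar> \<le> R \<and> \<bar>\<gamma> s\<bar> \<le> R \<and> \<bar>\<delta> s\<bar> \<le> R" if "\<bar>s\<bar> \<le> T" for s
    proof -
      have "s \<in> {-T..T}" using that by auto
      with R show ?thesis unfolding R_def by (meson max.coboundedI1 max.coboundedI2)
    qed
    have R0: "0 \<le> R" using Rb[of t] by (force simp: T_def)
    define M D where "M = max \<bar>x0\<bar> \<bar>y0\<bar>" and "D = 2 * R"
    have lin: "\<bar>u * a + v * b\<bar> \<le> M * (D * e)"
      if "\<bar>u\<bar> \<le> R" "\<bar>v\<bar> \<le> R" "\<bar>a\<bar> \<le> M * e" "\<bar>b\<bar> \<le> M * e" for u v a b e :: real
    proof -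
      have "\<bar>u * a + v * b\<bar> \<le> \<bar>u\<bar> * \<bar>a\<bar> + \<bar>v\<bar> * \<bar>b\<bar>" by (metis abs_mult abs_triangle_ineq)
      also have "\<dots> \<le> R * (M * e) + R * (M * e)"
        using that R0 by (intro add_mono mult_mono) auto
      finally show ?thesis by (simp add: D_def algebra_simps)
    qed
    have bd: "\<bar>X k s\<bar> \<le> M * ((D * \<bar>s\<bar>) ^ k / fact k) \<and> \<bar>Y k s\<bar> \<le> M * ((D * \<bar>s\<bar>) ^ k / fact k)"
      if "\<bar>s\<bar> \<le> T" for k s
      using that
    proof (induction k arbitrary: s)
      case 0 thus ?case by (simp add: Z0 M_def)
    next
      case (Suc k)
      have "\<bar>\<alpha> s * X k s + \<beta> s * Y k s\<bar> \<le> M * (D * ((D * \<bar>s\<bar>) ^ k / fact k))"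
           "\<bar>\<gamma> s * X k s + \<delta> s * Y k s\<bar> \<le> M * (D * ((D * \<bar>s\<bar>) ^ k / fact k))" if "\<bar>s\<bar> \<le> T" for s
        using Suc.IH[OF that] Rb[OF that] by (intro lin; simp)+
      thus ?case
        using Suc.prems d[of "Suc k"] i0[of k]
        by (intro conjI abs_deriv_power_bound[where T = T]) (auto simp: X'_def Y'_def)
    qed
    define B where "B = (\<lambda>k. M * ((D * T) ^ k / fact k))"
    have D0: "0 \<le> D" "0 \<le> M" "0 \<le> T" using R0 by (auto simp: D_def M_def T_def)
    have Bsum: "summable B"
      unfolding B_def using summable_exp[of "D * T"]
      by (intro summable_mult) (simp add: divide_inverse mult.commute)
    have B0: "0 \<le> B k" for k using D0 by (simp add: B_def)
    have bdB: "\<bar>X k s\<bar> \<le> B k" "\<bar>Y k s\<bar> \<le> B k" if "s \<in> {-T..T}" for k s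
    proof -
      have s: "\<bar>s\<bar> \<le> T" using that by auto
      have "M * ((D * \<bar>s\<bar>) ^ k / fact k) \<le> B k"
        unfolding B_def using s D0
        by (intro mult_left_mono divide_right_mono power_mono) auto
      with bd[OF s, of k] show "\<bar>X k s\<bar> \<le> B k" "\<bar>Y k s\<bar> \<le> B k" by auto
    qed
    define B' where "B' = (\<lambda>k. if k = 0 then 0 else 2 * R * B (k - 1))"
    have "summable (\<lambda>k. B' (Suc k))" unfolding B'_def using Bsum by (auto intro: summable_mult)
    hence B'sum: "summable B'" by (rule summable_Suc_iff[THEN iffD1])
    have lin2: "\<bar>u * a + v * b\<bar> \<le> 2 * R * e"
      if "\<bar>u\<bar> \<le> R" "\<bar>v\<bar> \<le> R" "\<bar>a\<bar> \<le> e" "\<bar>b\<bar> \<le> e" for u v a b e :: real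
    proof -
      have "\<bar>u * a + v * b\<bar> \<le> \<bar>u\<bar> * \<bar>a\<bar> + \<bar>v\<bar> * \<bar>b\<bar>" by (metis abs_mult abs_triangle_ineq)
      also have "\<dots> \<le> R * e + R * e"
        using that R0 by (intro add_mono mult_mono) auto
      finally show ?thesis by simp
    qed
    have bdB': "norm (X' k s) \<le> B' k" "norm (Y' k s) \<le> B' k" if "s \<in> {-T..T}" for k s
    proof -
      have s: "\<bar>s\<bar> \<le> T" using that by auto
      show "norm (X' k s) \<le> B' k" "norm (Y' k s) \<le> B' k"
        using Rb[OF s] bdB[OF that] by (auto simp: X'_def Y'_def B'_def intro!: lin2)
    qed
    have tint: "t \<in> interior {-T..T}" by (auto simp: T_def)
    have t0: "0 \<in> {-T..T}" using D0 by auto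
    have sm: "summable (\<lambda>k. X k s)" "summable (\<lambda>k. Y k s)" if "s \<in> {-T..T}" for s
      using bdB[OF that] by (auto intro!: summable_comparison_test[OF _ Bsum])
    have tm: "t \<in> {-T..T}" by (auto simp: T_def)
    have dx: "(x has_real_derivative (\<Sum>k. X' k t)) (at t)"
      unfolding x_def
    proof (rule has_field_derivative_series'(2)[where S = "{-T..T}" and f' = X'])
      show "uniformly_convergent_on {-T..T} (\<lambda>n s. \<Sum>i<n. X' i s)"
        by (rule Weierstrass_m_test'[OF _ B'sum]) (rule bdB'(1))
    qed (use t0 sm(1)[OF t0] tint d in \<open>auto intro: has_field_derivative_at_within\<close>)
    have dy: "(y has_real_derivative (\<Sum>k. Y' k t)) (at t)"
      unfolding y_def
    proof (rule has_field_derivative_series'(2)[where S = "{-T..T}" and f' = Y'])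
      show "uniformly_convergent_on {-T..T} (\<lambda>n s. \<Sum>i<n. Y' i s)"
        by (rule Weierstrass_m_test'[OF _ B'sum]) (rule bdB'(2))
    qed (use t0 sm(2)[OF t0] tint d in \<open>auto intro: has_field_derivative_at_within\<close>)
    have s': "summable (\<lambda>k. X' k t)" "summable (\<lambda>k. Y' k t)"
      using bdB'[OF tm] by (auto intro!: summable_comparison_test[OF _ B'sum])
    have "(\<Sum>k. X' k t) = (\<Sum>k. X' (Suc k) t)" "(\<Sum>k. Y' k t) = (\<Sum>k. Y' (Suc k) t)"
      using suminf_split_head[OF s'(1)] suminf_split_head[OF s'(2)] by (auto simp: X'_def Y'_def)
    moreover have "(\<Sum>k. X' (Suc k) t) = \<alpha> t * x t + \<beta> t * y t"
      "(\<Sum>k. Y' (Suc k) t) = \<gamma> t * x t + \<delta> t * y t"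
      unfolding X'_def Y'_def x_def y_def using sm[OF tm]
      by (simp_all add: suminf_add[symmetric] suminf_mult summable_mult)
    ultimately show ?thesis using dx dy by simp
  qed
  have sums0: "x 0 = x0" "y 0 = y0"
  proof -
    have "X k 0 = 0" "Y k 0 = 0" if "k \<notin> {0}" for k
      using that i0[of "k - 1"] by simp_all
    hence "(\<lambda>k. X k 0) sums (\<Sum>k\<in>{0}. X k 0)" "(\<lambda>k. Y k 0) sums (\<Sum>k\<in>{0}. Y k 0)"
      by (intro sums_finite; simp)+
    thus "x 0 = x0" "y 0 = y0" by (simp_all add: x_def y_def sums_iff Z0)
  qed
  show ?thesis using main sums0 by blast
qed

section \<open>Square sums along contracting recursions\<close>

text \<open>
  Convexity of the square, since \<open>\<theta> * x + f\<close> is the combination of \<open>x\<close> and \<open>f / (1 - \<theta>)\<close> with the weights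
  \<open>\<theta>\<close> and \<open>1 - \<theta>\<close>.
\<close>

lemma square_convex:
  fixes x f \<theta> :: real
  assumes "0 \<le> \<theta>" "\<theta> < 1" "0 \<le> y" "y \<le> \<theta> * x + f"
  shows "y\<^sup>2 \<le> \<theta> * x\<^sup>2 + f\<^sup>2 / (1 - \<theta>)"
proof -
  have "y\<^sup>2 \<le> (\<theta> * x + f)\<^sup>2" using assms by (intro power_mono) auto
  also have "\<dots> \<le> \<theta> * x\<^sup>2 + f\<^sup>2 / (1 - \<theta>)"
  proof -
    have "0 \<le> \<theta> * ((1 - \<theta>) * x - f)\<^sup>2" using assms by simp
    also have "\<dots> = ((\<theta> * x\<^sup>2) * (1 - \<theta>) + f\<^sup>2 - (\<theta> * x + f)\<^sup>2 * (1 - \<theta>)) "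
      by (simp add: power2_eq_square algebra_simps)
    finally show ?thesis using assms by (simp add: field_simps)
  qed
  finally show ?thesis .
qed

text \<open>
  By convexity the sum that is to be estimated reappears on the right with the factor \<open>\<theta>\<close>, and is absorbed.
\<close>

lemma square_sum_contraction:
  fixes x f :: "nat \<Rightarrow> real"
  assumes th: "0 \<le> \<theta>" "\<theta> < 1" and x0: "x 0 = 0"
    and pos: "\<And>k. 0 \<le> x k"
    and rec: "\<And>k. k < K \<Longrightarrow> x (Suc k) \<le> \<theta> * x k + f k"
  shows "(\<Sum>k\<le>K. (x k)\<^sup>2) \<le> (\<Sum>k<K. (f k)\<^sup>2) / (1 - \<theta>)\<^sup>2"
proof -
  have "(\<Sum>k\<le>K. (x k)\<^sup>2) = (\<Sum>k<K. (x (Suc k))\<^sup>2)"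
    by (subst lessThan_Suc_atMost[symmetric], subst sum.lessThan_Suc_shift) (simp add: x0)
  also have "\<dots> \<le> (\<Sum>k<K. \<theta> * (x k)\<^sup>2 + (f k)\<^sup>2 / (1 - \<theta>))"
    using th pos rec by (intro sum_mono square_convex) auto
  also have "\<dots> = \<theta> * (\<Sum>k<K. (x k)\<^sup>2) + (\<Sum>k<K. (f k)\<^sup>2) / (1 - \<theta>)"
    by (simp add: sum.distrib sum_distrib_left sum_divide_distrib)
  also have "\<dots> \<le> \<theta> * (\<Sum>k\<le>K. (x k)\<^sup>2) + (\<Sum>k<K. (f k)\<^sup>2) / (1 - \<theta>)"
    using th by (intro add_right_mono mult_left_mono sum_mono2) auto
  finally have "(1 - \<theta>) * (\<Sum>k\<le>K. (x k)\<^sup>2) \<le> (\<Sum>k<K. (f k)\<^sup>2) / (1 - \<theta>)"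
    by (simp add: algebra_simps)
  thus ?thesis using th by (simp add: pos_le_divide_eq power2_eq_square mult.commute mult.left_commute)
qed

lemma sup_contraction:
  fixes x :: "nat \<Rightarrow> real"
  assumes th: "0 \<le> \<theta>" "\<theta> < 1" and x0: "x 0 = 0" and F: "0 \<le> F"
    and rec: "\<And>k. k < K \<Longrightarrow> x (Suc k) \<le> \<theta> * x k + F"
  shows "k \<le> K \<Longrightarrow> x k \<le> F / (1 - \<theta>)"
proof (induction k)
  case (Suc k)
  have "x (Suc k) \<le> \<theta> * x k + F" using rec Suc.prems by simp
  also have "\<dots> \<le> \<theta> * (F / (1 - \<theta>)) + F" using Suc th by (intro add_right_mono mult_left_mono) auto
  also have "\<dots> = F / (1 - \<theta>)" using th by (simp add: field_simps)
  finally show ?case .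
qed (use x0 th F in auto)

text \<open>
  Here the recursion runs towards the start and no value is prescribed at its far end. Boundedness
  replaces it: the boundary term of a partial sum is bounded, so the squares are summable, and then the
  boundary term tends to \<open>0\<close>.
\<close>

lemma square_sum_contraction_from_infinity:
  fixes x f :: "nat \<Rightarrow> real"
  assumes th: "0 \<le> \<theta>" "\<theta> < 1"
    and pos: "\<And>k. 0 \<le> x k" and bdd: "\<And>k. x k \<le> \<rho>"
    and rec: "\<And>k. x k \<le> \<theta> * x (Suc k) + f k"
    and F: "\<And>K. (\<Sum>k<K. (f k)\<^sup>2) \<le> F"
  shows "(\<Sum>k<K. (x k)\<^sup>2) \<le> F / (1 - \<theta>)\<^sup>2"
proof -
  have main: "(1 - \<theta>) * (\<Sum>k<K. (x k)\<^sup>2) \<le> \<theta> * (x K)\<^sup>2 + F / (1 - \<theta>)" for K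
  proof -
    have "(\<Sum>k<K. (x k)\<^sup>2) \<le> (\<Sum>k<K. \<theta> * (x (Suc k))\<^sup>2 + (f k)\<^sup>2 / (1 - \<theta>))"
      using th pos rec by (intro sum_mono square_convex) auto
    also have "\<dots> = \<theta> * (\<Sum>k<K. (x (Suc k))\<^sup>2) + (\<Sum>k<K. (f k)\<^sup>2) / (1 - \<theta>)"
      by (simp add: sum.distrib sum_distrib_left sum_divide_distrib)
    also have "\<dots> \<le> \<theta> * (\<Sum>k<Suc K. (x k)\<^sup>2) + F / (1 - \<theta>)"
    proof (intro add_mono mult_left_mono divide_right_mono F)
      show "(\<Sum>k<K. (x (Suc k))\<^sup>2) \<le> (\<Sum>k<Suc K. (x k)\<^sup>2)"
        by (simp only: sum.lessThan_Suc_shift) simp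
    qed (use th in auto)
    finally show ?thesis by (simp add: algebra_simps)
  qed
  have "summable (\<lambda>k. (x k)\<^sup>2)"
  proof (rule bounded_imp_summable)
    fix n
    have "(1 - \<theta>) * (\<Sum>k<Suc n. (x k)\<^sup>2) \<le> \<theta> * \<rho>\<^sup>2 + F / (1 - \<theta>)"
      using main[of "Suc n"] pos[of "Suc n"] bdd[of "Suc n"] th
      by (meson add_right_mono mult_left_mono order_trans power_mono)
    thus "(\<Sum>k\<le>n. (x k)\<^sup>2) \<le> (\<theta> * \<rho>\<^sup>2 + F / (1 - \<theta>)) / (1 - \<theta>)"
      using th by (simp add: pos_le_divide_eq lessThan_Suc_atMost mult.commute)
  qed auto
  hence lim: "(\<lambda>k. (x k)\<^sup>2) \<longlonglongrightarrow> 0" by (rule summable_LIMSEQ_zero)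
  have "(1 - \<theta>) * (\<Sum>k<K. (x k)\<^sup>2) \<le> F / (1 - \<theta>)"
  proof (rule LIMSEQ_le_const)
    show "(\<lambda>n. \<theta> * (x n)\<^sup>2 + F / (1 - \<theta>)) \<longlonglongrightarrow> F / (1 - \<theta>)"
      using tendsto_add[OF tendsto_mult_right_zero[OF lim, of \<theta>] tendsto_const[of "F / (1 - \<theta>)"]] by simp
    have "(1 - \<theta>) * (\<Sum>k<K. (x k)\<^sup>2) \<le> \<theta> * (x n)\<^sup>2 + F / (1 - \<theta>)" if "K \<le> n" for n
    proof -
      have "(\<Sum>k<K. (x k)\<^sup>2) \<le> (\<Sum>k<n. (x k)\<^sup>2)" using that by (intro sum_mono2) auto
      hence "(1 - \<theta>) * (\<Sum>k<K. (x k)\<^sup>2) \<le> (1 - \<theta>) * (\<Sum>k<n. (x k)\<^sup>2)"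
        using th by (intro mult_left_mono) auto
      with main[of n] show ?thesis by linarith
    qed
    thus "\<exists>N. \<forall>n\<ge>N. (1 - \<theta>) * (\<Sum>k<K. (x k)\<^sup>2) \<le> \<theta> * (x n)\<^sup>2 + F / (1 - \<theta>)" by blast
  qed
  thus ?thesis using th by (simp add: pos_le_divide_eq power2_eq_square mult.commute mult.left_commute)
qed

section \<open>The kink and the soliton\<close>

text \<open>
  The factor \<open>a\<close> of the soliton. For \<open>0 < k\<close> it decreases from \<open>exp k\<close> at \<open>- \<infinity>\<close> to \<open>exp (- k)\<close> at \<open>\<infinity>\<close>.
\<close>

definition kink :: "real \<Rightarrow> real \<Rightarrow> real" where
  "kink k z = cosh (k * (z - 1)) / cosh (k * z)"

lemma kink_pos: "0 < kink k z"
  by (simp add: kink_def)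

lemma kink_tanh: "kink k z = cosh k - sinh k * tanh (k * z)"
proof -
  have "cosh (k * (z - 1)) = cosh (k * z - k)" by (simp add: algebra_simps)
  thus ?thesis by (simp add: kink_def cosh_diff tanh_def field_simps)
qed

text \<open>
  The factors \<open>a n = kink k (n - x)\<close> and \<open>b n = 1 / a n\<close> of the soliton satisfy
  \<open>a n + b (n + 1) = 2 * cosh k\<close> and \<open>a n * b n = 1\<close>: when the factors change places, the soliton turns into
  the state \<open>0\<close>.
\<close>

lemma kink_step: "kink k z + 1 / kink k (z + 1) = 2 * cosh k"
proof -
  have "k * (z + 1) = k * z + k" "k * (z - 1) = k * z - k" by (simp_all add: algebra_simps)
  thus ?thesis
    by (simp add: kink_def cosh_diff cosh_add add_divide_distrib[symmetric])
qed

lemma kink_step_left: "kink k (z - 1) = 2 * cosh k - 1 / kink k z"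
  using kink_step[of k "z - 1"] by simp

lemma kink_bounds:
  assumes "0 < k"
  shows "exp (- k) < kink k z" "kink k z < exp k"
proof -
  have "sinh k * tanh (k * z) < sinh k * 1" "sinh k * (- 1) < sinh k * tanh (k * z)"
    using assms tanh_real_lt_1[of "k*z"] tanh_real_gt_neg1[of "k*z"]
    by (intro mult_strict_left_mono; simp)+
  thus "exp (- k) < kink k z" "kink k z < exp k"
    using cosh_minus_sinh[of k] cosh_plus_sinh[of k] unfolding kink_tanh by linarith+
qed

lemma kink_antimono:
  assumes "0 < k" "z \<le> z'"
  shows "kink k z' \<le> kink k z"
  unfolding kink_tanh using assms by (simp add: mult_left_mono)

lemma kink_half: "kink k (1 / 2) = 1"
  by (simp add: kink_def)

lemma kink_ge_1: "0 < k \<Longrightarrow> z \<le> 1 / 2 \<Longrightarrow> 1 \<le> kink k z"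
  using kink_antimono[of k z "1/2"] by (simp add: kink_half)

lemma kink_le_1: "0 < k \<Longrightarrow> 1 / 2 \<le> z \<Longrightarrow> kink k z \<le> 1"
  using kink_antimono[of k "1/2" z] by (simp add: kink_half)

lemma kink_deriv:
  "(kink k has_real_derivative - (k * sinh k * (1 - (tanh (k * z))\<^sup>2))) (at z)"
  unfolding kink_tanh[abs_def]
  by (rule derivative_eq_intros refl | simp)+

text \<open>
  With \<open>kink_deriv\<close> this is the equation of motion of a kink that moves with the speed \<open>sinh k / k\<close>.
\<close>

lemma kink_riccati: "(sinh k)\<^sup>2 * (1 - (tanh (k * z))\<^sup>2) = kink k z * (2 * cosh k - kink k z) - 1"
proof -
  have "(cosh k)\<^sup>2 = (sinh k)\<^sup>2 + 1" by (rule cosh_square_eq)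
  thus ?thesis unfolding kink_tanh by (simp add: power2_eq_square algebra_simps)
qed

text \<open>
  The soliton, with its exponential rate \<open>k\<close> as parameter in place of the speed \<open>sinh k / k\<close>, and written
  through its factors \<open>kink k z\<close> and \<open>1 / kink k z\<close>.
\<close>

definition sol :: "real \<Rightarrow> real \<Rightarrow> real \<times> real" where
  "sol k z = (ln (kink k (z + 1)) - ln (kink k z), 2 * cosh k - kink k z - 1 / kink k z)"

lemma kink_gap: "2 * cosh k - kink k z - 1 / kink k z
    = (sinh k / cosh (k * z))\<^sup>2 / kink k z"
proof -
  let ?A = "kink k z"
  have "1 - (tanh (k * z))\<^sup>2 = 1 / (cosh (k * z))\<^sup>2"
  proof -
    have "(cosh (k * z))\<^sup>2 - (sinh (k * z))\<^sup>2 = 1" by (simp add: cosh_square_eq)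
    moreover have "1 - (tanh (k * z))\<^sup>2 = ((cosh (k * z))\<^sup>2 - (sinh (k * z))\<^sup>2) / (cosh (k * z))\<^sup>2"
      by (simp add: tanh_def power_divide diff_divide_distrib)
    ultimately show ?thesis by simp
  qed
  hence "(sinh k / cosh (k * z))\<^sup>2 = ?A * (2 * cosh k - ?A) - 1"
    using kink_riccati[of k z] by (simp add: power_divide)
  moreover have "2 * cosh k - ?A - 1 / ?A = (?A * (2 * cosh k - ?A) - 1) / ?A"
    using kink_pos[of k z] by (simp add: diff_divide_distrib)
  ultimately show ?thesis by simp
qed

lemma u_tilde_sol:
  assumes "1 < c"
  shows "u_tilde c z = sol (kappa c) z"
proof -
  let ?k = "kappa c"
  have k: "0 < ?k" "c * ?k = sinh ?k" using kappa[OF assms] by (auto simp: field_simps)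
  have "p_tilde c z = sinh ?k * sinh ?k / (cosh (?k * (z - 1)) * cosh (?k * z))"
    unfolding p_tilde_eq using k by (simp add: mult.assoc[symmetric])
  also have "\<dots> = 2 * cosh ?k - kink ?k z - 1 / kink ?k z"
    unfolding kink_gap unfolding kink_def by (simp add: power2_eq_square mult.commute)
  finally show ?thesis
    by (simp add: u_tilde_def sol_def r_tilde_def q_tilde_def kink_def)
qed

lemma sol_fst: "fst (sol k z) = - ln (1 + (sinh k / cosh (k * z))\<^sup>2)"
proof -
  let ?A = "kink k z" and ?B = "kink k (z + 1)"
  have B: "1 / ?B = 2 * cosh k - ?A" using kink_step[of k z] by simp
  have "?A / ?B = ?A * (2 * cosh k - ?A)" unfolding B[symmetric] by simp
  also have "\<dots> = 1 + (sinh k / cosh (k * z))\<^sup>2"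
  proof -
    have "?A * (2 * cosh k - ?A - 1 / ?A) = (sinh k / cosh (k * z))\<^sup>2"
      unfolding kink_gap using kink_pos[of k z] by simp
    moreover have "?A * (2 * cosh k - ?A - 1 / ?A) = ?A * (2 * cosh k - ?A) - 1"
      using kink_pos[of k z] by (simp add: right_diff_distrib)
    ultimately show ?thesis by linarith
  qed
  finally have "ln (?A / ?B) = ln (1 + (sinh k / cosh (k * z))\<^sup>2)" by simp
  moreover have "ln (?A / ?B) = ln ?A - ln ?B" using kink_pos[of k z] kink_pos[of k "z + 1"] by (simp add: ln_div)
  ultimately show ?thesis by (simp add: sol_def)
qed

lemma sol_snd: "snd (sol k z) = (sinh k / cosh (k * z))\<^sup>2 / kink k z"
  by (simp add: sol_def kink_gap)

lemma exp_minus_sol_fst: "exp (- fst (sol k z)) = kink k z / kink k (z + 1)"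
  using kink_pos by (simp add: sol_def exp_diff)

section \<open>Lipschitz dependence of the soliton on rate and position\<close>

lemma cosh_lower: "1 + (y::real)\<^sup>2 / 4 \<le> cosh y"
proof -
  have "1 + y\<^sup>2 / 4 \<le> cosh y" if "0 \<le> y" for y :: real
    using exp_lower_Taylor_quadratic[OF that] exp_ge_add_one_self[of "-y"]
    by (simp add: cosh_def)
  from this[of y] this[of "-y"] show ?thesis by (cases "0 \<le> y") auto
qed

text \<open>
  Differentiating the soliton in its rate costs a factor \<open>\<bar>z\<bar>\<close>. The exponential decay pays for it and still
  leaves a weight that is summable over the lattice, uniformly in the rate.
\<close>

lemma weight_bound:
  fixes k1 k z \<mu> :: real
  assumes "0 < k1" "k1 \<le> k" and mu: "\<mu> = min 1 (k1\<^sup>2 / 4)"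
  shows "(1 + \<bar>z\<bar>) / (cosh (k * z))\<^sup>2 \<le> (2 / \<mu>\<^sup>2) / (1 + z\<^sup>2)"
proof -
  have m: "0 < \<mu>" "\<mu> \<le> 1" "\<mu> \<le> k1\<^sup>2 / 4" using assms by auto
  have p: "0 < 1 + z\<^sup>2" by (simp add: add_pos_nonneg)
  have "\<mu> * (1 + z\<^sup>2) \<le> 1 + (k1\<^sup>2 / 4) * z\<^sup>2"
    unfolding distrib_left using m by (intro add_mono mult_right_mono) auto
  also have "\<dots> \<le> 1 + (k\<^sup>2 / 4) * z\<^sup>2"
    using assms by (intro add_left_mono mult_right_mono divide_right_mono power_mono) auto
  also have "\<dots> \<le> cosh (k * z)" using cosh_lower[of "k * z"] by (simp add: power_mult_distrib)
  finally have c: "\<mu> * (1 + z\<^sup>2) \<le> cosh (k * z)" .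
  have "(\<mu> * (1 + z\<^sup>2))\<^sup>2 \<le> (cosh (k * z))\<^sup>2" using c m p by (intro power_mono) auto
  hence "(1 + \<bar>z\<bar>) / (cosh (k * z))\<^sup>2 \<le> (1 + \<bar>z\<bar>) / (\<mu> * (1 + z\<^sup>2))\<^sup>2"
    using m p by (intro divide_left_mono) auto
  also have "\<dots> \<le> (2 * (1 + z\<^sup>2)) / (\<mu> * (1 + z\<^sup>2))\<^sup>2"
  proof (rule divide_right_mono)
    have "2 * \<bar>z\<bar> \<le> 1 + z\<^sup>2" using sum_squares_bound[of 1 "\<bar>z\<bar>"] by simp
    moreover have "\<bar>z\<bar> \<le> 2 * \<bar>z\<bar>" "0 \<le> z\<^sup>2" by simp_all
    ultimately have "\<bar>z\<bar> \<le> 1 + 2 * z\<^sup>2" by argo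
    thus "1 + \<bar>z\<bar> \<le> 2 * (1 + z\<^sup>2)" by simp
  qed auto
  also have "\<dots> = (2 / \<mu>\<^sup>2) / (1 + z\<^sup>2)"
  proof -
    have "2 * q / (m * q)\<^sup>2 = 2 / m\<^sup>2 / q" if "0 < q" "0 < m" for q m :: real
      using that by (simp add: power_mult_distrib power2_eq_square)
    from this[OF p m(1)] show ?thesis .
  qed
  finally show ?thesis .
qed

lemma weight_shift:
  assumes "\<bar>z - z'\<bar> \<le> 1"
  shows "1 / (1 + z'\<^sup>2) \<le> 3 / (1 + (z::real)\<^sup>2)"
proof -
  have a: "(z - z')\<^sup>2 \<le> 1" using assms by (simp add: abs_square_le_1)
  have b: "0 \<le> (z - 2 * z')\<^sup>2" by (rule zero_le_power2)
  have "1 + z\<^sup>2 = 1 + 2 * (z - z')\<^sup>2 + 2 * z'\<^sup>2 - (z - 2 * z')\<^sup>2"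
    by (simp add: power2_eq_square algebra_simps)
  also have "\<dots> \<le> 1 + 2 * 1 + 2 * z'\<^sup>2 - 0"
    by (intro diff_mono add_mono mult_left_mono a b) auto
  also have "\<dots> \<le> 3 * (1 + z'\<^sup>2)" by simp
  finally have "1 + z\<^sup>2 \<le> 3 * (1 + z'\<^sup>2)" .
  thus ?thesis by (simp add: field_simps add_pos_nonneg)
qed

text \<open>
  Uniform in the position \<open>x\<close>, because a shift by an integer only reindexes the sum.
\<close>

lemma weight_sum_bound:
  "\<exists>S>0. \<forall>x::real. \<forall>F::int set. finite F \<longrightarrow> (\<Sum>n\<in>F. 1 / (1 + (of_int n - x)\<^sup>2)) \<le> S"
proof -
  let ?h = "\<lambda>n::int. 1 / (1 + (real_of_int n)\<^sup>2)"
  define S where "S = 3 * (infsum ?h UNIV + 1)"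
  have pos: "0 \<le> ?h n" for n by (simp add: add_nonneg_nonneg)
  have "0 < S" unfolding S_def by (intro mult_pos_pos add_nonneg_pos infsum_nonneg) (auto intro: pos)
  moreover have "(\<Sum>n\<in>F. 1 / (1 + (of_int n - x)\<^sup>2)) \<le> S" if F: "finite F" for F x
  proof -
    let ?m = "\<lfloor>x\<rfloor>"
    have "(\<Sum>n\<in>F. 1 / (1 + (of_int n - x)\<^sup>2)) \<le> (\<Sum>n\<in>F. 3 * ?h (n - ?m))"
    proof (rule sum_mono)
      fix n
      have "\<bar>of_int (n - ?m) - (of_int n - x)\<bar> \<le> 1" by simp linarith
      from weight_shift[OF this] show "1 / (1 + (of_int n - x)\<^sup>2) \<le> 3 * ?h (n - ?m)" by simp
    qed
    also have "\<dots> = 3 * (\<Sum>n\<in>(\<lambda>n. n - ?m) ` F. ?h n)"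
      by (simp add: sum.reindex inj_on_def sum_distrib_left)
    also have "(\<Sum>n\<in>(\<lambda>n. n - ?m) ` F. ?h n) \<le> infsum ?h UNIV"
      using F pos by (intro finite_sum_le_infsum summable_on_int_inverse_square) auto
    finally show ?thesis by (simp add: S_def)
  qed
  ultimately show ?thesis by blast
qed

lemma abs_tanh_le_1: "\<bar>tanh (y::real)\<bar> \<le> 1"
  using tanh_real_lt_1[of y] tanh_real_gt_neg1[of y] by linarith

text \<open>
  The mean value theorem on the segment from \<open>(k, z)\<close> to \<open>(k', z')\<close>. There \<open>A\<close> is the kink and
  \<open>s = sinh K / cosh (K * Z)\<close>, in terms of which the two components of the soliton are \<open>- ln (1 + s\<^sup>2)\<close> and
  \<open>s\<^sup>2 / A\<close>; their derivatives carry the weight of \<open>weight_bound\<close>.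
\<close>

lemma sol_lipschitz:
  assumes k1: "0 < k1"
  shows "\<exists>C>0. \<forall>k k' z z'. k1 \<le> k \<longrightarrow> k \<le> k2 \<longrightarrow> k1 \<le> k' \<longrightarrow> k' \<le> k2 \<longrightarrow> \<bar>z - z'\<bar> \<le> 1 \<longrightarrow>
      \<bar>fst (sol k' z') - fst (sol k z)\<bar> \<le> C * (\<bar>k' - k\<bar> + \<bar>z' - z\<bar>) / (1 + z\<^sup>2) \<and>
      \<bar>snd (sol k' z') - snd (sol k z)\<bar> \<le> C * (\<bar>k' - k\<bar> + \<bar>z' - z\<bar>) / (1 + z\<^sup>2)"
proof -
  define R where "R = exp k2"
  define \<mu> where "\<mu> = min 1 (k1\<^sup>2 / 4)"
  define C where "C = 7 * R ^ 6 * (2 / \<mu>\<^sup>2) * 3"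
  have R0: "0 < R" by (simp add: R_def)
  have m: "0 < \<mu>" using k1 by (simp add: \<mu>_def)
  have C: "0 < C" using R0 m by (simp add: C_def)
  have "\<bar>fst (sol k' z') - fst (sol k z)\<bar> \<le> C * (\<bar>k' - k\<bar> + \<bar>z' - z\<bar>) / (1 + z\<^sup>2) \<and>
      \<bar>snd (sol k' z') - snd (sol k z)\<bar> \<le> C * (\<bar>k' - k\<bar> + \<bar>z' - z\<bar>) / (1 + z\<^sup>2)"
    if k: "k1 \<le> k" "k \<le> k2" "k1 \<le> k'" "k' \<le> k2" and zz: "\<bar>z - z'\<bar> \<le> 1" for k k' z z'
  proof -
    define dk dz \<Delta> where "dk = k' - k" and "dz = z' - z" and "\<Delta> = \<bar>dk\<bar> + \<bar>dz\<bar>"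
    define K Z where "K = (\<lambda>\<tau>. k + \<tau> * dk)" and "Z = (\<lambda>\<tau>. z + \<tau> * dz)"
    define y where "y = (\<lambda>\<tau>. K \<tau> * Z \<tau>)"
    define y' where "y' = (\<lambda>\<tau>. dk * Z \<tau> + K \<tau> * dz)"
    define s where "s = (\<lambda>\<tau>. sinh (K \<tau>) / cosh (y \<tau>))"
    define s' where "s' = (\<lambda>\<tau>. (cosh (K \<tau>) * dk - sinh (K \<tau>) * tanh (y \<tau>) * y' \<tau>) / cosh (y \<tau>))"
    define A where "A = (\<lambda>\<tau>. cosh (K \<tau>) - sinh (K \<tau>) * tanh (y \<tau>))"
    define A' where "A' = (\<lambda>\<tau>. sinh (K \<tau>) * dk - (cosh (K \<tau>) * dk * tanh (y \<tau>)
        + sinh (K \<tau>) * ((1 - (tanh (y \<tau>))\<^sup>2) * y' \<tau>)))"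
    have A_kink: "A \<tau> = kink (K \<tau>) (Z \<tau>)" for \<tau> by (simp add: A_def kink_tanh y_def)
    have dK: "(K has_real_derivative dk) (at \<tau>)" and dZ: "(Z has_real_derivative dz) (at \<tau>)" for \<tau>
      unfolding K_def Z_def by (auto intro!: derivative_eq_intros)
    have dy: "(y has_real_derivative y' \<tau>) (at \<tau>)" for \<tau>
      unfolding y_def y'_def by (rule derivative_eq_intros dK dZ refl)+ simp
    have ds: "(s has_real_derivative s' \<tau>) (at \<tau>)" for \<tau>
    proof -
      have a: "((\<lambda>\<tau>. sinh (K \<tau>)) has_real_derivative cosh (K \<tau>) * dk) (at \<tau>)"
        by (rule DERIV_chain2[OF _ dK]) (auto intro!: derivative_eq_intros)
      have b: "((\<lambda>\<tau>. cosh (y \<tau>)) has_real_derivative sinh (y \<tau>) * y' \<tau>) (at \<tau>)"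
        by (rule DERIV_chain2[OF _ dy]) (auto intro!: derivative_eq_intros)
      have alg: "(u * c - sh * (v * y)) / (c * c) = (u - sh * (v / c) * y) / c"
        if "c \<noteq> 0" for u c sh v y :: real
        using that by (simp add: field_simps)
      show ?thesis
        unfolding s_def s'_def tanh_def
        by (rule DERIV_cong[OF DERIV_divide[OF a b] alg]) simp_all
    qed
    have dA: "(A has_real_derivative A' \<tau>) (at \<tau>)" for \<tau>
    proof -
      have a: "((\<lambda>\<tau>. sinh (K \<tau>)) has_real_derivative cosh (K \<tau>) * dk) (at \<tau>)"
        by (rule DERIV_chain2[OF _ dK]) (auto intro!: derivative_eq_intros)
      have b: "((\<lambda>\<tau>. cosh (K \<tau>)) has_real_derivative sinh (K \<tau>) * dk) (at \<tau>)"
        by (rule DERIV_chain2[OF _ dK]) (auto intro!: derivative_eq_intros)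
      have c: "((\<lambda>\<tau>. tanh (y \<tau>)) has_real_derivative (1 - (tanh (y \<tau>))\<^sup>2) * y' \<tau>) (at \<tau>)"
        by (rule DERIV_chain2[OF _ dy]) (rule has_field_derivative_tanh[OF _ DERIV_ident, THEN DERIV_cong]; simp)
      show ?thesis unfolding A_def A'_def
        by (rule DERIV_cong[OF DERIV_diff[OF b DERIV_mult[OF a c]]]) (simp add: algebra_simps)
    qed
    have Apos: "0 < A \<tau>" for \<tau> unfolding A_kink by (rule kink_pos)
    have dr: "((\<lambda>\<tau>. fst (sol (K \<tau>) (Z \<tau>))) has_real_derivative
        - (2 * s \<tau> * s' \<tau> / (1 + (s \<tau>)\<^sup>2))) (at \<tau>)" for \<tau>
    proof -
      have e: "(\<lambda>\<tau>. fst (sol (K \<tau>) (Z \<tau>))) = (\<lambda>\<tau>. - ln (1 + (s \<tau>)\<^sup>2))"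
        by (simp add: sol_fst s_def y_def)
      have "0 < 1 + (s \<tau>)\<^sup>2" by (simp add: add_pos_nonneg)
      thus ?thesis unfolding e
        by - (rule derivative_eq_intros ds refl | simp add: field_simps)+
    qed
    have dp: "((\<lambda>\<tau>. snd (sol (K \<tau>) (Z \<tau>))) has_real_derivative
        2 * s \<tau> * s' \<tau> / A \<tau> - (s \<tau>)\<^sup>2 * A' \<tau> / (A \<tau>)\<^sup>2) (at \<tau>)" for \<tau>
    proof -
      have e: "(\<lambda>\<tau>. snd (sol (K \<tau>) (Z \<tau>))) = (\<lambda>\<tau>. (s \<tau>)\<^sup>2 / A \<tau>)"
        by (simp add: sol_snd s_def y_def A_kink)
      show ?thesis unfolding e using Apos[of \<tau>]
        by - (rule derivative_eq_intros ds dA refl | simp add: field_simps power2_eq_square)+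
    qed
    have bnd: "\<bar>- (2 * s \<tau> * s' \<tau> / (1 + (s \<tau>)\<^sup>2))\<bar> \<le> C * \<Delta> / (1 + z\<^sup>2) \<and>
        \<bar>2 * s \<tau> * s' \<tau> / A \<tau> - (s \<tau>)\<^sup>2 * A' \<tau> / (A \<tau>)\<^sup>2\<bar> \<le> C * \<Delta> / (1 + z\<^sup>2)"
      if t: "0 \<le> \<tau>" "\<tau> \<le> 1" for \<tau>
    proof -
      have Kc: "K \<tau> = (1 - \<tau>) * k + \<tau> * k'" by (simp add: K_def dk_def algebra_simps)
      have "(1 - \<tau>) * k1 + \<tau> * k1 \<le> K \<tau>" "K \<tau> \<le> (1 - \<tau>) * k2 + \<tau> * k2"
        unfolding Kc using k t by (intro add_mono mult_left_mono; simp)+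
      hence K: "k1 \<le> K \<tau>" "K \<tau> \<le> k2" by (simp_all add: algebra_simps)
      hence K0: "0 < K \<tau>" using k1 by simp
      have "\<bar>\<tau> * dz\<bar> \<le> 1 * 1" unfolding abs_mult using t zz by (intro mult_mono) (auto simp: dz_def)
      hence Z: "\<bar>z - Z \<tau>\<bar> \<le> 1" by (simp add: Z_def)
      have expK: "exp (K \<tau>) \<le> R" using K by (simp add: R_def)
      have shR: "0 \<le> sinh (K \<tau>)" "sinh (K \<tau>) \<le> R" "0 \<le> cosh (K \<tau>)" "cosh (K \<tau>) \<le> R"
        using K0 expK cosh_plus_sinh[of "K \<tau>"] cosh_real_ge_1[of "K \<tau>"] sinh_real_nonneg_iff[of "K \<tau>"]
        by linarith+
      have R1: "1 \<le> R" using shR(4) cosh_real_ge_1[of "K \<tau>"] by linarith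
      have KR: "K \<tau> \<le> R" using expK exp_ge_add_one_self[of "K \<tau>"] by linarith
      have Ainv: "1 / A \<tau> \<le> R"
      proof -
        have "1 / A \<tau> \<le> 1 / exp (- K \<tau>)"
          unfolding A_kink using kink_bounds(1)[OF K0, of "Z \<tau>"] kink_pos[of "K \<tau>" "Z \<tau>"]
          by (intro divide_left_mono) auto
        thus ?thesis using expK by (simp add: exp_minus inverse_eq_divide)
      qed
      define w where "w = 1 + \<bar>Z \<tau>\<bar>"
      have w: "1 \<le> w" by (simp add: w_def)
      have D: "0 \<le> \<Delta>" "\<bar>dk\<bar> \<le> \<Delta>" "\<bar>dz\<bar> \<le> \<Delta>" by (simp_all add: \<Delta>_def)
      have y'b: "\<bar>y' \<tau>\<bar> \<le> R * (w * \<Delta>)"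
      proof -
        have "\<bar>y' \<tau>\<bar> \<le> \<bar>dk\<bar> * \<bar>Z \<tau>\<bar> + K \<tau> * \<bar>dz\<bar>"
          using abs_triangle_ineq[of "dk * Z \<tau>" "K \<tau> * dz"] K0 by (simp add: y'_def abs_mult)
        also have "\<dots> \<le> R * (\<Delta> * \<bar>Z \<tau>\<bar>) + R * \<Delta>"
        proof (rule add_mono)
          show "K \<tau> * \<bar>dz\<bar> \<le> R * \<Delta>" using KR D R0 by (intro mult_mono) auto
          have "\<bar>dk\<bar> * \<bar>Z \<tau>\<bar> \<le> 1 * (\<Delta> * \<bar>Z \<tau>\<bar>)" using D by (simp add: mult_right_mono)
          also have "\<dots> \<le> R * (\<Delta> * \<bar>Z \<tau>\<bar>)" using R1 D by (intro mult_right_mono) auto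
          finally show "\<bar>dk\<bar> * \<bar>Z \<tau>\<bar> \<le> R * (\<Delta> * \<bar>Z \<tau>\<bar>)" by simp
        qed
        also have "\<dots> = R * (w * \<Delta>)" by (simp add: w_def algebra_simps)
        finally show ?thesis .
      qed
      have wD: "\<Delta> \<le> w * \<Delta>" using w D by (simp add: mult_le_cancel_right1)
      have wD0: "0 \<le> w * \<Delta>" using w D by simp
      have RR: "R \<le> R\<^sup>2" using R1 by (simp add: power2_eq_square mult_le_cancel_left1)
      have T: "\<bar>tanh (y \<tau>)\<bar> \<le> 1" by (rule abs_tanh_le_1)
      have RwD: "R * \<Delta> \<le> R\<^sup>2 * (w * \<Delta>)" using RR wD D R0 by (intro mult_mono) auto
      have s'b: "\<bar>s' \<tau>\<bar> \<le> 2 * R\<^sup>2 * (w * \<Delta>) / cosh (y \<tau>)"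
      proof -
        have "\<bar>cosh (K \<tau>) * dk - sinh (K \<tau>) * tanh (y \<tau>) * y' \<tau>\<bar>
            \<le> cosh (K \<tau>) * \<bar>dk\<bar> + sinh (K \<tau>) * \<bar>tanh (y \<tau>)\<bar> * \<bar>y' \<tau>\<bar>"
          using abs_triangle_ineq4[of "cosh (K \<tau>) * dk" "sinh (K \<tau>) * tanh (y \<tau>) * y' \<tau>"] shR
          by (simp add: abs_mult)
        also have "\<dots> \<le> R * \<Delta> + R * 1 * (R * (w * \<Delta>))"
          using shR D T y'b R0 by (intro add_mono mult_mono) auto
        also have "\<dots> \<le> 2 * R\<^sup>2 * (w * \<Delta>)" using RwD by (simp add: power2_eq_square algebra_simps)
        finally show ?thesis unfolding s'_def by (simp add: abs_divide divide_right_mono)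
      qed
      have A'b: "\<bar>A' \<tau>\<bar> \<le> 3 * R\<^sup>2 * (w * \<Delta>)"
      proof -
        let ?q = "1 - (tanh (y \<tau>))\<^sup>2"
        have q: "0 \<le> ?q" "?q \<le> 1" using T by (auto simp: abs_square_le_1)
        have "\<bar>A' \<tau>\<bar> \<le> sinh (K \<tau>) * \<bar>dk\<bar> + (cosh (K \<tau>) * \<bar>dk\<bar> * \<bar>tanh (y \<tau>)\<bar>
            + sinh (K \<tau>) * (?q * \<bar>y' \<tau>\<bar>))"
          unfolding A'_def
          using abs_triangle_ineq4[of "sinh (K \<tau>) * dk" "cosh (K \<tau>) * dk * tanh (y \<tau>) + sinh (K \<tau>) * (?q * y' \<tau>)"]
            abs_triangle_ineq[of "cosh (K \<tau>) * dk * tanh (y \<tau>)" "sinh (K \<tau>) * (?q * y' \<tau>)"] shR q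
          by (simp add: abs_mult)
        also have "\<dots> \<le> R * \<Delta> + (R * \<Delta> * 1 + R * (1 * (R * (w * \<Delta>))))"
          using shR D T y'b R0 q by (intro add_mono mult_mono mult_nonneg_nonneg) auto
        also have "\<dots> \<le> 3 * R\<^sup>2 * (w * \<Delta>)" using RwD by (simp add: power2_eq_square algebra_simps)
        finally show ?thesis .
      qed
      have sb: "0 \<le> s \<tau>" "s \<tau> \<le> R / cosh (y \<tau>)" unfolding s_def using shR by (auto intro: divide_right_mono)
      define W where "W = w * \<Delta> / (cosh (y \<tau>))\<^sup>2"
      have W0: "0 \<le> W" using wD0 by (simp add: W_def)
      have ss: "s \<tau> * \<bar>s' \<tau>\<bar> \<le> 2 * R ^ 3 * W"
      proof -
        have "s \<tau> * \<bar>s' \<tau>\<bar> \<le> (R / cosh (y \<tau>)) * (2 * R\<^sup>2 * (w * \<Delta>) / cosh (y \<tau>))"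
          using sb s'b R0 by (intro mult_mono) auto
        thus ?thesis by (simp add: W_def power2_eq_square power3_eq_cube algebra_simps)
      qed
      have s2: "(s \<tau>)\<^sup>2 * \<bar>A' \<tau>\<bar> \<le> 3 * R ^ 4 * W"
      proof -
        have "(s \<tau>)\<^sup>2 * \<bar>A' \<tau>\<bar> \<le> (R / cosh (y \<tau>))\<^sup>2 * (3 * R\<^sup>2 * (w * \<Delta>))"
          using sb A'b R0 by (intro mult_mono power_mono) auto
        thus ?thesis by (simp add: W_def power2_eq_square power4_eq_xxxx algebra_simps)
      qed
      have CW: "7 * R ^ 6 * W \<le> C * \<Delta> / (1 + z\<^sup>2)"
      proof -
        have "W = \<Delta> * ((1 + \<bar>Z \<tau>\<bar>) / (cosh (K \<tau> * Z \<tau>))\<^sup>2)" by (simp add: W_def w_def y_def)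
        also have "\<dots> \<le> \<Delta> * ((2 / \<mu>\<^sup>2) / (1 + (Z \<tau>)\<^sup>2))"
          using D K k1 by (intro mult_left_mono weight_bound) (auto simp: \<mu>_def)
        also have "\<dots> = \<Delta> * (2 / \<mu>\<^sup>2) * (1 / (1 + (Z \<tau>)\<^sup>2))" by simp
        also have "\<dots> \<le> \<Delta> * (2 / \<mu>\<^sup>2) * (3 / (1 + z\<^sup>2))"
          using D weight_shift[OF Z] by (intro mult_left_mono) auto
        finally have "7 * R ^ 6 * W \<le> 7 * R ^ 6 * (\<Delta> * (2 / \<mu>\<^sup>2) * (3 / (1 + z\<^sup>2)))"
          using R0 by (intro mult_left_mono) auto
        also have "\<dots> = C * \<Delta> / (1 + z\<^sup>2)" by (simp add: C_def)
        finally show ?thesis .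
      qed
      have pw: "R ^ 3 \<le> R ^ 6" "R ^ 4 \<le> R ^ 6"  using R1 by (auto intro: power_increasing)
      have r: "\<bar>- (2 * s \<tau> * s' \<tau> / (1 + (s \<tau>)\<^sup>2))\<bar> \<le> 7 * R ^ 6 * W"
      proof -
        have "\<bar>- (2 * s \<tau> * s' \<tau> / (1 + (s \<tau>)\<^sup>2))\<bar> = 2 * (s \<tau> * \<bar>s' \<tau>\<bar>) / (1 + (s \<tau>)\<^sup>2)"
          using sb by (simp add: abs_mult abs_divide add_nonneg_nonneg)
        also have "\<dots> \<le> 2 * (s \<tau> * \<bar>s' \<tau>\<bar>) / 1"
          using sb by (intro divide_left_mono) (auto simp: add_pos_nonneg)
        also have "\<dots> \<le> 4 * R ^ 3 * W" using ss unfolding div_by_1 by argo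
        also have "\<dots> \<le> 7 * R ^ 6 * W" using pw W0 zero_le_power[of R 6] R0 by (intro mult_right_mono) linarith+
        finally show ?thesis .
      qed
      have p: "\<bar>2 * s \<tau> * s' \<tau> / A \<tau> - (s \<tau>)\<^sup>2 * A' \<tau> / (A \<tau>)\<^sup>2\<bar> \<le> 7 * R ^ 6 * W"
      proof -
        have "\<bar>2 * s \<tau> * s' \<tau> / A \<tau> - (s \<tau>)\<^sup>2 * A' \<tau> / (A \<tau>)\<^sup>2\<bar>
            \<le> \<bar>2 * s \<tau> * s' \<tau> / A \<tau>\<bar> + \<bar>(s \<tau>)\<^sup>2 * A' \<tau> / (A \<tau>)\<^sup>2\<bar>" by (rule abs_triangle_ineq4)
        also have "\<dots> = 2 * (s \<tau> * \<bar>s' \<tau>\<bar>) * (1 / A \<tau>) + ((s \<tau>)\<^sup>2 * \<bar>A' \<tau>\<bar>) * (1 / A \<tau>)\<^sup>2"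
          using sb Apos[of \<tau>] by (simp add: abs_mult abs_divide power_divide)
        also have "\<dots> \<le> 2 * (2 * R ^ 3 * W) * R + (3 * R ^ 4 * W) * R\<^sup>2"
        proof (rule add_mono)
          show "2 * (s \<tau> * \<bar>s' \<tau>\<bar>) * (1 / A \<tau>) \<le> 2 * (2 * R ^ 3 * W) * R"
            by (rule mult_mono) (use ss Ainv Apos[of \<tau>] W0 R0 in \<open>auto simp: ac_simps\<close>)
          show "((s \<tau>)\<^sup>2 * \<bar>A' \<tau>\<bar>) * (1 / A \<tau>)\<^sup>2 \<le> (3 * R ^ 4 * W) * R\<^sup>2"
            by (rule mult_mono[OF s2 power_mono[OF Ainv]]) (use Apos[of \<tau>] W0 R0 in auto)
        qed
        also have "\<dots> = 4 * R ^ 4 * W + 3 * R ^ 6 * W"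
          by (simp add: eval_nat_numeral)
        also have "\<dots> \<le> 7 * R ^ 6 * W" using mult_right_mono[OF pw(2) W0] by argo
        finally show ?thesis .
      qed
      show ?thesis using r p CW by linarith
    qed
    have end_pts: "K 0 = k" "K 1 = k'" "Z 0 = z" "Z 1 = z'"
      by (simp_all add: K_def Z_def dk_def dz_def)
    obtain \<tau>1 where 1: "0 < \<tau>1" "\<tau>1 < 1"
      "fst (sol (K 1) (Z 1)) - fst (sol (K 0) (Z 0)) = (1 - 0) * - (2 * s \<tau>1 * s' \<tau>1 / (1 + (s \<tau>1)\<^sup>2))"
      using MVT2[OF zero_less_one, of "\<lambda>\<tau>. fst (sol (K \<tau>) (Z \<tau>))" "\<lambda>\<tau>. - (2 * s \<tau> * s' \<tau> / (1 + (s \<tau>)\<^sup>2))"] dr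
      by blast
    obtain \<tau>2 where 2: "0 < \<tau>2" "\<tau>2 < 1"
      "snd (sol (K 1) (Z 1)) - snd (sol (K 0) (Z 0)) = (1 - 0) * (2 * s \<tau>2 * s' \<tau>2 / A \<tau>2 - (s \<tau>2)\<^sup>2 * A' \<tau>2 / (A \<tau>2)\<^sup>2)"
      using MVT2[OF zero_less_one, of "\<lambda>\<tau>. snd (sol (K \<tau>) (Z \<tau>))" "\<lambda>\<tau>. 2 * s \<tau> * s' \<tau> / A \<tau> - (s \<tau>)\<^sup>2 * A' \<tau> / (A \<tau>)\<^sup>2"] dp
      by blast
    have "\<Delta> = \<bar>k' - k\<bar> + \<bar>z' - z\<bar>" by (simp add: \<Delta>_def dk_def dz_def)
    thus ?thesis using 1 2 bnd[of \<tau>1] bnd[of \<tau>2] unfolding end_pts by simp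
  qed
  with C show ?thesis by blast
qed

lemma sol_lipschitz_l2:
  assumes k1: "0 < k1"
  shows "\<exists>C>0. \<forall>k k' x x' F. k1 \<le> k \<longrightarrow> k \<le> k2 \<longrightarrow> k1 \<le> k' \<longrightarrow> k' \<le> k2 \<longrightarrow> \<bar>x - x'\<bar> \<le> 1 \<longrightarrow> finite F \<longrightarrow>
      (\<Sum>n\<in>F. (norm (sol k' (of_int n - x') - sol k (of_int n - x)))\<^sup>2) \<le> (C * (\<bar>k' - k\<bar> + \<bar>x' - x\<bar>))\<^sup>2"
proof -
  obtain C where C: "C > 0" and lip: "\<And>k k' z z'. k1 \<le> k \<Longrightarrow> k \<le> k2 \<Longrightarrow> k1 \<le> k' \<Longrightarrow> k' \<le> k2 \<Longrightarrow> \<bar>z - z'\<bar> \<le> 1 \<Longrightarrow>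
      \<bar>fst (sol k' z') - fst (sol k z)\<bar> \<le> C * (\<bar>k' - k\<bar> + \<bar>z' - z\<bar>) / (1 + z\<^sup>2) \<and>
      \<bar>snd (sol k' z') - snd (sol k z)\<bar> \<le> C * (\<bar>k' - k\<bar> + \<bar>z' - z\<bar>) / (1 + z\<^sup>2)"
    using sol_lipschitz[OF k1, of k2] by blast
  obtain S where S: "S > 0" "\<And>(x::real) (F :: int set). finite F \<Longrightarrow> (\<Sum>n\<in>F. 1 / (1 + (of_int n - x)\<^sup>2)) \<le> S"
    using weight_sum_bound by blast
  define C' where "C' = C * sqrt (2 * S)"
  have "C' > 0" using C S by (simp add: C'_def)
  moreover have "(\<Sum>n\<in>F. (norm (sol k' (of_int n - x') - sol k (of_int n - x)))\<^sup>2) \<le> (C' * (\<bar>k' - k\<bar> + \<bar>x' - x\<bar>))\<^sup>2"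
    if k: "k1 \<le> k" "k \<le> k2" "k1 \<le> k'" "k' \<le> k2" and x: "\<bar>x - x'\<bar> \<le> 1" and F: "finite F" for k k' x x' F
  proof -
    define \<Delta> where "\<Delta> = \<bar>k' - k\<bar> + \<bar>x' - x\<bar>"
    have "(norm (sol k' (of_int n - x') - sol k (of_int n - x)))\<^sup>2 \<le> 2 * (C * \<Delta>)\<^sup>2 * (1 / (1 + (of_int n - x)\<^sup>2))" for n :: int
    proof -
      let ?z = "of_int n - x" and ?z' = "of_int n - x'"
      define g where "g = 1 / (1 + ?z\<^sup>2)"
      have g: "0 \<le> g" "g \<le> 1" by (auto simp: g_def add_nonneg_nonneg field_simps add_pos_nonneg)
      have D: "\<Delta> = \<bar>k' - k\<bar> + \<bar>?z' - ?z\<bar>" unfolding \<Delta>_def by (simp add: abs_minus_commute)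
      have "\<bar>?z - ?z'\<bar> \<le> 1" using x by simp
      from lip[OF k this, folded D]
      have "\<bar>fst (sol k' ?z') - fst (sol k ?z)\<bar> \<le> C * \<Delta> * g" "\<bar>snd (sol k' ?z') - snd (sol k ?z)\<bar> \<le> C * \<Delta> * g"
        by (simp_all add: g_def)
      hence "(fst (sol k' ?z') - fst (sol k ?z))\<^sup>2 \<le> (C * \<Delta> * g)\<^sup>2" "(snd (sol k' ?z') - snd (sol k ?z))\<^sup>2 \<le> (C * \<Delta> * g)\<^sup>2"
        by (metis abs_ge_zero power2_abs power_mono)+
      hence "(norm (sol k' ?z' - sol k ?z))\<^sup>2 \<le> 2 * (C * \<Delta>)\<^sup>2 * g\<^sup>2"
        by (simp add: norm_prod_square power_mult_distrib)
      also have "\<dots> \<le> 2 * (C * \<Delta>)\<^sup>2 * g" using g by (intro mult_left_mono) (auto simp: power2_eq_square mult_left_le)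
      finally show ?thesis by (simp add: g_def)
    qed
    hence "(\<Sum>n\<in>F. (norm (sol k' (of_int n - x') - sol k (of_int n - x)))\<^sup>2)
        \<le> 2 * (C * \<Delta>)\<^sup>2 * (\<Sum>n\<in>F. 1 / (1 + (of_int n - x)\<^sup>2))"
      unfolding sum_distrib_left by (intro sum_mono)
    also have "\<dots> \<le> 2 * (C * \<Delta>)\<^sup>2 * S" using S(2)[OF F] by (intro mult_left_mono) auto
    also have "\<dots> = (C' * \<Delta>)\<^sup>2" using S(1) by (simp add: C'_def power_mult_distrib)
    finally show ?thesis by (simp add: \<Delta>_def)
  qed
  ultimately show ?thesis by blast
qed

section \<open>Perturbed kinks\<close>

text \<open>
  A deviation that vanishes at \<open>m\<close> and contracts away from \<open>m\<close> in both directions inherits square summability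
  from its source. The estimate can be restricted to the sites from \<open>N\<close> on as long as the starting point \<open>m\<close>
  is one of them; this locality yields convergence in front of the radiation.
\<close>

lemma two_sided_contraction_sum:
  fixes d f :: "int \<Rightarrow> real"
  assumes th: "0 \<le> \<theta>" "\<theta> < 1" and d0: "d m = 0" and d: "\<And>n. 0 \<le> d n"
    and fwd: "\<And>n. m \<le> n \<Longrightarrow> d (n + 1) \<le> \<theta> * d n + f n"
    and bwd: "\<And>n. n < m \<Longrightarrow> d n \<le> \<theta> * d (n + 1) + f n"
    and N: "N \<le> m" and B: "\<And>F. finite F \<Longrightarrow> F \<subseteq> {N..} \<Longrightarrow> (\<Sum>n\<in>F. (f n)\<^sup>2) \<le> B"
    and F: "finite F" "F \<subseteq> {N..}"
  shows "(\<Sum>n\<in>F. (d n)\<^sup>2) \<le> 2 * B / (1 - \<theta>)\<^sup>2"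
proof -
  define M where "M = Max (insert m F)"
  have M: "n \<le> M" if "n \<in> F" for n using F(1) that by (simp add: M_def)
  have t: "0 < (1 - \<theta>)\<^sup>2" using th by simp
  have right: "(\<Sum>n\<in>F \<inter> {m..}. (d n)\<^sup>2) \<le> B / (1 - \<theta>)\<^sup>2"
  proof -
    define K where "K = nat (M - m)"
    have "F \<inter> {m..} \<subseteq> (\<lambda>k. m + int k) ` {..K}"
    proof
      fix n assume "n \<in> F \<inter> {m..}"
      thus "n \<in> (\<lambda>k. m + int k) ` {..K}" using M[of n]
        by (intro image_eqI[of _ _ "nat (n - m)"]) (auto simp: K_def)
    qed
    hence "(\<Sum>n\<in>F \<inter> {m..}. (d n)\<^sup>2) \<le> (\<Sum>n\<in>(\<lambda>k. m + int k) ` {..K}. (d n)\<^sup>2)"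
      by (intro sum_mono2) auto
    also have "\<dots> = (\<Sum>k\<le>K. (d (m + int k))\<^sup>2)" by (subst sum.reindex) (auto simp: inj_on_def)
    also have "\<dots> \<le> (\<Sum>k<K. (f (m + int k))\<^sup>2) / (1 - \<theta>)\<^sup>2"
    proof (rule square_sum_contraction[OF th])
      show "d (m + int (Suc k)) \<le> \<theta> * d (m + int k) + f (m + int k)" for k
        using fwd[of "m + int k"] by (simp add: algebra_simps)
    qed (use d0 d in auto)
    also have "(\<Sum>k<K. (f (m + int k))\<^sup>2) = (\<Sum>n\<in>(\<lambda>k. m + int k) ` {..<K}. (f n)\<^sup>2)"
      by (subst sum.reindex) (auto simp: inj_on_def)
    also have "\<dots> / (1 - \<theta>)\<^sup>2 \<le> B / (1 - \<theta>)\<^sup>2"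
      using N by (intro divide_right_mono B) auto
    finally show ?thesis .
  qed
  have left: "(\<Sum>n\<in>F \<inter> {..<m}. (d n)\<^sup>2) \<le> B / (1 - \<theta>)\<^sup>2"
  proof -
    define K where "K = nat (m - N)"
    have "F \<inter> {..<m} \<subseteq> (\<lambda>k. m - int k) ` {..K}"
    proof
      fix n assume "n \<in> F \<inter> {..<m}"
      thus "n \<in> (\<lambda>k. m - int k) ` {..K}" using F(2)
        by (intro image_eqI[of _ _ "nat (m - n)"]) (auto simp: K_def)
    qed
    hence "(\<Sum>n\<in>F \<inter> {..<m}. (d n)\<^sup>2) \<le> (\<Sum>n\<in>(\<lambda>k. m - int k) ` {..K}. (d n)\<^sup>2)"
      by (intro sum_mono2) auto
    also have "\<dots> = (\<Sum>k\<le>K. (d (m - int k))\<^sup>2)" by (subst sum.reindex) (auto simp: inj_on_def)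
    also have "\<dots> \<le> (\<Sum>k<K. (f (m - int k - 1))\<^sup>2) / (1 - \<theta>)\<^sup>2"
    proof (rule square_sum_contraction[OF th])
      show "d (m - int (Suc k)) \<le> \<theta> * d (m - int k) + f (m - int k - 1)" for k
        using bwd[of "m - int k - 1"] by (simp add: algebra_simps)
    qed (use d0 d in auto)
    also have "(\<Sum>k<K. (f (m - int k - 1))\<^sup>2) = (\<Sum>n\<in>(\<lambda>k. m - int k - 1) ` {..<K}. (f n)\<^sup>2)"
      by (subst sum.reindex) (auto simp: inj_on_def)
    also have "\<dots> / (1 - \<theta>)\<^sup>2 \<le> B / (1 - \<theta>)\<^sup>2"
      using N by (intro divide_right_mono B) (auto simp: K_def)
    finally show ?thesis .
  qed
  have "(\<Sum>n\<in>F. (d n)\<^sup>2) = (\<Sum>n\<in>(F \<inter> {..<m}) \<union> (F \<inter> {m..}). (d n)\<^sup>2)"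
    by (rule sum.cong) auto
  also have "\<dots> = (\<Sum>n\<in>F \<inter> {..<m}. (d n)\<^sup>2) + (\<Sum>n\<in>F \<inter> {m..}. (d n)\<^sup>2)"
    using F by (intro sum.union_disjoint) auto
  finally show ?thesis using left right by (simp add: add_divide_distrib)
qed

lemma two_sided_contraction_sup:
  fixes d f :: "int \<Rightarrow> real"
  assumes th: "0 \<le> \<theta>" "\<theta> < 1" and d0: "d m = 0"
    and fwd: "\<And>n. m \<le> n \<Longrightarrow> d (n + 1) \<le> \<theta> * d n + f n"
    and bwd: "\<And>n. n < m \<Longrightarrow> d n \<le> \<theta> * d (n + 1) + f n"
    and f: "\<And>j. min n m \<le> j \<Longrightarrow> j \<le> max n m \<Longrightarrow> f j \<le> \<Phi>" and \<Phi>: "0 \<le> \<Phi>"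
  shows "d n \<le> \<Phi> / (1 - \<theta>)"
proof (cases "m \<le> n")
  case True
  define K where "K = nat (n - m)"
  have "d (m + int K) \<le> \<Phi> / (1 - \<theta>)"
  proof (rule sup_contraction[where x = "\<lambda>k. d (m + int k)" and K = K, OF th])
    fix k assume "k < K"
    hence "f (m + int k) \<le> \<Phi>" using True by (intro f) (auto simp: K_def)
    thus "d (m + int (Suc k)) \<le> \<theta> * d (m + int k) + \<Phi>"
      using fwd[of "m + int k"] by (simp add: algebra_simps)
  qed (use d0 \<Phi> in auto)
  thus ?thesis using True by (simp add: K_def)
next
  case False
  define K where "K = nat (m - n)"
  have "d (m - int K) \<le> \<Phi> / (1 - \<theta>)"
  proof (rule sup_contraction[where x = "\<lambda>k. d (m - int k)" and K = K, OF th])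
    fix k assume "k < K"
    hence "f (m - int k - 1) \<le> \<Phi>" using False by (intro f) (auto simp: K_def)
    thus "d (m - int (Suc k)) \<le> \<theta> * d (m - int k) + \<Phi>"
      using bwd[of "m - int k - 1"] by (simp add: algebra_simps)
  qed (use d0 \<Phi> in auto)
  thus ?thesis using False by (simp add: K_def)
qed

lemma exp_minus_one_small:
  fixes r :: real
  assumes "\<bar>r\<bar> \<le> ln (1 + e)" "0 < e" "e \<le> 1"
  shows "\<bar>exp (- r) - 1\<bar> \<le> e" "\<bar>exp (- r) - 1\<bar> \<le> 2 * \<bar>r\<bar>"
proof -
  have E: "exp \<bar>r\<bar> \<le> 1 + e" using assms by (metis add_pos_pos exp_le_cancel_iff exp_ln zero_less_one)
  have b: "\<bar>exp s - 1\<bar> \<le> exp \<bar>s\<bar> - 1" for s :: real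
  proof (cases "0 \<le> s")
    case False
    have "1 - exp s \<le> - s" using exp_ge_add_one_self[of s] by linarith
    also have "\<dots> \<le> exp \<bar>s\<bar> - 1" using False exp_ge_add_one_self[of "\<bar>s\<bar>"] by simp
    finally show ?thesis using False by simp
  qed simp
  show "\<bar>exp (- r) - 1\<bar> \<le> e" using b[of "- r"] E by simp
  have "exp \<bar>r\<bar> - 1 = exp \<bar>r\<bar> * (1 - exp (- \<bar>r\<bar>))" by (simp add: exp_minus algebra_simps)
  also have "\<dots> \<le> (1 + e) * \<bar>r\<bar>"
    using E exp_ge_add_one_self[of "- \<bar>r\<bar>"] assms by (intro mult_mono) auto
  also have "\<dots> \<le> 2 * \<bar>r\<bar>" using assms by (intro mult_right_mono) auto
  finally show "\<bar>exp (- r) - 1\<bar> \<le> 2 * \<bar>r\<bar>" using b[of "- r"] by simp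
qed

text \<open>
  At a fixed time the factor \<open>a\<close> satisfies the recursion of the kink up to the small sequences \<open>p\<close> and \<open>r\<close>.
  This recursion moves values below \<open>1\<close> towards \<open>exp (- k)\<close> when it runs to the right, and values above \<open>1\<close>
  towards \<open>exp k\<close> when it runs to the left. Starting from the site \<open>m\<close> at which \<open>a\<close> crosses \<open>1\<close>, it is therefore
  a contraction in both directions. Once the position \<open>y\<close> is chosen such that the kink agrees with \<open>a\<close> at \<open>m\<close>,
  the deviation is bounded by \<open>p\<close> and \<open>r\<close>, both in square sum on a half line and in supremum norm between
  \<open>m\<close> and a given site.

  The gap \<open>\<beta>\<close> at the neighbouring sites is what keeps the crossing alive when time varies a little.
\<close>

lemma perturbed_kink:
  assumes k1: "0 < k1"
  shows "\<exists>\<eta>0>0. \<exists>C>0. \<exists>\<beta>>0. \<forall>k p r a m. k1 \<le> k \<longrightarrow> (\<forall>n::int. 0 < a n \<and> \<bar>p n\<bar> \<le> \<eta>0 \<and> \<bar>r n\<bar> \<le> \<eta>0 \<and>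
        a n + exp (- r n) / a (n + 1) = 2 * cosh k - p n) \<longrightarrow> 1 \<le> a m \<longrightarrow> a (m + 1) < 1 \<longrightarrow>
      (1 + \<beta> \<le> a (m - 1) \<and> a (m + 2) \<le> 1 / (1 + \<beta>)) \<and>
      (\<exists>y. -1 \<le> of_int m - y \<and> of_int m - y \<le> 1 / 2 \<and> kink k (of_int m - y) = a m \<and>
        (\<forall>N B F. N \<le> m \<longrightarrow> (\<forall>F. finite F \<longrightarrow> F \<subseteq> {N..} \<longrightarrow> (\<Sum>n\<in>F. (\<bar>p n\<bar> + \<bar>r n\<bar>)\<^sup>2) \<le> B) \<longrightarrow>
            finite F \<longrightarrow> F \<subseteq> {N..} \<longrightarrow> (\<Sum>n\<in>F. (a n - kink k (of_int n - y))\<^sup>2) \<le> C * B) \<and>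
        (\<forall>n \<Phi>. (\<forall>j. min n m \<le> j \<longrightarrow> j \<le> max n m \<longrightarrow> \<bar>p j\<bar> + \<bar>r j\<bar> \<le> \<Phi>) \<longrightarrow>
            \<bar>a n - kink k (of_int n - y)\<bar> \<le> C * \<Phi>))"
proof -
  define \<beta> where "\<beta> = 2 * cosh k1 - 2"
  have ck1: "1 < cosh k1" using k1 cosh_real_ge_1[of k1] cosh_real_one_iff[of k1] by linarith
  hence \<beta>: "0 < \<beta>" by (simp add: \<beta>_def)
  define \<theta> where "\<theta> = 1 / (1 + \<beta> / 2)"
  have \<theta>: "0 \<le> \<theta>" "\<theta> < 1" using \<beta> by (auto simp: \<theta>_def)
  define e where "e = min (1 / 16) (min (\<beta> / 16) ((1 - 1 / cosh k1) / 4))"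
  have e: "0 < e" "e \<le> 1 / 16" "e \<le> \<beta> / 16" "e \<le> (1 - 1 / cosh k1) / 4"
    using \<beta> ck1 unfolding e_def by (simp, linarith+)
  define \<eta>0 where "\<eta>0 = ln (1 + e)"
  have \<eta>0: "0 < \<eta>0" "\<eta>0 \<le> e" using e by (auto simp: \<eta>0_def intro: ln_add_one_self_le_self)
  define C where "C = max (32 / (1 - \<theta>)\<^sup>2) (4 / (1 - \<theta>))"
  have C: "0 < C" using \<theta> by (simp add: C_def less_max_iff_disj)
  have main: "(1 + \<beta> / 2 \<le> a (m - 1) \<and> a (m + 2) \<le> 1 / (1 + \<beta> / 2)) \<and>
      (\<exists>y. -1 \<le> of_int m - y \<and> of_int m - y \<le> 1 / 2 \<and> kink k (of_int m - y) = a m \<and>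
        (\<forall>N B F. N \<le> m \<longrightarrow> (\<forall>F. finite F \<longrightarrow> F \<subseteq> {N..} \<longrightarrow> (\<Sum>n\<in>F. (\<bar>p n\<bar> + \<bar>r n\<bar>)\<^sup>2) \<le> B) \<longrightarrow>
            finite F \<longrightarrow> F \<subseteq> {N..} \<longrightarrow> (\<Sum>n\<in>F. (a n - kink k (of_int n - y))\<^sup>2) \<le> C * B) \<and>
        (\<forall>n \<Phi>. (\<forall>j. min n m \<le> j \<longrightarrow> j \<le> max n m \<longrightarrow> \<bar>p j\<bar> + \<bar>r j\<bar> \<le> \<Phi>) \<longrightarrow>
            \<bar>a n - kink k (of_int n - y)\<bar> \<le> C * \<Phi>))"
    if k: "k1 \<le> k" and H: "\<forall>n::int. 0 < a n \<and> \<bar>p n\<bar> \<le> \<eta>0 \<and> \<bar>r n\<bar> \<le> \<eta>0 \<and>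
        a n + exp (- r n) / a (n + 1) = 2 * cosh k - p n"
      and am: "1 \<le> a m" "a (m + 1) < 1" for k p r a m
  proof -
    define \<alpha> where "\<alpha> = 2 * cosh k"
    have k0: "0 < k" using k k1 by simp
    have ck: "cosh k1 \<le> cosh k" using k k1 by (simp add: cosh_real_nonneg_le_iff)
    hence \<alpha>: "2 + \<beta> \<le> \<alpha>" by (simp add: \<alpha>_def \<beta>_def)
    have apos: "0 < a n" for n using H by blast
    have pb: "\<bar>p n\<bar> \<le> e" for n using H \<eta>0 by (meson order_trans)
    have rb: "\<bar>exp (- r n) - 1\<bar> \<le> e" "\<bar>exp (- r n) - 1\<bar> \<le> 2 * \<bar>r n\<bar>" for n
      using exp_minus_one_small[of "r n" e] H e by (auto simp: \<eta>0_def)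
    have rec: "a n = \<alpha> - p n - exp (- r n) / a (n + 1)" for n
      using H by (simp add: \<alpha>_def eq_diff_eq)
    have D1: "exp (- r n) / a (n + 1) = \<alpha> - p n - a n" for n using rec[of n] by simp
    have anext: "a (n + 1) = exp (- r n) / (\<alpha> - p n - a n)" for n
      unfolding D1[symmetric] using apos[of "n + 1"] by simp
    have right_step: "a (n + 1) \<le> 1 / (1 + \<beta> / 2)" if "a n < 1" for n
    proof -
      have "1 + \<beta> - e \<le> \<alpha> - p n - a n" using \<alpha> pb[of n] that by linarith
      moreover have "exp (- r n) \<le> 1 + e" using rb(1)[of n] by linarith
      ultimately have "a (n + 1) \<le> (1 + e) / (1 + \<beta> - e)"
        unfolding anext using e \<beta> by (intro frac_le) auto
      also have "\<dots> \<le> 1 / (1 + \<beta> / 2)"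
      proof -
        have "e * \<beta> \<le> (1 / 16) * \<beta>" using e \<beta> by (intro mult_right_mono) auto
        hence "1 + \<beta> / 2 + e + (e * \<beta>) / 2 \<le> 1 + \<beta> - e" using e(3) \<beta> by linarith
        moreover have "(1 + e) * (1 + \<beta> / 2) = 1 + \<beta> / 2 + e + (e * \<beta>) / 2" by (simp add: algebra_simps)
        ultimately have "(1 + e) * (1 + \<beta> / 2) \<le> 1 * (1 + \<beta> - e)" by simp
        thus ?thesis using e \<beta> by (intro frac_le_eq[THEN iffD2] | simp add: divide_simps)+
      qed
      finally show ?thesis .
    qed
    have left_step: "1 + \<beta> / 2 \<le> a (n - 1)" if "1 \<le> a n" for n
    proof -
      have "exp (- r (n - 1)) / a n \<le> (1 + e) / 1"
        using rb(1)[of "n - 1"] that e by (intro frac_le) auto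
      thus ?thesis using rec[of "n - 1"] pb[of "n - 1"] \<alpha> e by simp
    qed
    have lt1: "a (m + 1 + int j) < 1" for j
    proof (induction j)
      case (Suc j)
      from right_step[OF this] have "a (m + 1 + int j + 1) \<le> 1 / (1 + \<beta> / 2)" .
      also have "\<dots> < 1" using \<beta> by simp
      finally show ?case by (simp add: algebra_simps)
    qed (use am in simp)
    have ge1: "1 \<le> a (m - int j)" for j
    proof (induction j)
      case (Suc j)
      from left_step[OF this] show ?case using \<beta> by (simp add: algebra_simps)
    qed (use am in simp)
    have lt1': "a n < 1" if "m < n" for n using lt1[of "nat (n - m - 1)"] that by simp
    have ge1': "1 \<le> a n" if "n \<le> m" for n using ge1[of "nat (m - n)"] that by simp
    have gt1': "1 + \<beta> / 2 \<le> a n" if "n < m" for n using left_step[OF ge1'[of "n + 1"]] that by simp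
    have am_up: "a m \<le> \<alpha> - 1 + 2 * e"
    proof -
      have "(1 - e) / 1 \<le> exp (- r m) / a (m + 1)"
        using rb(1)[of m] am(2) apos[of "m + 1"] e by (intro frac_le) auto
      thus ?thesis using rec[of m] pb[of m] by simp
    qed
    (* The kink equals 1 at 1/2, and at -1 it equals 2 * cosh k - 1 / cosh k, which lies above
       the upper bound of a m because e is small compared with 1 - 1 / cosh k1. *)
    have "\<exists>z. -1 \<le> z \<and> z \<le> 1 / 2 \<and> kink k z = a m"
    proof (rule IVT2')
      show "kink k (1 / 2) \<le> a m" using am by (simp add: kink_half)
      have "kink k (-1) = \<alpha> - 1 / kink k 0" using kink_step_left[of k 0] by (simp add: \<alpha>_def)
      also have "\<dots> = \<alpha> - 1 / cosh k" by (simp add: kink_def)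
      finally have "kink k (-1) = \<alpha> - 1 / cosh k" .
      moreover have "1 / cosh k \<le> 1 / cosh k1" using ck by (intro divide_left_mono) auto
      moreover have "1 / cosh k1 \<le> 1" using ck1 by simp
      ultimately show "a m \<le> kink k (-1)" using am_up e(4) by argo
      show "continuous_on {-1..1/2} (kink k)"
        by (meson kink_deriv DERIV_isCont continuous_at_imp_continuous_on)
    qed simp
    then obtain z where z: "-1 \<le> z" "z \<le> 1 / 2" "kink k z = a m" by blast
    define y where "y = of_int m - z"
    define A where "A = (\<lambda>n::int. kink k (of_int n - y))"
    have Apos: "0 < A n" for n by (simp add: A_def kink_pos)
    have Am: "A m = a m" using z by (simp add: A_def y_def)
    have Astep: "1 / A (n + 1) = \<alpha> - A n" for n
      using kink_step[of k "of_int n - y"] by (simp add: A_def \<alpha>_def algebra_simps)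
    have A_left: "1 \<le> A n" if "n \<le> m" for n
      unfolding A_def using z that by (intro kink_ge_1[OF k0]) (auto simp: y_def)
    have Am1: "A (m + 1) \<le> 1 + 4 * e"
    proof -
      have "1 - 2 * e \<le> 1 / A (m + 1)" unfolding Astep Am using am_up by simp
      hence "(1 - 2 * e) * A (m + 1) \<le> 1" using Apos[of "m + 1"] by (simp add: field_simps)
      also have "1 \<le> (1 - 2 * e) * (1 + 4 * e)"
      proof -
        have "e * e \<le> e * (1 / 16)" using e by (intro mult_left_mono) auto
        thus ?thesis using e by (simp add: algebra_simps)
      qed
      finally show ?thesis using e by (simp add: mult_le_cancel_left)
    qed
    have A_right: "A n \<le> 1 + 4 * e" if "m < n" for n
    proof -
      have "A n \<le> A (m + 1)" unfolding A_def using that by (intro kink_antimono[OF k0]) simp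
      thus ?thesis using Am1 by simp
    qed
    define d f where "d = (\<lambda>n. \<bar>a n - A n\<bar>)" and "f = (\<lambda>n. 4 * (\<bar>p n\<bar> + \<bar>r n\<bar>))"
    have dm: "d m = 0" by (simp add: d_def Am)
    have fwd: "d (n + 1) \<le> \<theta> * d n + f n" if n: "m \<le> n" for n
    proof -
      define X Y where "X = \<alpha> - p n - a n" and "Y = \<alpha> - A n"
      have X: "X = exp (- r n) / a (n + 1)" by (simp add: X_def D1)
      have Y: "Y = 1 / A (n + 1)" by (simp add: Y_def Astep)
      have XY0: "0 < X" "0 < Y" unfolding X Y using apos Apos by simp_all
      have "a (n + 1) - A (n + 1) = exp (- r n) / X - 1 / Y"
        unfolding X Y using apos[of "n + 1"] by simp
      also have "\<dots> = (exp (- r n) - 1) / X + (p n + (a n - A n)) / (X * Y)"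
      proof -
        have e: "p n + (a n - A n) = Y - X" by (simp add: X_def Y_def)
        show ?thesis unfolding e using XY0 by (simp add: field_simps)
      qed
      finally have "d (n + 1) = \<bar>(exp (- r n) - 1) / X + (p n + (a n - A n)) / (X * Y)\<bar>" by (simp add: d_def)
      also have "\<dots> \<le> \<bar>exp (- r n) - 1\<bar> / X + \<bar>p n + (a n - A n)\<bar> / (X * Y)"
        using XY0 by (intro order_trans[OF abs_triangle_ineq]) (simp add: abs_divide abs_mult)
      also have "\<dots> \<le> 2 * \<bar>r n\<bar> / X + (\<bar>p n\<bar> + d n) / (X * Y)"
        using XY0 rb(2)[of n] abs_triangle_ineq[of "p n" "a n - A n"]
        by (intro add_mono divide_right_mono) (auto simp: d_def)
      also have "\<dots> \<le> \<theta> * d n + f n"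
      proof (cases "n = m")
        case True
        have X': "1 / 2 \<le> X"
        proof -
          have "(1 - e) / 1 \<le> X" unfolding X True
            using rb(1)[of m] am(2) apos[of "m + 1"] e by (intro frac_le) auto
          thus ?thesis using e by simp
        qed
        have "1 - 2 * e \<le> Y" using am_up by (simp add: Y_def True Am)
        hence Y': "1 / 2 \<le> Y" using e by simp
        have "2 * \<bar>r n\<bar> / X \<le> 2 * \<bar>r n\<bar> / (1 / 2)" using X' by (intro divide_left_mono) auto
        moreover have "\<bar>p n\<bar> / (X * Y) \<le> \<bar>p n\<bar> / (1 / 2 * (1 / 2))"
          using X' Y' by (intro divide_left_mono mult_mono) auto
        ultimately show ?thesis using dm True by (simp add: f_def)
      next
        case False
        hence mn: "m < n" using n by simp
        have X': "1 + \<beta> / 2 \<le> X" using lt1'[OF mn] \<alpha> pb[of n] e unfolding X_def by linarith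
        have Y': "1 + \<beta> / 2 \<le> Y" using A_right[OF mn] \<alpha> e unfolding Y_def by linarith
        have XY: "1 + \<beta> / 2 \<le> X * Y"
        proof -
          have "(1 + \<beta> / 2) * 1 \<le> X * Y" using X' Y' \<beta> by (intro mult_mono) auto
          thus ?thesis by simp
        qed
        have "2 * \<bar>r n\<bar> / X \<le> 2 * \<bar>r n\<bar> / 1" using X' \<beta> by (intro divide_left_mono) auto
        moreover have "\<bar>p n\<bar> / (X * Y) \<le> \<bar>p n\<bar> / 1" using XY \<beta> by (intro divide_left_mono) auto
        moreover have "d n / (X * Y) \<le> d n / (1 + \<beta> / 2)"
          using XY \<beta> by (intro divide_left_mono) (auto simp: d_def)
        ultimately show ?thesis by (simp add: f_def \<theta>_def add_divide_distrib)
      qed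
      finally show ?thesis .
    qed
    have bwd: "d n \<le> \<theta> * d (n + 1) + f n" if n: "n < m" for n
    proof -
      let ?a = "a (n + 1)" and ?A = "A (n + 1)"
      have a1: "1 \<le> ?a" and A1: "1 \<le> ?A" using ge1' A_left n by simp_all
      have "A n = \<alpha> - 1 / ?A" using Astep[of n] by simp
      with rec[of n] have "a n - A n = (\<alpha> - p n - exp (- r n) / ?a) - (\<alpha> - 1 / ?A)" by argo
      also have "\<dots> = - p n + (1 - exp (- r n)) / ?a + (?a - ?A) / (?a * ?A)"
        using a1 A1 by (simp add: field_simps)
      finally have "d n \<le> \<bar>p n\<bar> + \<bar>(1 - exp (- r n)) / ?a\<bar> + \<bar>(?a - ?A) / (?a * ?A)\<bar>"
        unfolding d_def by argo
      also have "\<bar>(1 - exp (- r n)) / ?a\<bar> \<le> 2 * \<bar>r n\<bar> / 1"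
        using a1 rb(2)[of n] by (simp only: abs_divide) (intro frac_le; auto simp: abs_minus_commute)
      also have "\<bar>(?a - ?A) / (?a * ?A)\<bar> \<le> \<theta> * d (n + 1)"
      proof (cases "n + 1 = m")
        case True
        thus ?thesis using Am \<theta> by (simp add: d_def)
      next
        case False
        hence "1 + \<beta> / 2 \<le> ?a" using n by (intro gt1') simp
        hence "(1 + \<beta> / 2) * 1 \<le> ?a * ?A" using A1 \<beta> by (intro mult_mono) auto
        hence "\<bar>?a - ?A\<bar> / (?a * ?A) \<le> \<bar>?a - ?A\<bar> / (1 + \<beta> / 2)"
          using \<beta> by (intro divide_left_mono) auto
        thus ?thesis using a1 A1 by (simp add: abs_divide abs_mult d_def \<theta>_def)
      qed
      finally show ?thesis by (simp add: f_def)
    qed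
    have d0: "0 \<le> d n" for n by (simp add: d_def)
    have sumc: "(\<Sum>n\<in>F. (a n - A n)\<^sup>2) \<le> C * B"
      if N: "N \<le> m" and B: "\<forall>F. finite F \<longrightarrow> F \<subseteq> {N..} \<longrightarrow> (\<Sum>n\<in>F. (\<bar>p n\<bar> + \<bar>r n\<bar>)\<^sup>2) \<le> B"
        and F: "finite F" "F \<subseteq> {N..}" for N B F
    proof -
      have B0: "0 \<le> B" using B[rule_format, of "{}"] by simp
      have fB: "(\<Sum>n\<in>F. (f n)\<^sup>2) \<le> 16 * B" if "finite F" "F \<subseteq> {N..}" for F
      proof -
        have "(\<Sum>n\<in>F. (f n)\<^sup>2) = 16 * (\<Sum>n\<in>F. (\<bar>p n\<bar> + \<bar>r n\<bar>)\<^sup>2)"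
          unfolding f_def power_mult_distrib sum_distrib_left[symmetric] by simp
        thus ?thesis using B that by simp
      qed
      have "(\<Sum>n\<in>F. (d n)\<^sup>2) \<le> 2 * (16 * B) / (1 - \<theta>)\<^sup>2"
        by (rule two_sided_contraction_sum[OF \<theta> dm d0 fwd bwd N fB F])
      also have "\<dots> = 32 / (1 - \<theta>)\<^sup>2 * B" by simp
      also have "\<dots> \<le> C * B" using B0 by (intro mult_right_mono) (auto simp: C_def)
      finally show ?thesis by (simp add: d_def)
    qed
    have supc: "\<bar>a n - A n\<bar> \<le> C * \<Phi>"
      if \<Phi>: "\<forall>j. min n m \<le> j \<longrightarrow> j \<le> max n m \<longrightarrow> \<bar>p j\<bar> + \<bar>r j\<bar> \<le> \<Phi>" for n \<Phi>
    proof -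
      have \<Phi>0: "0 \<le> \<Phi>" using \<Phi>[rule_format, of m] by simp
      have "d n \<le> (4 * \<Phi>) / (1 - \<theta>)"
      proof (rule two_sided_contraction_sup[OF \<theta> dm fwd bwd])
        show "f j \<le> 4 * \<Phi>" if "min n m \<le> j" "j \<le> max n m" for j
          using \<Phi>[rule_format, OF that] by (simp add: f_def)
      qed (use \<Phi>0 in auto)
      also have "\<dots> = 4 / (1 - \<theta>) * \<Phi>" by simp
      also have "\<dots> \<le> C * \<Phi>" using \<Phi>0 by (intro mult_right_mono) (auto simp: C_def)
      finally show ?thesis by (simp add: d_def)
    qed
    show ?thesis
    proof (intro conjI exI[of _ y])
      show "1 + \<beta> / 2 \<le> a (m - 1)" by (rule left_step[OF am(1)])
      show "a (m + 2) \<le> 1 / (1 + \<beta> / 2)" using right_step[OF am(2)] by (simp add: add.assoc)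
      show "- 1 \<le> of_int m - y" "of_int m - y \<le> 1 / 2" "kink k (of_int m - y) = a m"
        using z by (simp_all add: y_def)
    qed (use sumc supc in \<open>unfold A_def, blast+\<close>)
  qed
  show ?thesis
    by (rule exI[of _ \<eta>0], rule conjI[OF \<eta>0(1)], rule exI[of _ C], rule conjI[OF C],
        rule exI[of _ "\<beta> / 2"], rule conjI, use \<beta> in simp, intro allI impI, rule main; assumption)
qed

text \<open>
  The kink is decreasing, and \<open>1 / K\<close> is a lower bound for the modulus of its slope on \<open>{- (R + 1)..R + 1}\<close>. Two values that
  differ by less than \<open>1 / K\<close> therefore belong to arguments at distance less than \<open>1\<close>, so that \<open>z'\<close> lies in
  this interval too.
\<close>

lemma kink_inverse_lipschitz:
  assumes k1: "0 < k1" and R: "0 \<le> R"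
  shows "\<exists>K>0. \<forall>k z z'. k1 \<le> k \<longrightarrow> k \<le> k2 \<longrightarrow> \<bar>z\<bar> \<le> R \<longrightarrow> \<bar>kink k z - kink k z'\<bar> < 1 / K \<longrightarrow>
      \<bar>z - z'\<bar> \<le> K * \<bar>kink k z - kink k z'\<bar>"
proof -
  define K where "K = (cosh (k2 * (R + 1)))\<^sup>2 / (k1 * sinh k1)"
  have K: "0 < K" using k1 by (simp add: K_def)
  have near: "(z2 - z1) / K \<le> kink k z1 - kink k z2"
    if k: "k1 \<le> k" "k \<le> k2" and z: "z1 \<le> z2" "- (R + 1) \<le> z1" "z2 \<le> R + 1" for k z1 z2
  proof (cases "z1 = z2")
    case False
    hence lt: "z1 < z2" using z by simp
    from MVT2[OF lt kink_deriv] obtain \<xi> where \<xi>: "z1 < \<xi>" "\<xi> < z2"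
      "kink k z2 - kink k z1 = (z2 - z1) * - (k * sinh k * (1 - (tanh (k * \<xi>))\<^sup>2))" by blast
    have c: "1 - (tanh (k * \<xi>))\<^sup>2 = 1 / (cosh (k * \<xi>))\<^sup>2"
    proof -
      have "(cosh (k * \<xi>))\<^sup>2 - (sinh (k * \<xi>))\<^sup>2 = 1" by (simp add: cosh_square_eq)
      moreover have "1 - (tanh (k * \<xi>))\<^sup>2 = ((cosh (k * \<xi>))\<^sup>2 - (sinh (k * \<xi>))\<^sup>2) / (cosh (k * \<xi>))\<^sup>2"
        by (simp add: tanh_def power_divide diff_divide_distrib)
      ultimately show ?thesis by simp
    qed
    have "\<bar>k * \<xi>\<bar> \<le> k2 * (R + 1)"
      unfolding abs_mult using k k1 \<xi> z R by (intro mult_mono) auto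
    hence "cosh \<bar>k * \<xi>\<bar> \<le> cosh (k2 * (R + 1))" using R k k1 by (subst cosh_real_nonneg_le_iff) auto
    hence ch: "cosh (k * \<xi>) \<le> cosh (k2 * (R + 1))" by simp
    have "1 / K = (k1 * sinh k1) * (1 / (cosh (k2 * (R + 1)))\<^sup>2)" by (simp add: K_def)
    also have "\<dots> \<le> (k * sinh k) * (1 / (cosh (k * \<xi>))\<^sup>2)"
      using k k1 ch by (intro mult_mono divide_left_mono power_mono) auto
    finally have "(z2 - z1) * (1 / K) \<le> (z2 - z1) * (k * sinh k * (1 - (tanh (k * \<xi>))\<^sup>2))"
      unfolding c using lt by (intro mult_left_mono) auto
    thus ?thesis using \<xi>(3) by simp
  qed simp
  have "\<bar>z - z'\<bar> \<le> K * \<bar>kink k z - kink k z'\<bar>"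
    if k: "k1 \<le> k" "k \<le> k2" and z: "\<bar>z\<bar> \<le> R" and lt: "\<bar>kink k z - kink k z'\<bar> < 1 / K" for k z z'
  proof -
    have k0: "0 < k" using k k1 by simp
    have r: "z' \<le> z + 1"
    proof (rule ccontr)
      assume "\<not> z' \<le> z + 1"
      hence "kink k z' \<le> kink k (z + 1)" by (intro kink_antimono[OF k0]) simp
      moreover have "(z + 1 - z) / K \<le> kink k z - kink k (z + 1)" using z k by (intro near) auto
      ultimately show False using lt by simp
    qed
    have l: "z - 1 \<le> z'"
    proof (rule ccontr)
      assume "\<not> z - 1 \<le> z'"
      hence "kink k (z - 1) \<le> kink k z'" by (intro kink_antimono[OF k0]) simp
      moreover have "(z - (z - 1)) / K \<le> kink k (z - 1) - kink k z" using z k by (intro near) auto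
      ultimately show False using lt by simp
    qed
    have "\<bar>z - z'\<bar> / K \<le> \<bar>kink k z - kink k z'\<bar>"
    proof (cases "z \<le> z'")
      case True
      have "(z' - z) / K \<le> kink k z - kink k z'" using True z r by (intro near[OF k]) linarith+
      thus ?thesis using True by simp
    next
      case False
      have "(z - z') / K \<le> kink k z' - kink k z" using False z l by (intro near[OF k]) linarith+
      thus ?thesis using False by simp
    qed
    thus ?thesis using K by (simp add: field_simps)
  qed
  thus ?thesis using K by blast
qed

section \<open>Removing the soliton from the initial state\<close>

lemma geometric_bound_from_infinity:
  fixes e :: "nat \<Rightarrow> real"
  assumes th: "0 \<le> \<theta>" "\<theta> < 1" and rec: "\<And>k. e k \<le> c + \<theta> * e (Suc k)" and B: "\<And>k. e k \<le> B"
  shows "e k \<le> c / (1 - \<theta>)"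
proof -
  have step: "e k \<le> c / (1 - \<theta>) + \<theta> ^ j * (B - c / (1 - \<theta>))" for j k
  proof (induction j arbitrary: k)
    case (Suc j)
    have "e k \<le> c + \<theta> * e (Suc k)" by (rule rec)
    also have "\<dots> \<le> c + \<theta> * (c / (1 - \<theta>) + \<theta> ^ j * (B - c / (1 - \<theta>)))"
      using th by (intro add_left_mono mult_left_mono Suc.IH)
    also have "\<dots> = (c + \<theta> * (c / (1 - \<theta>))) + \<theta> ^ Suc j * (B - c / (1 - \<theta>))"
      by (simp add: algebra_simps)
    also have "c + \<theta> * (c / (1 - \<theta>)) = c / (1 - \<theta>)" using th by (simp add: field_simps)
    finally show ?case .
  qed (use B in simp)
  have "(\<lambda>j. c / (1 - \<theta>) + \<theta> ^ j * (B - c / (1 - \<theta>))) \<longlonglongrightarrow> c / (1 - \<theta>) + 0 * (B - c / (1 - \<theta>))"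
    using th by (intro tendsto_intros LIMSEQ_power_zero) auto
  hence "(\<lambda>j. c / (1 - \<theta>) + \<theta> ^ j * (B - c / (1 - \<theta>))) \<longlonglongrightarrow> c / (1 - \<theta>)" by simp
  thus ?thesis by (rule LIMSEQ_le_const) (use step in blast)
qed

text \<open>
  Banach's fixed point theorem in a product of intervals. No value is prescribed at the far end; the solution
  is selected by the requirement to stay close to \<open>X\<close>. The iterate \<open>G j\<close> starts from \<open>X\<close>.
\<close>

lemma half_line_fixed_point:
  fixes F :: "nat \<Rightarrow> real \<Rightarrow> real" and X :: "nat \<Rightarrow> real"
  assumes th: "0 \<le> \<theta>" "\<theta> < 1" and \<rho>: "0 \<le> \<rho>"
    and lip: "\<And>k x x'. \<bar>x - X (Suc k)\<bar> \<le> \<rho> \<Longrightarrow> \<bar>x' - X (Suc k)\<bar> \<le> \<rho> \<Longrightarrow> \<bar>F k x - F k x'\<bar> \<le> \<theta> * \<bar>x - x'\<bar>"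
    and cen: "\<And>k. \<bar>F k (X (Suc k)) - X k\<bar> \<le> (1 - \<theta>) * \<rho>"
  shows "\<exists>x. \<forall>k. x k = F k (x (Suc k)) \<and> \<bar>x k - X k\<bar> \<le> \<rho>"
proof -
  define G where "G = rec_nat X (\<lambda>_ g k. F k (g (Suc k)))"
  have G0: "G 0 k = X k" and GS: "G (Suc j) k = F k (G j (Suc k))" for j k
    by (simp_all add: G_def)
  have ball: "\<bar>G j k - X k\<bar> \<le> \<rho>" for j k
  proof (induction j arbitrary: k)
    case (Suc j)
    have "\<bar>F k (G j (Suc k)) - F k (X (Suc k))\<bar> \<le> \<theta> * \<bar>G j (Suc k) - X (Suc k)\<bar>"
      using Suc \<rho> by (intro lip) auto
    also have "\<dots> \<le> \<theta> * \<rho>" using Suc th by (intro mult_left_mono)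
    finally have "\<bar>F k (G j (Suc k)) - X k\<bar> \<le> \<theta> * \<rho> + (1 - \<theta>) * \<rho>" using cen[of k] by linarith
    thus ?case by (simp add: GS algebra_simps)
  qed (use \<rho> in \<open>simp add: G0\<close>)
  have diff: "\<bar>G (Suc j) k - G j k\<bar> \<le> \<theta> ^ j * \<rho>" for j k
  proof (induction j arbitrary: k)
    case 0
    show ?case using ball[of "Suc 0" k] by (simp add: G0)
  next
    case (Suc j)
    have "\<bar>F k (G (Suc j) (Suc k)) - F k (G j (Suc k))\<bar> \<le> \<theta> * \<bar>G (Suc j) (Suc k) - G j (Suc k)\<bar>"
      by (intro lip ball)
    also have "\<dots> \<le> \<theta> * (\<theta> ^ j * \<rho>)" using Suc th by (intro mult_left_mono)
    finally show ?case by (simp add: GS[of "Suc j"] GS[of j k, symmetric])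
  qed
  have "convergent (\<lambda>j. G j k)" for k
  proof -
    have "summable (\<lambda>j. \<theta> ^ j * \<rho>)" using th by (intro summable_mult2 summable_geometric) simp
    hence "summable (\<lambda>j. G (Suc j) k - G j k)"
      by (rule summable_comparison_test'[where N = 0]) (use diff in auto)
    hence "convergent (\<lambda>n. \<Sum>j<n. G (Suc j) k - G j k)" by (simp add: summable_iff_convergent)
    hence "convergent (\<lambda>n. (G n k - G 0 k) + G 0 k)"
      by (intro convergent_add convergent_const) (simp only: sum_lessThan_telescope[of "\<lambda>j. G j k"])
    thus ?thesis by simp
  qed
  then obtain x where x: "\<And>k. (\<lambda>j. G j k) \<longlonglongrightarrow> x k" unfolding convergent_def by metis
  have xb: "\<bar>x k - X k\<bar> \<le> \<rho>" for k
    by (rule LIMSEQ_le_const2[OF tendsto_rabs[OF tendsto_diff[OF x[of k] tendsto_const]]])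
       (use ball in blast)
  have "x k = F k (x (Suc k))" for k
  proof (rule LIMSEQ_unique)
    show "(\<lambda>j. G (Suc j) k) \<longlonglongrightarrow> x k" using x[of k] by (rule LIMSEQ_Suc)
    have "(\<lambda>j. F k (G j (Suc k)) - F k (x (Suc k))) \<longlonglongrightarrow> 0"
    proof (rule Lim_null_comparison)
      show "\<forall>\<^sub>F j in sequentially. norm (F k (G j (Suc k)) - F k (x (Suc k))) \<le> \<theta> * \<bar>G j (Suc k) - x (Suc k)\<bar>"
        by (intro always_eventually allI) (simp add: lip[OF ball xb])
      have "(\<lambda>j. \<theta> * \<bar>G j (Suc k) - x (Suc k)\<bar>) \<longlonglongrightarrow> \<theta> * \<bar>x (Suc k) - x (Suc k)\<bar>"
        by (intro tendsto_intros x)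
      thus "(\<lambda>j. \<theta> * \<bar>G j (Suc k) - x (Suc k)\<bar>) \<longlonglongrightarrow> 0" by simp
    qed
    thus "(\<lambda>j. G (Suc j) k) \<longlonglongrightarrow> F k (x (Suc k))" unfolding GS by (rule LIM_zero_cancel)
  qed
  thus ?thesis using xb by blast
qed

text \<open>
  Let \<open>k\<close> count the sites away from the soliton. On the left half line the factor \<open>a\<close>, and on the right half
  line the factor \<open>b\<close>, satisfies the recursion \<open>x k = \<alpha> - P k - Q k / x (Suc k)\<close>. Near the corresponding factor
  \<open>X\<close> of the soliton, which exceeds \<open>1\<close>, its right hand side is a contraction in \<open>x (Suc k)\<close>, so there is
  one solution near \<open>X\<close> for each \<open>\<alpha>\<close>. Since \<open>Q\<close> is nonnegative, the solution increases with \<open>\<alpha>\<close> at least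
  with slope \<open>1\<close>.
\<close>

lemma riccati_half_line:
  fixes X P Q :: "nat \<Rightarrow> real"
  assumes \<beta>: "0 < \<beta>" and \<rho>: "\<rho> = \<beta> / 8" and \<theta>: "\<theta> = (1 + \<beta> / 4) / (1 + 7 * \<beta> / 8)"
    and X: "\<And>k. 1 \<le> X k" "\<And>k. 1 + \<beta> \<le> X (Suc k)"
    and P: "\<And>k. \<bar>P k - (\<alpha>0 - X k - 1 / X k)\<bar> \<le> \<nu>"
    and Q: "\<And>k. \<bar>Q k - X (Suc k) / X k\<bar> \<le> \<nu>" "\<And>k. 0 \<le> Q k"
    and \<nu>: "\<nu> \<le> \<rho>" "h + 2 * \<nu> \<le> (1 - \<theta>) * \<rho>" and h: "0 \<le> h"
  shows "\<exists>x. (\<forall>\<alpha> k. \<bar>\<alpha> - \<alpha>0\<bar> \<le> h \<longrightarrow> x \<alpha> k = \<alpha> - P k - Q k / x \<alpha> (Suc k) \<and> \<bar>x \<alpha> k - X k\<bar> \<le> \<rho>) \<and>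
    (\<forall>\<alpha> \<alpha>' k. \<bar>\<alpha> - \<alpha>0\<bar> \<le> h \<longrightarrow> \<bar>\<alpha>' - \<alpha>0\<bar> \<le> h \<longrightarrow> \<alpha> \<le> \<alpha>' \<longrightarrow>
        \<alpha>' - \<alpha> \<le> x \<alpha>' k - x \<alpha> k \<and> x \<alpha>' k - x \<alpha> k \<le> (\<alpha>' - \<alpha>) / (1 - \<theta>)) \<and>
    (\<forall>k. \<bar>x \<alpha>0 k - X k\<bar> \<le> 2 * \<nu> / (1 - \<theta>))"
proof -
  have th: "0 \<le> \<theta>" "\<theta> < 1" using \<beta> by (auto simp: \<theta>)
  have \<rho>0: "0 \<le> \<rho>" using \<beta> by (simp add: \<rho>)
  (* The quotient Q k / (x * x') is the contraction rate. With Y = X (Suc k) - \<rho> it is at most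
     (Y + 2 * \<rho>) / Y\<^sup>2, which is at most \<theta> because Y is at least 1 + 7 * \<beta> / 8. *)
  have coef: "0 \<le> Q k / (x * x')" "Q k / (x * x') \<le> \<theta>" "0 < x" "0 < x'" "1 \<le> x"
    if x: "\<bar>x - X (Suc k)\<bar> \<le> \<rho>" "\<bar>x' - X (Suc k)\<bar> \<le> \<rho>" for k x x'
  proof -
    let ?Y = "X (Suc k) - \<rho>"
    have Y: "1 + 7 * \<beta> / 8 \<le> ?Y" using X(2)[of k] by (simp add: \<rho>)
    have xY: "?Y \<le> x" "?Y \<le> x'" using x by linarith+
    show "0 < x" "0 < x'" "1 \<le> x" using xY Y \<beta> by linarith+
    thus "0 \<le> Q k / (x * x')" using Q(2) by simp
    have "X (Suc k) / X k \<le> X (Suc k) / 1" using X(1)[of k] X(1)[of "Suc k"] by (intro divide_left_mono) auto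
    hence "Q k \<le> X (Suc k) + \<rho>" using Q(1)[of k] \<nu> by simp
    also have "\<dots> \<le> (1 + \<beta> / 4) * ?Y"
    proof -
      have "(1 + \<beta>) * (\<beta> / 4) \<le> X (Suc k) * (\<beta> / 4)" using X(2) \<beta> by (intro mult_right_mono) auto
      moreover have "(1 + \<beta>) * (\<beta> / 4) = \<rho> * (2 + \<beta> / 4) + 7 * (\<beta> * \<beta>) / 32"
        by (simp add: \<rho> algebra_simps)
      moreover have "(1 + b) * (y - r) = y + y * b - r * (2 + b) + r" for b y r :: real
        by (simp add: algebra_simps)
      note this[of "\<beta> / 4" "X (Suc k)" \<rho>]
      moreover have "0 \<le> \<beta> * \<beta>" using \<beta> by simp
      ultimately show ?thesis by argo
    qed
    finally have "Q k / (x * x') \<le> ((1 + \<beta> / 4) * ?Y) / (?Y * ?Y)"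
      using xY Y \<beta> Q(2)[of k] by (intro frac_le mult_mono) auto
    also have "\<dots> = (1 + \<beta> / 4) / ?Y" using Y \<beta> by simp
    also have "\<dots> \<le> \<theta>" unfolding \<theta> using Y \<beta> by (intro divide_left_mono) auto
    finally show "Q k / (x * x') \<le> \<theta>" .
  qed
  have quot: "Q k / x - Q k / x' = Q k / (x * x') * (x' - x)" if "0 < x" "0 < x'" for k x x'
    using that by (simp add: field_simps)
  have "\<exists>x. \<forall>k. x k = \<alpha> - P k - Q k / x (Suc k) \<and> \<bar>x k - X k\<bar> \<le> \<rho>" if \<alpha>: "\<bar>\<alpha> - \<alpha>0\<bar> \<le> h" for \<alpha>
  proof (rule half_line_fixed_point[OF th \<rho>0])
    fix k x x' assume x: "\<bar>x - X (Suc k)\<bar> \<le> \<rho>" "\<bar>x' - X (Suc k)\<bar> \<le> \<rho>"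
    have "\<bar>(\<alpha> - P k - Q k / x) - (\<alpha> - P k - Q k / x')\<bar> = \<bar>Q k / x - Q k / x'\<bar>" by simp
    also have "\<dots> = Q k / (x * x') * \<bar>x - x'\<bar>"
      using coef(1)[OF x] unfolding quot[OF coef(3,4)[OF x]] by (simp only: abs_mult abs_of_nonneg abs_minus_commute)
    also have "\<dots> \<le> \<theta> * \<bar>x - x'\<bar>" using coef(2)[OF x] by (intro mult_right_mono) auto
    finally show "\<bar>(\<alpha> - P k - Q k / x) - (\<alpha> - P k - Q k / x')\<bar> \<le> \<theta> * \<bar>x - x'\<bar>" .
  next
    fix k
    have X1: "1 \<le> X (Suc k)" "1 \<le> X k" using X by auto
    have "\<bar>(Q k - X (Suc k) / X k) / X (Suc k)\<bar> \<le> \<nu> / 1"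
      unfolding abs_divide using Q(1)[of k] X1 by (intro frac_le) auto
    moreover have "(\<alpha> - P k - Q k / X (Suc k)) - X k
        = (\<alpha> - \<alpha>0) - (P k - (\<alpha>0 - X k - 1 / X k)) - (Q k - X (Suc k) / X k) / X (Suc k)"
      using X1 by (simp add: field_simps)
    ultimately have "\<bar>(\<alpha> - P k - Q k / X (Suc k)) - X k\<bar> \<le> h + 2 * \<nu>" using P[of k] \<alpha> by argo
    thus "\<bar>\<alpha> - P k - Q k / X (Suc k) - X k\<bar> \<le> (1 - \<theta>) * \<rho>" using \<nu> by linarith
  qed
  then obtain x where x: "\<And>\<alpha> k. \<bar>\<alpha> - \<alpha>0\<bar> \<le> h \<Longrightarrow> x \<alpha> k = \<alpha> - P k - Q k / x \<alpha> (Suc k)"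
    and xb: "\<And>\<alpha> k. \<bar>\<alpha> - \<alpha>0\<bar> \<le> h \<Longrightarrow> \<bar>x \<alpha> k - X k\<bar> \<le> \<rho>" by metis
  have mono: "\<alpha>' - \<alpha> \<le> x \<alpha>' k - x \<alpha> k \<and> x \<alpha>' k - x \<alpha> k \<le> (\<alpha>' - \<alpha>) / (1 - \<theta>)"
    if a: "\<bar>\<alpha> - \<alpha>0\<bar> \<le> h" "\<bar>\<alpha>' - \<alpha>0\<bar> \<le> h" "\<alpha> \<le> \<alpha>'" for \<alpha> \<alpha>' k
  proof -
    define e where "e = (\<lambda>k. x \<alpha>' k - x \<alpha> k)"
    define w where "w = (\<lambda>k. Q k / (x \<alpha>' (Suc k) * x \<alpha> (Suc k)))"
    have w: "0 \<le> w k" "w k \<le> \<theta>" for k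
      unfolding w_def using coef(1,2)[OF xb[OF a(2), of "Suc k"] xb[OF a(1), of "Suc k"]] by auto
    have erec: "e k = (\<alpha>' - \<alpha>) + w k * e (Suc k)" for k
    proof -
      have "e k = (\<alpha>' - \<alpha>) - (Q k / x \<alpha>' (Suc k) - Q k / x \<alpha> (Suc k))"
        unfolding e_def using x[OF a(1), of k] x[OF a(2), of k] by argo
      also have "Q k / x \<alpha>' (Suc k) - Q k / x \<alpha> (Suc k) = w k * (x \<alpha> (Suc k) - x \<alpha>' (Suc k))"
        unfolding w_def using coef(3,4)[OF xb[OF a(2), of "Suc k"] xb[OF a(1), of "Suc k"]] by (rule quot)
      finally show ?thesis by (simp add: e_def algebra_simps)
    qed
    have eb: "\<bar>e k\<bar> \<le> 2 * \<rho>" for k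
      using xb[OF a(1), of k] xb[OF a(2), of k] unfolding e_def by linarith
    have "max 0 (- e k) \<le> 0 / (1 - \<theta>)" for k
    proof (rule geometric_bound_from_infinity[where e = "\<lambda>k. max 0 (- e k)", OF th])
      fix k
      have "w k * - e (Suc k) \<le> w k * max 0 (- e (Suc k))" using w by (intro mult_left_mono) auto
      also have "\<dots> \<le> \<theta> * max 0 (- e (Suc k))" using w by (intro mult_right_mono) auto
      finally have 1: "w k * - e (Suc k) \<le> \<theta> * max 0 (- e (Suc k))" .
      have "0 \<le> \<theta> * max 0 (- e (Suc k))" using th by simp
      thus "max 0 (- e k) \<le> 0 + \<theta> * max 0 (- e (Suc k))" using 1 erec[of k] a(3) by auto
      show "max 0 (- e k) \<le> 2 * \<rho>" using eb[of k] by linarith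
    qed
    hence e0: "0 \<le> e k" for k by (smt (verit) divide_eq_0_iff)
    have "e k \<le> (\<alpha>' - \<alpha>) / (1 - \<theta>)"
    proof (rule geometric_bound_from_infinity[OF th])
      show "e k \<le> (\<alpha>' - \<alpha>) + \<theta> * e (Suc k)" for k
        unfolding erec[of k] using w e0 by (intro add_left_mono mult_right_mono)
      show "e k \<le> 2 * \<rho>" for k using eb[of k] by linarith
    qed
    moreover have "\<alpha>' - \<alpha> \<le> e k" unfolding erec[of k] using w e0 by simp
    ultimately show ?thesis by (simp add: e_def)
  qed
  have near: "\<bar>x \<alpha>0 k - X k\<bar> \<le> 2 * \<nu> / (1 - \<theta>)" for k
  proof (rule geometric_bound_from_infinity[where e = "\<lambda>k. \<bar>x \<alpha>0 k - X k\<bar>", OF th])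
    fix k
    have a: "\<bar>\<alpha>0 - \<alpha>0\<bar> \<le> h" using h by simp
    let ?x = "x \<alpha>0 (Suc k)" and ?X = "X (Suc k)"
    have X1: "1 \<le> ?X" "1 \<le> X k" using X by auto
    have c: "0 \<le> Q k / (?x * ?X)" "Q k / (?x * ?X) \<le> \<theta>" "0 < ?x"
      using coef[OF xb[OF a, of "Suc k"], of ?X] \<rho>0 by auto
    have "\<bar>(Q k - ?X / X k) / ?X\<bar> \<le> \<nu> / 1"
      unfolding abs_divide using Q(1)[of k] X1 by (intro frac_le) auto
    moreover have "x \<alpha>0 k - X k = - (P k - (\<alpha>0 - X k - 1 / X k)) - (Q k - ?X / X k) / ?X
        - (Q k / ?x - Q k / ?X)"
    proof -
      have "x \<alpha>0 k = \<alpha>0 - P k - Q k / ?x" by (rule x[OF a])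
      moreover have "(Q k - ?X / X k) / ?X = Q k / ?X - 1 / X k" using X1 by (simp add: field_simps)
      ultimately show ?thesis by argo
    qed
    moreover have "\<bar>Q k / ?x - Q k / ?X\<bar> \<le> \<theta> * \<bar>?x - ?X\<bar>"
    proof -
      have "\<bar>Q k / ?x - Q k / ?X\<bar> = Q k / (?x * ?X) * \<bar>?x - ?X\<bar>"
        using c X1 Q(2)[of k] by (subst quot) (auto simp: abs_mult abs_minus_commute)
      thus ?thesis using mult_right_mono[OF c(2) abs_ge_zero[of "?x - ?X"]] by simp
    qed
    ultimately show "\<bar>x \<alpha>0 k - X k\<bar> \<le> 2 * \<nu> + \<theta> * \<bar>?x - ?X\<bar>" using P[of k] by argo
    show "\<bar>x \<alpha>0 k - X k\<bar> \<le> \<rho>" by (rule xb[OF a])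
  qed
  show ?thesis using x xb mono near by (intro exI[of _ x]) blast
qed

text \<open>
  Two solutions of the half line recursion for the same \<open>\<alpha>\<close>: their difference contracts towards the soliton,
  and its square sum is bounded by that of the difference of the coefficients.
\<close>

lemma riccati_half_line_deviation:
  fixes x X P Q :: "nat \<Rightarrow> real"
  assumes \<theta>: "0 < \<beta>" "\<theta> = 1 / (1 + \<beta> / 2)"
    and x: "\<And>k. x k = \<alpha> - P k - Q k / x (Suc k)" "\<And>k. 1 + \<beta> / 2 \<le> x (Suc k)" "\<And>k. 0 \<le> x k" "\<And>k. x k \<le> M"
    and X: "\<And>k. X k = \<alpha> - P' k - Q' k / X (Suc k)" "\<And>k. 1 \<le> X k" "\<And>k. Q' k = X (Suc k) / X k" "\<And>k. X k \<le> M"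
    and F: "\<And>K. (\<Sum>k<K. (\<bar>P k - P' k\<bar> + \<bar>Q k - Q' k\<bar>)\<^sup>2) \<le> F"
  shows "(\<Sum>k<K. (x k - X k)\<^sup>2) \<le> F / (1 - \<theta>)\<^sup>2"
proof -
  have th: "0 \<le> \<theta>" "\<theta> < 1" using \<theta> by auto
  have "(\<Sum>k<K. (\<bar>x k - X k\<bar>)\<^sup>2) \<le> F / (1 - \<theta>)\<^sup>2"
  proof (rule square_sum_contraction_from_infinity[OF th])
    fix k
    let ?x = "x (Suc k)" and ?X = "X (Suc k)"
    have p: "1 \<le> ?x" "1 \<le> ?X" "1 \<le> X k" using x(2)[of k] \<theta> X(2) by auto
    have "\<bar>(Q k - Q' k) / ?x\<bar> \<le> \<bar>Q k - Q' k\<bar> / 1"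
      unfolding abs_divide using p by (intro frac_le) auto
    moreover have "\<bar>Q' k / (?x * ?X) * (?X - ?x)\<bar> \<le> \<theta> * \<bar>?x - ?X\<bar>"
    proof -
      have "Q' k / (?x * ?X) = 1 / (?x * X k)" unfolding X(3) using p by simp
      also have "\<dots> \<le> 1 / ((1 + \<beta> / 2) * 1)"
        using p x(2)[of k] \<theta> by (intro divide_left_mono mult_mono) auto
      finally have "Q' k / (?x * ?X) \<le> \<theta>" by (simp add: \<theta>)
      moreover have "0 \<le> Q' k / (?x * ?X)" unfolding X(3) using p by simp
      ultimately show ?thesis
        by (simp only: abs_mult abs_of_nonneg abs_minus_commute[of ?X]) (intro mult_right_mono; simp)
    qed
    moreover have "x k - X k = - (P k - P' k) - (Q k - Q' k) / ?x - Q' k / (?x * ?X) * (?X - ?x)"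
    proof -
      have "Q k / ?x - Q' k / ?X = (Q k - Q' k) / ?x + Q' k / (?x * ?X) * (?X - ?x)"
        using p by (simp add: field_simps)
      thus ?thesis using x(1)[of k] X(1)[of k] by argo
    qed
    ultimately show "\<bar>x k - X k\<bar> \<le> \<theta> * \<bar>?x - ?X\<bar> + (\<bar>P k - P' k\<bar> + \<bar>Q k - Q' k\<bar>)" by argo
    show "\<bar>x k - X k\<bar> \<le> M" using x(3,4)[of k] X(2,4)[of k] by linarith
  qed (use F in auto)
  thus ?thesis by simp
qed

lemma sum_bound_lower_half:
  fixes g :: "int \<Rightarrow> real"
  assumes "\<And>n. 0 \<le> g n" "\<And>K. (\<Sum>k<K. g (m - int k)) \<le> W" "finite F" "F \<subseteq> {..m}"
  shows "(\<Sum>n\<in>F. g n) \<le> W"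
proof -
  define M where "M = Min (insert m F)"
  have M: "M \<le> n" if "n \<in> F" for n using assms(3) that by (simp add: M_def)
  have "F \<subseteq> (\<lambda>k. m - int k) ` {..<Suc (nat (m - M))}"
  proof
    fix n assume "n \<in> F"
    thus "n \<in> (\<lambda>k. m - int k) ` {..<Suc (nat (m - M))}" using M[of n] assms(4)
      by (intro image_eqI[of _ _ "nat (m - n)"]) auto
  qed
  hence "(\<Sum>n\<in>F. g n) \<le> (\<Sum>n\<in>(\<lambda>k. m - int k) ` {..<Suc (nat (m - M))}. g n)"
    by (intro sum_mono2 assms(1)) auto
  also have "\<dots> = (\<Sum>k<Suc (nat (m - M)). g (m - int k))"
    by (subst sum.reindex) (auto simp: inj_on_def)
  also have "\<dots> \<le> W" by (rule assms(2))
  finally show ?thesis .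
qed

lemma sum_bound_upper_half:
  fixes g :: "int \<Rightarrow> real"
  assumes "\<And>n. 0 \<le> g n" "\<And>K. (\<Sum>k<K. g (m + int k)) \<le> W" "finite F" "F \<subseteq> {m..}"
  shows "(\<Sum>n\<in>F. g n) \<le> W"
proof -
  have "(\<Sum>n\<in>uminus ` F. g (- n)) \<le> W"
    by (rule sum_bound_lower_half[where m = "- m"]) (use assms in \<open>auto simp: add.commute\<close>)
  thus ?thesis by (subst (asm) sum.reindex) (auto simp: inj_on_def)
qed

lemma sum_bound_reindex:
  fixes g :: "int \<Rightarrow> real"
  assumes "\<And>F. finite F \<Longrightarrow> (\<Sum>n\<in>F. g n) \<le> W" "inj_on \<phi> A" "finite A"
  shows "(\<Sum>k\<in>A. g (\<phi> k)) \<le> W"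
proof -
  have "(\<Sum>k\<in>A. g (\<phi> k)) = (\<Sum>n\<in>\<phi> ` A. g n)" using assms(2) by (simp add: sum.reindex)
  thus ?thesis using assms by simp
qed

lemma square_add_le: "((x::real) + y)\<^sup>2 \<le> 2 * x\<^sup>2 + 2 * y\<^sup>2"
  using zero_le_power2[of "x - y"] by (simp add: power2_sum power2_diff)

lemma square_abs_add_le: "(\<bar>x::real\<bar> + \<bar>y\<bar>)\<^sup>2 \<le> 2 * x\<^sup>2 + 2 * y\<^sup>2"
  using square_add_le[of "\<bar>x\<bar>" "\<bar>y\<bar>"] by simp

lemma exp_minus_lipschitz:
  fixes r r0 :: real
  assumes "\<bar>r - r0\<bar> \<le> ln 2" "exp (- r0) \<le> E"
  shows "\<bar>exp (- r) - exp (- r0)\<bar> \<le> 2 * E * \<bar>r - r0\<bar>"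
proof -
  have "exp (- r) = exp (- r0) * exp (- (r - r0))" by (simp add: exp_add[symmetric])
  hence "\<bar>exp (- r) - exp (- r0)\<bar> = exp (- r0) * \<bar>exp (- (r - r0)) - 1\<bar>"
  proof -
    assume e: "exp (- r) = exp (- r0) * exp (- (r - r0))"
    have "exp (- r) - exp (- r0) = exp (- r0) * (exp (- (r - r0)) - 1)"
      unfolding e by (simp only: right_diff_distrib mult_1_right)
    thus ?thesis by (simp only: abs_mult abs_exp_cancel)
  qed
  also have "\<dots> \<le> E * (2 * \<bar>r - r0\<bar>)"
    using exp_minus_one_small(2)[of "r - r0" 1] assms by (intro mult_mono order_trans[OF _ assms(2)]) auto
  finally show ?thesis by simp
qed

lemma abs_ln_quotient_le:
  fixes a A :: real
  assumes "1 / E \<le> A" "0 < E" "\<bar>a - A\<bar> \<le> 1 / (2 * E)"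
  shows "\<bar>ln (a / A)\<bar> \<le> 2 * E * \<bar>a - A\<bar>" "1 / (2 * E) \<le> a"
proof -
  have A: "0 < A" using assms by (meson less_le_trans zero_less_divide_1_iff)
  define x where "x = (a - A) / A"
  have "\<bar>x\<bar> = \<bar>a - A\<bar> * (1 / A)" using A by (simp add: x_def abs_divide)
  also have "\<dots> \<le> \<bar>a - A\<bar> * E" using assms A by (intro mult_left_mono) (auto simp: field_simps)
  finally have xE: "\<bar>x\<bar> \<le> E * \<bar>a - A\<bar>" by (simp add: mult.commute)
  also have "\<dots> \<le> E * (1 / (2 * E))" using assms by (intro mult_left_mono) auto
  finally have x: "\<bar>x\<bar> \<le> 1 / 2" using assms by simp
  have "\<bar>x\<bar> * \<bar>x\<bar> \<le> \<bar>x\<bar> * (1 / 2)" using x by (intro mult_left_mono) auto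
  hence "2 * x\<^sup>2 \<le> \<bar>x\<bar>" by (simp add: power2_eq_square)
  hence "\<bar>ln (1 + x)\<bar> \<le> 2 * \<bar>x\<bar>"
    using abs_ln_one_plus_x_minus_x_bound[OF x] by linarith
  moreover have "1 + x = a / A" using A by (simp add: x_def field_simps)
  ultimately show "\<bar>ln (a / A)\<bar> \<le> 2 * E * \<bar>a - A\<bar>" using xE by simp
  have "1 / E = 1 / (2 * E) + 1 / (2 * E)" using assms by (simp add: field_simps)
  thus "1 / (2 * E) \<le> a" using assms by linarith
qed

lemma cosh_diff_lower:
  fixes s t :: real
  assumes "0 \<le> k" "k \<le> s" "s \<le> t"
  shows "(t - s) * sinh k \<le> cosh t - cosh s"
proof (cases "s = t")
  case False
  hence "s < t" using assms by simp
  moreover have "(cosh has_real_derivative sinh x) (at x)" for x :: real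
    by (auto intro!: derivative_eq_intros)
  ultimately obtain z where z: "s < z" "cosh t - cosh s = (t - s) * sinh z"
    using MVT2[of s t cosh sinh] by blast
  have "(t - s) * sinh k \<le> (t - s) * sinh z" using assms z by (intro mult_left_mono) auto
  thus ?thesis using z(2) by simp
qed simp

text \<open>
  Every state near a soliton has a factorisation near that of a soliton whose rate \<open>k\<close> is slightly
  different. On the left half line the recursion determines the factor \<open>a\<close> for each \<open>\<alpha> = 2 * cosh k\<close>, on the
  right half line it determines \<open>b\<close>. The two solutions fit together if and only if \<open>a m * b (m + 1) = exp (- r m)\<close>,
  and this one scalar equation fixes \<open>\<alpha>\<close>: its defect increases with slope at least \<open>1\<close> and is of
  order \<open>\<nu>\<close> at the rate \<open>\<kappa>0\<close>, so it vanishes at distance of order \<open>\<nu>\<close>.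

  The last conclusion says that the state with exchanged factors has norm at most \<open>C * \<nu>\<close>: removing the soliton
  leaves a remainder as small as the perturbation.
\<close>

theorem near_soliton_factorization:
  assumes k1: "0 < k1" "k1 < \<kappa>0" "\<kappa>0 < k2"
  shows "\<exists>\<delta>>0. \<exists>C>0. \<forall>x0 p r \<nu>. 0 \<le> \<nu> \<longrightarrow> \<nu> < \<delta> \<longrightarrow>
      (\<forall>F. finite F \<longrightarrow> (\<Sum>n\<in>F. (r n - fst (sol \<kappa>0 (of_int n - x0)))\<^sup>2 + (p n - snd (sol \<kappa>0 (of_int n - x0)))\<^sup>2) \<le> \<nu>\<^sup>2) \<longrightarrow>
    (\<exists>k a b. k1 \<le> k \<and> k \<le> k2 \<and> \<bar>k - \<kappa>0\<bar> \<le> C * \<nu> \<and>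
      (\<forall>n. 0 < a n \<and> 0 < b n \<and> a n + b n = 2 * cosh k - p n \<and> a n * b (n + 1) = exp (- r n)) \<and>
      (\<forall>n. \<bar>a n - kink k (of_int n - x0)\<bar> \<le> C * \<nu>) \<and>
      (\<forall>F. finite F \<longrightarrow> (\<Sum>n\<in>F. (ln (a (n + 1) * b (n + 1)))\<^sup>2 + (2 * cosh k - a n - b (n + 1))\<^sup>2) \<le> (C * \<nu>)\<^sup>2))"
proof -
  have k2: "0 < k2" "0 < \<kappa>0" using k1 by simp_all
  define \<beta> where "\<beta> = min 1 (2 * cosh k1 - 2)"
  have ck1: "1 < cosh k1" using k1(1) cosh_real_ge_1[of k1] cosh_real_one_iff[of k1] by linarith
  hence \<beta>: "0 < \<beta>" "\<beta> \<le> 1" "\<beta> \<le> 2 * cosh k1 - 2" by (auto simp: \<beta>_def)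
  define \<rho> where "\<rho> = \<beta> / 8"
  define \<theta> where "\<theta> = (1 + \<beta> / 4) / (1 + 7 * \<beta> / 8)"
  define \<theta>1 where "\<theta>1 = 1 / (1 + \<beta> / 2)"
  have \<rho>: "0 < \<rho>" "\<rho> \<le> 1 / 8" using \<beta> by (auto simp: \<rho>_def)
  have th: "0 < 1 - \<theta>" "0 < 1 - \<theta>1" "0 < \<theta>" using \<beta> by (auto simp: \<theta>_def \<theta>1_def)
  define M where "M = exp k2"
  define E where "E = exp (2 * k2)"
  have M: "1 \<le> M" "0 < M" using k2 by (auto simp: M_def)
  have E: "1 \<le> E" "0 < E" "M \<le> E" "1 / E \<le> 1 / M"
    using k2 by (auto simp: E_def M_def field_simps exp_add[symmetric])
  have EM: "E = M * M" by (simp add: E_def M_def exp_add[symmetric])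
  define C1 where "C1 = (2 * M + \<rho>) * (2 * (2 * E) / (1 - \<theta>)) + 2 * E"
  have C1: "0 < C1" using M E \<rho> th by (auto simp: C1_def intro!: add_pos_pos mult_pos_pos)
  define C2 where "C2 = C1 / (2 * sinh k1)"
  have C2: "0 < C2" using C1 k1 by (simp add: C2_def)
  obtain C3 where C3: "C3 > 0" and lip: "\<And>k k' x x' F. k1 \<le> k \<Longrightarrow> k \<le> k2 \<Longrightarrow> k1 \<le> k' \<Longrightarrow> k' \<le> k2 \<Longrightarrow> \<bar>x - x'\<bar> \<le> 1 \<Longrightarrow> finite F \<Longrightarrow>
      (\<Sum>n\<in>F. (norm (sol k' (of_int n - x') - sol k (of_int n - x)))\<^sup>2) \<le> (C3 * (\<bar>k' - k\<bar> + \<bar>x' - x\<bar>))\<^sup>2"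
    using sol_lipschitz_l2[OF k1(1), of k2] by blast
  define C4 where "C4 = 2 + 2 * (C3 * C2)\<^sup>2"
  have C4: "0 < C4" by (simp add: C4_def add_pos_nonneg)
  define W where "W = 16 * E\<^sup>2 * C4 / (1 - \<theta>1)\<^sup>2"
  have W: "0 < W" unfolding W_def
    by (intro divide_pos_pos mult_pos_pos zero_less_power) (use E(2) C4 th in auto)
  define C5 where "C5 = 6 * W + 4 * C4"
  have C5: "0 < C5" using W C4 by (simp add: C5_def)
  define C6 where "C6 = (4 + 16 * E\<^sup>2) * C5"
  have C6: "0 < C6" using C5 E by (simp add: C6_def add_pos_nonneg)
  define C where "C = C2 + sqrt C5 + sqrt C6"
  have C: "0 < C" "C2 \<le> C" "sqrt C5 \<le> C" "sqrt C6 \<le> C" using C2 C5 C6 by (auto simp: C_def add_pos_pos)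
  define \<delta> where "\<delta> = Min {ln 2, (1 - \<theta>) * \<rho> / (C1 + 4 * E), (\<kappa>0 - k1) / C2, (k2 - \<kappa>0) / C2,
      ln 2 / sqrt C4, 1 / (2 * E) / sqrt C5}"
  have \<delta>: "0 < \<delta>" using C1 C2 C4 C5 E th \<rho> k1 by (auto simp: \<delta>_def intro!: divide_pos_pos mult_pos_pos add_pos_pos)
  have main: "\<exists>k a b. k1 \<le> k \<and> k \<le> k2 \<and> \<bar>k - \<kappa>0\<bar> \<le> C * \<nu> \<and>
      (\<forall>n. 0 < a n \<and> 0 < b n \<and> a n + b n = 2 * cosh k - p n \<and> a n * b (n + 1) = exp (- r n)) \<and>
      (\<forall>n. \<bar>a n - kink k (of_int n - x0)\<bar> \<le> C * \<nu>) \<and>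
      (\<forall>F. finite F \<longrightarrow> (\<Sum>n\<in>F. (ln (a (n + 1) * b (n + 1)))\<^sup>2 + (2 * cosh k - a n - b (n + 1))\<^sup>2) \<le> (C * \<nu>)\<^sup>2)"
    if \<nu>: "0 \<le> \<nu>" "\<nu> < \<delta>" and
      H: "\<And>F. finite F \<Longrightarrow> (\<Sum>n\<in>F. (r n - fst (sol \<kappa>0 (of_int n - x0)))\<^sup>2 + (p n - snd (sol \<kappa>0 (of_int n - x0)))\<^sup>2) \<le> \<nu>\<^sup>2"
    for x0 \<nu> :: real and p r :: "int \<Rightarrow> real"
  proof -
    have d1: "\<nu> \<le> ln 2" and d2: "(C1 + 4 * E) * \<nu> \<le> (1 - \<theta>) * \<rho>" and d3: "C2 * \<nu> \<le> \<kappa>0 - k1"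
      and d4: "C2 * \<nu> \<le> k2 - \<kappa>0" and d5: "sqrt C4 * \<nu> \<le> ln 2" and d6: "sqrt C5 * \<nu> \<le> 1 / (2 * E)"
    proof -
      have n: "\<nu> < ln 2" "\<nu> < (1 - \<theta>) * \<rho> / (C1 + 4 * E)" "\<nu> < (\<kappa>0 - k1) / C2" "\<nu> < (k2 - \<kappa>0) / C2"
        "\<nu> < ln 2 / sqrt C4" "\<nu> < 1 / (2 * E) / sqrt C5"
        using \<nu>(2) by (auto simp: \<delta>_def)
      have c: "0 < C1 + 4 * E" "0 < sqrt C4" "0 < sqrt C5" using C1 E C4 C5 by auto
      have mult: "c * x \<le> y" if "x < y / c" "0 < c" for x y c :: real
        using that by (simp add: pos_less_divide_eq mult.commute)
      show "\<nu> \<le> ln 2" using n(1) by simp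
      show "(C1 + 4 * E) * \<nu> \<le> (1 - \<theta>) * \<rho>" by (rule mult[OF n(2) c(1)])
      show "C2 * \<nu> \<le> \<kappa>0 - k1" by (rule mult[OF n(3) C2])
      show "C2 * \<nu> \<le> k2 - \<kappa>0" by (rule mult[OF n(4) C2])
      show "sqrt C4 * \<nu> \<le> ln 2" by (rule mult[OF n(5) c(2)])
      show "sqrt C5 * \<nu> \<le> 1 / (2 * E)" by (rule mult[OF n(6) c(3)])
    qed
    (* The last site at which the unperturbed kink is at least 1. *)
    define m where "m = \<lfloor>x0 + 1 / 2\<rfloor>"
    have m: "of_int m - x0 \<le> 1 / 2" "1 / 2 < of_int m + 1 - x0" unfolding m_def by linarith+
    define A0 where "A0 = (\<lambda>n::int. kink \<kappa>0 (of_int n - x0))"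
    define \<alpha>0 where "\<alpha>0 = 2 * cosh \<kappa>0"
    define r0 p0 where "r0 = (\<lambda>n::int. fst (sol \<kappa>0 (of_int n - x0)))" and "p0 = (\<lambda>n::int. snd (sol \<kappa>0 (of_int n - x0)))"
    have kf: "0 < kink k (of_int n - x0)" "kink k (of_int n - x0) \<le> M" "1 / M \<le> kink k (of_int n - x0)"
        "kink k (of_int n - x0) + 1 / kink k (of_int (n + 1) - x0) = 2 * cosh k"
        "exp (- fst (sol k (of_int n - x0))) = kink k (of_int n - x0) / kink k (of_int (n + 1) - x0)"
        "snd (sol k (of_int n - x0)) = 2 * cosh k - kink k (of_int n - x0) - 1 / kink k (of_int n - x0)"
        "exp (- fst (sol k (of_int n - x0))) \<le> E"
        "n \<le> m \<Longrightarrow> 1 \<le> kink k (of_int n - x0)" "m < n \<Longrightarrow> kink k (of_int n - x0) \<le> 1"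
        "n < m \<Longrightarrow> 1 + \<beta> \<le> kink k (of_int n - x0)" "m + 1 < n \<Longrightarrow> 1 + \<beta> \<le> 1 / kink k (of_int n - x0)"
      if k: "k1 \<le> k" "k \<le> k2" for k and n :: int
    proof -
      have k0: "0 < k" using k k1 by simp
      let ?z = "of_int n - x0" and ?z1 = "of_int (n + 1) - x0"
      have e: "?z1 = ?z + 1" by simp
      have "cosh k1 \<le> cosh k" using k k1 by (simp add: cosh_real_nonneg_le_iff)
      hence \<alpha>: "2 + \<beta> \<le> 2 * cosh k" using \<beta> by simp
      show pos: "0 < kink k ?z" by (rule kink_pos)
      have "exp k \<le> M" using k by (simp add: M_def)
      thus up: "kink k ?z \<le> M" using kink_bounds(2)[OF k0, of ?z] by simp
      have "1 / M \<le> exp (- k)" using k by (simp add: M_def exp_minus field_simps)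
      thus low: "1 / M \<le> kink k ?z" using kink_bounds(1)[OF k0, of ?z] by simp
      show st: "kink k ?z + 1 / kink k ?z1 = 2 * cosh k" unfolding e by (rule kink_step)
      show ex: "exp (- fst (sol k ?z)) = kink k ?z / kink k ?z1" unfolding e by (rule exp_minus_sol_fst)
      show "snd (sol k ?z) = 2 * cosh k - kink k ?z - 1 / kink k ?z" by (simp add: sol_def)
      have low1: "1 / M \<le> kink k ?z1"
        using kink_bounds(1)[OF k0, of ?z1] \<open>1 / M \<le> exp (- k)\<close> by simp
      have "kink k ?z / kink k ?z1 \<le> M / (1 / M)"
        using up low1 M pos by (intro frac_le) auto
      thus "exp (- fst (sol k ?z)) \<le> E" unfolding ex EM by simp
      show "n \<le> m \<Longrightarrow> 1 \<le> kink k ?z" using m by (intro kink_ge_1[OF k0]) linarith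
      show "m < n \<Longrightarrow> kink k ?z \<le> 1" using m by (intro kink_le_1[OF k0]) linarith
      show "1 + \<beta> \<le> kink k ?z" if "n < m"
      proof -
        have "1 \<le> kink k ?z1" using m that unfolding e by (intro kink_ge_1[OF k0]) linarith
        hence "1 / kink k ?z1 \<le> 1" by simp
        thus ?thesis using st \<alpha> by linarith
      qed
      show "1 + \<beta> \<le> 1 / kink k ?z" if "m + 1 < n"
      proof -
        have "kink k (?z - 1) \<le> 1" using m that by (intro kink_le_1[OF k0]) linarith
        thus ?thesis using kink_step[of k "?z - 1"] \<alpha> by simp
      qed
    qed
    have k0r: "k1 \<le> \<kappa>0" "\<kappa>0 \<le> k2" using k1 by simp_all
    have H1: "(r n - r0 n)\<^sup>2 + (p n - p0 n)\<^sup>2 \<le> \<nu>\<^sup>2" for n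
      using H[of "{n}"] by (simp add: r0_def p0_def)
    have rb: "\<bar>r n - r0 n\<bar> \<le> \<nu>" "\<bar>p n - p0 n\<bar> \<le> \<nu>" for n
    proof -
      have "(r n - r0 n)\<^sup>2 \<le> \<nu>\<^sup>2" "(p n - p0 n)\<^sup>2 \<le> \<nu>\<^sup>2"
        using H1[of n] zero_le_power2[of "r n - r0 n"] zero_le_power2[of "p n - p0 n"] by linarith+
      thus "\<bar>r n - r0 n\<bar> \<le> \<nu>" "\<bar>p n - p0 n\<bar> \<le> \<nu>" using \<nu>(1) by (auto simp: power2_le_iff_abs_le)
    qed
    define \<nu>1 where "\<nu>1 = 2 * E * \<nu>"
    have \<nu>1: "0 \<le> \<nu>1" "\<nu> \<le> \<nu>1"
    proof -
      have "1 * \<nu> \<le> 2 * E * \<nu>" using E \<nu> by (intro mult_right_mono) auto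
      thus "0 \<le> \<nu>1" "\<nu> \<le> \<nu>1" using \<nu> by (auto simp: \<nu>1_def)
    qed
    have qb: "\<bar>exp (- r n) - exp (- r0 n)\<bar> \<le> \<nu>1" for n
    proof -
      have "\<bar>exp (- r n) - exp (- r0 n)\<bar> \<le> 2 * E * \<bar>r n - r0 n\<bar>"
        using rb(1)[of n] d1 kf(7)[OF k0r, of n] by (intro exp_minus_lipschitz) (auto simp: r0_def)
      also have "\<dots> \<le> \<nu>1" unfolding \<nu>1_def using rb(1)[of n] E by (intro mult_left_mono) auto
      finally show ?thesis .
    qed
    (* Bounds the defect at \<alpha>0; as the slope is at least 1, it also bounds how far the zero is from \<alpha>0. *)
    define h where "h = C1 * \<nu>"
    have h0: "0 \<le> h" using C1 \<nu> by (simp add: h_def)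
    have h1: "h + 2 * \<nu>1 \<le> (1 - \<theta>) * \<rho>" using d2 by (simp add: h_def \<nu>1_def algebra_simps)
    have h2: "\<nu>1 \<le> \<rho>"
    proof -
      have "(1 - \<theta>) * \<rho> \<le> 1 * \<rho>" using th \<rho> by (intro mult_right_mono) auto
      thus ?thesis using h1 h0 \<nu>1 by linarith
    qed
    define XL PL QL where "XL = (\<lambda>k. A0 (m - int k))" and "PL = (\<lambda>k. p (m - int k))"
      and "QL = (\<lambda>k. exp (- r (m - int k - 1)))"
    define XR PR QR where "XR = (\<lambda>k. 1 / A0 (m + 1 + int k))" and "PR = (\<lambda>k. p (m + 1 + int k))"
      and "QR = (\<lambda>k. exp (- r (m + 1 + int k)))"
    have "\<exists>x. (\<forall>\<alpha> k. \<bar>\<alpha> - \<alpha>0\<bar> \<le> h \<longrightarrow> x \<alpha> k = \<alpha> - PL k - QL k / x \<alpha> (Suc k) \<and> \<bar>x \<alpha> k - XL k\<bar> \<le> \<rho>) \<and>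
      (\<forall>\<alpha> \<alpha>' k. \<bar>\<alpha> - \<alpha>0\<bar> \<le> h \<longrightarrow> \<bar>\<alpha>' - \<alpha>0\<bar> \<le> h \<longrightarrow> \<alpha> \<le> \<alpha>' \<longrightarrow>
          \<alpha>' - \<alpha> \<le> x \<alpha>' k - x \<alpha> k \<and> x \<alpha>' k - x \<alpha> k \<le> (\<alpha>' - \<alpha>) / (1 - \<theta>)) \<and>
      (\<forall>k. \<bar>x \<alpha>0 k - XL k\<bar> \<le> 2 * \<nu>1 / (1 - \<theta>))"
    proof (rule riccati_half_line[OF \<beta>(1) \<rho>_def \<theta>_def _ _ _ _ _ h2 h1 h0])
      fix k
      show "1 \<le> XL k" unfolding XL_def A0_def by (rule kf(8)[OF k0r]) simp
      show "1 + \<beta> \<le> XL (Suc k)" unfolding XL_def A0_def by (rule kf(10)[OF k0r]) simp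
      have "p0 (m - int k) = \<alpha>0 - XL k - 1 / XL k" unfolding p0_def XL_def A0_def \<alpha>0_def by (rule kf(6)[OF k0r])
      thus "\<bar>PL k - (\<alpha>0 - XL k - 1 / XL k)\<bar> \<le> \<nu>1" using rb(2)[of "m - int k"] \<nu>1 by (simp add: PL_def)
      have "exp (- r0 (m - int k - 1)) = XL (Suc k) / XL k"
        unfolding r0_def XL_def A0_def using kf(5)[OF k0r, of "m - int k - 1"] by (simp add: algebra_simps)
      thus "\<bar>QL k - XL (Suc k) / XL k\<bar> \<le> \<nu>1" using qb[of "m - int k - 1"] by (simp add: QL_def)
    qed (simp add: QL_def)
    then obtain xL where xL: "\<And>\<alpha> k. \<bar>\<alpha> - \<alpha>0\<bar> \<le> h \<Longrightarrow> xL \<alpha> k = \<alpha> - PL k - QL k / xL \<alpha> (Suc k)"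
        "\<And>\<alpha> k. \<bar>\<alpha> - \<alpha>0\<bar> \<le> h \<Longrightarrow> \<bar>xL \<alpha> k - XL k\<bar> \<le> \<rho>"
      and xLm: "\<And>\<alpha> \<alpha>' k. \<bar>\<alpha> - \<alpha>0\<bar> \<le> h \<Longrightarrow> \<bar>\<alpha>' - \<alpha>0\<bar> \<le> h \<Longrightarrow> \<alpha> \<le> \<alpha>' \<Longrightarrow>
          \<alpha>' - \<alpha> \<le> xL \<alpha>' k - xL \<alpha> k \<and> xL \<alpha>' k - xL \<alpha> k \<le> (\<alpha>' - \<alpha>) / (1 - \<theta>)"
      and xL0: "\<And>k. \<bar>xL \<alpha>0 k - XL k\<bar> \<le> 2 * \<nu>1 / (1 - \<theta>)" by blast
    have "\<exists>x. (\<forall>\<alpha> k. \<bar>\<alpha> - \<alpha>0\<bar> \<le> h \<longrightarrow> x \<alpha> k = \<alpha> - PR k - QR k / x \<alpha> (Suc k) \<and> \<bar>x \<alpha> k - XR k\<bar> \<le> \<rho>) \<and>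
      (\<forall>\<alpha> \<alpha>' k. \<bar>\<alpha> - \<alpha>0\<bar> \<le> h \<longrightarrow> \<bar>\<alpha>' - \<alpha>0\<bar> \<le> h \<longrightarrow> \<alpha> \<le> \<alpha>' \<longrightarrow>
          \<alpha>' - \<alpha> \<le> x \<alpha>' k - x \<alpha> k \<and> x \<alpha>' k - x \<alpha> k \<le> (\<alpha>' - \<alpha>) / (1 - \<theta>)) \<and>
      (\<forall>k. \<bar>x \<alpha>0 k - XR k\<bar> \<le> 2 * \<nu>1 / (1 - \<theta>))"
    proof (rule riccati_half_line[OF \<beta>(1) \<rho>_def \<theta>_def _ _ _ _ _ h2 h1 h0])
      fix k
      have "A0 (m + 1 + int k) \<le> 1" "0 < A0 (m + 1 + int k)"
        unfolding A0_def by (rule kf(9)[OF k0r], simp) (rule kink_pos)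
      thus "1 \<le> XR k" by (simp add: XR_def)
      show "1 + \<beta> \<le> XR (Suc k)" unfolding XR_def A0_def by (rule kf(11)[OF k0r]) simp
      have "p0 (m + 1 + int k) = \<alpha>0 - XR k - 1 / XR k"
        unfolding p0_def XR_def A0_def \<alpha>0_def using kf(6)[OF k0r, of "m + 1 + int k"] by simp
      thus "\<bar>PR k - (\<alpha>0 - XR k - 1 / XR k)\<bar> \<le> \<nu>1" using rb(2)[of "m + 1 + int k"] \<nu>1 by (simp add: PR_def)
      have "exp (- r0 (m + 1 + int k)) = XR (Suc k) / XR k"
        unfolding r0_def XR_def A0_def using kf(5)[OF k0r, of "m + 1 + int k"] by (simp add: algebra_simps)
      thus "\<bar>QR k - XR (Suc k) / XR k\<bar> \<le> \<nu>1" using qb[of "m + 1 + int k"] by (simp add: QR_def)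
    qed (simp add: QR_def)
    then obtain xR where xR: "\<And>\<alpha> k. \<bar>\<alpha> - \<alpha>0\<bar> \<le> h \<Longrightarrow> xR \<alpha> k = \<alpha> - PR k - QR k / xR \<alpha> (Suc k)"
        "\<And>\<alpha> k. \<bar>\<alpha> - \<alpha>0\<bar> \<le> h \<Longrightarrow> \<bar>xR \<alpha> k - XR k\<bar> \<le> \<rho>"
      and xRm: "\<And>\<alpha> \<alpha>' k. \<bar>\<alpha> - \<alpha>0\<bar> \<le> h \<Longrightarrow> \<bar>\<alpha>' - \<alpha>0\<bar> \<le> h \<Longrightarrow> \<alpha> \<le> \<alpha>' \<Longrightarrow>
          \<alpha>' - \<alpha> \<le> xR \<alpha>' k - xR \<alpha> k \<and> xR \<alpha>' k - xR \<alpha> k \<le> (\<alpha>' - \<alpha>) / (1 - \<theta>)"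
      and xR0: "\<And>k. \<bar>xR \<alpha>0 k - XR k\<bar> \<le> 2 * \<nu>1 / (1 - \<theta>)" by blast
    have XLb: "1 \<le> XL k" "XL k \<le> M" "1 + \<beta> \<le> XL (Suc k)" for k
      unfolding XL_def A0_def
      using kf(2,8)[OF k0r, of "m - int k"] kf(10)[OF k0r, of "m - int (Suc k)"] by auto
    have XRb: "1 \<le> XR k" "XR k \<le> M" "1 + \<beta> \<le> XR (Suc k)" for k
    proof -
      have "0 < A0 (m + 1 + int k)" "A0 (m + 1 + int k) \<le> 1" "1 / M \<le> A0 (m + 1 + int k)"
        unfolding A0_def using kf(1,3,9)[OF k0r, of "m + 1 + int k"] by auto
      thus "1 \<le> XR k" "XR k \<le> M" using M by (auto simp: XR_def field_simps)
      show "1 + \<beta> \<le> XR (Suc k)" unfolding XR_def A0_def by (rule kf(11)[OF k0r]) simp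
    qed
    have xLb: "7 / 8 \<le> xL \<alpha> k" "xL \<alpha> k \<le> M + \<rho>" "1 + \<beta> / 2 \<le> xL \<alpha> (Suc k)" if "\<bar>\<alpha> - \<alpha>0\<bar> \<le> h" for \<alpha> k
      using xL(2)[OF that, of k] xL(2)[OF that, of "Suc k"] XLb[of k] \<rho> \<beta> unfolding \<rho>_def by linarith+
    have xRb: "7 / 8 \<le> xR \<alpha> k" "xR \<alpha> k \<le> M + \<rho>" "1 + \<beta> / 2 \<le> xR \<alpha> (Suc k)" if "\<bar>\<alpha> - \<alpha>0\<bar> \<le> h" for \<alpha> k
      using xR(2)[OF that, of k] xR(2)[OF that, of "Suc k"] XRb[of k] \<rho> \<beta> unfolding \<rho>_def by linarith+
    (* The defect of the matching condition between the two half lines. *)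
    define D where "D = (\<lambda>\<alpha>. xL \<alpha> 0 * xR \<alpha> 0 - exp (- r m))"
    have a0: "\<bar>\<alpha>0 - \<alpha>0\<bar> \<le> h" using h0 by simp
    have D0: "\<bar>D \<alpha>0\<bar> \<le> h"
    proof -
      have XX: "XL 0 * XR 0 = exp (- r0 m)"
        unfolding XL_def XR_def r0_def A0_def using kf(5)[OF k0r, of m] by simp
      have "\<bar>(xL \<alpha>0 0 - XL 0) * xR \<alpha>0 0\<bar> \<le> (2 * \<nu>1 / (1 - \<theta>)) * (M + \<rho>)"
        unfolding abs_mult using xL0[of 0] xRb[OF a0, of 0] th \<nu>1 by (intro mult_mono) auto
      moreover have "\<bar>XL 0 * (xR \<alpha>0 0 - XR 0)\<bar> \<le> M * (2 * \<nu>1 / (1 - \<theta>))"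
        unfolding abs_mult using xR0[of 0] XLb[of 0] M by (intro mult_mono) auto
      moreover have "D \<alpha>0 = (xL \<alpha>0 0 - XL 0) * xR \<alpha>0 0 + XL 0 * (xR \<alpha>0 0 - XR 0) - (exp (- r m) - exp (- r0 m))"
        unfolding D_def XX[symmetric] by (simp add: algebra_simps)
      moreover have "(2 * \<nu>1 / (1 - \<theta>)) * (M + \<rho>) + M * (2 * \<nu>1 / (1 - \<theta>)) + \<nu>1 = h"
        proof -
        have "(2 * (2 * E * n) * q) * (M + r) + M * (2 * (2 * E * n) * q) + 2 * E * n
            = ((2 * M + r) * (2 * (2 * E) * q) + 2 * E) * n" for n q r :: real
          by (simp add: algebra_simps)
        thus ?thesis unfolding h_def C1_def \<nu>1_def divide_inverse .
      qed
      ultimately show ?thesis using qb[of m] by argo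
    qed
    have Dslope: "\<alpha>' - \<alpha> \<le> D \<alpha>' - D \<alpha>" if a: "\<bar>\<alpha> - \<alpha>0\<bar> \<le> h" "\<bar>\<alpha>' - \<alpha>0\<bar> \<le> h" "\<alpha> \<le> \<alpha>'" for \<alpha> \<alpha>'
    proof -
      have "(\<alpha>' - \<alpha>) * (7 / 8) \<le> (xL \<alpha>' 0 - xL \<alpha> 0) * xR \<alpha>' 0"
        using xLm[OF a, of 0] xRb(1)[OF a(2), of 0] a by (intro mult_mono) auto
      moreover have "(7 / 8) * (\<alpha>' - \<alpha>) \<le> xL \<alpha> 0 * (xR \<alpha>' 0 - xR \<alpha> 0)"
        using xRm[OF a, of 0] xLb(1)[OF a(1), of 0] a by (intro mult_mono) auto
      moreover have "D \<alpha>' - D \<alpha> = (xL \<alpha>' 0 - xL \<alpha> 0) * xR \<alpha>' 0 + xL \<alpha> 0 * (xR \<alpha>' 0 - xR \<alpha> 0)"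
        by (simp add: D_def algebra_simps)
      ultimately show ?thesis using a by argo
    qed
    have cont: "continuous_on {\<alpha>0 - h..\<alpha>0 + h} (\<lambda>\<alpha>. x \<alpha> 0)"
      if "\<And>\<alpha> \<alpha>' k. \<bar>\<alpha> - \<alpha>0\<bar> \<le> h \<Longrightarrow> \<bar>\<alpha>' - \<alpha>0\<bar> \<le> h \<Longrightarrow> \<alpha> \<le> \<alpha>' \<Longrightarrow>
          \<alpha>' - \<alpha> \<le> x \<alpha>' k - x \<alpha> k \<and> x \<alpha>' k - x \<alpha> k \<le> (\<alpha>' - \<alpha>) / (1 - \<theta>)" for x :: "real \<Rightarrow> nat \<Rightarrow> real"
    proof -
      have "(1 / (1 - \<theta>))-lipschitz_on {\<alpha>0 - h..\<alpha>0 + h} (\<lambda>\<alpha>. x \<alpha> 0)"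
      proof (rule lipschitz_onI)
        fix \<alpha> \<alpha>' assume "\<alpha> \<in> {\<alpha>0 - h..\<alpha>0 + h}" "\<alpha>' \<in> {\<alpha>0 - h..\<alpha>0 + h}"
        hence i: "\<bar>\<alpha> - \<alpha>0\<bar> \<le> h" "\<bar>\<alpha>' - \<alpha>0\<bar> \<le> h" by auto
        show "dist (x \<alpha> 0) (x \<alpha>' 0) \<le> 1 / (1 - \<theta>) * dist \<alpha> \<alpha>'"
          using that[OF i, of 0] that[OF i(2,1), of 0]
          by (cases "\<alpha> \<le> \<alpha>'") (auto simp: dist_real_def)
      qed (use th in simp)
      thus ?thesis by (rule lipschitz_on_continuous_on)
    qed
    have "\<exists>\<alpha>. \<alpha>0 - h \<le> \<alpha> \<and> \<alpha> \<le> \<alpha>0 + h \<and> D \<alpha> = 0"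
    proof (rule IVT')
      have "\<bar>\<alpha>0 - h - \<alpha>0\<bar> \<le> h" "\<bar>\<alpha>0 + h - \<alpha>0\<bar> \<le> h" using h0 by auto
      from Dslope[OF this(1) a0] Dslope[OF a0 this(2)] D0 h0
      show "D (\<alpha>0 - h) \<le> 0" "0 \<le> D (\<alpha>0 + h)" by auto
      show "continuous_on {\<alpha>0 - h..\<alpha>0 + h} D"
        unfolding D_def by (intro continuous_intros cont xLm xRm)
    qed (use h0 in simp)
    then obtain \<alpha> where \<alpha>: "\<alpha>0 - h \<le> \<alpha>" "\<alpha> \<le> \<alpha>0 + h" "D \<alpha> = 0" by blast
    hence \<alpha>h: "\<bar>\<alpha> - \<alpha>0\<bar> \<le> h" by linarith
    define h' where "h' = C2 * \<nu>"
    have h': "0 \<le> h'" "h' * sinh k1 = h / 2" "k1 \<le> \<kappa>0 - h'" "\<kappa>0 + h' \<le> k2"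
    proof -
      show "0 \<le> h'" using C2 \<nu> by (simp add: h'_def)
      show "h' * sinh k1 = h / 2" using k1 by (simp add: h'_def h_def C2_def)
      show "k1 \<le> \<kappa>0 - h'" "\<kappa>0 + h' \<le> k2" using d3 d4 unfolding h'_def by linarith+
    qed
    have "\<exists>k. \<kappa>0 - h' \<le> k \<and> k \<le> \<kappa>0 + h' \<and> cosh k = \<alpha> / 2"
    proof (rule IVT')
      have "(\<kappa>0 - (\<kappa>0 - h')) * sinh k1 \<le> cosh \<kappa>0 - cosh (\<kappa>0 - h')"
        using k1 h' by (intro cosh_diff_lower) auto
      thus "cosh (\<kappa>0 - h') \<le> \<alpha> / 2" using h'(2) \<alpha> by (simp add: \<alpha>0_def)
      have "(\<kappa>0 + h' - \<kappa>0) * sinh k1 \<le> cosh (\<kappa>0 + h') - cosh \<kappa>0"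
        using k1 h' by (intro cosh_diff_lower) auto
      thus "\<alpha> / 2 \<le> cosh (\<kappa>0 + h')" using h'(2) \<alpha> by (simp add: \<alpha>0_def)
    qed (use h' in \<open>auto intro!: continuous_intros\<close>)
    then obtain k where k: "\<kappa>0 - h' \<le> k" "k \<le> \<kappa>0 + h'" "cosh k = \<alpha> / 2" by blast
    have kr: "k1 \<le> k" "k \<le> k2" using k h' by linarith+
    have \<alpha>k: "\<alpha> = 2 * cosh k" using k(3) by simp
    have kk: "\<bar>k - \<kappa>0\<bar> \<le> C2 * \<nu>" using k unfolding h'_def by linarith
    define A where "A = (\<lambda>n::int. kink k (of_int n - x0))"
    define rk pk where "rk = (\<lambda>n::int. fst (sol k (of_int n - x0)))" and "pk = (\<lambda>n::int. snd (sol k (of_int n - x0)))"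
    have app: "kink k (of_int n - x0) = A n" "fst (sol k (of_int n - x0)) = rk n"
        "snd (sol k (of_int n - x0)) = pk n" "2 * cosh k = \<alpha>" for n :: int
      by (simp_all add: A_def rk_def pk_def \<alpha>k)
    note kk_f = kf[OF kr, unfolded app]
    have G: "(\<Sum>n\<in>F. (r n - rk n)\<^sup>2 + (p n - pk n)\<^sup>2) \<le> C4 * \<nu>\<^sup>2" if F: "finite F" for F
    proof -
      have "(r n - rk n)\<^sup>2 + (p n - pk n)\<^sup>2 \<le> 2 * ((r n - r0 n)\<^sup>2 + (p n - p0 n)\<^sup>2)
          + 2 * (norm (sol \<kappa>0 (of_int n - x0) - sol k (of_int n - x0)))\<^sup>2" for n
        using square_add_le[of "r n - r0 n" "r0 n - rk n"] square_add_le[of "p n - p0 n" "p0 n - pk n"]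
        by (simp add: norm_prod_square r0_def p0_def rk_def pk_def)
      hence "(\<Sum>n\<in>F. (r n - rk n)\<^sup>2 + (p n - pk n)\<^sup>2) \<le> 2 * (\<Sum>n\<in>F. (r n - r0 n)\<^sup>2 + (p n - p0 n)\<^sup>2)
          + 2 * (\<Sum>n\<in>F. (norm (sol \<kappa>0 (of_int n - x0) - sol k (of_int n - x0)))\<^sup>2)"
        unfolding sum_distrib_left sum.distrib[symmetric] by (intro sum_mono)
      also have "\<dots> \<le> 2 * \<nu>\<^sup>2 + 2 * (C3 * (\<bar>\<kappa>0 - k\<bar> + \<bar>x0 - x0\<bar>))\<^sup>2"
        using H[OF F] lip[OF kr k0r _ F, of x0 x0] by (simp add: r0_def p0_def)
      also have "\<dots> \<le> 2 * \<nu>\<^sup>2 + 2 * (C3 * (C2 * \<nu>))\<^sup>2"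
        using kk C3 by (intro add_left_mono mult_left_mono power_mono) (auto simp: abs_minus_commute)
      also have "\<dots> = C4 * \<nu>\<^sup>2" by (simp add: C4_def power_mult_distrib algebra_simps)
      finally show ?thesis .
    qed
    have G1: "\<bar>r n - rk n\<bar> \<le> ln 2" for n
    proof -
      have "(r n - rk n)\<^sup>2 \<le> (r n - rk n)\<^sup>2 + (p n - pk n)\<^sup>2" by simp
      also have "\<dots> \<le> C4 * \<nu>\<^sup>2" using G[of "{n}"] by simp
      also have "C4 * \<nu>\<^sup>2 = (sqrt C4 * \<nu>)\<^sup>2" using C4 by (simp add: power_mult_distrib)
      finally have "\<bar>r n - rk n\<bar> \<le> sqrt C4 * \<nu>" using \<nu> C4 by (simp add: power2_le_iff_abs_le)
      thus ?thesis using d5 by simp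
    qed
    have q1: "\<bar>exp (- r n) - exp (- rk n)\<bar> \<le> 2 * E * \<bar>r n - rk n\<bar>" for n
      using G1 kk_f(7) by (intro exp_minus_lipschitz) auto
    have fbound: "(\<Sum>j<K. (\<bar>p (\<phi> j) - pk (\<phi> j)\<bar> + \<bar>exp (- r (\<psi> j)) - exp (- rk (\<psi> j))\<bar>)\<^sup>2) \<le> 16 * E\<^sup>2 * C4 * \<nu>\<^sup>2"
      if inj: "inj \<phi>" "inj \<psi>" for \<phi> \<psi> :: "nat \<Rightarrow> int" and K
    proof -
      let ?g = "\<lambda>n. (r n - rk n)\<^sup>2 + (p n - pk n)\<^sup>2"
      have E2: "2 \<le> 8 * E\<^sup>2" using E one_le_power[of E 2] by linarith
      have summand: "(\<bar>p (\<phi> j) - pk (\<phi> j)\<bar> + \<bar>exp (- r (\<psi> j)) - exp (- rk (\<psi> j))\<bar>)\<^sup>2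
          \<le> 8 * E\<^sup>2 * ?g (\<phi> j) + 8 * E\<^sup>2 * ?g (\<psi> j)" for j
      proof -
        have "(exp (- r (\<psi> j)) - exp (- rk (\<psi> j)))\<^sup>2 \<le> (2 * E * \<bar>r (\<psi> j) - rk (\<psi> j)\<bar>)\<^sup>2"
          using q1[of "\<psi> j"] by (metis abs_ge_zero power2_abs power_mono)
        also have "\<dots> = 4 * E\<^sup>2 * (r (\<psi> j) - rk (\<psi> j))\<^sup>2" by (simp add: power_mult_distrib)
        also have "\<dots> \<le> 4 * E\<^sup>2 * ?g (\<psi> j)" by (intro mult_left_mono) auto
        finally have 1: "2 * (exp (- r (\<psi> j)) - exp (- rk (\<psi> j)))\<^sup>2 \<le> 8 * E\<^sup>2 * ?g (\<psi> j)" by simp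
        have "2 * (p (\<phi> j) - pk (\<phi> j))\<^sup>2 \<le> 8 * E\<^sup>2 * ?g (\<phi> j)"
          using E2 by (intro mult_mono) auto
        thus ?thesis using 1 square_abs_add_le[of "p (\<phi> j) - pk (\<phi> j)" "exp (- r (\<psi> j)) - exp (- rk (\<psi> j))"] by linarith
      qed
      have "(\<Sum>j<K. (\<bar>p (\<phi> j) - pk (\<phi> j)\<bar> + \<bar>exp (- r (\<psi> j)) - exp (- rk (\<psi> j))\<bar>)\<^sup>2)
          \<le> (\<Sum>j<K. 8 * E\<^sup>2 * ?g (\<phi> j) + 8 * E\<^sup>2 * ?g (\<psi> j))" by (intro sum_mono summand)
      also have "\<dots> = 8 * E\<^sup>2 * (\<Sum>j<K. ?g (\<phi> j)) + 8 * E\<^sup>2 * (\<Sum>j<K. ?g (\<psi> j))"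
        unfolding sum_distrib_left by (rule sum.distrib)
      also have "\<dots> \<le> 8 * E\<^sup>2 * (C4 * \<nu>\<^sup>2) + 8 * E\<^sup>2 * (C4 * \<nu>\<^sup>2)"
      proof (intro add_mono mult_left_mono)
        show "(\<Sum>j<K. ?g (\<phi> j)) \<le> C4 * \<nu>\<^sup>2"
          by (rule sum_bound_reindex[where g = ?g and \<phi> = \<phi>]) (use G inj in \<open>auto intro: inj_on_subset\<close>)
        show "(\<Sum>j<K. ?g (\<psi> j)) \<le> C4 * \<nu>\<^sup>2"
          by (rule sum_bound_reindex[where g = ?g and \<phi> = \<psi>]) (use G inj in \<open>auto intro: inj_on_subset\<close>)
      qed auto
      finally show ?thesis using E by (simp add: algebra_simps)
    qed
    have Apos: "0 < A n" for n by (simp add: A_def kink_pos)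
    have MR: "M \<le> M + \<rho>" using \<rho> by simp
    have devL: "(\<Sum>j<K. (xL \<alpha> j - A (m - int j))\<^sup>2) \<le> W * \<nu>\<^sup>2" for K
    proof -
      have "(\<Sum>j<K. (xL \<alpha> j - A (m - int j))\<^sup>2) \<le> (16 * E\<^sup>2 * C4 * \<nu>\<^sup>2) / (1 - \<theta>1)\<^sup>2"
      proof (rule riccati_half_line_deviation[where x = "xL \<alpha>" and P = PL and Q = QL
            and X = "\<lambda>j. A (m - int j)" and P' = "\<lambda>j. pk (m - int j)"
            and Q' = "\<lambda>j. exp (- rk (m - int j - 1))" and M = "M + \<rho>" and \<alpha> = \<alpha>, OF \<beta>(1) \<theta>1_def])
        fix j
        show "xL \<alpha> j = \<alpha> - PL j - QL j / xL \<alpha> (Suc j)" by (rule xL(1)[OF \<alpha>h])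
        show "1 + \<beta> / 2 \<le> xL \<alpha> (Suc j)" "xL \<alpha> j \<le> M + \<rho>" by (rule xLb[OF \<alpha>h])+
        let ?n = "m - int j"
        have e: "m - int (Suc j) = ?n - 1" by simp
        show "0 \<le> xL \<alpha> j" using xLb(1)[OF \<alpha>h, of j] by simp
        show Q: "exp (- rk (?n - 1)) = A (m - int (Suc j)) / A ?n" using kk_f(5)[of "?n - 1"] unfolding e by simp
        show "A ?n = \<alpha> - pk ?n - exp (- rk (?n - 1)) / A (m - int (Suc j))"
          unfolding Q using kk_f(6)[of ?n] Apos[of "m - int (Suc j)"] by simp
        show "1 \<le> A ?n" by (rule kk_f(8)) simp
        show "A ?n \<le> M + \<rho>" using kk_f(2)[of ?n] MR by linarith
      next
        show "(\<Sum>j<K. (\<bar>PL j - pk (m - int j)\<bar> + \<bar>QL j - exp (- rk (m - int j - 1))\<bar>)\<^sup>2) \<le> 16 * E\<^sup>2 * C4 * \<nu>\<^sup>2" for K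
          unfolding PL_def QL_def by (rule fbound) (auto simp: inj_on_def)
      qed
      thus ?thesis by (simp add: W_def)
    qed
    have devR: "(\<Sum>j<K. (xR \<alpha> j - 1 / A (m + 1 + int j))\<^sup>2) \<le> W * \<nu>\<^sup>2" for K
    proof -
      have "(\<Sum>j<K. (xR \<alpha> j - 1 / A (m + 1 + int j))\<^sup>2) \<le> (16 * E\<^sup>2 * C4 * \<nu>\<^sup>2) / (1 - \<theta>1)\<^sup>2"
      proof (rule riccati_half_line_deviation[where x = "xR \<alpha>" and P = PR and Q = QR
            and X = "\<lambda>j. 1 / A (m + 1 + int j)" and P' = "\<lambda>j. pk (m + 1 + int j)"
            and Q' = "\<lambda>j. exp (- rk (m + 1 + int j))" and M = "M + \<rho>" and \<alpha> = \<alpha>, OF \<beta>(1) \<theta>1_def])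
        fix j
        show "xR \<alpha> j = \<alpha> - PR j - QR j / xR \<alpha> (Suc j)" by (rule xR(1)[OF \<alpha>h])
        show "1 + \<beta> / 2 \<le> xR \<alpha> (Suc j)" "xR \<alpha> j \<le> M + \<rho>" by (rule xRb[OF \<alpha>h])+
        let ?n = "m + 1 + int j"
        have e: "m + 1 + int (Suc j) = ?n + 1" by simp
        show "0 \<le> xR \<alpha> j" using xRb(1)[OF \<alpha>h, of j] by simp
        show Q: "exp (- rk ?n) = 1 / A (m + 1 + int (Suc j)) / (1 / A ?n)" using kk_f(5)[of ?n] unfolding e by simp
        show "1 / A ?n = \<alpha> - pk ?n - exp (- rk ?n) / (1 / A (m + 1 + int (Suc j)))"
          unfolding Q using kk_f(6)[of ?n] Apos[of "m + 1 + int (Suc j)"] by simp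
        show "1 \<le> 1 / A ?n" using kk_f(9)[of ?n] Apos[of ?n] by simp
        have "1 / A ?n \<le> M" using kk_f(3)[of ?n] Apos[of ?n] M by (simp add: field_simps)
        thus "1 / A ?n \<le> M + \<rho>" using MR by linarith
      next
        show "(\<Sum>j<K. (\<bar>PR j - pk (m + 1 + int j)\<bar> + \<bar>QR j - exp (- rk (m + 1 + int j))\<bar>)\<^sup>2) \<le> 16 * E\<^sup>2 * C4 * \<nu>\<^sup>2" for K
          unfolding PR_def QR_def by (rule fbound) (auto simp: inj_on_def)
      qed
      thus ?thesis by (simp add: W_def)
    qed
    define a where "a = (\<lambda>n. if n \<le> m then xL \<alpha> (nat (m - n)) else \<alpha> - p n - xR \<alpha> (nat (n - (m + 1))))"
    define b where "b = (\<lambda>n. if n \<le> m then \<alpha> - p n - xL \<alpha> (nat (m - n)) else xR \<alpha> (nat (n - (m + 1))))"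
    have sumab: "a n + b n = \<alpha> - p n" for n by (simp add: a_def b_def)
    have prodab: "a n * b (n + 1) = exp (- r n)" for n
    proof -
      consider "n < m" | "n = m" | "m < n" by linarith
      thus ?thesis
      proof cases
        case 1
        define j where "j = nat (m - (n + 1))"
        have j: "nat (m - n) = Suc j" "m - int j - 1 = n" "m - int j = n + 1" using 1 by (auto simp: j_def)
        have "b (n + 1) = exp (- r n) / xL \<alpha> (Suc j)"
          using xL(1)[OF \<alpha>h, of j] 1 unfolding b_def PL_def QL_def j by (simp add: j_def)
        moreover have "a n = xL \<alpha> (Suc j)" using 1 j by (simp add: a_def)
        ultimately show ?thesis using xLb(1)[OF \<alpha>h, of "Suc j"] by simp
      next
        case 2
        thus ?thesis using \<alpha>(3) by (simp add: a_def b_def D_def)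
      next
        case 3
        define j where "j = nat (n - (m + 1))"
        have j: "nat (n + 1 - (m + 1)) = Suc j" "m + 1 + int j = n" using 3 by (auto simp: j_def)
        have "a n = exp (- r n) / xR \<alpha> (Suc j)"
          using xR(1)[OF \<alpha>h, of j] 3 unfolding a_def PR_def QR_def j by (simp add: j_def)
        moreover have "b (n + 1) = xR \<alpha> (Suc j)" using 3 j by (simp add: b_def)
        ultimately show ?thesis using xRb(1)[OF \<alpha>h, of "Suc j"] by simp
      qed
    qed
    define g where "g = (\<lambda>n. (a n - A n)\<^sup>2 + (b n - 1 / A n)\<^sup>2)"
    have g0: "0 \<le> g n" for n by (simp add: g_def)
    have ABk: "A n + 1 / A n = \<alpha> - pk n" for n using kk_f(6)[of n] by simp
    have gsum: "(\<Sum>n\<in>F. g n) \<le> C5 * \<nu>\<^sup>2" if F: "finite F" for F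
    proof -
      have Wn: "0 \<le> W * \<nu>\<^sup>2" using W by simp
      have pF: "(\<Sum>n\<in>F. (p n - pk n)\<^sup>2) \<le> C4 * \<nu>\<^sup>2" if "finite F" for F
        by (rule order_trans[OF sum_mono G[OF that]]) simp
      have "(\<Sum>n\<in>F \<inter> {..m}. (a n - A n)\<^sup>2) \<le> W * \<nu>\<^sup>2"
        by (rule sum_bound_lower_half[where m = m]) (use devL F in \<open>auto simp: a_def\<close>)
      hence L: "3 * (\<Sum>n\<in>F \<inter> {..m}. (a n - A n)\<^sup>2) + 2 * (\<Sum>n\<in>F \<inter> {..m}. (p n - pk n)\<^sup>2) \<le> 3 * (W * \<nu>\<^sup>2) + 2 * (C4 * \<nu>\<^sup>2)"
        using pF[of "F \<inter> {..m}"] F by simp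
      have "(\<Sum>n\<in>F \<inter> {m + 1..}. (b n - 1 / A n)\<^sup>2) \<le> W * \<nu>\<^sup>2"
        by (rule sum_bound_upper_half[where m = "m + 1"]) (use devR F in \<open>auto simp: b_def\<close>)
      hence R: "3 * (\<Sum>n\<in>F \<inter> {m + 1..}. (b n - 1 / A n)\<^sup>2) + 2 * (\<Sum>n\<in>F \<inter> {m + 1..}. (p n - pk n)\<^sup>2) \<le> 3 * (W * \<nu>\<^sup>2) + 2 * (C4 * \<nu>\<^sup>2)"
        using pF[of "F \<inter> {m + 1..}"] F by simp
      have ba: "b n - 1 / A n = (pk n - p n) + (A n - a n)" for n
        using sumab[of n] ABk[of n] by linarith
      have ab: "a n - A n = (pk n - p n) + (1 / A n - b n)" for n
        using sumab[of n] ABk[of n] by linarith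
      have gl: "g n \<le> 3 * (a n - A n)\<^sup>2 + 2 * (p n - pk n)\<^sup>2" for n
        using square_add_le[of "pk n - p n" "A n - a n"] unfolding g_def ba by (simp add: power2_commute)
      have gr: "g n \<le> 3 * (b n - 1 / A n)\<^sup>2 + 2 * (p n - pk n)\<^sup>2" for n
        using square_add_le[of "pk n - p n" "1 / A n - b n"] unfolding g_def ab by (simp add: power2_commute)
      have "(\<Sum>n\<in>F. g n) = (\<Sum>n\<in>(F \<inter> {..m}) \<union> (F \<inter> {m + 1..}). g n)" by (rule sum.cong) auto
      also have "\<dots> = (\<Sum>n\<in>F \<inter> {..m}. g n) + (\<Sum>n\<in>F \<inter> {m + 1..}. g n)"
        using F by (intro sum.union_disjoint) auto
      also have "\<dots> \<le> (3 * (\<Sum>n\<in>F \<inter> {..m}. (a n - A n)\<^sup>2) + 2 * (\<Sum>n\<in>F \<inter> {..m}. (p n - pk n)\<^sup>2))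
          + (3 * (\<Sum>n\<in>F \<inter> {m + 1..}. (b n - 1 / A n)\<^sup>2) + 2 * (\<Sum>n\<in>F \<inter> {m + 1..}. (p n - pk n)\<^sup>2))"
        unfolding sum_distrib_left sum.distrib[symmetric] by (intro add_mono sum_mono gl gr)
      also have "\<dots> \<le> (3 * (W * \<nu>\<^sup>2) + 2 * (C4 * \<nu>\<^sup>2)) + (3 * (W * \<nu>\<^sup>2) + 2 * (C4 * \<nu>\<^sup>2))"
        by (rule add_mono[OF L R])
      also have "\<dots> = C5 * \<nu>\<^sup>2" by (simp add: C5_def algebra_simps)
      finally show ?thesis .
    qed
    have dev1: "\<bar>a n - A n\<bar> \<le> sqrt C5 * \<nu>" "\<bar>b n - 1 / A n\<bar> \<le> sqrt C5 * \<nu>" for n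
    proof -
      have "(a n - A n)\<^sup>2 \<le> C5 * \<nu>\<^sup>2" "(b n - 1 / A n)\<^sup>2 \<le> C5 * \<nu>\<^sup>2"
      proof -
        have "(a n - A n)\<^sup>2 \<le> g n" "(b n - 1 / A n)\<^sup>2 \<le> g n" by (simp_all add: g_def)
        thus "(a n - A n)\<^sup>2 \<le> C5 * \<nu>\<^sup>2" "(b n - 1 / A n)\<^sup>2 \<le> C5 * \<nu>\<^sup>2"
          using gsum[of "{n}"] by simp_all
      qed
      moreover have "C5 * \<nu>\<^sup>2 = (sqrt C5 * \<nu>)\<^sup>2" using C5 by (simp add: power_mult_distrib)
      ultimately show "\<bar>a n - A n\<bar> \<le> sqrt C5 * \<nu>" "\<bar>b n - 1 / A n\<bar> \<le> sqrt C5 * \<nu>"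
        using \<nu> C5 by (simp_all add: power2_le_iff_abs_le)
    qed
    have Alow: "1 / E \<le> A n" "1 / E \<le> 1 / A n" for n
    proof -
      show "1 / E \<le> A n" using kk_f(3)[of n] E by linarith
      have "A n \<le> E" using kk_f(2)[of n] E by linarith
      thus "1 / E \<le> 1 / A n" using Apos[of n] by (intro divide_left_mono) (auto simp: E)
    qed
    have da: "\<bar>a n - A n\<bar> \<le> 1 / (2 * E)" "\<bar>b n - 1 / A n\<bar> \<le> 1 / (2 * E)" for n
      using dev1[of n] d6 by linarith+
    have pos: "0 < a n" "0 < b n" for n
    proof -
      have "0 < 1 / (2 * E)" using E by simp
      thus "0 < a n" "0 < b n"
        using abs_ln_quotient_le(2)[OF Alow(1) E(2) da(1), of n] abs_ln_quotient_le(2)[OF Alow(2) E(2) da(2), of n]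
        by linarith+
    qed
    have final: "(\<Sum>n\<in>F. (ln (a (n + 1) * b (n + 1)))\<^sup>2 + (\<alpha> - a n - b (n + 1))\<^sup>2) \<le> (C * \<nu>)\<^sup>2" if F: "finite F" for F
    proof -
      have t1: "(ln (a n * b n))\<^sup>2 \<le> 8 * E\<^sup>2 * g n" for n
      proof -
        have "a n * b n = (a n / A n) * (b n / (1 / A n))" using Apos[of n] by simp
        moreover have "0 < a n / A n" "0 < b n / (1 / A n)" using pos[of n] Apos[of n] by auto
        ultimately have "ln (a n * b n) = ln (a n / A n) + ln (b n / (1 / A n))"
          by (simp only: ln_mult_pos)
        hence "(ln (a n * b n))\<^sup>2 \<le> 2 * (ln (a n / A n))\<^sup>2 + 2 * (ln (b n / (1 / A n)))\<^sup>2"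
          using square_add_le by metis
        also have "\<dots> \<le> 2 * (2 * E * \<bar>a n - A n\<bar>)\<^sup>2 + 2 * (2 * E * \<bar>b n - 1 / A n\<bar>)\<^sup>2"
          using abs_ln_quotient_le(1)[OF Alow(1) E(2) da(1), of n] abs_ln_quotient_le(1)[OF Alow(2) E(2) da(2), of n]
          by (intro add_mono mult_left_mono) (metis abs_ge_zero power2_abs power_mono, simp, metis abs_ge_zero power2_abs power_mono, simp)
        also have "\<dots> = 8 * E\<^sup>2 * g n" by (simp add: g_def power_mult_distrib algebra_simps)
        finally show ?thesis .
      qed
      have t2: "(\<alpha> - a n - b (n + 1))\<^sup>2 \<le> 2 * g n + 2 * g (n + 1)" for n
      proof -
        have "\<alpha> - a n - b (n + 1) = (A n - a n) + (1 / A (n + 1) - b (n + 1))" using kk_f(4)[of n] by simp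
        hence "(\<alpha> - a n - b (n + 1))\<^sup>2 \<le> 2 * (A n - a n)\<^sup>2 + 2 * (1 / A (n + 1) - b (n + 1))\<^sup>2"
          using square_add_le by metis
        also have "\<dots> \<le> 2 * g n + 2 * g (n + 1)" by (simp add: g_def power2_commute)
        finally show ?thesis .
      qed
      have "(\<Sum>n\<in>F. (ln (a (n + 1) * b (n + 1)))\<^sup>2 + (\<alpha> - a n - b (n + 1))\<^sup>2)
          \<le> (\<Sum>n\<in>F. 8 * E\<^sup>2 * g (n + 1) + (2 * g n + 2 * g (n + 1)))"
        by (intro sum_mono add_mono t1 t2)
      also have "\<dots> = (8 * E\<^sup>2 + 2) * (\<Sum>n\<in>F. g (n + 1)) + 2 * (\<Sum>n\<in>F. g n)"
        unfolding sum_distrib_left sum.distrib[symmetric] by (rule sum.cong) (auto simp: algebra_simps)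
      also have "\<dots> \<le> (8 * E\<^sup>2 + 2) * (C5 * \<nu>\<^sup>2) + 2 * (C5 * \<nu>\<^sup>2)"
      proof (intro add_mono mult_left_mono gsum F)
        show "(\<Sum>n\<in>F. g (n + 1)) \<le> C5 * \<nu>\<^sup>2"
          by (rule sum_bound_reindex[where g = g and \<phi> = "\<lambda>n. n + 1"]) (use gsum F in auto)
      qed auto
      also have "\<dots> \<le> C6 * \<nu>\<^sup>2"
      proof -
        have "(8 * E\<^sup>2 + 2) * (C5 * \<nu>\<^sup>2) + 2 * (C5 * \<nu>\<^sup>2) = (4 + 8 * E\<^sup>2) * (C5 * \<nu>\<^sup>2)" by (simp add: algebra_simps)
        also have "\<dots> \<le> (4 + 16 * E\<^sup>2) * (C5 * \<nu>\<^sup>2)" using C5 by (intro mult_right_mono) auto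
        finally show ?thesis by (simp add: C6_def algebra_simps)
      qed
      also have "\<dots> = (sqrt C6 * \<nu>)\<^sup>2" using C6 by (simp add: power_mult_distrib)
      also have "\<dots> \<le> (C * \<nu>)\<^sup>2" using C \<nu> C6 by (intro power_mono mult_right_mono) auto
      finally show ?thesis .
    qed
    have C2\<nu>: "C2 * \<nu> \<le> C * \<nu>" "sqrt C5 * \<nu> \<le> C * \<nu>" using C \<nu> by (auto intro: mult_right_mono)
    show ?thesis
    proof (rule exI[of _ k], rule exI[of _ a], rule exI[of _ b], intro conjI allI impI)
      show "\<bar>k - \<kappa>0\<bar> \<le> C * \<nu>" using kk C2\<nu> by linarith
      show "\<bar>a n - kink k (real_of_int n - x0)\<bar> \<le> C * \<nu>" for n using dev1(1)[of n] C2\<nu> unfolding A_def by linarith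
    qed (use kr pos sumab prodab final in \<open>auto simp: \<alpha>k\<close>)
  qed
  show ?thesis
    by (rule exI[of _ \<delta>], rule conjI[OF \<delta>], rule exI[of _ C], rule conjI[OF C(1)], intro allI impI, rule main) auto
qed

section \<open>Energy estimates for the Toda lattice\<close>

text \<open>
  Solutions without any summability: the following estimates use derivatives at single sites and finite sums.
\<close>

definition toda_flow :: "(real \<Rightarrow> int \<Rightarrow> real) \<Rightarrow> (real \<Rightarrow> int \<Rightarrow> real) \<Rightarrow> bool" where
  "toda_flow r p \<longleftrightarrow> (\<forall>t n.
     ((\<lambda>t. r t n) has_real_derivative p t (n + 1) - p t n) (at t) \<and>
     ((\<lambda>t. p t n) has_real_derivative exp (- r t (n - 1)) - exp (- r t n)) (at t))"

lemma toda_flowD: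
  assumes "toda_flow r p"
  shows "((\<lambda>t. r t n) has_real_derivative p t (n + 1) - p t n) (at t)"
    "((\<lambda>t. p t n) has_real_derivative exp (- r t (n - 1)) - exp (- r t n)) (at t)"
  using assms by (auto simp: toda_flow_def)

lemma DERIV_reflect:
  assumes "(f has_real_derivative D) (at (- t))"
  shows "((\<lambda>t. f (- t)) has_real_derivative - D) (at t)"
proof -
  have "(uminus has_real_derivative - 1) (at t)" by (auto intro!: derivative_eq_intros)
  from DERIV_chain2[OF assms this] show ?thesis by simp
qed

lemma DERIV_square:
  fixes f :: "real \<Rightarrow> real"
  assumes "(f has_real_derivative D) (at t)"
  shows "((\<lambda>t. (f t)\<^sup>2) has_real_derivative 2 * f t * D) (at t)"
  using DERIV_mult[OF assms assms] by (simp add: power2_eq_square algebra_simps)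

text \<open>
  Turns estimates for positive times into estimates for negative times.
\<close>

lemma toda_flow_reverse:
  assumes "toda_flow r p"
  shows "toda_flow (\<lambda>t. r (- t)) (\<lambda>t n. - p (- t) n)"
  unfolding toda_flow_def
proof (intro allI conjI)
  fix t n
  show "((\<lambda>t. r (- t) n) has_real_derivative - p (- t) (n + 1) - - p (- t) n) (at t)"
    using DERIV_reflect[OF toda_flowD(1)[OF assms, of n "- t"]] by simp
  show "((\<lambda>t. - p (- t) n) has_real_derivative exp (- r (- t) (n - 1)) - exp (- r (- t) n)) (at t)"
    using DERIV_minus[OF DERIV_reflect[OF toda_flowD(2)[OF assms, of n "- t"]]] by simp
qed

lemma toda_V_deriv: "(toda_V has_real_derivative 1 - exp (- r)) (at r)"
  unfolding toda_V_def[abs_def] by (auto intro!: derivative_eq_intros)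

lemma nonneg_of_deriv_sign:
  fixes f f' :: "real \<Rightarrow> real"
  assumes "\<And>x. \<bar>x\<bar> \<le> B \<Longrightarrow> (f has_real_derivative f' x) (at x)" "f 0 = 0"
    and "\<And>x. 0 \<le> x \<Longrightarrow> x \<le> B \<Longrightarrow> 0 \<le> f' x" "\<And>x. - B \<le> x \<Longrightarrow> x \<le> 0 \<Longrightarrow> f' x \<le> 0"
    and "\<bar>r\<bar> \<le> B"
  shows "0 \<le> f r"
proof (cases "0 \<le> r")
  case True
  have "f 0 \<le> f r"
  proof (rule DERIV_nonneg_imp_nondecreasing[OF True])
    fix x assume "0 \<le> x" "x \<le> r"
    thus "\<exists>y. (f has_real_derivative y) (at x) \<and> 0 \<le> y"
      using assms(1)[of x] assms(3)[of x] assms(5) by (intro exI[of _ "f' x"]) auto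
  qed
  thus ?thesis using assms(2) by simp
next
  case False
  have "f 0 \<le> f r"
  proof (rule DERIV_nonpos_imp_nonincreasing[of r 0 f])
    show "r \<le> 0" using False by simp
    fix x assume "r \<le> x" "x \<le> 0"
    thus "\<exists>y. (f has_real_derivative y) (at x) \<and> y \<le> 0"
      using assms(1)[of x] assms(4)[of x] assms(5) by (intro exI[of _ "f' x"]) auto
  qed
  thus ?thesis using assms(2) by simp
qed

lemma toda_V_coercive:
  assumes "\<bar>r\<bar> \<le> B"
  shows "(1 - exp (- r))\<^sup>2 \<le> 2 * (exp B * toda_V r)" "r\<^sup>2 \<le> 2 * (exp B * toda_V r)"
proof -
  have "0 \<le> 2 * (exp B * toda_V r) - (1 - exp (- r))\<^sup>2"
  proof (rule nonneg_of_deriv_sign[where f = "\<lambda>r. 2 * (exp B * toda_V r) - (1 - exp (- r))\<^sup>2"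
        and f' = "\<lambda>r. 2 * (1 - exp (- r)) * (exp B - exp (- r))", OF _ _ _ _ assms])
    show "((\<lambda>r. 2 * (exp B * toda_V r) - (1 - exp (- r))\<^sup>2) has_real_derivative
        2 * (1 - exp (- x)) * (exp B - exp (- x))) (at x)" for x
      by (auto intro!: derivative_eq_intros toda_V_deriv simp: algebra_simps)
    show "0 \<le> 2 * (1 - exp (- x)) * (exp B - exp (- x))" if "0 \<le> x" "x \<le> B" for x
      using that by (intro mult_nonneg_nonneg) auto
    show "2 * (1 - exp (- x)) * (exp B - exp (- x)) \<le> 0" if "- B \<le> x" "x \<le> 0" for x
      using that by (intro mult_nonpos_nonneg[of "2 * (1 - exp (- x))"]) auto
  qed (simp add: toda_V_def)
  thus "(1 - exp (- r))\<^sup>2 \<le> 2 * (exp B * toda_V r)" by simp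
  have "0 \<le> 2 * (exp B * toda_V r) - r\<^sup>2"
  proof (rule nonneg_of_deriv_sign[where f = "\<lambda>r. 2 * (exp B * toda_V r) - r\<^sup>2"
        and f' = "\<lambda>r. 2 * (exp B * (1 - exp (- r)) - r)", OF _ _ _ _ assms])
    show "((\<lambda>r. 2 * (exp B * toda_V r) - r\<^sup>2) has_real_derivative 2 * (exp B * (1 - exp (- x)) - x)) (at x)" for x
      by (auto intro!: derivative_eq_intros toda_V_deriv simp: algebra_simps)
    show "0 \<le> 2 * (exp B * (1 - exp (- x)) - x)" if x: "0 \<le> x" "x \<le> B" for x
    proof -
      have "exp x * (1 - exp (- x)) \<le> exp B * (1 - exp (- x))" using x by (intro mult_right_mono) auto
      moreover have "exp x * (1 - exp (- x)) = exp x - 1" by (simp add: exp_minus right_diff_distrib)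
      ultimately have "x \<le> exp B * (1 - exp (- x))" using exp_ge_add_one_self[of x] by linarith
      thus ?thesis by simp
    qed
    show "2 * (exp B * (1 - exp (- x)) - x) \<le> 0" if x: "- B \<le> x" "x \<le> 0" for x
    proof -
      have "exp B * (1 - exp (- x)) \<le> exp B * x"
        using exp_ge_add_one_self[of "- x"] by (intro mult_left_mono) auto
      also have "\<dots> \<le> 1 * x" using x by (intro mult_right_mono_neg) auto
      finally show ?thesis by simp
    qed
  qed (simp add: toda_V_def)
  thus "r\<^sup>2 \<le> 2 * (exp B * toda_V r)" by simp
qed

lemma toda_V_small:
  assumes "toda_V r < 1 / 3"
  shows "\<bar>r\<bar> \<le> 1"
proof (rule ccontr)
  assume "\<not> \<bar>r\<bar> \<le> 1"
  then consider "1 \<le> r" | "r \<le> - 1" by linarith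
  thus False
  proof cases
    case 1
    have "toda_V 1 \<le> toda_V r"
    proof (rule DERIV_nonneg_imp_nondecreasing[OF 1])
      fix x :: real assume "1 \<le> x"
      thus "\<exists>y. (toda_V has_real_derivative y) (at x) \<and> 0 \<le> y"
        using toda_V_deriv[of x] by (intro exI[of _ "1 - exp (- x)"]) auto
    qed
    moreover have "1 / 3 \<le> toda_V 1"
      using exp_le by (simp add: toda_V_def exp_minus inverse_eq_divide divide_left_mono)
    ultimately show False using assms by simp
  next
    case 2
    have "1 + (- r) + (- r)\<^sup>2 / 2 \<le> exp (- r)" using 2 by (intro exp_lower_Taylor_quadratic) simp
    moreover have "1\<^sup>2 \<le> (- r)\<^sup>2" using 2 by (intro power_mono) auto
    ultimately show False using assms by (simp add: toda_V_def)
  qed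
qed

lemma abs_exp_minus_one_le:
  fixes r :: real
  assumes "\<bar>r\<bar> \<le> B"
  shows "\<bar>exp (- r) - 1\<bar> \<le> exp B * \<bar>r\<bar>"
proof (cases "0 \<le> r")
  case True
  have "1 - exp (- r) \<le> r" using exp_ge_add_one_self[of "- r"] by linarith
  also have "\<dots> \<le> exp B * r" using True assms by (simp add: mult_le_cancel_right1)
  finally show ?thesis using True by simp
next
  case False
  have "exp (- r) - 1 = exp (- r) * (1 - exp r)" by (simp add: exp_minus right_diff_distrib)
  also have "\<dots> \<le> exp B * (- r)"
  proof (rule mult_mono)
    show "1 - exp r \<le> - r" using exp_ge_add_one_self[of r] by linarith
  qed (use False assms in auto)
  finally show ?thesis using False by simp
qed

lemma sum_shift_le:
  fixes q :: "int \<Rightarrow> real"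
  assumes "\<And>n. 0 \<le> q n" "\<bar>k\<bar> \<le> 1"
  shows "(\<Sum>n\<in>{- int N..int N}. q (n + k)) \<le> (\<Sum>n\<in>{- int (Suc N)..int (Suc N)}. q n)"
proof -
  have "(\<Sum>n\<in>{- int N..int N}. q (n + k)) = (\<Sum>n\<in>(\<lambda>n. n + k) ` {- int N..int N}. q n)"
    by (subst sum.reindex) (auto simp: inj_on_def)
  also have "\<dots> \<le> (\<Sum>n\<in>{- int (Suc N)..int (Suc N)}. q n)"
    using assms by (intro sum_mono2) auto
  finally show ?thesis .
qed

text \<open>
  The square sum over a window changes at a rate bounded by the square sum over the next larger window,
  and \<open>cascade_bound\<close> applies. The resulting bound depends on \<open>T\<close>; it provides the finite energy that the proof
  of the conservation law starts from.
\<close>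

lemma toda_l2_propagation:
  assumes flow: "toda_flow r p"
    and B: "\<And>t n. 0 \<le> t \<Longrightarrow> t \<le> T \<Longrightarrow> \<bar>r t n\<bar> \<le> B \<and> \<bar>p t n\<bar> \<le> B"
    and A: "\<And>F. finite F \<Longrightarrow> (\<Sum>n\<in>F. (r 0 n)\<^sup>2 + (p 0 n)\<^sup>2) \<le> A"
  shows "\<exists>S. \<forall>t F. 0 \<le> t \<longrightarrow> t \<le> T \<longrightarrow> finite F \<longrightarrow> (\<Sum>n\<in>F. (r t n)\<^sup>2 + (p t n)\<^sup>2) \<le> S"
proof -
  define q where "q = (\<lambda>t n. (r t n)\<^sup>2 + (p t n)\<^sup>2)"
  have q0: "0 \<le> q t n" for t n by (simp add: q_def)
  define q' where "q' = (\<lambda>t n. 2 * r t n * (p t (n + 1) - p t n) + 2 * p t n * (exp (- r t (n - 1)) - exp (- r t n)))"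
  define S where "S = (\<lambda>N t. \<Sum>n\<in>{- int N..int N}. q t n)"
  define S' where "S' = (\<lambda>N t. \<Sum>n\<in>{- int N..int N}. q' t n)"
  have A0: "0 \<le> A" using A[of "{}"] by simp
  define C where "C = 3 * (2 + 2 * exp B)"
  have C: "0 \<le> C" by (simp add: C_def add_nonneg_nonneg)
  have dq: "((\<lambda>t. q t n) has_real_derivative q' t n) (at t)" for t n
    unfolding q_def q'_def
    by (intro DERIV_add DERIV_square toda_flowD[OF flow])
  have bound: "S N t \<le> A * exp (C * t)" if t: "0 \<le> t" "t \<le> T" for N t
  proof (rule cascade_bound[where S = S and S' = S' and T = T and M = "2 * B\<^sup>2" and K = 3, OF _ _ _ _ C A0 t])
    show "(S N has_real_derivative S' N t) (at t)" for N t
      unfolding S_def S'_def by (intro DERIV_sum dq)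
    show "S' N t \<le> C * S (Suc N) t" if t: "0 \<le> t" "t \<le> T" for N t
    proof -
      have "q' t n \<le> (2 + 2 * exp B) * (q t (n + 0) + q t (n + 1) + q t (n + (-1)))" for n
      proof -
        let ?a = "r t (n - 1)" and ?r = "r t n" and ?p = "p t n" and ?b = "p t (n + 1)" and ?e = "exp B"
        have s: "2 * x * y \<le> x\<^sup>2 + y\<^sup>2" for x y :: real by (rule sum_squares_bound)
        have e: "\<bar>exp (- ?a) - 1\<bar> \<le> ?e * \<bar>?a\<bar>" "\<bar>exp (- ?r) - 1\<bar> \<le> ?e * \<bar>?r\<bar>"
          using B[OF t] by (intro abs_exp_minus_one_le; blast)+
        have "2 * ?p * (exp (- ?a) - exp (- ?r)) \<le> 2 * \<bar>?p\<bar> * \<bar>exp (- ?a) - exp (- ?r)\<bar>"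
          using abs_ge_self[of "2 * ?p * (exp (- ?a) - exp (- ?r))"] by (simp only: abs_mult abs_numeral)
        also have "\<dots> \<le> 2 * \<bar>?p\<bar> * (?e * \<bar>?a\<bar> + ?e * \<bar>?r\<bar>)"
          using e by (intro mult_left_mono) linarith+
        also have "\<dots> = ?e * (2 * \<bar>?p\<bar> * \<bar>?a\<bar>) + ?e * (2 * \<bar>?p\<bar> * \<bar>?r\<bar>)" by (simp add: algebra_simps)
        also have "\<dots> \<le> ?e * (?p\<^sup>2 + ?a\<^sup>2) + ?e * (?p\<^sup>2 + ?r\<^sup>2)"
          using s[of "\<bar>?p\<bar>" "\<bar>?a\<bar>"] s[of "\<bar>?p\<bar>" "\<bar>?r\<bar>"] by (intro add_mono mult_left_mono) auto
        finally have 1: "2 * ?p * (exp (- ?a) - exp (- ?r)) \<le> ?e * (2 * ?p\<^sup>2 + ?a\<^sup>2 + ?r\<^sup>2)"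
          by (simp add: algebra_simps)
        have 2: "2 * ?r * (?b - ?p) \<le> 2 * ?r\<^sup>2 + ?b\<^sup>2 + ?p\<^sup>2"
          using s[of ?r ?b] s[of "- ?r" ?p] by (simp add: algebra_simps)
        have 3: "?e * (2 * ?p\<^sup>2 + ?a\<^sup>2 + ?r\<^sup>2) \<le> ?e * (2 * (q t n + q t (n + 1) + q t (n - 1)))"
          by (intro mult_left_mono) (auto simp: q_def)
        have 4: "2 * ?r\<^sup>2 + ?b\<^sup>2 + ?p\<^sup>2 \<le> 2 * (q t n + q t (n + 1) + q t (n - 1))"
          by (simp add: q_def)
        have "q' t n \<le> 2 * (q t n + q t (n + 1) + q t (n - 1)) + ?e * (2 * (q t n + q t (n + 1) + q t (n - 1)))"
          unfolding q'_def using 1 2 3 4 by linarith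
        thus ?thesis by (simp add: algebra_simps)
      qed
      hence "S' N t \<le> (2 + 2 * exp B) * ((\<Sum>n\<in>{- int N..int N}. q t (n + 0)) + (\<Sum>n\<in>{- int N..int N}. q t (n + 1))
          + (\<Sum>n\<in>{- int N..int N}. q t (n + (-1))))"
        unfolding S'_def sum.distrib[symmetric] sum_distrib_left by (rule sum_mono)
      also have "\<dots> \<le> (2 + 2 * exp B) * (S (Suc N) t + S (Suc N) t + S (Suc N) t)"
        unfolding S_def by (intro mult_left_mono add_mono sum_shift_le q0) (auto simp: add_nonneg_nonneg)
      finally show ?thesis by (simp add: C_def algebra_simps)
    qed
    show "S N 0 \<le> A" for N unfolding S_def q_def by (rule A) simp
    show "S N t \<le> 2 * B\<^sup>2 * 3 ^ N" if t: "0 \<le> t" "t \<le> T" for N t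
    proof -
      have "q t n \<le> 2 * B\<^sup>2" for n
      proof -
        have "(r t n)\<^sup>2 \<le> B\<^sup>2" "(p t n)\<^sup>2 \<le> B\<^sup>2"
          using B[OF t, of n] by (auto simp: abs_le_square_iff[symmetric])
        thus ?thesis by (simp add: q_def)
      qed
      hence "S N t \<le> (\<Sum>n\<in>{- int N..int N}. 2 * B\<^sup>2)" unfolding S_def by (intro sum_mono)
      also have "\<dots> = 2 * B\<^sup>2 * (2 * real N + 1)" by simp
      also have "2 * real N + 1 \<le> 3 ^ N"
      proof (induction N)
        case (Suc N)
        have "1 \<le> (3::real) ^ N" by simp
        with Suc show ?case by simp
      qed simp
      hence "2 * B\<^sup>2 * (2 * real N + 1) \<le> 2 * B\<^sup>2 * 3 ^ N" by (intro mult_left_mono) auto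
      finally show ?thesis .
    qed
  qed
  have "(\<Sum>n\<in>F. (r t n)\<^sup>2 + (p t n)\<^sup>2) \<le> A * exp (C * T)" if t: "0 \<le> t" "t \<le> T" and F: "finite F" for t F
  proof -
    obtain N where N: "F \<subseteq> {- int N..int N}"
    proof
      show "F \<subseteq> {- int (nat (Max (insert 0 (abs ` F))))..int (nat (Max (insert 0 (abs ` F))))}"
      proof
        fix n assume "n \<in> F"
        hence "\<bar>n\<bar> \<le> Max (insert 0 (abs ` F))" using F by (intro Max_ge) auto
        thus "n \<in> {- int (nat (Max (insert 0 (abs ` F))))..int (nat (Max (insert 0 (abs ` F))))}" by auto
      qed
    qed
    have "(\<Sum>n\<in>F. (r t n)\<^sup>2 + (p t n)\<^sup>2) \<le> S N t"
      unfolding S_def q_def using N by (intro sum_mono2) auto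
    also have "\<dots> \<le> A * exp (C * t)" by (rule bound[OF t])
    also have "\<dots> \<le> A * exp (C * T)" using t A0 C by (intro mult_left_mono) (auto intro: mult_left_mono)
    finally show ?thesis .
  qed
  thus ?thesis by blast
qed

text \<open>
  The density of \<^const>\<open>toda_H\<close>.
\<close>

definition toda_e :: "(real \<Rightarrow> int \<Rightarrow> real) \<Rightarrow> (real \<Rightarrow> int \<Rightarrow> real) \<Rightarrow> real \<Rightarrow> int \<Rightarrow> real" where
  "toda_e r p t n = (p t n)\<^sup>2 / 2 + toda_V (r t n)"

lemma toda_e_nonneg: "0 \<le> toda_e r p t n"
  by (simp add: toda_e_def toda_V_bounds(1))

lemma sum_shift_finite_support:
  fixes \<omega> G :: "int \<Rightarrow> real"
  assumes "\<And>n. n \<notin> {-L..L} \<Longrightarrow> \<omega> n = 0"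
  shows "(\<Sum>n\<in>{-L-1..L+1}. \<omega> n * G (n + 1)) = (\<Sum>n\<in>{-L-1..L+1}. \<omega> (n - 1) * G n)"
proof -
  have "(\<Sum>n\<in>{-L-1..L+1}. \<omega> n * G (n + 1)) = (\<Sum>n\<in>{-L..L}. \<omega> n * G (n + 1))"
    using assms by (intro sum.mono_neutral_right) auto
  also have "\<dots> = (\<Sum>n\<in>{-L+1..L+1}. \<omega> (n - 1) * G n)"
    by (rule sum.reindex_bij_witness[of _ "\<lambda>n. n - 1" "\<lambda>n. n + 1"]) auto
  also have "\<dots> = (\<Sum>n\<in>{-L-1..L+1}. \<omega> (n - 1) * G n)"
    using assms by (intro sum.mono_neutral_left) auto
  finally show ?thesis .
qed

text \<open>
  The local conservation law is \<open>e' n = Fl (n + 1) - Fl n\<close> with the flux \<open>Fl n = p n * (1 - exp (- r (n - 1)))\<close>,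
  and the flux is bounded by the kinetic energy at \<open>n\<close> plus \<open>\<gamma>\<close> times the potential energy at \<open>n - 1\<close>. Summation by
  parts moves the difference onto the weight. If the weight travels to the right so fast that its rate of loss at
  every site is at least its increments in space, then the weighted energy does not grow. With the weight \<open>1\<close> this is
  the energy bound, with a travelling front it is the virial estimate.
\<close>

lemma weighted_energy_bound:
  assumes flow: "toda_flow r p" and T: "0 \<le> T"
    and E1: "\<And>t F. 0 \<le> t \<Longrightarrow> t \<le> T \<Longrightarrow> finite F \<Longrightarrow> (\<Sum>n\<in>F. toda_e r p t n) \<le> E1"
    and \<gamma>: "0 \<le> \<gamma>" "\<And>t n. 0 \<le> t \<Longrightarrow> t \<le> T \<Longrightarrow> (1 - exp (- r t n))\<^sup>2 \<le> 2 * (\<gamma> * toda_V (r t n))"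
    and W: "\<And>t n. ((\<lambda>t. W t n) has_real_derivative W' t n) (at t)"
    and W01: "\<And>t n. 0 \<le> W t n \<and> W t n \<le> 1" and Wmono: "\<And>t n. W t (n - 1) \<le> W t n"
    and speed: "\<And>t n. W t n - W t (n - 1) \<le> - W' t n" "\<And>t n. \<gamma> * (W t (n + 1) - W t n) \<le> - W' t n"
    and init: "\<And>F. finite F \<Longrightarrow> (\<Sum>n\<in>F. W 0 n * toda_e r p 0 n) \<le> B0"
    and F: "finite F"
  shows "(\<Sum>n\<in>F. W T n * toda_e r p T n) \<le> B0"
proof -
  define e where "e = toda_e r p"
  have e0: "0 \<le> e t n" for t n by (simp add: e_def toda_e_nonneg)
  define Fl where "Fl = (\<lambda>t n. p t n * (1 - exp (- r t (n - 1))))"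
  have de: "((\<lambda>t. e t n) has_real_derivative Fl t (n + 1) - Fl t n) (at t)" for t n
  proof -
    have "((\<lambda>t. toda_V (r t n)) has_real_derivative (1 - exp (- r t n)) * (p t (n + 1) - p t n)) (at t)"
      by (rule DERIV_chain2[OF toda_V_deriv toda_flowD(1)[OF flow]])
    moreover have "((\<lambda>t. (p t n)\<^sup>2 / 2) has_real_derivative p t n * (exp (- r t (n - 1)) - exp (- r t n))) (at t)"
      using DERIV_cdivide[OF DERIV_square[OF toda_flowD(2)[OF flow, of n t]], of 2] by simp
    ultimately have "((\<lambda>t. (p t n)\<^sup>2 / 2 + toda_V (r t n)) has_real_derivative
        p t n * (exp (- r t (n - 1)) - exp (- r t n)) + (1 - exp (- r t n)) * (p t (n + 1) - p t n)) (at t)"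
      by (rule DERIV_add[rotated])
    thus ?thesis unfolding e_def toda_e_def Fl_def by (rule DERIV_cong) (simp add: algebra_simps)
  qed
  define P V where "P = (\<lambda>t n. (p t n)\<^sup>2 / 2)" and "V = (\<lambda>t n. toda_V (r t n))"
  have eP: "e t n = P t n + V t n" for t n by (simp add: e_def toda_e_def P_def V_def)
  have PV0: "0 \<le> P t n" "0 \<le> V t n" for t n by (simp_all add: P_def V_def toda_V_bounds(1))
  define K where "K = (1 + 2 * \<gamma>) * E1"
  have step: "(1 - real L / real M) * (\<Sum>n\<in>F. W T n * e T n) \<le> B0 + K * T / real M"
    if M: "0 < M" and L: "\<And>n. n \<in> F \<Longrightarrow> \<bar>n\<bar> \<le> int L" for L M :: nat
  proof -
    (* A cut-off that makes the sums finite. It has slope 1 / M, so it adds an error of order 1 / M,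
       which disappears in the limit. *)
    define ct where "ct = (\<lambda>n::int. max 0 (1 - real_of_int \<bar>n\<bar> / real M))"
    have ct: "0 \<le> ct n" "ct n \<le> 1" for n using M by (auto simp: ct_def)
    have ctz: "ct n = 0" if "int M \<le> \<bar>n\<bar>" for n
    proof -
      have "real M \<le> real_of_int \<bar>n\<bar>" using that by linarith
      thus ?thesis using M by (simp add: ct_def field_simps)
    qed
    have ctlip: "\<bar>ct n - ct (n - 1)\<bar> \<le> 1 / real M" for n
    proof -
      have "\<bar>real_of_int \<bar>n\<bar> / real M - real_of_int \<bar>n - 1\<bar> / real M\<bar> \<le> 1 / real M"
        unfolding diff_divide_distrib[symmetric] using M by (simp add: abs_divide divide_right_mono)
      thus ?thesis unfolding ct_def by linarith
    qed
    define I where "I = {- (int M + 1) - 1..(int M + 1) + 1}"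
    have fI: "finite I" by (simp add: I_def)
    define J where "J = (\<lambda>t. \<Sum>n\<in>I. ct n * W t n * e t n)"
    define J' where "J' = (\<lambda>t. \<Sum>n\<in>I. ct n * W' t n * e t n + ct n * W t n * (Fl t (n + 1) - Fl t n))"
    have dJ: "(J has_real_derivative J' t) (at t)" for t
      unfolding J_def J'_def
    proof (intro DERIV_sum)
      fix n
      show "((\<lambda>t. ct n * W t n * e t n) has_real_derivative
          ct n * W' t n * e t n + ct n * W t n * (Fl t (n + 1) - Fl t n)) (at t)"
        using DERIV_mult[OF DERIV_cmult[OF W[of n t], of "ct n"] de[of n t]] by (simp add: algebra_simps)
    qed
    have J'K: "J' t \<le> K / real M" if t: "0 \<le> t" "t \<le> T" for t
    proof -
      have Flb: "\<bar>Fl t n\<bar> \<le> P t n + \<gamma> * V t (n - 1)" for n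
      proof -
        let ?y = "1 - exp (- r t (n - 1))"
        have "2 * (\<bar>p t n\<bar> * \<bar>?y\<bar>) \<le> (p t n)\<^sup>2 + ?y\<^sup>2"
          using sum_squares_bound[of "\<bar>p t n\<bar>" "\<bar>?y\<bar>"] by simp
        also have "?y\<^sup>2 \<le> 2 * (\<gamma> * V t (n - 1))" unfolding V_def using \<gamma>(2)[OF t] .
        finally show ?thesis by (simp add: Fl_def P_def abs_mult)
      qed
      have parts: "(\<Sum>n\<in>I. ct n * W t n * (Fl t (n + 1) - Fl t n))
          = (\<Sum>n\<in>I. - (ct n * W t n - ct (n - 1) * W t (n - 1)) * Fl t n)"
      proof -
        have "(\<Sum>n\<in>I. ct n * W t n * Fl t (n + 1)) = (\<Sum>n\<in>I. ct (n - 1) * W t (n - 1) * Fl t n)"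
          unfolding I_def
          by (rule sum_shift_finite_support[where \<omega> = "\<lambda>n. ct n * W t n"]) (auto simp: ctz)
        thus ?thesis by (simp add: right_diff_distrib left_diff_distrib sum_subtractf minus_diff_eq)
      qed
      have ptw: "- (ct n * W t n - ct (n - 1) * W t (n - 1)) * Fl t n
          \<le> ct n * (W t n - W t (n - 1)) * P t n + ct n * (W t n - W t (n - 1)) * (\<gamma> * V t (n - 1))
            + (P t n + \<gamma> * V t (n - 1)) / real M" for n
      proof -
        let ?d = "ct n * (W t n - W t (n - 1)) + 1 / real M"
        have "ct n * W t n - ct (n - 1) * W t (n - 1) = ct n * (W t n - W t (n - 1)) + (ct n - ct (n - 1)) * W t (n - 1)"
          by (simp add: algebra_simps)
        moreover have "\<bar>(ct n - ct (n - 1)) * W t (n - 1)\<bar> \<le> 1 / real M * 1"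
          unfolding abs_mult using ctlip[of n] W01[of t "n - 1"] by (intro mult_mono) auto
        moreover have "0 \<le> ct n * (W t n - W t (n - 1))" using ct Wmono[of t n] by simp
        ultimately have d: "\<bar>ct n * W t n - ct (n - 1) * W t (n - 1)\<bar> \<le> ?d" by linarith
        have "- (ct n * W t n - ct (n - 1) * W t (n - 1)) * Fl t n
            \<le> \<bar>ct n * W t n - ct (n - 1) * W t (n - 1)\<bar> * \<bar>Fl t n\<bar>"
          using abs_ge_self[of "- (ct n * W t n - ct (n - 1) * W t (n - 1)) * Fl t n"]
          by (simp only: abs_mult abs_minus_cancel)
        also have "\<dots> \<le> ?d * (P t n + \<gamma> * V t (n - 1))"
          using d Flb[of n] by (intro mult_mono) auto
        finally show ?thesis by (simp add: algebra_simps add_divide_distrib)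
      qed
      have shift: "(\<Sum>n\<in>I. ct n * (W t n - W t (n - 1)) * (\<gamma> * V t (n - 1)))
          = (\<Sum>n\<in>I. ct (n + 1) * (W t (n + 1) - W t n) * (\<gamma> * V t n))"
      proof -
        have "(\<Sum>n\<in>I. (ct (n + 1) * (W t (n + 1) - W t n) * (\<gamma> * V t n)) * 1)
          = (\<Sum>n\<in>I. (ct (n - 1 + 1) * (W t (n - 1 + 1) - W t (n - 1)) * (\<gamma> * V t (n - 1))) * 1)"
          unfolding I_def
          by (rule sum_shift_finite_support[where \<omega> = "\<lambda>n. ct (n + 1) * (W t (n + 1) - W t n) * (\<gamma> * V t n)" and G = "\<lambda>_. 1"])
             (auto simp: ctz)
        thus ?thesis by simp
      qed
      have ptw2: "ct (n + 1) * (W t (n + 1) - W t n) * (\<gamma> * V t n)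
          \<le> ct n * (\<gamma> * (W t (n + 1) - W t n)) * V t n + (\<gamma> * V t n) / real M" for n
      proof -
        have m: "0 \<le> W t (n + 1) - W t n" "W t (n + 1) - W t n \<le> 1"
          using Wmono[of t "n + 1"] W01[of t n] W01[of t "n + 1"] by auto
        have "ct (n + 1) \<le> ct n + 1 / real M" using ctlip[of "n + 1"] by simp
        hence "ct (n + 1) * (W t (n + 1) - W t n) \<le> (ct n + 1 / real M) * (W t (n + 1) - W t n)"
          using m by (intro mult_right_mono) auto
        also have "\<dots> = ct n * (W t (n + 1) - W t n) + 1 / real M * (W t (n + 1) - W t n)"
          by (simp add: algebra_simps)
        also have "\<dots> \<le> ct n * (W t (n + 1) - W t n) + 1 / real M * 1"
          using m M by (intro add_left_mono mult_left_mono) auto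
        finally have "ct (n + 1) * (W t (n + 1) - W t n) * (\<gamma> * V t n)
            \<le> (ct n * (W t (n + 1) - W t n) + 1 / real M * 1) * (\<gamma> * V t n)"
          using \<gamma> PV0 by (intro mult_right_mono) auto
        thus ?thesis by (simp add: algebra_simps)
      qed
      have "J' t = (\<Sum>n\<in>I. ct n * W' t n * e t n) + (\<Sum>n\<in>I. - (ct n * W t n - ct (n - 1) * W t (n - 1)) * Fl t n)"
        unfolding J'_def sum.distrib parts ..
      also have "\<dots> \<le> (\<Sum>n\<in>I. ct n * W' t n * e t n) + (\<Sum>n\<in>I. ct n * (W t n - W t (n - 1)) * P t n
          + ct n * (W t n - W t (n - 1)) * (\<gamma> * V t (n - 1)) + (P t n + \<gamma> * V t (n - 1)) / real M)"
        by (intro add_left_mono sum_mono ptw)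
      also have "\<dots> = (\<Sum>n\<in>I. ct n * W' t n * e t n) + ((\<Sum>n\<in>I. ct n * (W t n - W t (n - 1)) * P t n)
          + (\<Sum>n\<in>I. ct (n + 1) * (W t (n + 1) - W t n) * (\<gamma> * V t n)) + (\<Sum>n\<in>I. (P t n + \<gamma> * V t (n - 1)) / real M))"
        unfolding sum.distrib shift ..
      also have "\<dots> \<le> (\<Sum>n\<in>I. ct n * W' t n * e t n) + ((\<Sum>n\<in>I. ct n * (W t n - W t (n - 1)) * P t n)
          + (\<Sum>n\<in>I. ct n * (\<gamma> * (W t (n + 1) - W t n)) * V t n + (\<gamma> * V t n) / real M)
          + (\<Sum>n\<in>I. (P t n + \<gamma> * V t (n - 1)) / real M))"
        by (intro add_left_mono add_right_mono sum_mono ptw2)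
      also have "\<dots> = (\<Sum>n\<in>I. ct n * ((W' t n + (W t n - W t (n - 1))) * P t n + (W' t n + \<gamma> * (W t (n + 1) - W t n)) * V t n)
          + (\<gamma> * V t n + (P t n + \<gamma> * V t (n - 1))) / real M)"
        unfolding sum.distrib[symmetric] eP by (rule sum.cong) (auto simp: algebra_simps add_divide_distrib)
      also have "\<dots> \<le> (\<Sum>n\<in>I. 0 + (\<gamma> * V t n + (P t n + \<gamma> * V t (n - 1))) / real M)"
      proof (intro sum_mono add_right_mono)
        fix n
        have "(W' t n + (W t n - W t (n - 1))) * P t n \<le> 0"
          using speed(1)[of t n] PV0 by (intro mult_nonpos_nonneg) auto
        moreover have "(W' t n + \<gamma> * (W t (n + 1) - W t n)) * V t n \<le> 0"
          using speed(2)[of t n] PV0 by (intro mult_nonpos_nonneg) auto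
        ultimately show "ct n * ((W' t n + (W t n - W t (n - 1))) * P t n + (W' t n + \<gamma> * (W t (n + 1) - W t n)) * V t n) \<le> 0"
          using ct(1)[of n] by (intro mult_nonneg_nonpos) auto
      qed
      also have "\<dots> = (\<gamma> * (\<Sum>n\<in>I. V t n) + ((\<Sum>n\<in>I. P t n) + \<gamma> * (\<Sum>n\<in>I. V t (n - 1)))) / real M"
        by (simp add: sum_divide_distrib[symmetric] sum.distrib sum_distrib_left)
      also have "\<dots> \<le> (\<gamma> * E1 + (E1 + \<gamma> * E1)) / real M"
      proof (intro divide_right_mono add_mono mult_left_mono \<gamma>)
        have Vb: "(\<Sum>n\<in>G. V t n) \<le> E1" "(\<Sum>n\<in>G. P t n) \<le> E1" if "finite G" for G
          using E1[OF t that] PV0 unfolding e_def[symmetric] eP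
          by (meson order_trans sum_mono le_add_same_cancel1 le_add_same_cancel2)+
        show "(\<Sum>n\<in>I. V t n) \<le> E1" "(\<Sum>n\<in>I. P t n) \<le> E1" using Vb fI by auto
        have "(\<Sum>n\<in>I. V t (n - 1)) = (\<Sum>n\<in>(\<lambda>n. n - 1) ` I. V t n)"
          by (subst sum.reindex) (auto simp: inj_on_def)
        thus "(\<Sum>n\<in>I. V t (n - 1)) \<le> E1" using Vb fI by simp
      qed simp
      finally show ?thesis by (simp add: K_def algebra_simps)
    qed
    have "J T \<le> B0 + K / real M * T"
    proof (rule deriv_compare[where f = J and f' = J' and g' = "\<lambda>_. K / real M" and a = 0, OF T])
      show "((\<lambda>t. B0 + K / real M * t) has_real_derivative K / real M) (at s)" for s
        using M by (auto intro!: derivative_eq_intros)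
      have "J 0 \<le> (\<Sum>n\<in>I. W 0 n * e 0 n)"
        unfolding J_def
      proof (intro sum_mono)
        fix n
        have "ct n * (W 0 n * e 0 n) \<le> 1 * (W 0 n * e 0 n)"
          using ct(2)[of n] W01[of 0 n] e0 by (intro mult_right_mono) auto
        thus "ct n * W 0 n * e 0 n \<le> W 0 n * e 0 n" by (simp add: mult.assoc)
      qed
      also have "\<dots> \<le> B0" unfolding e_def by (rule init[OF fI])
      finally show "J 0 \<le> B0 + K / real M * 0" by simp
    qed (use dJ J'K in auto)
    moreover have "(1 - real L / real M) * (\<Sum>n\<in>F. W T n * e T n) \<le> J T"
    proof -
      have WT: "0 \<le> W T n * e T n" for n using W01[of T n] e0 by simp
      have "(1 - real L / real M) * (\<Sum>n\<in>F. W T n * e T n) = (\<Sum>n\<in>F. (1 - real L / real M) * (W T n * e T n))"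
        by (rule sum_distrib_left)
      also have "\<dots> \<le> (\<Sum>n\<in>F. ct n * (W T n * e T n))"
      proof (intro sum_mono mult_right_mono WT)
        fix n assume "n \<in> F"
        hence "real_of_int \<bar>n\<bar> \<le> real L" using L by fastforce
        hence "real_of_int \<bar>n\<bar> / real M \<le> real L / real M" by (simp add: divide_right_mono)
        thus "1 - real L / real M \<le> ct n" by (simp add: ct_def)
      qed
      also have "\<dots> = (\<Sum>n\<in>F \<inter> I. ct n * (W T n * e T n))"
      proof (intro sum.mono_neutral_right)
        show "\<forall>n\<in>F - F \<inter> I. ct n * (W T n * e T n) = 0"
        proof
          fix n assume "n \<in> F - F \<inter> I"
          hence "int M \<le> \<bar>n\<bar>" by (auto simp: I_def)
          thus "ct n * (W T n * e T n) = 0" by (simp add: ctz)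
        qed
      qed (use F in auto)
      also have "\<dots> \<le> (\<Sum>n\<in>I. ct n * (W T n * e T n))"
        using fI ct WT by (intro sum_mono2) auto
      finally show ?thesis by (simp add: J_def mult.assoc)
    qed
    ultimately show ?thesis by simp
  qed
  define L where "L = nat (Max (insert 0 (abs ` F)))"
  have L: "\<bar>n\<bar> \<le> int L" if "n \<in> F" for n
  proof -
    have "\<bar>n\<bar> \<le> Max (insert 0 (abs ` F))" using F that by (intro Max_ge) auto
    moreover from this have "0 \<le> Max (insert 0 (abs ` F))" by (rule order_trans[OF abs_ge_zero])
    ultimately show ?thesis unfolding L_def by (simp only: nat_0_le)
  qed
  let ?s = "\<Sum>n\<in>F. W T n * e T n"
  have "?s \<le> B0"
  proof (rule LIMSEQ_le)
    show "(\<lambda>M. (1 - real L / real (Suc M)) * ?s) \<longlonglongrightarrow> ?s"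
    proof -
      have "(\<lambda>M. real L / real (Suc M)) \<longlonglongrightarrow> 0"
        using tendsto_mult_right_zero[OF LIMSEQ_inverse_real_of_nat, of "real L"] by (simp add: divide_inverse)
      hence "(\<lambda>M. (1 - real L / real (Suc M)) * ?s) \<longlonglongrightarrow> (1 - 0) * ?s" by (intro tendsto_intros)
      thus ?thesis by simp
    qed
    show "(\<lambda>M. B0 + K * T / real (Suc M)) \<longlonglongrightarrow> B0"
    proof -
      have "(\<lambda>M. K * T / real (Suc M)) \<longlonglongrightarrow> 0"
        using tendsto_mult_right_zero[OF LIMSEQ_inverse_real_of_nat, of "K * T"] by (simp add: divide_inverse)
      hence "(\<lambda>M. B0 + K * T / real (Suc M)) \<longlonglongrightarrow> B0 + 0" by (intro tendsto_intros)
      thus ?thesis by simp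
    qed
    show "\<exists>N. \<forall>M\<ge>N. (1 - real L / real (Suc M)) * ?s \<le> B0 + K * T / real (Suc M)"
      by (intro exI[of _ 0] allI impI step[OF _ L]) auto
  qed
  thus ?thesis by (simp add: e_def)
qed

text \<open>
  Weight \<open>1\<close> in \<open>weighted_energy_bound\<close>.
\<close>

lemma toda_energy_bound_forward:
  assumes flow: "toda_flow r p" and T: "0 \<le> T"
    and B: "\<And>t n. 0 \<le> t \<Longrightarrow> t \<le> T \<Longrightarrow> \<bar>r t n\<bar> \<le> B \<and> \<bar>p t n\<bar> \<le> B"
    and E0: "\<And>F. finite F \<Longrightarrow> (\<Sum>n\<in>F. toda_e r p 0 n) \<le> E0"
    and F: "finite F"
  shows "(\<Sum>n\<in>F. toda_e r p T n) \<le> E0"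
proof -
  have B0: "0 \<le> B" using B[of 0 0] T by linarith
  have coer: "(r t n)\<^sup>2 + (p t n)\<^sup>2 \<le> 2 * exp B * toda_e r p t n" if "0 \<le> t" "t \<le> T" for t n
  proof -
    have "(r t n)\<^sup>2 \<le> 2 * (exp B * toda_V (r t n))" using B[OF that] by (intro toda_V_coercive(2)) blast
    moreover have "2 * 1 * ((p t n)\<^sup>2 / 2) \<le> 2 * exp B * ((p t n)\<^sup>2 / 2)"
      using B0 by (intro mult_right_mono) auto
    ultimately show ?thesis by (simp add: toda_e_def algebra_simps)
  qed
  have "\<exists>S. \<forall>t F. 0 \<le> t \<longrightarrow> t \<le> T \<longrightarrow> finite F \<longrightarrow> (\<Sum>n\<in>F. (r t n)\<^sup>2 + (p t n)\<^sup>2) \<le> S"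
  proof (rule toda_l2_propagation[OF flow B])
    fix F :: "int set" assume F: "finite F"
    have "(\<Sum>n\<in>F. (r 0 n)\<^sup>2 + (p 0 n)\<^sup>2) \<le> (\<Sum>n\<in>F. 2 * exp B * toda_e r p 0 n)"
      using T by (intro sum_mono coer) auto
    also have "\<dots> \<le> 2 * exp B * E0" unfolding sum_distrib_left[symmetric] using E0[OF F] by simp
    finally show "(\<Sum>n\<in>F. (r 0 n)\<^sup>2 + (p 0 n)\<^sup>2) \<le> 2 * exp B * E0" .
  qed auto
  then obtain S where S: "\<And>t F. 0 \<le> t \<Longrightarrow> t \<le> T \<Longrightarrow> finite F \<Longrightarrow> (\<Sum>n\<in>F. (r t n)\<^sup>2 + (p t n)\<^sup>2) \<le> S" by blast
  have E1: "(\<Sum>n\<in>F. toda_e r p t n) \<le> exp B * S" if t: "0 \<le> t" "t \<le> T" and F: "finite F" for t F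
  proof -
    have "toda_e r p t n \<le> exp B * ((r t n)\<^sup>2 + (p t n)\<^sup>2)" for n
    proof -
      have "toda_V (r t n) \<le> exp \<bar>r t n\<bar> * (r t n)\<^sup>2" by (rule toda_V_bounds(2))
      also have "\<dots> \<le> exp B * (r t n)\<^sup>2" using B[OF t] by (intro mult_right_mono) auto
      finally have 1: "toda_V (r t n) \<le> exp B * (r t n)\<^sup>2" .
      have "1 * (p t n)\<^sup>2 \<le> exp B * (p t n)\<^sup>2" using B0 by (intro mult_right_mono) auto
      moreover have "0 \<le> (p t n)\<^sup>2" by simp
      ultimately have "(p t n)\<^sup>2 / 2 \<le> exp B * (p t n)\<^sup>2" by linarith
      thus ?thesis using 1 by (simp add: toda_e_def algebra_simps)
    qed
    hence "(\<Sum>n\<in>F. toda_e r p t n) \<le> (\<Sum>n\<in>F. exp B * ((r t n)\<^sup>2 + (p t n)\<^sup>2))" by (intro sum_mono)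
    also have "\<dots> \<le> exp B * S" unfolding sum_distrib_left[symmetric] using S[OF t F] by simp
    finally show ?thesis .
  qed
  have "(\<Sum>n\<in>F. 1 * toda_e r p T n) \<le> E0"
  proof (rule weighted_energy_bound[where W = "\<lambda>_ _. 1" and W' = "\<lambda>_ _. 0" and \<gamma> = "exp B", OF flow T E1])
    show "(1 - exp (- r t n))\<^sup>2 \<le> 2 * (exp B * toda_V (r t n))" if "0 \<le> t" "t \<le> T" for t n
      using B[OF that] by (intro toda_V_coercive(1)) blast
  qed (use E0 F in auto)
  thus ?thesis by simp
qed

lemma toda_energy_bound:
  assumes flow: "toda_flow r p"
    and B: "\<And>T. \<exists>B. \<forall>t n. \<bar>t\<bar> \<le> T \<longrightarrow> \<bar>r t n\<bar> \<le> B \<and> \<bar>p t n\<bar> \<le> B"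
    and E0: "\<And>F. finite F \<Longrightarrow> (\<Sum>n\<in>F. toda_e r p 0 n) \<le> E0"
    and F: "finite F"
  shows "(\<Sum>n\<in>F. toda_e r p t n) \<le> E0"
proof -
  obtain B where B: "\<And>s n. \<bar>s\<bar> \<le> \<bar>t\<bar> \<Longrightarrow> \<bar>r s n\<bar> \<le> B \<and> \<bar>p s n\<bar> \<le> B" using B[of "\<bar>t\<bar>"] by blast
  show ?thesis
  proof (cases "0 \<le> t")
    case True
    show ?thesis by (rule toda_energy_bound_forward[OF flow True _ E0 F, of B]) (use B True in auto)
  next
    case False
    have "(\<Sum>n\<in>F. toda_e (\<lambda>t. r (- t)) (\<lambda>t n. - p (- t) n) (- t) n) \<le> E0"
    proof (rule toda_energy_bound_forward[OF toda_flow_reverse[OF flow] _ _ _ F, of "- t" B])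
      show "(\<Sum>n\<in>F. toda_e (\<lambda>t. r (- t)) (\<lambda>t n. - p (- t) n) 0 n) \<le> E0" if "finite F" for F
        using E0[OF that] by (simp add: toda_e_def)
    qed (use B False in auto)
    thus ?thesis by (simp add: toda_e_def)
  qed
qed

text \<open>
  Stability of the state \<open>0\<close>. As long as \<open>\<bar>r\<bar> \<le> 1\<close>, the energy is comparable with the square sum; and a small energy
  forces \<open>\<bar>r\<bar> \<le> 1\<close> (\<open>toda_V_small\<close>), so that the comparison holds at all times.
\<close>

lemma toda_small_data:
  assumes flow: "toda_flow r p"
    and B: "\<And>T. \<exists>B. \<forall>t n. \<bar>t\<bar> \<le> T \<longrightarrow> \<bar>r t n\<bar> \<le> B \<and> \<bar>p t n\<bar> \<le> B"
    and init: "\<forall>F. finite F \<longrightarrow> (\<Sum>n\<in>F. (r 0 n)\<^sup>2 + (p 0 n)\<^sup>2) \<le> \<eta>\<^sup>2"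
    and \<eta>: "0 \<le> \<eta>" "\<eta> \<le> 1 / 10"
  shows "finite F \<Longrightarrow> (\<Sum>n\<in>F. toda_e r p t n) \<le> 3 * \<eta>\<^sup>2"
    and "finite F \<Longrightarrow> (\<Sum>n\<in>F. (r t n)\<^sup>2 + (p t n)\<^sup>2) \<le> (5 * \<eta>)\<^sup>2"
    and "\<bar>r t n\<bar> \<le> 5 * \<eta>" "\<bar>p t n\<bar> \<le> 5 * \<eta>"
    and "(r t n)\<^sup>2 + (p t n)\<^sup>2 \<le> 6 * toda_e r p t n"
proof -
  have e3: "exp 1 \<le> (3::real)" by (rule exp_le)
  have init1: "\<bar>r 0 n\<bar> \<le> 1" for n
  proof -
    have "(r 0 n)\<^sup>2 \<le> (r 0 n)\<^sup>2 + (p 0 n)\<^sup>2" by simp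
    also have "\<dots> \<le> \<eta>\<^sup>2" using init[rule_format, of "{n}"] by simp
    finally have "\<bar>r 0 n\<bar> \<le> \<eta>" using \<eta> by (simp add: power2_le_iff_abs_le)
    thus ?thesis using \<eta> by simp
  qed
  have E0: "(\<Sum>n\<in>F. toda_e r p 0 n) \<le> 3 * \<eta>\<^sup>2" if F: "finite F" for F
  proof -
    have "toda_e r p 0 n \<le> 3 * ((r 0 n)\<^sup>2 + (p 0 n)\<^sup>2)" for n
    proof -
      have "exp \<bar>r 0 n\<bar> \<le> 3" by (rule order_trans[OF _ e3]) (use init1[of n] in simp)
      hence "exp \<bar>r 0 n\<bar> * (r 0 n)\<^sup>2 \<le> 3 * (r 0 n)\<^sup>2" using e3 by (intro mult_right_mono) auto
      hence "toda_V (r 0 n) \<le> 3 * (r 0 n)\<^sup>2" using toda_V_bounds(2)[of "r 0 n"] by linarith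
      moreover have "(p 0 n)\<^sup>2 / 2 \<le> 3 * (p 0 n)\<^sup>2" by simp
      ultimately show ?thesis unfolding toda_e_def distrib_left by linarith
    qed
    hence "(\<Sum>n\<in>F. toda_e r p 0 n) \<le> (\<Sum>n\<in>F. 3 * ((r 0 n)\<^sup>2 + (p 0 n)\<^sup>2))" by (intro sum_mono)
    also have "\<dots> \<le> 3 * \<eta>\<^sup>2" unfolding sum_distrib_left[symmetric] using init F by simp
    finally show ?thesis .
  qed
  have E: "(\<Sum>n\<in>F. toda_e r p t n) \<le> 3 * \<eta>\<^sup>2" if "finite F" for t F
    by (rule toda_energy_bound[OF flow B E0 that])
  have r1: "\<bar>r t n\<bar> \<le> 1" for t n
  proof (rule toda_V_small)
    have "toda_V (r t n) \<le> toda_e r p t n" by (simp add: toda_e_def)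
    also have "\<dots> \<le> 3 * \<eta>\<^sup>2" using E[of "{n}"] by simp
    also have "\<dots> \<le> 3 * (1 / 10)\<^sup>2" using \<eta> by (intro mult_left_mono power_mono) auto
    also have "\<dots> < 1 / 3" by (simp add: power2_eq_square)
    finally show "toda_V (r t n) < 1 / 3" .
  qed
  have q6: "(r t n)\<^sup>2 + (p t n)\<^sup>2 \<le> 6 * toda_e r p t n" for t n
  proof -
    have "(r t n)\<^sup>2 \<le> 2 * (exp 1 * toda_V (r t n))" by (rule toda_V_coercive(2)[OF r1])
    also have "\<dots> \<le> 2 * (3 * toda_V (r t n))" using e3 toda_V_bounds(1) by (intro mult_left_mono mult_right_mono) auto
    finally show ?thesis unfolding toda_e_def distrib_left using zero_le_power2[of "p t n"] by linarith
  qed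
  have S: "(\<Sum>n\<in>F. (r t n)\<^sup>2 + (p t n)\<^sup>2) \<le> (5 * \<eta>)\<^sup>2" if F: "finite F" for t F
  proof -
    have "(\<Sum>n\<in>F. (r t n)\<^sup>2 + (p t n)\<^sup>2) \<le> 6 * (\<Sum>n\<in>F. toda_e r p t n)"
      unfolding sum_distrib_left by (intro sum_mono q6)
    also have "\<dots> \<le> 6 * (3 * \<eta>\<^sup>2)" using E[OF F] by simp
    also have "\<dots> \<le> (5 * \<eta>)\<^sup>2" by (simp add: power_mult_distrib)
    finally show ?thesis .
  qed
  show "finite F \<Longrightarrow> (\<Sum>n\<in>F. toda_e r p t n) \<le> 3 * \<eta>\<^sup>2" by (rule E)
  show "finite F \<Longrightarrow> (\<Sum>n\<in>F. (r t n)\<^sup>2 + (p t n)\<^sup>2) \<le> (5 * \<eta>)\<^sup>2" by (rule S)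
  have "(r t n)\<^sup>2 \<le> (5 * \<eta>)\<^sup>2" "(p t n)\<^sup>2 \<le> (5 * \<eta>)\<^sup>2"
  proof -
    have s: "(r t n)\<^sup>2 + (p t n)\<^sup>2 \<le> (5 * \<eta>)\<^sup>2" using S[of "{n}" t] by simp
    show "(r t n)\<^sup>2 \<le> (5 * \<eta>)\<^sup>2" "(p t n)\<^sup>2 \<le> (5 * \<eta>)\<^sup>2" by (rule order_trans[OF _ s]; simp)+
  qed
  moreover have h: "0 \<le> 5 * \<eta>" using \<eta> by simp
  ultimately show "\<bar>r t n\<bar> \<le> 5 * \<eta>" "\<bar>p t n\<bar> \<le> 5 * \<eta>" unfolding power2_le_iff_abs_le[OF h] by blast+
  show "(r t n)\<^sup>2 + (p t n)\<^sup>2 \<le> 6 * toda_e r p t n" by (rule q6)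
qed

lemma cosh_add_le: "cosh (x + y) \<le> exp \<bar>y\<bar> * cosh (x::real)"
proof -
  have "exp (x + y) \<le> exp \<bar>y\<bar> * exp x" "exp (- (x + y)) \<le> exp \<bar>y\<bar> * exp (- x)"
    unfolding exp_add[symmetric] by simp_all
  thus ?thesis by (simp add: cosh_def algebra_simps)
qed

text \<open>
  Compares an increment of the front with its slope at either end of the step, which is what the two speed
  conditions of \<open>weighted_energy_bound\<close> ask for.
\<close>

lemma tanh_increment:
  fixes x y \<mu> :: real
  assumes "0 < \<mu>" "0 \<le> h" "h \<le> 1" "y = x \<or> y = x + h"
  shows "tanh (\<mu> * (x + h)) - tanh (\<mu> * x) \<le> \<mu> * exp (2 * \<mu>) * (1 - (tanh (\<mu> * y))\<^sup>2)"
proof -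
  have sech: "1 - (tanh u)\<^sup>2 = 1 / (cosh u)\<^sup>2" for u :: real
  proof -
    have "(cosh u)\<^sup>2 - (sinh u)\<^sup>2 = 1" by (simp add: cosh_square_eq)
    moreover have "1 - (tanh u)\<^sup>2 = ((cosh u)\<^sup>2 - (sinh u)\<^sup>2) / (cosh u)\<^sup>2"
      by (simp add: tanh_def power_divide diff_divide_distrib)
    ultimately show ?thesis by simp
  qed
  show ?thesis
  proof (cases "h = 0")
    case True
    thus ?thesis using assms by (simp add: sech)
  next
    case False
    have d: "((\<lambda>u. tanh (\<mu> * u)) has_real_derivative (1 - (tanh (\<mu> * u))\<^sup>2) * \<mu>) (at u)" for u
      by (rule derivative_eq_intros refl | simp)+
    have "x < x + h" using False assms by simp
    from MVT2[OF this d] obtain z where z: "x < z" "z < x + h"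
      "tanh (\<mu> * (x + h)) - tanh (\<mu> * x) = h * ((1 - (tanh (\<mu> * z))\<^sup>2) * \<mu>)" by auto
    have yz: "\<bar>\<mu> * (y - z)\<bar> \<le> \<mu> * 1" unfolding abs_mult using assms z by (intro mult_mono) auto
    have "cosh (\<mu> * y) = cosh (\<mu> * z + \<mu> * (y - z))" by (simp add: algebra_simps)
    also have "\<dots> \<le> exp \<bar>\<mu> * (y - z)\<bar> * cosh (\<mu> * z)" by (rule cosh_add_le)
    also have "\<dots> \<le> exp \<mu> * cosh (\<mu> * z)" using yz by (intro mult_right_mono) auto
    finally have "(cosh (\<mu> * y))\<^sup>2 \<le> (exp \<mu> * cosh (\<mu> * z))\<^sup>2" by (intro power_mono) auto
    hence "(cosh (\<mu> * y))\<^sup>2 \<le> exp (2 * \<mu>) * (cosh (\<mu> * z))\<^sup>2" by (simp only: power_mult_distrib exp_double)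
    hence c: "1 / (cosh (\<mu> * z))\<^sup>2 \<le> exp (2 * \<mu>) * (1 / (cosh (\<mu> * y))\<^sup>2)"
      by (simp add: field_simps)
    have "h * ((1 - (tanh (\<mu> * z))\<^sup>2) * \<mu>) \<le> 1 * ((1 - (tanh (\<mu> * z))\<^sup>2) * \<mu>)"
      using assms by (intro mult_right_mono) (auto simp: sech)
    also have "\<dots> = \<mu> * (1 / (cosh (\<mu> * z))\<^sup>2)" by (simp add: sech)
    also have "\<dots> \<le> \<mu> * (exp (2 * \<mu>) * (1 / (cosh (\<mu> * y))\<^sup>2))" using c assms by (intro mult_left_mono) auto
    finally show ?thesis unfolding z(3) by (simp add: sech)
  qed
qed

text \<open>
  Small waves travel with speed at most about \<open>1\<close>. A front \<open>w (n - X - \<sigma>1 * t)\<close> of slope \<open>\<mu>\<close> with speed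
  \<open>\<sigma>1 \<ge> exp (4 * \<mu>)\<close> satisfies the speed conditions of \<open>weighted_energy_bound\<close>. For large \<open>X\<close> the weighted energy
  is small at time \<open>0\<close>, hence at all later times; and the sites \<open>n \<ge> \<sigma> * t\<close> with \<open>\<sigma> > \<sigma>1\<close> end up ahead of the front.
\<close>

lemma small_toda_solution_left_behind:
  assumes flow: "toda_flow r p"
    and B: "\<And>T. \<exists>B. \<forall>t n. \<bar>t\<bar> \<le> T \<longrightarrow> \<bar>r t n\<bar> \<le> B \<and> \<bar>p t n\<bar> \<le> B"
    and init: "\<forall>F. finite F \<longrightarrow> (\<Sum>n\<in>F. (r 0 n)\<^sup>2 + (p 0 n)\<^sup>2) \<le> \<eta>\<^sup>2"
    and \<eta>: "0 \<le> \<eta>" "\<eta> \<le> 1 / 10" and \<mu>: "0 < \<mu>" "5 * \<eta> \<le> 2 * \<mu>"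
    and \<sigma>: "exp (4 * \<mu>) \<le> \<sigma>1" "\<sigma>1 < \<sigma>" and \<epsilon>: "0 < \<epsilon>"
  shows "\<exists>T\<ge>0. \<forall>t\<ge>T. \<forall>F. finite F \<longrightarrow> F \<subseteq> {n. \<sigma> * t \<le> of_int n} \<longrightarrow> (\<Sum>n\<in>F. (r t n)\<^sup>2 + (p t n)\<^sup>2) \<le> \<epsilon>"
proof -
  note small = toda_small_data[OF flow B init \<eta>]
  define e where "e = toda_e r p"
  have e0: "0 \<le> e t n" for t n by (simp add: e_def toda_e_nonneg)
  define E0 where "E0 = 3 * \<eta>\<^sup>2"
  have E: "(\<Sum>n\<in>F. e t n) \<le> E0" if "finite F" for t F unfolding e_def E0_def by (rule small(1)[OF that])
  have E00: "0 \<le> E0" by (simp add: E0_def)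
  define w where "w = (\<lambda>x::real. (1 + tanh (\<mu> * x)) / 2)"
  have w01: "0 \<le> w x" "w x \<le> 1" for x
    using tanh_real_lt_1[of "\<mu> * x"] tanh_real_gt_neg1[of "\<mu> * x"] by (auto simp: w_def)
  have wmono: "w x \<le> w y" if "x \<le> y" for x y using that \<mu> by (simp add: w_def divide_right_mono)
  have whalf: "1 / 2 \<le> w x" if "0 \<le> x" for x
    using that \<mu> by (simp add: w_def)
  (* 12 = 6 * 2: the factor between square sum and energy, and the weight 1/2 ahead of the front. *)
  define \<epsilon>' where "\<epsilon>' = \<epsilon> / 12"
  have \<epsilon>': "0 < \<epsilon>'" using \<epsilon> by (simp add: \<epsilon>'_def)
  have "\<exists>X\<ge>0. \<forall>F. finite F \<longrightarrow> (\<Sum>n\<in>F. w (of_int n - X) * e 0 n) \<le> \<epsilon>'"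
  proof -
    define Sm where "Sm = Sup {(\<Sum>n\<in>F. e 0 n) | F. finite F}"
    have bdd: "bdd_above {(\<Sum>n\<in>F. e 0 n) | F. finite F}" using E by (auto simp: bdd_above_def)
    have "\<exists>F. finite F \<and> Sm - \<epsilon>' / 2 < (\<Sum>n\<in>F. e 0 n)"
    proof -
      have "Sm - \<epsilon>' / 2 < Sm" using \<epsilon>' by simp
      hence "\<exists>s\<in>{(\<Sum>n\<in>F. e 0 n) | F. finite F}. Sm - \<epsilon>' / 2 < s"
        unfolding Sm_def using bdd by (subst (asm) less_cSup_iff) auto
      thus ?thesis by auto
    qed
    then obtain F0 where F0: "finite F0" "Sm - \<epsilon>' / 2 < (\<Sum>n\<in>F0. e 0 n)" by blast
    have tail: "(\<Sum>n\<in>F. e 0 n) \<le> \<epsilon>' / 2" if F: "finite F" "F \<inter> F0 = {}" for F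
    proof -
      have "(\<Sum>n\<in>F \<union> F0. e 0 n) \<le> Sm"
        unfolding Sm_def by (rule cSup_upper[OF _ bdd]) (use F F0 in auto)
      moreover have "(\<Sum>n\<in>F \<union> F0. e 0 n) = (\<Sum>n\<in>F. e 0 n) + (\<Sum>n\<in>F0. e 0 n)"
        using F F0 by (intro sum.union_disjoint) auto
      ultimately show ?thesis using F0 by linarith
    qed
    define N0 where "N0 = Max (insert 0 F0)"
    have N0: "n \<le> N0" if "n \<in> F0" for n using F0 that by (simp add: N0_def)
    have "((\<lambda>x. w (- x)) \<longlongrightarrow> 0) at_top"
    proof -
      have "filterlim (\<lambda>x. \<mu> * - x) at_bot at_top"
        using \<mu> by (intro filterlim_tendsto_pos_mult_at_bot[OF tendsto_const] filterlim_uminus_at_bot_at_top) auto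
      from filterlim_compose[OF tanh_real_at_bot this]
      have "((\<lambda>x. (1 + tanh (\<mu> * - x)) / 2) \<longlongrightarrow> (1 + (-1)) / 2) at_top" by (intro tendsto_intros) auto
      thus ?thesis by (simp add: w_def)
    qed
    moreover have "0 < \<epsilon>' / (2 * (E0 + 1))" using \<epsilon>' E00 by simp
    ultimately have "eventually (\<lambda>x. w (- x) < \<epsilon>' / (2 * (E0 + 1))) at_top" by (rule order_tendstoD(2))
    then obtain X0 where X0: "\<And>x. X0 \<le> x \<Longrightarrow> w (- x) < \<epsilon>' / (2 * (E0 + 1))"
      by (auto simp: eventually_at_top_linorder)
    define X where "X = max 0 (X0 + of_int N0)"
    have "(\<Sum>n\<in>F. w (of_int n - X) * e 0 n) \<le> \<epsilon>'" if F: "finite F" for F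
    proof -
      have "(\<Sum>n\<in>F. w (of_int n - X) * e 0 n) = (\<Sum>n\<in>(F \<inter> F0) \<union> (F - F0). w (of_int n - X) * e 0 n)"
        by (rule sum.cong) auto
      also have "\<dots> = (\<Sum>n\<in>F \<inter> F0. w (of_int n - X) * e 0 n) + (\<Sum>n\<in>F - F0. w (of_int n - X) * e 0 n)"
        using F by (intro sum.union_disjoint) auto
      also have "\<dots> \<le> (\<Sum>n\<in>F \<inter> F0. \<epsilon>' / (2 * (E0 + 1)) * e 0 n) + (\<Sum>n\<in>F - F0. 1 * e 0 n)"
      proof (intro add_mono sum_mono mult_right_mono e0 w01)
        fix n assume "n \<in> F \<inter> F0"
        hence "of_int n - X \<le> - X0" using N0[of n] by (simp add: X_def)
        hence "w (of_int n - X) \<le> w (- X0)" by (rule wmono)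
        thus "w (of_int n - X) \<le> \<epsilon>' / (2 * (E0 + 1))" using X0[of X0] by simp
      qed
      also have "\<dots> \<le> \<epsilon>' / (2 * (E0 + 1)) * (E0 + 1) + \<epsilon>' / 2"
      proof (intro add_mono)
        have "(\<Sum>n\<in>F \<inter> F0. e 0 n) \<le> E0 + 1" using E[of "F \<inter> F0" 0] F by simp
        thus "(\<Sum>n\<in>F \<inter> F0. \<epsilon>' / (2 * (E0 + 1)) * e 0 n) \<le> \<epsilon>' / (2 * (E0 + 1)) * (E0 + 1)"
          unfolding sum_distrib_left[symmetric] using \<epsilon>' E00 by (intro mult_left_mono) auto
        show "(\<Sum>n\<in>F - F0. 1 * e 0 n) \<le> \<epsilon>' / 2" using tail[of "F - F0"] F by auto
      qed
      also have "\<epsilon>' / (2 * (E0 + 1)) * (E0 + 1) = \<epsilon>' / 2" using E00 by (simp add: field_simps)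
      also have "\<epsilon>' / 2 + \<epsilon>' / 2 = \<epsilon>'" by simp
      finally show ?thesis .
    qed
    thus ?thesis by (intro exI[of _ X]) (auto simp: X_def)
  qed
  then obtain X where X: "0 \<le> X" "\<And>F. finite F \<Longrightarrow> (\<Sum>n\<in>F. w (of_int n - X) * e 0 n) \<le> \<epsilon>'" by blast
  define W where "W = (\<lambda>t (n::int). w (of_int n - X - \<sigma>1 * t))"
  define W' where "W' = (\<lambda>t (n::int). - (\<sigma>1 * (\<mu> * (1 - (tanh (\<mu> * (of_int n - X - \<sigma>1 * t)))\<^sup>2) / 2)))"
  have \<sigma>1: "1 \<le> \<sigma>1" using \<sigma> \<mu> by (meson order_trans one_le_exp_iff mult_nonneg_nonneg less_imp_le zero_le_numeral)
  have dW: "((\<lambda>t. W t n) has_real_derivative W' t n) (at t)" for t n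
  proof -
    have d: "((\<lambda>t. \<mu> * (of_int n - X - \<sigma>1 * t)) has_real_derivative - (\<mu> * \<sigma>1)) (at t)"
      by (auto intro!: derivative_eq_intros)
    have alg: "(0 + (1 - q) * - (\<mu> * \<sigma>1)) / 2 = - (\<sigma>1 * (\<mu> * (1 - q) / 2))" for q :: real
      by (simp add: field_simps)
    show ?thesis
      unfolding W_def W'_def w_def
      by (rule DERIV_cong[OF DERIV_cdivide[OF DERIV_add[OF DERIV_const[of 1] has_field_derivative_tanh[OF _ d]], of 2] alg]) simp
  qed
  have wt: "(\<Sum>n\<in>F. W t n * e t n) \<le> \<epsilon>'" if t: "0 \<le> t" and F: "finite F" for t F
  proof -
    have h1: "(\<Sum>n\<in>F. toda_e r p s n) \<le> E0" if "finite F" for s F using E[OF that] by (simp add: e_def)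
    have h2: "(1 - exp (- r s n))\<^sup>2 \<le> 2 * (exp (2 * \<mu>) * toda_V (r s n))" for s n
      using small(3)[of s n] \<mu> by (intro toda_V_coercive(1)) linarith
    have h3: "0 \<le> W s n \<and> W s n \<le> 1" for s n by (simp add: W_def w01)
    have h4: "W s (n - 1) \<le> W s n" for s n unfolding W_def by (rule wmono) simp
    have pos: "0 \<le> 1 - (tanh u)\<^sup>2" for u :: real using abs_tanh_le_1[of u] by (simp add: abs_square_le_1)
    have bnd: "c * (exp (2 * \<mu>) * (\<mu> * s / 2)) \<le> \<sigma>1 * (\<mu> * s / 2)" if "0 \<le> s" "c \<le> exp (2 * \<mu>)" for c s
    proof -
      have "c * exp (2 * \<mu>) \<le> exp (2 * \<mu>) * exp (2 * \<mu>)" using that by (intro mult_right_mono) auto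
      also have "\<dots> = exp (4 * \<mu>)" by (simp add: exp_add[symmetric])
      finally have "c * exp (2 * \<mu>) * (\<mu> * s / 2) \<le> \<sigma>1 * (\<mu> * s / 2)"
        using \<sigma> \<mu> that by (intro mult_right_mono) auto
      thus ?thesis by (simp add: mult.assoc)
    qed
    have h5: "W s n - W s (n - 1) \<le> - W' s n" for s n
    proof -
      let ?x = "of_int n - X - \<sigma>1 * s"
      have "tanh (\<mu> * ((?x - 1) + 1)) - tanh (\<mu> * (?x - 1)) \<le> \<mu> * exp (2 * \<mu>) * (1 - (tanh (\<mu> * ?x))\<^sup>2)"
        by (rule tanh_increment[OF \<mu>(1)]) auto
      moreover have "W s n - W s (n - 1) = (tanh (\<mu> * ((?x - 1) + 1)) - tanh (\<mu> * (?x - 1))) / 2"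
      proof -
        have "of_int (n - 1) - X - \<sigma>1 * s = ?x - 1" by simp
        thus ?thesis unfolding W_def w_def by (simp only: add_divide_distrib diff_divide_distrib; simp)
      qed
      ultimately have "W s n - W s (n - 1) \<le> 1 * (exp (2 * \<mu>) * (\<mu> * (1 - (tanh (\<mu> * ?x))\<^sup>2) / 2))"
        by (simp add: algebra_simps)
      also have "\<dots> \<le> \<sigma>1 * (\<mu> * (1 - (tanh (\<mu> * ?x))\<^sup>2) / 2)" using \<mu> pos by (intro bnd) auto
      finally show ?thesis by (simp add: W'_def)
    qed
    have h6: "exp (2 * \<mu>) * (W s (n + 1) - W s n) \<le> - W' s n" for s n
    proof -
      let ?x = "of_int n - X - \<sigma>1 * s"
      have "tanh (\<mu> * (?x + 1)) - tanh (\<mu> * ?x) \<le> \<mu> * exp (2 * \<mu>) * (1 - (tanh (\<mu> * ?x))\<^sup>2)"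
        by (rule tanh_increment[OF \<mu>(1)]) auto
      moreover have "W s (n + 1) - W s n = (tanh (\<mu> * (?x + 1)) - tanh (\<mu> * ?x)) / 2"
      proof -
        have "of_int (n + 1) - X - \<sigma>1 * s = ?x + 1" by simp
        thus ?thesis unfolding W_def w_def by (simp only: add_divide_distrib diff_divide_distrib; simp)
      qed
      ultimately have "W s (n + 1) - W s n \<le> exp (2 * \<mu>) * (\<mu> * (1 - (tanh (\<mu> * ?x))\<^sup>2) / 2)"
        by (simp add: algebra_simps)
      hence "exp (2 * \<mu>) * (W s (n + 1) - W s n) \<le> exp (2 * \<mu>) * (exp (2 * \<mu>) * (\<mu> * (1 - (tanh (\<mu> * ?x))\<^sup>2) / 2))"
        by (intro mult_left_mono) auto
      also have "\<dots> \<le> \<sigma>1 * (\<mu> * (1 - (tanh (\<mu> * ?x))\<^sup>2) / 2)" using \<mu> pos by (intro bnd) auto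
      finally show ?thesis by (simp add: W'_def)
    qed
    have h7: "(\<Sum>n\<in>F. W 0 n * toda_e r p 0 n) \<le> \<epsilon>'" if "finite F" for F
      using X(2)[OF that] by (simp add: W_def e_def)
    have h8: "0 \<le> exp (2 * \<mu>)" by simp
    have "(\<Sum>n\<in>F. W t n * toda_e r p t n) \<le> \<epsilon>'"
      by (rule weighted_energy_bound[where W = W and W' = W' and \<gamma> = "exp (2 * \<mu>)", OF flow t h1 h8 h2 dW h3 h4 h5 h6 h7 F]; assumption)
    thus ?thesis by (simp add: e_def)
  qed
  define T where "T = X / (\<sigma> - \<sigma>1)"
  have "(\<Sum>n\<in>F. (r t n)\<^sup>2 + (p t n)\<^sup>2) \<le> \<epsilon>"
    if t: "T \<le> t" and F: "finite F" "F \<subseteq> {n. \<sigma> * t \<le> of_int n}" for t F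
  proof -
    have T0: "0 \<le> T" using X \<sigma> by (simp add: T_def)
    have "X \<le> (\<sigma> - \<sigma>1) * t" using t \<sigma> by (simp add: T_def field_simps)
    hence pos: "0 \<le> of_int n - X - \<sigma>1 * t" if "n \<in> F" for n
      using F(2) that by (auto simp: algebra_simps)
    have "(r t n)\<^sup>2 + (p t n)\<^sup>2 \<le> 12 * (W t n * e t n)" if "n \<in> F" for n
    proof -
      have "(r t n)\<^sup>2 + (p t n)\<^sup>2 \<le> 6 * e t n" unfolding e_def by (rule small(5))
      moreover have "1 / 2 * e t n \<le> W t n * e t n"
        unfolding W_def using whalf[OF pos[OF that]] e0 by (intro mult_right_mono)
      ultimately show ?thesis by simp
    qed
    hence "(\<Sum>n\<in>F. (r t n)\<^sup>2 + (p t n)\<^sup>2) \<le> 12 * (\<Sum>n\<in>F. W t n * e t n)"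
      unfolding sum_distrib_left by (rule sum_mono)
    also have "\<dots> \<le> 12 * \<epsilon>'" using wt[OF _ F(1), of t] t T0 by simp
    finally show ?thesis by (simp add: \<epsilon>'_def)
  qed
  moreover have "0 \<le> T" using X \<sigma> by (simp add: T_def)
  ultimately show ?thesis by blast
qed

section \<open>The Darboux transformation in time\<close>

lemma DERIV_everywhere_continuous_on:
  fixes f f' :: "real \<Rightarrow> real"
  assumes "\<And>t. (f has_real_derivative f' t) (at t)"
  shows "continuous_on S f"
  using assms by (auto intro!: continuous_at_imp_continuous_on DERIV_isCont)

lemma jacobi_solution_exists:
  fixes r p :: "int \<Rightarrow> real"
  shows "\<exists>\<psi>. \<psi> 0 = x \<and> \<psi> 1 = y \<and> (\<forall>n. \<psi> (n - 1) + exp (- r n) * \<psi> (n + 1) = (\<alpha> - p n) * \<psi> n)"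
proof -
  define U where "U = rec_nat (x, y) (\<lambda>k (u, v). (v, exp (r (int k + 1)) * ((\<alpha> - p (int k + 1)) * v - u)))"
  define D where "D = rec_nat (x, y) (\<lambda>k (u, v). ((\<alpha> - p (- int k)) * u - exp (- r (- int k)) * v, u))"
  have U0: "U 0 = (x, y)" and D0: "D 0 = (x, y)" by (simp_all add: U_def D_def)
  have US: "fst (U (Suc k)) = snd (U k)"
    "snd (U (Suc k)) = exp (r (int k + 1)) * ((\<alpha> - p (int k + 1)) * snd (U k) - fst (U k))" for k
    by (simp_all add: U_def case_prod_beta)
  have DS: "fst (D (Suc k)) = (\<alpha> - p (- int k)) * fst (D k) - exp (- r (- int k)) * snd (D k)"
    "snd (D (Suc k)) = fst (D k)" for k
    by (simp_all add: D_def case_prod_beta)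
  define \<psi> where "\<psi> = (\<lambda>n::int. if 0 \<le> n then fst (U (nat n)) else fst (D (nat (- n))))"
  have up: "\<psi> (int k) = fst (U k)" for k by (simp add: \<psi>_def)
  have down: "\<psi> (- int k) = fst (D k)" for k
    by (cases "k = 0") (simp_all add: \<psi>_def U0 D0)
  have down': "\<psi> (1 - int k) = snd (D k)" for k
  proof (cases k)
    case 0
    thus ?thesis using up[of 1] US(1)[of 0] by (simp add: U0 D0)
  next
    case (Suc j)
    thus ?thesis using down[of j] DS(2)[of j] by simp
  qed
  have "\<psi> (n - 1) + exp (- r n) * \<psi> (n + 1) = (\<alpha> - p n) * \<psi> n" for n
  proof (cases "0 < n")
    case True
    define k where "k = nat (n - 1)"
    have n: "n = int k + 1" using True by (simp add: k_def)
    have v: "\<psi> (n - 1) = fst (U k)" "\<psi> n = snd (U k)" "\<psi> (n + 1) = snd (U (Suc k))"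
      using up[of k] up[of "Suc k"] up[of "Suc (Suc k)"] US(1)[of k] US(1)[of "Suc k"]
      by (simp_all add: n algebra_simps)
    have c: "exp (- x) * (exp x * w) = w" for x w :: real by (simp add: exp_minus)
    show ?thesis unfolding v US(2)[of k] unfolding n c by simp
  next
    case False
    define k where "k = nat (- n)"
    have n: "n = - int k" using False by (simp add: k_def)
    have e: "- int k - 1 = - int (Suc k)" "- int k + 1 = 1 - int k" by simp_all
    show ?thesis unfolding n e down down' DS(1)[of k] by simp
  qed
  moreover have "\<psi> 0 = x" "\<psi> 1 = y" using up[of 0] up[of 1] US(1)[of 0] by (simp_all add: U0)
  ultimately show ?thesis by blast
qed

text \<open>
  Geometric growth in \<open>n\<close> is the condition under which \<open>cascade_positive\<close> applies.
\<close>

lemma jacobi_growth: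
  fixes \<psi> :: "int \<Rightarrow> real"
  assumes rec: "\<And>n. \<psi> (n - 1) + exp (- r n) * \<psi> (n + 1) = (\<alpha> - p n) * \<psi> n"
    and B: "\<And>n. \<bar>r n\<bar> \<le> B \<and> \<bar>p n\<bar> \<le> B" and M: "\<bar>\<psi> 0\<bar> \<le> M" "\<bar>\<psi> 1\<bar> \<le> M"
    and K: "K = exp B * (\<bar>\<alpha>\<bar> + B + 1)"
  shows "\<bar>\<psi> n\<bar> \<le> M * K ^ nat \<bar>n\<bar>"
proof -
  have B0: "0 \<le> B" using B[of 0] by linarith
  have M0: "0 \<le> M" using M by linarith
  have e1: "1 \<le> exp B" using B0 by simp
  have K1: "1 \<le> K"
  proof -
    have "1 * 1 \<le> exp B * (\<bar>\<alpha>\<bar> + B + 1)" using e1 B0 by (intro mult_mono) auto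
    thus ?thesis by (simp add: K)
  qed
  have K2: "\<bar>\<alpha>\<bar> + B + exp B \<le> K"
  proof -
    have "1 * (\<bar>\<alpha>\<bar> + B) \<le> exp B * (\<bar>\<alpha>\<bar> + B)" using e1 B0 by (intro mult_right_mono) auto
    thus ?thesis by (simp add: K algebra_simps)
  qed
  have ap: "\<bar>\<alpha> - p n\<bar> \<le> \<bar>\<alpha>\<bar> + B" for n using B[of n] by linarith
  have er: "exp (r n) \<le> exp B" "exp (- r n) \<le> exp B" for n using B[of n] by auto
  have "\<bar>\<psi> n\<bar> \<le> M * K ^ nat \<bar>n\<bar> \<and> \<bar>\<psi> (n + 1)\<bar> \<le> M * K ^ nat \<bar>n\<bar>" for n
  proof (induction n rule: int_induct[where k = 0])
    case base
    thus ?case using M by simp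
  next
    case (step1 n)
    let ?Q = "M * K ^ nat \<bar>n\<bar>"
    have Q0: "0 \<le> ?Q" using M0 K1 by simp
    have e: "M * K ^ nat \<bar>n + 1\<bar> = K * ?Q"
    proof -
      have h: "nat \<bar>n + 1\<bar> = Suc (nat \<bar>n\<bar>)" using step1 by simp
      show ?thesis unfolding h by simp
    qed
    have "exp (- r (n + 1)) * \<psi> (n + 2) = (\<alpha> - p (n + 1)) * \<psi> (n + 1) - \<psi> n"
      using rec[of "n + 1"] by (simp add: algebra_simps)
    hence "\<psi> (n + 2) = exp (r (n + 1)) * ((\<alpha> - p (n + 1)) * \<psi> (n + 1) - \<psi> n)"
      by (simp add: exp_minus field_simps)
    hence "\<bar>\<psi> (n + 2)\<bar> = exp (r (n + 1)) * \<bar>(\<alpha> - p (n + 1)) * \<psi> (n + 1) - \<psi> n\<bar>" by (simp add: abs_mult)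
    also have "\<dots> \<le> exp B * ((\<bar>\<alpha>\<bar> + B) * ?Q + ?Q)"
    proof (rule mult_mono)
      have "\<bar>(\<alpha> - p (n + 1)) * \<psi> (n + 1)\<bar> \<le> (\<bar>\<alpha>\<bar> + B) * ?Q"
        unfolding abs_mult using ap[of "n + 1"] step1 B0 by (intro mult_mono) auto
      thus "\<bar>(\<alpha> - p (n + 1)) * \<psi> (n + 1) - \<psi> n\<bar> \<le> (\<bar>\<alpha>\<bar> + B) * ?Q + ?Q" using step1 by linarith
    qed (use er in auto)
    also have "\<dots> = K * ?Q" by (simp add: K algebra_simps)
    finally have "\<bar>\<psi> (n + 2)\<bar> \<le> K * ?Q" .
    moreover have "1 * ?Q \<le> K * ?Q" using K1 Q0 by (intro mult_right_mono) auto
    ultimately show ?case using step1 unfolding e by (simp add: add.assoc)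
  next
    case (step2 n)
    let ?Q = "M * K ^ nat \<bar>n\<bar>"
    have Q0: "0 \<le> ?Q" using M0 K1 by simp
    have e: "M * K ^ nat \<bar>n - 1\<bar> = K * ?Q"
    proof -
      have h: "nat \<bar>n - 1\<bar> = Suc (nat \<bar>n\<bar>)" using step2 by simp
      show ?thesis unfolding h by simp
    qed
    have "\<bar>(\<alpha> - p n) * \<psi> n\<bar> \<le> (\<bar>\<alpha>\<bar> + B) * ?Q"
      unfolding abs_mult using ap[of n] step2 B0 by (intro mult_mono) auto
    moreover have "\<bar>exp (- r n) * \<psi> (n + 1)\<bar> \<le> exp B * ?Q"
      unfolding abs_mult using er[of n] step2 by (intro mult_mono) auto
    moreover have "\<psi> (n - 1) = (\<alpha> - p n) * \<psi> n - exp (- r n) * \<psi> (n + 1)" using rec[of n] by simp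
    ultimately have "\<bar>\<psi> (n - 1)\<bar> \<le> (\<bar>\<alpha>\<bar> + B) * ?Q + exp B * ?Q" by linarith
    also have "\<dots> = (\<bar>\<alpha>\<bar> + B + exp B) * ?Q" by (simp add: algebra_simps)
    also have "\<dots> \<le> K * ?Q" using K2 Q0 by (intro mult_right_mono)
    finally have "\<bar>\<psi> (n - 1)\<bar> \<le> K * ?Q" .
    moreover have "1 * ?Q \<le> K * ?Q" using K1 Q0 by (intro mult_right_mono) auto
    ultimately show ?case using step2 unfolding e by simp
  qed
  thus ?thesis by blast
qed

text \<open>
  The Lax pair. With the recursion in \<open>n\<close>, the evolution equation at the sites \<open>0\<close> and \<open>1\<close> is a closed linear
  system; the other values are defined by the recursion. That the evolution equation passes on from two adjacent
  sites to the next site on either side is exactly the Toda lattice equation.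
\<close>

lemma lax_eigenfunction:
  assumes flow: "toda_flow r p"
  shows "\<exists>\<psi>. \<psi> 0 0 = x0 \<and> \<psi> 0 1 = y0 \<and>
    (\<forall>t n. \<psi> t (n - 1) + exp (- r t n) * \<psi> t (n + 1) = (\<alpha> - p t n) * \<psi> t n) \<and>
    (\<forall>t n. ((\<lambda>t. \<psi> t n) has_real_derivative - (exp (- r t n) * \<psi> t (n + 1))) (at t))"
proof -
  have dr: "((\<lambda>t. r t n) has_real_derivative p t (n + 1) - p t n) (at t)"
    and dp: "((\<lambda>t. p t n) has_real_derivative exp (- r t (n - 1)) - exp (- r t n)) (at t)" for t n
    by (rule toda_flowD[OF flow])+
  have cr: "continuous_on UNIV (\<lambda>t. r t n)" and cp: "continuous_on UNIV (\<lambda>t. p t n)" for n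
    by (rule DERIV_everywhere_continuous_on, rule dr)
       (rule DERIV_everywhere_continuous_on, rule dp)
  have "\<exists>x y. x 0 = x0 \<and> y 0 = y0 \<and>
    (\<forall>t. (x has_real_derivative 0 * x t + - exp (- r t 0) * y t) (at t)) \<and>
    (\<forall>t. (y has_real_derivative 1 * x t + - (\<alpha> - p t 1) * y t) (at t))"
    by (rule planar_linear_ode) (intro continuous_intros cr cp)+
  then obtain x y where xy: "x 0 = x0" "y 0 = y0"
    "\<And>t. (x has_real_derivative - exp (- r t 0) * y t) (at t)"
    "\<And>t. (y has_real_derivative x t + - (\<alpha> - p t 1) * y t) (at t)" by auto
  have "\<forall>t. \<exists>\<psi>. \<psi> 0 = x t \<and> \<psi> 1 = y t \<and>
      (\<forall>n. \<psi> (n - 1) + exp (- r t n) * \<psi> (n + 1) = (\<alpha> - p t n) * \<psi> n)"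
    by (intro allI jacobi_solution_exists)
  from choice[OF this] obtain \<psi> where \<psi>: "\<And>t. \<psi> t 0 = x t" "\<And>t. \<psi> t 1 = y t"
    and rec: "\<And>t n. \<psi> t (n - 1) + exp (- r t n) * \<psi> t (n + 1) = (\<alpha> - p t n) * \<psi> t n" by blast
  define C where "C = (\<lambda>n. \<forall>t. ((\<lambda>t. \<psi> t n) has_real_derivative - (exp (- r t n) * \<psi> t (n + 1))) (at t))"
  have "C n \<and> C (n + 1)" for n
  proof (induction n rule: int_induct[where k = 0])
    case base
    have "C 0" using xy(3) by (simp add: C_def \<psi>)
    moreover have "C 1"
      unfolding C_def
    proof
      fix t
      have "x t + - (\<alpha> - p t 1) * y t = - (exp (- r t 1) * \<psi> t (1 + 1))"
        using rec[of t 1] by (simp add: \<psi> algebra_simps)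
      thus "((\<lambda>t. \<psi> t 1) has_real_derivative - (exp (- r t 1) * \<psi> t (1 + 1))) (at t)"
        using xy(4)[of t] by (simp add: \<psi>)
    qed
    ultimately show ?case by simp
  next
    case (step1 n)
    define m where "m = n + 1"
    have Cm: "C m" "C (m - 1)" using step1 by (simp_all add: m_def)
    have "C (m + 1)"
      unfolding C_def
    proof
      fix t
      let ?e = "\<lambda>n. exp (- r t n)"
      have f: "(\<lambda>t. \<psi> t (m + 1)) = (\<lambda>t. exp (r t m) * ((\<alpha> - p t m) * \<psi> t m - \<psi> t (m - 1)))"
      proof
        fix s
        have "exp (- r s m) * \<psi> s (m + 1) = (\<alpha> - p s m) * \<psi> s m - \<psi> s (m - 1)" using rec[of s m] by simp
        thus "\<psi> s (m + 1) = exp (r s m) * ((\<alpha> - p s m) * \<psi> s m - \<psi> s (m - 1))"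
          by (simp add: exp_minus field_simps)
      qed
      have d1: "((\<lambda>t. \<psi> t m) has_real_derivative - (?e m * \<psi> t (m + 1))) (at t)"
        and d2: "((\<lambda>t. \<psi> t (m - 1)) has_real_derivative - (?e (m - 1) * \<psi> t m)) (at t)"
        using Cm by (simp_all add: C_def)
      have d3: "((\<lambda>t. exp (r t m)) has_real_derivative exp (r t m) * (p t (m + 1) - p t m)) (at t)"
        by (rule DERIV_chain2[OF DERIV_exp dr])
      have d4: "((\<lambda>t. \<alpha> - p t m) has_real_derivative 0 - (?e (m - 1) - ?e m)) (at t)"
        by (rule DERIV_diff[OF DERIV_const dp])
      have d: "((\<lambda>t. \<psi> t (m + 1)) has_real_derivative
          exp (r t m) * (p t (m + 1) - p t m) * ((\<alpha> - p t m) * \<psi> t m - \<psi> t (m - 1))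
          + ((0 - (?e (m - 1) - ?e m)) * \<psi> t m + - (?e m * \<psi> t (m + 1)) * (\<alpha> - p t m) - - (?e (m - 1) * \<psi> t m)) * exp (r t m)) (at t)"
        unfolding f by (rule DERIV_mult[OF d3 DERIV_diff[OF DERIV_mult[OF d4 d1] d2]])
      have em: "exp (r t m) * ?e m = 1" by (simp add: exp_minus)
      have r1: "?e m * \<psi> t (m + 1) = (\<alpha> - p t m) * \<psi> t m - \<psi> t (m - 1)" using rec[of t m] by simp
      have r2: "?e (m + 1) * \<psi> t (m + 1 + 1) = (\<alpha> - p t (m + 1)) * \<psi> t (m + 1) - \<psi> t m"
        using rec[of t "m + 1"] by simp
      have "exp (r t m) * (p t (m + 1) - p t m) * ((\<alpha> - p t m) * \<psi> t m - \<psi> t (m - 1))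
          + ((0 - (?e (m - 1) - ?e m)) * \<psi> t m + - (?e m * \<psi> t (m + 1)) * (\<alpha> - p t m) - - (?e (m - 1) * \<psi> t m)) * exp (r t m)
          = (exp (r t m) * ?e m) * ((p t (m + 1) - p t m) * \<psi> t (m + 1) + \<psi> t m - \<psi> t (m + 1) * (\<alpha> - p t m))"
        unfolding r1[symmetric] by (simp add: algebra_simps)
      also have "\<dots> = - (?e (m + 1) * \<psi> t (m + 1 + 1))" unfolding em r2 by (simp add: algebra_simps)
      finally show "((\<lambda>t. \<psi> t (m + 1)) has_real_derivative - (?e (m + 1) * \<psi> t (m + 1 + 1))) (at t)"
        by (rule DERIV_cong[OF d])
    qed
    thus ?case using step1 by (simp add: m_def)
  next
    case (step2 n)
    have "C (n - 1)"
      unfolding C_def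
    proof
      fix t
      let ?e = "\<lambda>n. exp (- r t n)"
      have f: "(\<lambda>t. \<psi> t (n - 1)) = (\<lambda>t. (\<alpha> - p t n) * \<psi> t n - exp (- r t n) * \<psi> t (n + 1))"
        using rec[of _ n] by (simp add: fun_eq_iff eq_diff_eq)
      have d1: "((\<lambda>t. \<psi> t n) has_real_derivative - (?e n * \<psi> t (n + 1))) (at t)"
        and d2: "((\<lambda>t. \<psi> t (n + 1)) has_real_derivative - (?e (n + 1) * \<psi> t (n + 1 + 1))) (at t)"
        using step2 by (simp_all add: C_def)
      have d3: "((\<lambda>t. exp (- r t n)) has_real_derivative ?e n * - (p t (n + 1) - p t n)) (at t)"
        by (rule DERIV_chain2[OF DERIV_exp DERIV_minus[OF dr]])
      have d4: "((\<lambda>t. \<alpha> - p t n) has_real_derivative 0 - (?e (n - 1) - ?e n)) (at t)"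
        by (rule DERIV_diff[OF DERIV_const dp])
      have d: "((\<lambda>t. \<psi> t (n - 1)) has_real_derivative
          ((0 - (?e (n - 1) - ?e n)) * \<psi> t n + - (?e n * \<psi> t (n + 1)) * (\<alpha> - p t n))
          - (?e n * - (p t (n + 1) - p t n) * \<psi> t (n + 1) + - (?e (n + 1) * \<psi> t (n + 1 + 1)) * ?e n)) (at t)"
        unfolding f by (rule DERIV_diff[OF DERIV_mult[OF d4 d1] DERIV_mult[OF d3 d2]])
      have r2: "?e (n + 1) * \<psi> t (n + 1 + 1) = (\<alpha> - p t (n + 1)) * \<psi> t (n + 1) - \<psi> t n"
        using rec[of t "n + 1"] by simp
      have "((0 - (?e (n - 1) - ?e n)) * \<psi> t n + - (?e n * \<psi> t (n + 1)) * (\<alpha> - p t n))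
          - (?e n * - (p t (n + 1) - p t n) * \<psi> t (n + 1) + - (?e (n + 1) * \<psi> t (n + 1 + 1)) * ?e n)
          = - (?e (n - 1) * \<psi> t (n - 1 + 1))"
        unfolding r2 by (simp add: algebra_simps)
      thus "((\<lambda>t. \<psi> t (n - 1)) has_real_derivative - (?e (n - 1) * \<psi> t (n - 1 + 1))) (at t)"
        by (rule DERIV_cong[OF d])
    qed
    thus ?case using step2 by simp
  qed
  thus ?thesis using \<psi> xy(1,2) rec unfolding C_def by (intro exI[of _ \<psi>]) simp
qed

text \<open>
  A factorisation at time \<open>0\<close> amounts to a positive solution \<open>\<psi>\<close> of the linear problem, via \<open>b n = \<psi> (n - 1) / \<psi> n\<close> and
  \<open>a n = exp (- r n) * \<psi> (n + 1) / \<psi> n\<close>. The Lax pair transports \<open>\<psi>\<close> in time and keeps it positive, so the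
  factorisation persists for all times with the same \<open>\<alpha>\<close>. The equations for \<open>a\<close> and \<open>b\<close> are the Volterra lattice.
\<close>

theorem darboux_transformation:
  fixes a0 b0 :: "int \<Rightarrow> real"
  assumes flow: "toda_flow r p"
    and B: "\<And>T. \<exists>B. \<forall>t n. \<bar>t\<bar> \<le> T \<longrightarrow> \<bar>r t n\<bar> \<le> B \<and> \<bar>p t n\<bar> \<le> B"
    and fac: "\<And>n. 0 < a0 n \<and> 0 < b0 n \<and> a0 n + b0 n = \<alpha> - p 0 n \<and> a0 n * b0 (n + 1) = exp (- r 0 n)"
  shows "\<exists>a b. a 0 = a0 \<and> b 0 = b0 \<and>
    (\<forall>t n. 0 < a t n \<and> 0 < b t n \<and> a t n + b t n = \<alpha> - p t n \<and> a t n * b t (n + 1) = exp (- r t n)) \<and>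
    (\<forall>t n. ((\<lambda>t. a t n) has_real_derivative a t n * (b t (n + 1) - b t n)) (at t)) \<and>
    (\<forall>t n. ((\<lambda>t. b t n) has_real_derivative b t n * (a t n - a t (n - 1))) (at t))"
proof -
  obtain \<psi> where \<psi>0: "\<psi> 0 0 = 1" "\<psi> 0 1 = 1 / b0 1"
    and rec: "\<And>t n. \<psi> t (n - 1) + exp (- r t n) * \<psi> t (n + 1) = (\<alpha> - p t n) * \<psi> t n"
    and d\<psi>: "\<And>t n. ((\<lambda>t. \<psi> t n) has_real_derivative - (exp (- r t n) * \<psi> t (n + 1))) (at t)"
    using lax_eigenfunction[OF flow, of 1 "1 / b0 1" \<alpha>] by blast
  have b00: "0 < b0 n" "0 < a0 n" for n using fac by auto
  have R: "\<psi> 0 n = b0 (n + 1) * \<psi> 0 (n + 1)" for n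
  proof (induction n rule: int_induct[where k = 0])
    case base
    show ?case using \<psi>0 b00(1)[of 1] by simp
  next
    case (step1 n)
    let ?m = "n + 1"
    have "exp (- r 0 ?m) * \<psi> 0 (?m + 1) = (\<alpha> - p 0 ?m - b0 ?m) * \<psi> 0 ?m"
      using rec[of 0 ?m] step1 by (simp add: algebra_simps)
    also have "\<alpha> - p 0 ?m - b0 ?m = a0 ?m" using fac[of ?m] by simp
    also have "exp (- r 0 ?m) = a0 ?m * b0 (?m + 1)" using fac[of ?m] by simp
    finally show ?case using b00(2)[of ?m] by simp
  next
    case (step2 n)
    have "exp (- r 0 n) * \<psi> 0 (n + 1) = a0 n * (b0 (n + 1) * \<psi> 0 (n + 1))" using fac[of n] by (simp add: mult.assoc[symmetric])
    also have "\<dots> = a0 n * \<psi> 0 n" using step2 by simp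
    finally have "\<psi> 0 (n - 1) = (\<alpha> - p 0 n - a0 n) * \<psi> 0 n" using rec[of 0 n] by (simp add: algebra_simps)
    also have "\<alpha> - p 0 n - a0 n = b0 n" using fac[of n] by simp
    finally show ?case by simp
  qed
  have pos0: "0 < \<psi> 0 n" for n
  proof (induction n rule: int_induct[where k = 0])
    case base
    show ?case using \<psi>0 by simp
  next
    case (step1 n)
    thus ?case using R[of n] b00(1)[of "n + 1"] by (simp add: zero_less_mult_iff)
  next
    case (step2 n)
    thus ?case using R[of "n - 1"] b00(1)[of n] by simp
  qed
  have growth: "\<exists>M K. 1 \<le> K \<and> 0 \<le> M \<and> (\<forall>t n. \<bar>t\<bar> \<le> T \<longrightarrow> \<bar>\<psi> t n\<bar> \<le> M * K ^ nat \<bar>n\<bar>)" for T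
  proof -
    obtain B where B: "\<And>t n. \<bar>t\<bar> \<le> T \<Longrightarrow> \<bar>r t n\<bar> \<le> B \<and> \<bar>p t n\<bar> \<le> B" using B[of T] by blast
    have "\<exists>M. \<forall>t\<in>{-T..T}. \<bar>\<psi> t n\<bar> \<le> M" for n
    proof -
      have "continuous_on {-T..T} (\<lambda>t. \<psi> t n)"
        by (rule DERIV_everywhere_continuous_on) (rule d\<psi>)
      hence "compact ((\<lambda>t. \<psi> t n) ` {-T..T})" by (intro compact_continuous_image) auto
      from compact_imp_bounded[OF this] show ?thesis by (auto simp: bounded_iff)
    qed
    then obtain M0 M1 where M: "\<forall>t\<in>{-T..T}. \<bar>\<psi> t 0\<bar> \<le> M0" "\<forall>t\<in>{-T..T}. \<bar>\<psi> t 1\<bar> \<le> M1" by metis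
    define M where "M = max 0 (max M0 M1)"
    define B' where "B' = max 0 B"
    define K where "K = exp B' * (\<bar>\<alpha>\<bar> + B' + 1)"
    have K1: "1 \<le> K"
    proof -
      have "1 * 1 \<le> exp B' * (\<bar>\<alpha>\<bar> + B' + 1)" by (intro mult_mono) (auto simp: B'_def)
      thus ?thesis by (simp add: K_def)
    qed
    have "\<bar>\<psi> t n\<bar> \<le> M * K ^ nat \<bar>n\<bar>" if t: "\<bar>t\<bar> \<le> T" for t n
    proof (rule jacobi_growth[where \<psi> = "\<psi> t" and r = "r t" and p = "p t" and B = B' and \<alpha> = \<alpha>, OF rec _ _ _ K_def])
      have tT: "t \<in> {-T..T}" using t by auto
      show "\<bar>r t n\<bar> \<le> B' \<and> \<bar>p t n\<bar> \<le> B'" for n using B[OF t, of n] by (auto simp: B'_def)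
      have "\<bar>\<psi> t 0\<bar> \<le> M0" "\<bar>\<psi> t 1\<bar> \<le> M1" using M tT by blast+
      thus "\<bar>\<psi> t 0\<bar> \<le> M" "\<bar>\<psi> t 1\<bar> \<le> M" unfolding M_def by linarith+
    qed
    thus ?thesis using K1 by (intro exI[of _ M] exI[of _ K]) (auto simp: M_def)
  qed
  have Kshift: "M * K ^ nat \<bar>n + k\<bar> \<le> M * K ^ nat \<bar>n\<bar> * K ^ N" if "1 \<le> K" "0 \<le> M" "\<bar>k\<bar> \<le> int N" for M K :: real and n k N
  proof -
    have "nat \<bar>n + k\<bar> \<le> nat \<bar>n\<bar> + N" using that by linarith
    hence "K ^ nat \<bar>n + k\<bar> \<le> K ^ (nat \<bar>n\<bar> + N)" using that by (intro power_increasing)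
    thus ?thesis using that by (simp add: power_add mult_left_mono mult.assoc)
  qed
  have pos: "0 < \<psi> t n" for t n
  proof -
    define T where "T = \<bar>t\<bar>"
    obtain B where B: "\<And>s n. \<bar>s\<bar> \<le> T \<Longrightarrow> \<bar>r s n\<bar> \<le> B \<and> \<bar>p s n\<bar> \<le> B" using B[of T] by blast
    obtain M K where MK: "1 \<le> K" "0 \<le> M" "\<And>s n. \<bar>s\<bar> \<le> T \<Longrightarrow> \<bar>\<psi> s n\<bar> \<le> M * K ^ nat \<bar>n\<bar>" using growth[of T] by blast
    have B0: "0 \<le> B" using B[of 0 0] by (force simp: T_def)
    define R where "R = \<bar>\<alpha>\<bar> + B + exp B"
    show ?thesis
    proof (cases "0 \<le> t")
      case True
      have tT: "t \<le> T" by (simp add: T_def)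
      (* Forward in time the value at n is driven by the value at n - 1, with coefficient 1. *)
      have "0 < \<psi> t (n - int 0)"
      proof (rule cascade_positive[where g = "\<lambda>N s. \<psi> s (n - int N)" and \<rho> = "\<lambda>_ _. 1"
            and \<mu> = "\<lambda>N s. - (\<alpha> - p s (n - int N))" and R = R and T = T
            and M = "M * K ^ nat \<bar>n\<bar>" and K = K, OF _ _ _ _ True tT])
        fix N s assume s: "0 \<le> s" "s \<le> T"
        have sT: "\<bar>s\<bar> \<le> T" using s by simp
        have "1 * \<psi> s (n - int (Suc N)) + - (\<alpha> - p s (n - int N)) * \<psi> s (n - int N)
            = - (exp (- r s (n - int N)) * \<psi> s (n - int N + 1))"
          using rec[of s "n - int N"] by (simp add: algebra_simps)
        thus "((\<lambda>s. \<psi> s (n - int N)) has_real_derivative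
            1 * \<psi> s (n - int (Suc N)) + - (\<alpha> - p s (n - int N)) * \<psi> s (n - int N)) (at s)"
          using d\<psi>[of "n - int N" s] by simp
        have "1 \<le> exp B" using B0 by simp
        moreover have "\<bar>p s (n - int N)\<bar> \<le> B" using B[OF sT] by blast
        ultimately show "0 \<le> (1::real) \<and> 1 \<le> R \<and> \<bar>- (\<alpha> - p s (n - int N))\<bar> \<le> R"
          using B0 unfolding R_def by linarith
        have "\<bar>\<psi> s (n - int N)\<bar> \<le> M * K ^ nat \<bar>n + (- int N)\<bar>" using MK(3)[OF sT, of "n - int N"] by simp
        also have "\<dots> \<le> M * K ^ nat \<bar>n\<bar> * K ^ N" using MK by (intro Kshift) auto
        finally show "\<bar>\<psi> s (n - int N)\<bar> \<le> M * K ^ nat \<bar>n\<bar> * K ^ N" .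
      qed (rule pos0)
      thus ?thesis by simp
    next
      case False
      have tT: "0 \<le> - t" "- t \<le> T" using False by (simp_all add: T_def)
      (* Backward in time it is driven by the value at n + 1, with coefficient exp (- r n). *)
      have "0 < \<psi> (- (- t)) (n + int 0)"
      proof (rule cascade_positive[where g = "\<lambda>N s. \<psi> (- s) (n + int N)" and \<rho> = "\<lambda>N s. exp (- r (- s) (n + int N))"
            and \<mu> = "\<lambda>_ _. 0" and R = R and T = T
            and M = "M * K ^ nat \<bar>n\<bar>" and K = K, OF _ _ _ _ tT])
        fix N s assume s: "0 \<le> s" "s \<le> T"
        have sT: "\<bar>- s\<bar> \<le> T" using s by simp
        show "((\<lambda>s. \<psi> (- s) (n + int N)) has_real_derivative
            exp (- r (- s) (n + int N)) * \<psi> (- s) (n + int (Suc N)) + 0 * \<psi> (- s) (n + int N)) (at s)"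
          using DERIV_reflect[OF d\<psi>[of "n + int N" "- s"]] by (simp add: add_ac)
        have "exp (- r (- s) (n + int N)) \<le> exp B" using B[OF sT, of "n + int N"] by auto
        thus "0 \<le> exp (- r (- s) (n + int N)) \<and> exp (- r (- s) (n + int N)) \<le> R \<and> \<bar>0\<bar> \<le> R"
          using B0 unfolding R_def by (auto intro: add_nonneg_nonneg order_trans)
        have "\<bar>\<psi> (- s) (n + int N)\<bar> \<le> M * K ^ nat \<bar>n + int N\<bar>" by (rule MK(3)[OF sT])
        also have "\<dots> \<le> M * K ^ nat \<bar>n\<bar> * K ^ N" using MK by (intro Kshift) auto
        finally show "\<bar>\<psi> (- s) (n + int N)\<bar> \<le> M * K ^ nat \<bar>n\<bar> * K ^ N" .
      qed (use pos0 in simp)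
      thus ?thesis by simp
    qed
  qed
  define a where "a = (\<lambda>t n. exp (- r t n) * \<psi> t (n + 1) / \<psi> t n)"
  define b where "b = (\<lambda>t n. \<psi> t (n - 1) / \<psi> t n)"
  have nz: "\<psi> t n \<noteq> 0" for t n using pos[of t n] by simp
  have apos: "0 < a t n" "0 < b t n" for t n using pos by (simp_all add: a_def b_def)
  have ab: "a t n + b t n = \<alpha> - p t n" for t n
    using rec[of t n] nz[of t n] by (simp add: a_def b_def add_divide_distrib[symmetric] field_simps)
  have prod: "a t n * b t (n + 1) = exp (- r t n)" for t n
    using nz[of t n] nz[of t "n + 1"] by (simp add: a_def b_def)
  have d\<psi>': "((\<lambda>t. \<psi> t n) has_real_derivative - (a t n * \<psi> t n)) (at t)" for t n
    using d\<psi>[of n t] nz[of t n] by (simp add: a_def)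
  have db: "((\<lambda>t. b t n) has_real_derivative b t n * (a t n - a t (n - 1))) (at t)" for t n
  proof -
    have "((\<lambda>t. \<psi> t (n - 1) / \<psi> t n) has_real_derivative
      (- (a t (n - 1) * \<psi> t (n - 1)) * \<psi> t n - \<psi> t (n - 1) * - (a t n * \<psi> t n)) / (\<psi> t n * \<psi> t n)) (at t)"
      by (rule DERIV_divide[OF d\<psi>' d\<psi>' nz])
    moreover have "(- (x * u) * v - u * - (y * v)) / (v * v) = u / v * (y - x)" if "v \<noteq> 0" for x y u v :: real
      using that by (simp add: field_simps)
    ultimately show ?thesis unfolding b_def using nz[of t n] by simp
  qed
  have da: "((\<lambda>t. a t n) has_real_derivative a t n * (b t (n + 1) - b t n)) (at t)" for t n
  proof -
    have de: "((\<lambda>t. exp (- r t n)) has_real_derivative exp (- r t n) * - (p t (n + 1) - p t n)) (at t)"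
      by (rule DERIV_chain2[OF DERIV_exp DERIV_minus[OF toda_flowD(1)[OF flow]]])
    have "a t n = exp (- r t n) / b t (n + 1)" for t
      using prod[of t n] apos(2)[of t "n + 1"] by (simp add: field_simps)
    hence f: "(\<lambda>t. a t n) = (\<lambda>t. exp (- r t n) / b t (n + 1))" by simp
    have bz: "b t (n + 1) \<noteq> 0" using apos(2)[of t "n + 1"] by simp
    have "((\<lambda>t. exp (- r t n) / b t (n + 1)) has_real_derivative
        (exp (- r t n) * - (p t (n + 1) - p t n) * b t (n + 1)
          - exp (- r t n) * (b t (n + 1) * (a t (n + 1) - a t (n + 1 - 1)))) / (b t (n + 1) * b t (n + 1))) (at t)"
      by (rule DERIV_divide[OF de db bz])
    moreover have "(e * - (q - p) * c - e * (c * (y - x))) / (c * c) = e / c * ((x - y) - (q - p))"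
      if "c \<noteq> 0" for e c p q x y :: real
      using that by (simp add: field_simps)
    ultimately have "((\<lambda>t. a t n) has_real_derivative
        exp (- r t n) / b t (n + 1) * ((a t n - a t (n + 1)) - (p t (n + 1) - p t n))) (at t)"
      unfolding f using bz by simp
    moreover have "(a t n - a t (n + 1)) - (p t (n + 1) - p t n) = b t (n + 1) - b t n"
      using ab[of t n] ab[of t "n + 1"] by linarith
    moreover have "exp (- r t n) / b t (n + 1) = a t n" using bz prod[of t n] by (simp add: field_simps)
    ultimately show ?thesis by simp
  qed
  have init: "b 0 = b0" "a 0 = a0"
  proof -
    show bb: "b 0 = b0"
    proof
      fix n
      show "b 0 n = b0 n" using R[of "n - 1"] nz[of 0 n] by (simp add: b_def)
    qed
    show "a 0 = a0"
    proof
      fix n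
      show "a 0 n = a0 n" using ab[of 0 n] fac[of n] by (simp add: bb)
    qed
  qed
  show ?thesis
    by (rule exI[of _ a], rule exI[of _ b]) (use init apos ab prod da db in auto)
qed

text \<open>
  Exchanging the factors maps solutions to solutions.
\<close>

lemma transformed_toda_flow:
  assumes H: "\<And>t n. 0 < a t n \<and> 0 < b t n"
    and da: "\<And>t n. ((\<lambda>t. a t n) has_real_derivative a t n * (b t (n + 1) - b t n)) (at t)"
    and db: "\<And>t n. ((\<lambda>t. b t n) has_real_derivative b t n * (a t n - a t (n - 1))) (at t)"
  shows "toda_flow (\<lambda>t n. - ln (a t (n + 1) * b t (n + 1))) (\<lambda>t n. \<alpha> - a t n - b t (n + 1))"
  unfolding toda_flow_def
proof (intro allI conjI)
  fix t n
  have e: "exp (- (- ln (a t n * b t n))) = a t n * b t n" for t n using H[of t n] by simp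
  have dl: "((\<lambda>t. ln (f t)) has_real_derivative D) (at t)" if "(f has_real_derivative f t * D) (at t)" "0 < f t"
    for f :: "real \<Rightarrow> real" and D
  proof -
    have "((\<lambda>t. ln (f t)) has_real_derivative 1 / f t * (f t * D)) (at t)"
      by (rule DERIV_chain2[OF DERIV_ln_divide that(1)]) (use that in auto)
    thus ?thesis using that by simp
  qed
  have eq: "(\<lambda>t. - ln (a t (n + 1) * b t (n + 1))) = (\<lambda>t. - (ln (a t (n + 1)) + ln (b t (n + 1))))"
    using H by (simp add: ln_mult_pos)
  have "((\<lambda>t. - (ln (a t (n + 1)) + ln (b t (n + 1)))) has_real_derivative
      - ((b t (n + 1 + 1) - b t (n + 1)) + (a t (n + 1) - a t (n + 1 - 1)))) (at t)"
    by (intro DERIV_minus DERIV_add dl da db) (use H in auto)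
  thus "((\<lambda>t. - ln (a t (n + 1) * b t (n + 1))) has_real_derivative
      \<alpha> - a t (n + 1) - b t (n + 1 + 1) - (\<alpha> - a t n - b t (n + 1))) (at t)"
    unfolding eq by (rule DERIV_cong) simp
  have "((\<lambda>t. \<alpha> - a t n - b t (n + 1)) has_real_derivative
      0 - a t n * (b t (n + 1) - b t n) - b t (n + 1) * (a t (n + 1) - a t (n + 1 - 1))) (at t)"
    by (intro DERIV_diff DERIV_const da db)
  thus "((\<lambda>t. \<alpha> - a t n - b t (n + 1)) has_real_derivative
      exp (- (- ln (a t (n - 1 + 1) * b t (n - 1 + 1)))) - exp (- (- ln (a t (n + 1) * b t (n + 1))))) (at t)"
    unfolding e by (rule DERIV_cong) (simp add: algebra_simps)
qed

section \<open>The position of the soliton\<close>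

lemma abs_ln_diff_le:
  fixes a A :: real
  assumes "0 < L" "1 / L \<le> a" "1 / L \<le> A"
  shows "\<bar>ln a - ln A\<bar> \<le> L * \<bar>a - A\<bar>"
proof -
  have one: "ln x - ln y \<le> L * \<bar>x - y\<bar>" if "1 / L \<le> x" "1 / L \<le> y" for x y :: real
  proof -
    have p: "0 < x" "0 < y" using that assms(1) by (meson less_le_trans zero_less_divide_1_iff)+
    have "ln x - ln y = ln (x / y)" using p by (simp add: ln_div)
    also have "\<dots> \<le> x / y - 1" using p by (intro ln_le_minus_one) simp
    also have "\<dots> = (x - y) * (1 / y)" using p by (simp add: field_simps)
    also have "\<dots> \<le> \<bar>x - y\<bar> * (1 / y)" using p by (intro mult_right_mono) auto
    also have "\<dots> \<le> \<bar>x - y\<bar> * L" using p that assms(1) by (intro mult_left_mono) (auto simp: field_simps)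
    finally show ?thesis by (simp add: mult.commute)
  qed
  show ?thesis using one[OF assms(2,3)] one[OF assms(3,2)] by (simp add: abs_minus_commute abs_le_iff)
qed

lemma abs_le_imp_square_le: "\<bar>x\<bar> \<le> y \<Longrightarrow> (x::real)\<^sup>2 \<le> y\<^sup>2"
  by (metis abs_ge_zero power2_abs power_mono)

lemma square_add3_le: "((x::real) + y + z)\<^sup>2 \<le> 3 * x\<^sup>2 + 3 * y\<^sup>2 + 3 * z\<^sup>2"
proof -
  have "0 \<le> (x - y)\<^sup>2 + (y - z)\<^sup>2 + (x - z)\<^sup>2" by simp
  also have "\<dots> = 3 * x\<^sup>2 + 3 * y\<^sup>2 + 3 * z\<^sup>2 - (x + y + z)\<^sup>2" by (simp add: power2_eq_square algebra_simps)
  finally show ?thesis by simp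
qed

text \<open>
  The way back: here \<open>p\<close> and \<open>r\<close> are the small transformed sequences, and the first argument of the norm
  is the original state, expressed by its factors. The soliton is given by the same expression in terms of the
  kink. The site \<open>n\<close> needs \<open>r\<close> at \<open>n - 1\<close>, hence the bound starts at \<open>N + 1\<close>.
\<close>

lemma soliton_from_kink:
  assumes k1: "0 < k1" and C: "0 < C"
  shows "\<exists>C'>0. \<forall>k a b p r N B y. k1 \<le> k \<longrightarrow> k \<le> k2 \<longrightarrow>
      (\<forall>n::int. 0 < a n \<and> 0 < b n \<and> \<bar>p n\<bar> \<le> 1 \<and> \<bar>r n\<bar> \<le> ln 2 \<and>
        a n + b (n + 1) = 2 * cosh k - p n \<and> a n * b n = exp (- r (n - 1))) \<longrightarrow>
      (\<forall>F. finite F \<longrightarrow> F \<subseteq> {N..} \<longrightarrow> (\<Sum>n\<in>F. (\<bar>p n\<bar> + \<bar>r n\<bar>)\<^sup>2) \<le> B) \<longrightarrow>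
      (\<forall>F. finite F \<longrightarrow> F \<subseteq> {N..} \<longrightarrow> (\<Sum>n\<in>F. (a n - kink k (of_int n - y))\<^sup>2) \<le> C * B) \<longrightarrow>
      (\<forall>F. finite F \<longrightarrow> F \<subseteq> {N + 1..} \<longrightarrow>
        (\<Sum>n\<in>F. (norm ((- ln (a n * b (n + 1)), 2 * cosh k - a n - b n) - sol k (of_int n - y)))\<^sup>2) \<le> C' * B)"
proof -
  define L where "L = 2 * (2 * cosh k2 + 1) + exp k2"
  have ck2: "1 \<le> cosh k2" by (rule cosh_real_ge_1)
  have L: "exp k2 \<le> L" "2 * (2 * cosh k2 + 1) \<le> L" using ck2 by (simp_all add: L_def)
  hence L: "0 < L" "exp k2 \<le> L" "2 * (2 * cosh k2 + 1) \<le> L" using less_le_trans[OF exp_gt_zero[of k2]] L by blast+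
  define C' where "C' = (2 * (1 + L\<^sup>2)\<^sup>2 + 6 * L\<^sup>2) * C + (8 * L\<^sup>2 + 3)"
  have C'0: "0 < C'" using C by (simp add: C'_def add_nonneg_pos)
  have main: "(\<Sum>n\<in>F. (norm ((- ln (a n * b (n + 1)), 2 * cosh k - a n - b n) - sol k (of_int n - y)))\<^sup>2) \<le> C' * B"
    if k: "k1 \<le> k" "k \<le> k2"
      and H: "\<forall>n::int. 0 < a n \<and> 0 < b n \<and> \<bar>p n\<bar> \<le> 1 \<and> \<bar>r n\<bar> \<le> ln 2 \<and>
        a n + b (n + 1) = 2 * cosh k - p n \<and> a n * b n = exp (- r (n - 1))"
      and SB: "\<forall>F. finite F \<longrightarrow> F \<subseteq> {N..} \<longrightarrow> (\<Sum>n\<in>F. (\<bar>p n\<bar> + \<bar>r n\<bar>)\<^sup>2) \<le> B"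
      and SC: "\<forall>F. finite F \<longrightarrow> F \<subseteq> {N..} \<longrightarrow> (\<Sum>n\<in>F. (a n - kink k (of_int n - y))\<^sup>2) \<le> C * B"
      and F: "finite F" "F \<subseteq> {N + 1..}" for k a b p r N B y F
  proof -
    have k0: "0 < k" using k k1 by simp
    define A where "A = (\<lambda>n::int. kink k (of_int n - y))"
    define d where "d = (\<lambda>n. \<bar>a n - A n\<bar>)"
    have pos: "0 < a n" "0 < b n" for n using H by auto
    have alow: "1 / L \<le> a n" for n
    proof -
      have "b n \<le> 2 * cosh k2 + 1"
      proof -
        have "cosh k \<le> cosh k2" using k k0 by (simp add: cosh_real_nonneg_le_iff)
        moreover have "a (n - 1) + b n = 2 * cosh k - p (n - 1)" "\<bar>p (n - 1)\<bar> \<le> 1"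
          using H[rule_format, of "n - 1"] by auto
        ultimately show ?thesis using pos(1)[of "n - 1"] by linarith
      qed
      moreover have "1 / 2 \<le> a n * b n"
      proof -
        have "exp (- ln 2) \<le> exp (- r (n - 1))" using H[rule_format, of "n - 1"] by auto
        thus ?thesis using H[rule_format, of n] by (simp add: exp_minus)
      qed
      ultimately have "1 / 2 \<le> a n * (2 * cosh k2 + 1)"
        using pos(1)[of n] by (meson mult_left_mono less_imp_le order_trans)
      also have "\<dots> \<le> a n * (L / 2)" using L pos(1)[of n] by (intro mult_left_mono) auto
      finally show ?thesis using L by (simp add: field_simps)
    qed
    have Alow: "1 / L \<le> A n" for n
    proof -
      have "1 / L \<le> 1 / exp k" using k L by (intro divide_left_mono) (auto intro: order_trans[of _ "exp k2"])
      thus ?thesis unfolding A_def using kink_bounds(1)[OF k0, of "of_int n - y"] by (simp add: exp_minus inverse_eq_divide)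
    qed
    have Apos: "0 < A n" for n by (simp add: A_def kink_pos)
    have inv: "1 / a n \<le> L" "1 / A n \<le> L" for n
      using alow[of n] Alow[of n] L pos(1)[of n] Apos[of n] by (simp_all add: field_simps)
    define w where "w = (\<lambda>n. (norm ((- ln (a n * b (n + 1)), 2 * cosh k - a n - b n) - sol k (of_int n - y)))\<^sup>2)"
    have wb: "w n \<le> (2 * (1 + L\<^sup>2)\<^sup>2 + 3 * L\<^sup>2) * (d n)\<^sup>2 + 3 * L\<^sup>2 * (d (n + 1))\<^sup>2 + 8 * L\<^sup>2 * (r (n - 1))\<^sup>2 + 3 * (r n)\<^sup>2" for n
    proof -
      have bn: "b n = exp (- r (n - 1)) / a n" using H[rule_format, of n] pos(1)[of n] by (simp add: field_simps)
      have p1: "\<bar>(2 * cosh k - a n - b n) - snd (sol k (of_int n - y))\<bar> \<le> (1 + L\<^sup>2) * d n + 2 * L * \<bar>r (n - 1)\<bar>"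
      proof -
        have "(2 * cosh k - a n - b n) - snd (sol k (of_int n - y))
            = - (a n - A n) - (exp (- r (n - 1)) - 1) * (1 / a n) + (a n - A n) * (1 / a n * (1 / A n))"
          unfolding bn sol_def A_def[symmetric] using pos(1)[of n] Apos[of n] by (simp add: A_def field_simps)
        moreover have "\<bar>(exp (- r (n - 1)) - 1) * (1 / a n)\<bar> \<le> (2 * \<bar>r (n - 1)\<bar>) * L"
          unfolding abs_mult using exp_minus_one_small(2)[of "r (n - 1)" 1] H[rule_format, of "n - 1"] inv(1)[of n] pos(1)[of n] L
          by (intro mult_mono) auto
        moreover have "\<bar>(a n - A n) * (1 / a n * (1 / A n))\<bar> \<le> d n * (L * L)"
          unfolding abs_mult d_def using inv[of n] pos(1)[of n] Apos[of n] L by (intro mult_mono) auto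
        moreover have "(1 + L\<^sup>2) * d n + 2 * L * \<bar>r (n - 1)\<bar> = d n + (2 * \<bar>r (n - 1)\<bar>) * L + d n * (L * L)"
          by (simp add: power2_eq_square algebra_simps)
        ultimately show ?thesis unfolding d_def by linarith
      qed
      have r1: "\<bar>- ln (a n * b (n + 1)) - fst (sol k (of_int n - y))\<bar> \<le> L * d n + L * d (n + 1) + \<bar>r n\<bar>"
      proof -
        have "a (n + 1) * b (n + 1) = exp (- r n)" using H[rule_format, of "n + 1"] by simp
        hence "ln (a (n + 1)) + ln (b (n + 1)) = - r n" using pos by (simp add: ln_mult_pos[symmetric])
        moreover have "ln (a n * b (n + 1)) = ln (a n) + ln (b (n + 1))" using pos by (simp add: ln_mult_pos)
        moreover have "fst (sol k (of_int n - y)) = ln (A (n + 1)) - ln (A n)"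
        proof -
          have "of_int (n + 1) - y = of_int n - y + 1" by simp
          thus ?thesis by (simp only: sol_def A_def fst_conv)
        qed
        ultimately have "- ln (a n * b (n + 1)) - fst (sol k (of_int n - y))
            = (ln (a (n + 1)) - ln (A (n + 1))) - (ln (a n) - ln (A n)) + r n" by linarith
        thus ?thesis using abs_ln_diff_le[OF L(1) alow Alow, of n n] abs_ln_diff_le[OF L(1) alow Alow, of "n + 1" "n + 1"]
          unfolding d_def by linarith
      qed
      have d0: "0 \<le> d n" "0 \<le> d (n + 1)" by (simp_all add: d_def)
      have "w n = (- ln (a n * b (n + 1)) - fst (sol k (of_int n - y)))\<^sup>2 + ((2 * cosh k - a n - b n) - snd (sol k (of_int n - y)))\<^sup>2"
        by (simp add: w_def norm_prod_square)
      also have "\<dots> \<le> (L * d n + L * d (n + 1) + \<bar>r n\<bar>)\<^sup>2 + ((1 + L\<^sup>2) * d n + 2 * L * \<bar>r (n - 1)\<bar>)\<^sup>2"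
        by (intro add_mono abs_le_imp_square_le r1 p1)
      also have "\<dots> \<le> (3 * (L * d n)\<^sup>2 + 3 * (L * d (n + 1))\<^sup>2 + 3 * \<bar>r n\<bar>\<^sup>2)
          + (2 * ((1 + L\<^sup>2) * d n)\<^sup>2 + 2 * (2 * L * \<bar>r (n - 1)\<bar>)\<^sup>2)"
        by (intro add_mono square_add3_le square_add_le)
      also have "\<dots> = (2 * (1 + L\<^sup>2)\<^sup>2 + 3 * L\<^sup>2) * (d n)\<^sup>2 + 3 * L\<^sup>2 * (d (n + 1))\<^sup>2 + 8 * L\<^sup>2 * (r (n - 1))\<^sup>2 + 3 * (r n)\<^sup>2"
        unfolding power_mult_distrib power2_abs by (simp add: algebra_simps)
      finally show ?thesis .
    qed
    have D: "(\<Sum>n\<in>G. (d n)\<^sup>2) \<le> C * B" if "finite G" "G \<subseteq> {N..}" for G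
      using SC that by (simp add: d_def A_def)
    have R: "(\<Sum>n\<in>G. (r n)\<^sup>2) \<le> B" if "finite G" "G \<subseteq> {N..}" for G
    proof -
      have "(\<Sum>n\<in>G. (r n)\<^sup>2) \<le> (\<Sum>n\<in>G. (\<bar>p n\<bar> + \<bar>r n\<bar>)\<^sup>2)"
        by (intro sum_mono abs_le_imp_square_le) simp
      thus ?thesis using SB that by (meson order_trans)
    qed
    have FN: "F \<subseteq> {N..}" using F by auto
    have s1: "(\<Sum>n\<in>F. (d (n + 1))\<^sup>2) \<le> C * B"
    proof -
      have "(\<Sum>n\<in>F. (d (n + 1))\<^sup>2) = (\<Sum>n\<in>(\<lambda>n. n + 1) ` F. (d n)\<^sup>2)" by (subst sum.reindex) (auto simp: inj_on_def)
      moreover have "(\<lambda>n. n + 1) ` F \<subseteq> {N..}" using F(2) by force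
      ultimately show ?thesis using D[of "(\<lambda>n. n + 1) ` F"] F(1) by simp
    qed
    have s2: "(\<Sum>n\<in>F. (r (n - 1))\<^sup>2) \<le> B"
    proof -
      have "(\<Sum>n\<in>F. (r (n - 1))\<^sup>2) = (\<Sum>n\<in>(\<lambda>n. n - 1) ` F. (r n)\<^sup>2)" by (subst sum.reindex) (auto simp: inj_on_def)
      moreover have "(\<lambda>n. n - 1) ` F \<subseteq> {N..}" using F(2) by force
      ultimately show ?thesis using R[of "(\<lambda>n. n - 1) ` F"] F(1) by simp
    qed
    have "(\<Sum>n\<in>F. w n) \<le> (\<Sum>n\<in>F. (2 * (1 + L\<^sup>2)\<^sup>2 + 3 * L\<^sup>2) * (d n)\<^sup>2 + 3 * L\<^sup>2 * (d (n + 1))\<^sup>2 + 8 * L\<^sup>2 * (r (n - 1))\<^sup>2 + 3 * (r n)\<^sup>2)"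
      by (intro sum_mono wb)
    also have "\<dots> = (2 * (1 + L\<^sup>2)\<^sup>2 + 3 * L\<^sup>2) * (\<Sum>n\<in>F. (d n)\<^sup>2) + 3 * L\<^sup>2 * (\<Sum>n\<in>F. (d (n + 1))\<^sup>2)
        + 8 * L\<^sup>2 * (\<Sum>n\<in>F. (r (n - 1))\<^sup>2) + 3 * (\<Sum>n\<in>F. (r n)\<^sup>2)"
      unfolding sum_distrib_left by (simp only: sum.distrib)
    also have "\<dots> \<le> (2 * (1 + L\<^sup>2)\<^sup>2 + 3 * L\<^sup>2) * (C * B) + 3 * L\<^sup>2 * (C * B) + 8 * L\<^sup>2 * B + 3 * B"
      by (intro add_mono mult_left_mono s1 s2 D[OF F(1) FN] R[OF F(1) FN]) auto
    also have "\<dots> = C' * B" by (simp add: C'_def algebra_simps)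
    finally show ?thesis by (simp add: w_def)
  qed
  show ?thesis
    by (rule exI[of _ C'], rule conjI[OF C'0], intro allI impI, rule main; assumption)
qed

lemma deriv_bound_lipschitz:
  fixes f f' :: "real \<Rightarrow> real"
  assumes "\<And>t. (f has_real_derivative f' t) (at t)" "\<And>t. \<bar>f' t\<bar> \<le> U"
  shows "\<bar>f s - f t\<bar> \<le> U * \<bar>s - t\<bar>"
proof -
  have one: "\<bar>f b - f a\<bar> \<le> U * (b - a)" if "a < b" for a b
  proof -
    from MVT2[OF that assms(1)] obtain z where "f b - f a = (b - a) * f' z" by blast
    thus ?thesis using assms(2)[of z] that by (simp add: abs_mult mult.commute mult_left_mono)
  qed
  show ?thesis using one[of s t] one[of t s] by (cases s t rule: linorder_cases) (auto simp: abs_minus_commute)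
qed

lemma crossing_between:
  fixes a :: "int \<Rightarrow> real"
  assumes "1 \<le> a i" "a j < 1" "i < j"
  shows "\<exists>m. 1 \<le> a m \<and> a (m + 1) < 1"
proof (rule ccontr)
  assume no: "\<not> ?thesis"
  have "1 \<le> a (i + int n)" for n
  proof (induction n)
    case (Suc n)
    have "1 \<le> a (i + int n + 1)" using no Suc by force
    thus ?case by (simp add: algebra_simps)
  qed (use assms in simp)
  from this[of "nat (j - i)"] assms show False by simp
qed

text \<open>
  Follows the position \<open>Y\<close> of the perturbed kink in time; \<open>m t\<close> is a site at which \<open>a t\<close> crosses \<open>1\<close>, and \<open>Y t\<close> is
  the position that \<open>perturbed_kink\<close> assigns to it.

  The last conclusion gives the speed. In a unit of time, the value of \<open>a\<close> at the fixed site \<open>m t\<close> and the kink that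
  moves with speed \<open>sinh k / k\<close> solve the same Riccati equation up to \<open>p\<close> and \<open>r\<close>, so by Gronwall's inequality they
  stay close; the position is then read off from the value at this site. The bound involves the perturbation only
  at the sites from \<open>J\<close> on, so that it becomes small when the radiation has fallen behind. The function \<open>Y\<close> need not
  be continuous.
\<close>

lemma kink_trajectory:
  assumes k1: "0 < k1"
  shows "\<exists>\<eta>1>0. \<exists>K>0. \<exists>C>0. \<forall>k \<eta> a p r. k1 \<le> k \<longrightarrow> k \<le> k2 \<longrightarrow> \<eta> \<le> \<eta>1 \<longrightarrow>
      (\<forall>t n. 0 < a t n \<and> \<bar>p t n\<bar> \<le> \<eta> \<and> \<bar>r t n\<bar> \<le> \<eta> \<and>
        a t n + exp (- r t n) / a t (n + 1) = 2 * cosh k - p t n \<and>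
        ((\<lambda>t. a t n) has_real_derivative a t n * (2 * cosh k - p t n - a t n) - exp (- r t (n - 1))) (at t)) \<longrightarrow>
      (\<exists>i j. i < j \<and> 1 \<le> a 0 i \<and> a 0 j < 1) \<longrightarrow>
    (\<exists>m Y. (\<forall>t. Y t - 1 \<le> of_int (m t)) \<and>
      (\<forall>t N B F. N \<le> m t \<longrightarrow> (\<forall>F. finite F \<longrightarrow> F \<subseteq> {N..} \<longrightarrow> (\<Sum>n\<in>F. (\<bar>p t n\<bar> + \<bar>r t n\<bar>)\<^sup>2) \<le> B) \<longrightarrow>
            finite F \<longrightarrow> F \<subseteq> {N..} \<longrightarrow> (\<Sum>n\<in>F. (a t n - kink k (of_int n - Y t))\<^sup>2) \<le> C * B) \<and>
      (\<forall>t s J \<Phi>. 0 \<le> s \<longrightarrow> s \<le> 1 \<longrightarrow> J \<le> m t - 1 \<longrightarrow> J \<le> m (t + s) \<longrightarrow> \<Phi> \<le> 2 * \<eta> \<longrightarrow>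
          (\<forall>\<tau> n. t \<le> \<tau> \<longrightarrow> \<tau> \<le> t + 1 \<longrightarrow> J \<le> n \<longrightarrow> \<bar>p \<tau> n\<bar> + \<bar>r \<tau> n\<bar> \<le> \<Phi>) \<longrightarrow>
          \<bar>Y (t + s) - Y t - sinh k / k * s\<bar> \<le> K * \<Phi>))"
proof -
  obtain \<eta>0 C \<beta> where \<eta>0: "\<eta>0 > 0" and C: "C > 0" and \<beta>: "\<beta> > 0" and PK0:
    "\<forall>k p r a m. k1 \<le> k \<longrightarrow> (\<forall>n::int. 0 < a n \<and> \<bar>p n\<bar> \<le> \<eta>0 \<and> \<bar>r n\<bar> \<le> \<eta>0 \<and>
        a n + exp (- r n) / a (n + 1) = 2 * cosh k - p n) \<longrightarrow> 1 \<le> a m \<longrightarrow> a (m + 1) < 1 \<longrightarrow>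
      (1 + \<beta> \<le> a (m - 1) \<and> a (m + 2) \<le> 1 / (1 + \<beta>)) \<and>
      (\<exists>y. -1 \<le> of_int m - y \<and> of_int m - y \<le> 1 / 2 \<and> kink k (of_int m - y) = a m \<and>
        (\<forall>N B F. N \<le> m \<longrightarrow> (\<forall>F. finite F \<longrightarrow> F \<subseteq> {N..} \<longrightarrow> (\<Sum>n\<in>F. (\<bar>p n\<bar> + \<bar>r n\<bar>)\<^sup>2) \<le> B) \<longrightarrow>
            finite F \<longrightarrow> F \<subseteq> {N..} \<longrightarrow> (\<Sum>n\<in>F. (a n - kink k (of_int n - y))\<^sup>2) \<le> C * B) \<and>
        (\<forall>n \<Phi>. (\<forall>j. min n m \<le> j \<longrightarrow> j \<le> max n m \<longrightarrow> \<bar>p j\<bar> + \<bar>r j\<bar> \<le> \<Phi>) \<longrightarrow>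
            \<bar>a n - kink k (of_int n - y)\<bar> \<le> C * \<Phi>))"
    using perturbed_kink[OF k1] by (elim exE conjE) (rule that; assumption)
  have PK: "(1 + \<beta> \<le> a (m - 1) \<and> a (m + 2) \<le> 1 / (1 + \<beta>)) \<and>
      (\<exists>y. -1 \<le> of_int m - y \<and> of_int m - y \<le> 1 / 2 \<and> kink k (of_int m - y) = a m \<and>
        (\<forall>N B F. N \<le> m \<longrightarrow> (\<forall>F. finite F \<longrightarrow> F \<subseteq> {N..} \<longrightarrow> (\<Sum>n\<in>F. (\<bar>p n\<bar> + \<bar>r n\<bar>)\<^sup>2) \<le> B) \<longrightarrow>
            finite F \<longrightarrow> F \<subseteq> {N..} \<longrightarrow> (\<Sum>n\<in>F. (a n - kink k (of_int n - y))\<^sup>2) \<le> C * B) \<and>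
        (\<forall>n \<Phi>. (\<forall>j. min n m \<le> j \<longrightarrow> j \<le> max n m \<longrightarrow> \<bar>p j\<bar> + \<bar>r j\<bar> \<le> \<Phi>) \<longrightarrow>
            \<bar>a n - kink k (of_int n - y)\<bar> \<le> C * \<Phi>))"
    if "k1 \<le> k" "(\<forall>n::int. 0 < a n \<and> \<bar>p n\<bar> \<le> \<eta>0 \<and> \<bar>r n\<bar> \<le> \<eta>0 \<and>
        a n + exp (- r n) / a (n + 1) = 2 * cosh k - p n)" "1 \<le> a m" "a (m + 1) < 1" for k p r a m
    by (rule PK0[THEN spec[where x = k], THEN spec[where x = p], THEN spec[where x = r], THEN spec[where x = a],
          THEN spec[where x = m], THEN mp, THEN mp, THEN mp, THEN mp, OF that])
  define c2 where "c2 = \<bar>sinh k2\<bar> / k1"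
  define R where "R = 1 + c2"
  have R: "0 \<le> R" using k1 by (simp add: R_def c2_def)
  obtain K' where K': "K' > 0" and IL: "\<And>k z z'. k1 \<le> k \<Longrightarrow> k \<le> k2 \<Longrightarrow> \<bar>z\<bar> \<le> R \<Longrightarrow> \<bar>kink k z - kink k z'\<bar> < 1 / K' \<Longrightarrow>
      \<bar>z - z'\<bar> \<le> K' * \<bar>kink k z - kink k z'\<bar>"
    using kink_inverse_lipschitz[OF k1 R, of k2] by (elim exE conjE) (rule that, assumption, blast)
  define \<alpha>2 where "\<alpha>2 = 2 * \<bar>cosh k2\<bar>"
  define L1 where "L1 = 3 * (\<alpha>2 + 1)"
  define KA where "KA = (\<alpha>2 + 3) * exp (L1 + 1) + C"
  have \<alpha>20: "0 \<le> \<alpha>2" by (simp add: \<alpha>2_def)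
  have L10: "0 \<le> L1" using \<alpha>20 by (simp add: L1_def)
  have KA: "0 < KA" using \<alpha>20 C by (simp add: KA_def add_nonneg_pos)
  define K where "K = K' * KA"
  have K: "0 < K" using K' KA by (simp add: K_def)
  define \<eta>1 where "\<eta>1 = Min {\<eta>0, ln 2, 1 / 2, 1 / (4 * KA * K')}"
  have \<eta>1: "0 < \<eta>1" "\<eta>1 \<le> \<eta>0" "\<eta>1 \<le> ln 2" "\<eta>1 \<le> 1 / 2" "\<eta>1 \<le> 1 / (4 * KA * K')"
    using \<eta>0 KA K' by (auto simp: \<eta>1_def)
  have main: "\<exists>m Y. (\<forall>t. Y t - 1 \<le> of_int (m t)) \<and>
      (\<forall>t N B F. N \<le> m t \<longrightarrow> (\<forall>F. finite F \<longrightarrow> F \<subseteq> {N..} \<longrightarrow> (\<Sum>n\<in>F. (\<bar>p t n\<bar> + \<bar>r t n\<bar>)\<^sup>2) \<le> B) \<longrightarrow>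
            finite F \<longrightarrow> F \<subseteq> {N..} \<longrightarrow> (\<Sum>n\<in>F. (a t n - kink k (of_int n - Y t))\<^sup>2) \<le> C * B) \<and>
      (\<forall>t s J \<Phi>. 0 \<le> s \<longrightarrow> s \<le> 1 \<longrightarrow> J \<le> m t - 1 \<longrightarrow> J \<le> m (t + s) \<longrightarrow> \<Phi> \<le> 2 * \<eta> \<longrightarrow>
          (\<forall>\<tau> n. t \<le> \<tau> \<longrightarrow> \<tau> \<le> t + 1 \<longrightarrow> J \<le> n \<longrightarrow> \<bar>p \<tau> n\<bar> + \<bar>r \<tau> n\<bar> \<le> \<Phi>) \<longrightarrow>
          \<bar>Y (t + s) - Y t - sinh k / k * s\<bar> \<le> K * \<Phi>)"
    if k: "k1 \<le> k" "k \<le> k2" and \<eta>: "\<eta> \<le> \<eta>1"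
      and H: "\<forall>t n. 0 < a t n \<and> \<bar>p t n\<bar> \<le> \<eta> \<and> \<bar>r t n\<bar> \<le> \<eta> \<and>
        a t n + exp (- r t n) / a t (n + 1) = 2 * cosh k - p t n \<and>
        ((\<lambda>t. a t n) has_real_derivative a t n * (2 * cosh k - p t n - a t n) - exp (- r t (n - 1))) (at t)"
      and I: "\<exists>i j. i < j \<and> 1 \<le> a 0 i \<and> a 0 j < 1" for k \<eta> a p r
  proof -
    define \<alpha> where "\<alpha> = 2 * cosh k"
    have k0: "0 < k" using k k1 by simp
    have "cosh k \<le> cosh k2" using k k0 by (simp add: cosh_real_nonneg_le_iff)
    hence \<alpha>b: "\<alpha> \<le> \<alpha>2" "2 \<le> \<alpha>" using cosh_real_ge_1[of k] by (auto simp: \<alpha>_def \<alpha>2_def)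
    have apos: "0 < a t n" and pb: "\<bar>p t n\<bar> \<le> \<eta>" and rb: "\<bar>r t n\<bar> \<le> \<eta>"
      and rec: "a t n + exp (- r t n) / a t (n + 1) = \<alpha> - p t n"
      and da: "((\<lambda>t. a t n) has_real_derivative a t n * (\<alpha> - p t n - a t n) - exp (- r t (n - 1))) (at t)" for t n
      using H by (simp_all add: \<alpha>_def)
    have \<eta>h: "\<eta> \<le> 1 / 2" "\<eta> \<le> \<eta>0" "\<eta> \<le> ln 2" using \<eta> \<eta>1 by linarith+
    have aup: "a t n \<le> \<alpha>2 + 1" for t n
    proof -
      have "0 < exp (- r t n) / a t (n + 1)" using apos by simp
      thus ?thesis using rec[of t n] pb[of t n] \<alpha>b \<eta>h by linarith
    qed
    have Hk: "\<forall>n. 0 < a t n \<and> \<bar>p t n\<bar> \<le> \<eta>0 \<and> \<bar>r t n\<bar> \<le> \<eta>0 \<and> a t n + exp (- r t n) / a t (n + 1) = 2 * cosh k - p t n" for t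
    proof
      fix n
      show "0 < a t n \<and> \<bar>p t n\<bar> \<le> \<eta>0 \<and> \<bar>r t n\<bar> \<le> \<eta>0 \<and> a t n + exp (- r t n) / a t (n + 1) = 2 * cosh k - p t n"
        using apos[of t n] pb[of t n] rb[of t n] rec[of t n] \<eta>h by (simp add: \<alpha>_def)
    qed
    define U where "U = (\<alpha>2 + 1) * (2 * \<alpha>2 + 2) + 2"
    have U: "0 < U" using \<alpha>20 by (simp add: U_def add_nonneg_pos)
    have er: "exp (- r t n) \<le> 2" for t n
    proof -
      have "exp (- r t n) \<le> exp (ln 2)" using rb[of t n] \<eta>h by (subst exp_le_cancel_iff) linarith
      thus ?thesis by simp
    qed
    have speed: "\<bar>a t n * (\<alpha> - p t n - a t n) - exp (- r t (n - 1))\<bar> \<le> U" for t n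
    proof -
      have "\<bar>\<alpha> - p t n - a t n\<bar> \<le> 2 * \<alpha>2 + 2" using \<alpha>b aup[of t n] apos[of t n] pb[of t n] \<eta>h by linarith
      hence "\<bar>a t n * (\<alpha> - p t n - a t n)\<bar> \<le> (\<alpha>2 + 1) * (2 * \<alpha>2 + 2)"
        unfolding abs_mult using aup[of t n] apos[of t n] \<alpha>20 by (intro mult_mono) auto
      thus ?thesis using er[of t "n - 1"] exp_gt_zero[of "- r t (n - 1)"] unfolding U_def by linarith
    qed
    have lipa: "\<bar>a s n - a t n\<bar> \<le> U * \<bar>s - t\<bar>" for s t n
      by (rule deriv_bound_lipschitz[OF da speed])
    define gap where "gap = min \<beta> (1 - 1 / (1 + \<beta>))"
    have gap: "0 < gap" "gap \<le> \<beta>" "gap \<le> 1 - 1 / (1 + \<beta>)" using \<beta> by (auto simp: gap_def field_simps)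
    (* Within time h no value moves across the gap that perturbed_kink leaves on both sides of the crossing,
       so a crossing persists for time h, and hence for all times. *)
    define h where "h = gap / (2 * U)"
    have h: "0 < h" "U * h < gap" using gap U by (auto simp: h_def)
    define cross where "cross = (\<lambda>t. \<exists>m. 1 \<le> a t m \<and> a t (m + 1) < 1)"
    have cstep: "cross s" if ct: "cross t" and st: "\<bar>s - t\<bar> \<le> h" for s t
    proof -
      obtain m where m: "1 \<le> a t m" "a t (m + 1) < 1" using ct by (auto simp: cross_def)
      have g: "1 + \<beta> \<le> a t (m - 1)" "a t (m + 2) \<le> 1 / (1 + \<beta>)" using conjunct1[OF PK[where k = k and a = "a t" and m = m and p = "p t" and r = "r t", OF k(1) Hk m]] by auto
      have "U * \<bar>s - t\<bar> \<le> U * h" using st U by (intro mult_left_mono) auto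
      hence "1 \<le> a s (m - 1)" "a s (m + 2) < 1"
        using lipa[of s "m - 1" t] lipa[of s "m + 2" t] g h gap by linarith+
      thus ?thesis unfolding cross_def by (rule crossing_between) simp
    qed
    have call: "cross t" if "\<bar>t\<bar> \<le> real j * h" for j t
      using that
    proof (induction j arbitrary: t)
      case 0
      thus ?case using I crossing_between[of "a 0"] by (auto simp: cross_def)
    next
      case (Suc j)
      show ?case
      proof (cases "\<bar>t\<bar> \<le> h")
        case True
        have "cross 0" by (rule Suc.IH) (use h in simp)
        thus ?thesis by (rule cstep) (use True in simp)
      next
        case False
        define t' where "t' = t - sgn t * h"
        have "\<bar>t'\<bar> \<le> real j * h \<and> \<bar>t - t'\<bar> \<le> h"
          using False Suc.prems h unfolding t'_def by (cases "0 < t") (auto simp: sgn_if algebra_simps)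
        thus ?thesis using cstep[OF Suc.IH[of t'], of t] by blast
      qed
    qed
    have cr: "cross t" for t
    proof -
      obtain j where "\<bar>t\<bar> / h \<le> real j" using real_arch_simple by blast
      thus ?thesis using h by (intro call[of t j]) (simp add: field_simps)
    qed
    hence "\<forall>t. \<exists>m. 1 \<le> a t m \<and> a t (m + 1) < 1" by (simp add: cross_def)
    from choice[OF this] obtain m where m: "\<And>t. 1 \<le> a t (m t)" "\<And>t. a t (m t + 1) < 1" by blast
    define Q where "Q = (\<lambda>t y. -1 \<le> of_int (m t) - y \<and> of_int (m t) - y \<le> 1 / 2 \<and> kink k (of_int (m t) - y) = a t (m t) \<and>
        (\<forall>N B F. N \<le> m t \<longrightarrow> (\<forall>F. finite F \<longrightarrow> F \<subseteq> {N..} \<longrightarrow> (\<Sum>n\<in>F. (\<bar>p t n\<bar> + \<bar>r t n\<bar>)\<^sup>2) \<le> B) \<longrightarrow>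
            finite F \<longrightarrow> F \<subseteq> {N..} \<longrightarrow> (\<Sum>n\<in>F. (a t n - kink k (of_int n - y))\<^sup>2) \<le> C * B) \<and>
        (\<forall>n \<Phi>. (\<forall>j. min n (m t) \<le> j \<longrightarrow> j \<le> max n (m t) \<longrightarrow> \<bar>p t j\<bar> + \<bar>r t j\<bar> \<le> \<Phi>) \<longrightarrow>
            \<bar>a t n - kink k (of_int n - y)\<bar> \<le> C * \<Phi>))"
    have "\<forall>t. \<exists>y. Q t y"
      unfolding Q_def
      by (rule allI, rule conjunct2[OF PK, OF k(1) Hk m(1) m(2)])
    from choice[OF this] obtain Y where YQ: "\<And>t. Q t (Y t)" by blast
    note Yc = YQ[unfolded Q_def]
    have Y: "-1 \<le> of_int (m t) - Y t" "of_int (m t) - Y t \<le> 1 / 2" "kink k (of_int (m t) - Y t) = a t (m t)" for t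
      by (rule conjunct1[OF Yc] conjunct1[OF conjunct2[OF Yc]] conjunct1[OF conjunct2[OF conjunct2[OF Yc]]])+
    have Ysum: "\<forall>t N B F. N \<le> m t \<longrightarrow> (\<forall>F. finite F \<longrightarrow> F \<subseteq> {N..} \<longrightarrow> (\<Sum>n\<in>F. (\<bar>p t n\<bar> + \<bar>r t n\<bar>)\<^sup>2) \<le> B) \<longrightarrow>
            finite F \<longrightarrow> F \<subseteq> {N..} \<longrightarrow> (\<Sum>n\<in>F. (a t n - kink k (of_int n - Y t))\<^sup>2) \<le> C * B"
      by (rule allI) (rule conjunct1[OF conjunct2[OF conjunct2[OF conjunct2[OF Yc]]]])
    have Ysup: "\<bar>a t n - kink k (of_int n - Y t)\<bar> \<le> C * \<Phi>"
      if "\<forall>j. min n (m t) \<le> j \<longrightarrow> j \<le> max n (m t) \<longrightarrow> \<bar>p t j\<bar> + \<bar>r t j\<bar> \<le> \<Phi>" for t n \<Phi>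
      by (rule conjunct2[OF conjunct2[OF conjunct2[OF conjunct2[OF Yc[of t]]]], THEN spec[where x = n], THEN spec[where x = \<Phi>], THEN mp, OF that])
    define c where "c = sinh k / k"
    have c: "0 \<le> c" "c \<le> c2"
    proof -
      show "0 \<le> c" using k0 by (simp add: c_def)
      have "sinh k \<le> \<bar>sinh k2\<bar>" using k sinh_real_le_iff[of k k2] by linarith
      thus "c \<le> c2" unfolding c_def c2_def using k k0 k1 by (intro frac_le) auto
    qed
    have incr: "\<bar>Y (t + s) - Y t - c * s\<bar> \<le> K * \<Phi>"
      if s: "0 \<le> s" "s \<le> 1" and J: "J \<le> m t - 1" "J \<le> m (t + s)" and \<Phi>\<eta>: "\<Phi> \<le> 2 * \<eta>"
        and \<Phi>: "\<forall>\<tau> n. t \<le> \<tau> \<longrightarrow> \<tau> \<le> t + 1 \<longrightarrow> J \<le> n \<longrightarrow> \<bar>p \<tau> n\<bar> + \<bar>r \<tau> n\<bar> \<le> \<Phi>" for t s J \<Phi>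
    proof -
      let ?m = "m t"
      have \<Phi>0: "0 \<le> \<Phi>" using \<Phi>[rule_format, of t J] by linarith
      (* The argument, at the site m t, of the kink that leaves the position Y t with speed c. *)
      define z where "z = (\<lambda>\<sigma>. of_int ?m - Y t - c * \<sigma>)"
      define f where "f = (\<lambda>\<sigma>. kink k (z \<sigma>))"
      define A where "A = (\<lambda>\<sigma>. a (t + \<sigma>) ?m)"
      define e where "e = (\<lambda>\<sigma>. A \<sigma> - f \<sigma>)"
      define e' where "e' = (\<lambda>\<sigma>. (A \<sigma> * (\<alpha> - p (t + \<sigma>) ?m - A \<sigma>) - exp (- r (t + \<sigma>) (?m - 1))) - (f \<sigma> * (\<alpha> - f \<sigma>) - 1))"
      have de: "(e has_real_derivative e' \<sigma>) (at \<sigma>)" for \<sigma>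
      proof -
        have sh: "((\<lambda>\<sigma>. t + \<sigma>) has_real_derivative 1) (at \<sigma>)" by (auto intro!: derivative_eq_intros)
        have dA: "(A has_real_derivative (A \<sigma> * (\<alpha> - p (t + \<sigma>) ?m - A \<sigma>) - exp (- r (t + \<sigma>) (?m - 1))) * 1) (at \<sigma>)"
          unfolding A_def by (rule DERIV_chain2[OF da sh])
        have dz: "(z has_real_derivative - c) (at \<sigma>)" unfolding z_def by (auto intro!: derivative_eq_intros)
        have df: "(f has_real_derivative - (k * sinh k * (1 - (tanh (k * z \<sigma>))\<^sup>2)) * - c) (at \<sigma>)"
          unfolding f_def by (rule DERIV_chain2[OF kink_deriv dz])
        have "- (k * sinh k * (1 - (tanh (k * z \<sigma>))\<^sup>2)) * - c = (sinh k)\<^sup>2 * (1 - (tanh (k * z \<sigma>))\<^sup>2)"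
          using k0 by (simp add: c_def power2_eq_square)
        also have "\<dots> = f \<sigma> * (\<alpha> - f \<sigma>) - 1" unfolding f_def \<alpha>_def by (rule kink_riccati)
        finally have "(f has_real_derivative f \<sigma> * (\<alpha> - f \<sigma>) - 1) (at \<sigma>)" using df by simp
        from DERIV_diff[OF dA this] show ?thesis unfolding e_def e'_def by simp
      qed
      have fb: "0 < f \<sigma>" "f \<sigma> \<le> \<alpha>2 + 1" for \<sigma>
      proof -
        show "0 < f \<sigma>" by (simp add: f_def kink_pos)
        have "f \<sigma> + 1 / kink k (z \<sigma> + 1) = \<alpha>" unfolding f_def \<alpha>_def by (rule kink_step)
        moreover have "0 < 1 / kink k (z \<sigma> + 1)" using kink_pos by simp
        ultimately show "f \<sigma> \<le> \<alpha>2 + 1" using \<alpha>b by linarith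
      qed
      have "\<bar>e s\<bar> \<le> ((\<alpha>2 + 3) * \<Phi>) * exp (L1 + 1)"
      proof (rule scalar_gronwall[where e = e and e' = e', OF de])
        fix \<sigma> assume \<sigma>: "0 \<le> \<sigma>" "\<sigma> \<le> s"
        let ?\<tau> = "t + \<sigma>"
        have P: "\<bar>p ?\<tau> ?m\<bar> \<le> \<Phi>" "\<bar>r ?\<tau> (?m - 1)\<bar> \<le> \<Phi>"
          using \<Phi>[rule_format, of ?\<tau> ?m] \<Phi>[rule_format, of ?\<tau> "?m - 1"] \<sigma> s J by auto
        have Ab: "0 < A \<sigma>" "A \<sigma> \<le> \<alpha>2 + 1" by (simp_all add: A_def apos aup)
        have e'eq: "e' \<sigma> = (\<alpha> - A \<sigma> - f \<sigma>) * e \<sigma> - A \<sigma> * p ?\<tau> ?m - (exp (- r ?\<tau> (?m - 1)) - 1)"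
          by (simp add: e'_def e_def algebra_simps)
        have "\<bar>(\<alpha> - A \<sigma> - f \<sigma>) * e \<sigma>\<bar> \<le> L1 * \<bar>e \<sigma>\<bar>"
          unfolding abs_mult using Ab fb[of \<sigma>] \<alpha>b by (intro mult_right_mono) (auto simp: L1_def abs_le_iff)
        moreover have "\<bar>A \<sigma> * p ?\<tau> ?m\<bar> \<le> (\<alpha>2 + 1) * \<Phi>"
          unfolding abs_mult using Ab P \<alpha>20 by (intro mult_mono) auto
        moreover have "\<bar>exp (- r ?\<tau> (?m - 1)) - 1\<bar> \<le> 2 * \<Phi>"
          using exp_minus_one_small(2)[of "r ?\<tau> (?m - 1)" 1] rb[of ?\<tau> "?m - 1"] \<eta>h P by simp
        moreover have "(\<alpha>2 + 3) * \<Phi> = (\<alpha>2 + 1) * \<Phi> + 2 * \<Phi>" by (simp add: algebra_simps)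
        ultimately show "\<bar>e' \<sigma>\<bar> \<le> L1 * \<bar>e \<sigma>\<bar> + (\<alpha>2 + 3) * \<Phi>" unfolding e'eq by linarith
      next
        show "e 0 = 0" using Y(3)[of t] by (simp add: e_def A_def f_def z_def)
      qed (use \<alpha>20 \<Phi>0 L10 s in auto)
      hence E1: "\<bar>A s - kink k (z s)\<bar> \<le> ((\<alpha>2 + 3) * exp (L1 + 1)) * \<Phi>" by (simp add: e_def f_def algebra_simps)
      have E2: "\<bar>A s - kink k (of_int ?m - Y (t + s))\<bar> \<le> C * \<Phi>"
        unfolding A_def
      proof (rule Ysup, intro allI impI)
        fix j assume "min ?m (m (t + s)) \<le> j"
        hence "J \<le> j" using J by simp
        thus "\<bar>p (t + s) j\<bar> + \<bar>r (t + s) j\<bar> \<le> \<Phi>" using \<Phi> s by simp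
      qed
      have D: "\<bar>kink k (z s) - kink k (of_int ?m - Y (t + s))\<bar> \<le> KA * \<Phi>"
        using E1 E2 unfolding KA_def distrib_right by linarith
      have zR: "\<bar>z s\<bar> \<le> R"
      proof -
        have "c * s \<le> c2 * 1" using c s by (intro mult_mono) auto
        moreover have "0 \<le> c * s" using c s by simp
        ultimately show ?thesis unfolding z_def R_def using Y(1,2)[of t] by linarith
      qed
      have "KA * \<Phi> \<le> KA * (2 * (1 / (4 * KA * K')))"
        using \<Phi>\<eta> \<eta> \<eta>1 KA by (intro mult_left_mono) linarith+
      also have "\<dots> = 1 / 2 * (1 / K')" using KA by simp
      also have "\<dots> < 1 / K'" using K' by (simp add: field_simps)
      finally have "\<bar>kink k (z s) - kink k (of_int ?m - Y (t + s))\<bar> < 1 / K'" using D by linarith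
      from IL[OF k zR this] have "\<bar>z s - (of_int ?m - Y (t + s))\<bar> \<le> K' * (KA * \<Phi>)"
        using D K' by (meson mult_left_mono less_imp_le order_trans)
      moreover have "z s - (of_int ?m - Y (t + s)) = Y (t + s) - Y t - c * s" by (simp add: z_def)
      ultimately show ?thesis by (simp add: K_def mult.assoc)
    qed
    have low: "Y t - 1 \<le> of_int (m t)" for t using Y(1)[of t] by linarith
    show ?thesis
    proof (rule exI[of _ m], rule exI[of _ Y], intro conjI)
      show "\<forall>t. Y t - 1 \<le> of_int (m t)" using low by blast
      show "\<forall>t N B F. N \<le> m t \<longrightarrow> (\<forall>F. finite F \<longrightarrow> F \<subseteq> {N..} \<longrightarrow> (\<Sum>n\<in>F. (\<bar>p t n\<bar> + \<bar>r t n\<bar>)\<^sup>2) \<le> B) \<longrightarrow>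
            finite F \<longrightarrow> F \<subseteq> {N..} \<longrightarrow> (\<Sum>n\<in>F. (a t n - kink k (of_int n - Y t))\<^sup>2) \<le> C * B"
        by (rule Ysum)
      show "\<forall>t s J \<Phi>. 0 \<le> s \<longrightarrow> s \<le> 1 \<longrightarrow> J \<le> m t - 1 \<longrightarrow> J \<le> m (t + s) \<longrightarrow> \<Phi> \<le> 2 * \<eta> \<longrightarrow>
          (\<forall>\<tau> n. t \<le> \<tau> \<longrightarrow> \<tau> \<le> t + 1 \<longrightarrow> J \<le> n \<longrightarrow> \<bar>p \<tau> n\<bar> + \<bar>r \<tau> n\<bar> \<le> \<Phi>) \<longrightarrow>
          \<bar>Y (t + s) - Y t - sinh k / k * s\<bar> \<le> K * \<Phi>"
        unfolding c_def[symmetric] by (intro allI impI) (rule incr; assumption)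
    qed
  qed
  show ?thesis
    by (rule exI[of _ \<eta>1], rule conjI[OF \<eta>1(1)], rule exI[of _ K], rule conjI[OF K], rule exI[of _ C],
        rule conjI[OF C], intro allI impI, rule main; assumption)
qed

text \<open>
  On \<open>[j, j + 1]\<close> the increment \<open>h (j + 1) - h j\<close> is added with the profile \<open>3 * u\<^sup>2 - 2 * u ^ 3\<close>; its derivative
  \<open>6 * u * (1 - u)\<close> vanishes at both ends, so the pieces fit together continuously differentiably.
\<close>

lemma smooth_interpolation:
  fixes h :: "int \<Rightarrow> real"
  shows "\<exists>x g. (\<forall>t. (x has_real_derivative c + g t) (at t)) \<and> continuous_on UNIV g \<and>
    (\<forall>t. \<bar>g t\<bar> \<le> 2 * \<bar>h (\<lfloor>t\<rfloor> + 1) - h \<lfloor>t\<rfloor>\<bar>) \<and>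
    (\<forall>t. \<bar>x t - (c * t + h \<lfloor>t\<rfloor>)\<bar> \<le> 2 * \<bar>h (\<lfloor>t\<rfloor> + 1) - h \<lfloor>t\<rfloor>\<bar>)"
proof -
  define \<Delta> where "\<Delta> = (\<lambda>j. h (j + 1) - h j)"
  define g where "g = (\<lambda>t::real. \<Delta> \<lfloor>t\<rfloor> * (6 * (frac t * (1 - frac t))))"
  have piece: "g t = \<Delta> j * (6 * ((t - of_int j) * (1 - (t - of_int j))))" if "of_int j \<le> t" "t \<le> of_int j + 1" for t j
  proof (cases "t = of_int j + 1")
    case False
    hence "\<lfloor>t\<rfloor> = j" using that by (intro floor_unique) auto
    thus ?thesis by (simp add: g_def frac_def)
  next
    case True
    hence "frac t = 0" by (simp add: frac_def)
    thus ?thesis using True by (simp add: g_def)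
  qed
  have prodb: "0 \<le> u * (1 - u)" "u * (1 - u) \<le> 1 / 4" if "0 \<le> u" "u \<le> 1" for u :: real
  proof -
    show "0 \<le> u * (1 - u)" using that by simp
    have "0 \<le> (u - 1 / 2)\<^sup>2" by simp
    also have "\<dots> = 1 / 4 - u * (1 - u)" by (simp add: power2_eq_square algebra_simps)
    finally show "u * (1 - u) \<le> 1 / 4" by simp
  qed
  have gb: "\<bar>g t\<bar> \<le> 2 * \<bar>\<Delta> \<lfloor>t\<rfloor>\<bar>" for t
  proof -
    have f: "0 \<le> frac t" "frac t \<le> 1" using frac_ge_0[of t] frac_lt_1[of t] by auto
    have "\<bar>g t\<bar> = \<bar>\<Delta> \<lfloor>t\<rfloor>\<bar> * (6 * (frac t * (1 - frac t)))"
      using f by (simp add: g_def abs_mult)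
    also have "\<dots> \<le> \<bar>\<Delta> \<lfloor>t\<rfloor>\<bar> * 2" using prodb(2)[OF f] by (intro mult_left_mono) auto
    finally show ?thesis by simp
  qed
  have gcont: "continuous_on UNIV g"
  proof -
    have "isCont g t" for t
    proof -
      define j where "j = \<lfloor>t\<rfloor>"
      have jt: "of_int j \<le> t" "t < of_int j + 1" unfolding j_def by linarith+
      show ?thesis
      proof (cases "t = of_int j")
        case False
        have "eventually (\<lambda>s. s \<in> {of_int j<..<of_int j + 1}) (nhds t)"
          using jt False by (intro eventually_nhds_in_open) auto
        hence "eventually (\<lambda>s. g s = \<Delta> j * (6 * ((s - of_int j) * (1 - (s - of_int j))))) (nhds t)"
          by (rule eventually_mono) (auto intro!: piece)
        hence "isCont g t \<longleftrightarrow> isCont (\<lambda>s. \<Delta> j * (6 * ((s - of_int j) * (1 - (s - of_int j))))) t"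
          by (rule isCont_cong)
        thus ?thesis by simp
      next
        case True
        define D where "D = \<bar>\<Delta> j\<bar> + \<bar>\<Delta> (j - 1)\<bar>"
        have g0: "g t = 0" using piece[of j t] True by simp
        have "eventually (\<lambda>s. s \<in> {of_int j - 1<..<of_int j + 1}) (nhds t)"
          using True by (intro eventually_nhds_in_open) auto
        hence "eventually (\<lambda>s. s \<in> {of_int j - 1<..<of_int j + 1}) (at t)"
          by (simp add: eventually_nhds_conv_at)
        hence "eventually (\<lambda>s. norm (g s) \<le> 6 * D * \<bar>s - t\<bar>) (at t)"
        proof (rule eventually_mono)
          fix s assume s: "s \<in> {real_of_int j - 1<..<real_of_int j + 1}"
          show "norm (g s) \<le> 6 * D * \<bar>s - t\<bar>"
          proof (cases "t \<le> s")
            case True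
            let ?u = "s - of_int j"
            have u: "0 \<le> ?u" "?u \<le> 1" using s True \<open>t = of_int j\<close> by auto
            have "\<bar>g s\<bar> = \<bar>\<Delta> j\<bar> * (6 * (?u * (1 - ?u)))"
              using piece[of j s] u prodb(1)[OF u] by (simp add: abs_mult)
            also have "\<dots> \<le> D * (6 * (?u * 1))"
              using u by (intro mult_mono mult_left_mono) (auto simp: D_def)
            finally show ?thesis using u \<open>t = of_int j\<close> by (simp add: algebra_simps)
          next
            case False
            let ?u = "s - of_int (j - 1)"
            have u: "0 \<le> ?u" "?u \<le> 1" "1 - ?u = \<bar>s - t\<bar>" using s False \<open>t = of_int j\<close> by auto
            have "\<bar>g s\<bar> = \<bar>\<Delta> (j - 1)\<bar> * (6 * (?u * (1 - ?u)))"
              using piece[of "j - 1" s] u prodb(1)[OF u(1,2)] by (simp add: abs_mult)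
            also have "\<dots> \<le> D * (6 * (1 * (1 - ?u)))"
              using u by (intro mult_mono mult_left_mono mult_right_mono) (auto simp: D_def)
            finally show ?thesis unfolding u(3) by simp
          qed
        qed
        moreover have "((\<lambda>s. 6 * D * \<bar>s - t\<bar>) \<longlongrightarrow> 0) (at t)"
        proof -
          have "((\<lambda>s. 6 * D * \<bar>s - t\<bar>) \<longlongrightarrow> 6 * D * \<bar>t - t\<bar>) (at t)" by (intro tendsto_intros)
          thus ?thesis by simp
        qed
        ultimately have "(g \<longlongrightarrow> 0) (at t)" by (rule Lim_null_comparison)
        thus ?thesis using g0 by (simp add: isCont_def)
      qed
    qed
    thus ?thesis by (simp add: continuous_at_imp_continuous_on)
  qed
  have "continuous_on UNIV (\<lambda>t. c + g t)" by (intro continuous_intros gcont)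
  from antiderivative_on_line[OF this] obtain x0 where x0: "x0 0 = 0" "\<And>t. (x0 has_real_derivative c + g t) (at t)" by blast
  define x where "x = (\<lambda>t. x0 t + h 0)"
  have dx: "(x has_real_derivative c + g t) (at t)" for t
    unfolding x_def using DERIV_add[OF x0(2) DERIV_const] by simp
  (* The antiderivative in closed form on one piece; it identifies the values of x at the integers. *)
  define Q where "Q = (\<lambda>j t. c * t + \<Delta> j * (3 * (t - of_int j)\<^sup>2 - 2 * (t - of_int j) ^ 3))"
  have dQ: "(Q j has_real_derivative c + \<Delta> j * (6 * ((t - of_int j) * (1 - (t - of_int j))))) (at t)" for j t
    unfolding Q_def
    by (rule derivative_eq_intros refl | simp)+ (simp add: power2_eq_square algebra_simps)
  have step: "x t - x (of_int j) = Q j t - Q j (of_int j)" if t: "of_int j \<le> t" "t \<le> of_int j + 1" for j t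
  proof (cases "of_int j = t")
    case False
    have "((\<lambda>t. x t - Q j t) has_real_derivative 0) (at s)" if "of_int j \<le> s" "s \<le> t" for s
      using DERIV_diff[OF dx[of s] dQ[of j s]] piece[of j s] that t by simp
    hence "\<exists>z. x t - Q j t - (x (of_int j) - Q j (of_int j)) = (t - of_int j) * 0"
      using MVT2[of "of_int j" t "\<lambda>t. x t - Q j t" "\<lambda>_. 0"] False t by force
    thus ?thesis by simp
  qed simp
  have node_step: "x (of_int (j + 1)) = x (of_int j) + c + \<Delta> j" for j
    using step[of j "of_int (j + 1)"] by (simp add: Q_def algebra_simps)
  have node: "x (of_int j) = c * of_int j + h j" for j
  proof (induction j rule: int_induct[where k = 0])
    case base
    show ?case using x0 by (simp add: x_def)
  next
    case (step1 j)
    thus ?case using node_step[of j] by (simp add: \<Delta>_def algebra_simps)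
  next
    case (step2 j)
    thus ?case using node_step[of "j - 1"] by (simp add: \<Delta>_def algebra_simps)
  qed
  have dev: "\<bar>x t - (c * t + h \<lfloor>t\<rfloor>)\<bar> \<le> 2 * \<bar>\<Delta> \<lfloor>t\<rfloor>\<bar>" for t
  proof -
    let ?j = "\<lfloor>t\<rfloor>" and ?u = "t - of_int \<lfloor>t\<rfloor>"
    have u: "0 \<le> ?u" "?u \<le> 1" by linarith+
    have "x t - (c * t + h ?j) = \<Delta> ?j * (3 * ?u\<^sup>2 - 2 * ?u ^ 3)"
      using step[of ?j t] u unfolding node by (simp add: Q_def algebra_simps)
    moreover have "0 \<le> 3 * ?u\<^sup>2 - 2 * ?u ^ 3 \<and> 3 * ?u\<^sup>2 - 2 * ?u ^ 3 \<le> 2"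
    proof -
      have "?u ^ 3 = ?u\<^sup>2 * ?u" by (simp add: power3_eq_cube power2_eq_square)
      moreover have "?u\<^sup>2 * ?u \<le> ?u\<^sup>2 * 1" using u by (intro mult_left_mono) auto
      moreover have "?u\<^sup>2 \<le> 1" using u by (simp add: abs_square_le_1)
      moreover have "0 \<le> ?u\<^sup>2" by simp
      moreover have "?u * ?u \<le> ?u * 1" using u by (intro mult_left_mono) auto
      moreover have "3 * ?u\<^sup>2 - 2 * (?u\<^sup>2 * ?u) \<le> 2"
      proof -
        have "0 \<le> (1 - ?u)\<^sup>2 * (1 + 2 * ?u)" using u by simp
        also have "\<dots> = 1 - (3 * ?u\<^sup>2 - 2 * (?u\<^sup>2 * ?u))" by (simp add: power2_eq_square algebra_simps)
        finally show ?thesis by simp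
      qed
      ultimately show ?thesis by linarith
    qed
    ultimately have "\<bar>x t - (c * t + h ?j)\<bar> = \<bar>\<Delta> ?j\<bar> * (3 * ?u\<^sup>2 - 2 * ?u ^ 3)"
      and W: "3 * ?u\<^sup>2 - 2 * ?u ^ 3 \<le> 2" by (simp_all add: abs_mult)
    moreover have "\<bar>\<Delta> ?j\<bar> * (3 * ?u\<^sup>2 - 2 * ?u ^ 3) \<le> \<bar>\<Delta> ?j\<bar> * 2"
      using W by (intro mult_left_mono) auto
    ultimately show ?thesis by simp
  qed
  show ?thesis
    by (rule exI[of _ x], rule exI[of _ g]) (use dx gcont gb dev in \<open>simp add: \<Delta>_def\<close>)
qed

section \<open>Solutions in the state space, site by site\<close>

text \<open>
  The bound on finite sums yields convergence, so the default value of a divergent sum does not occur.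
\<close>

lemma l2_norm_on_le:
  assumes B: "0 \<le> B" and S: "\<And>F. finite F \<Longrightarrow> F \<subseteq> A \<Longrightarrow> (\<Sum>n\<in>F. (norm (w n))\<^sup>2) \<le> B\<^sup>2"
  shows "l2_norm_on A w \<le> B"
proof -
  have "(\<lambda>n. (norm (w n))\<^sup>2) summable_on A"
    by (rule nonneg_bdd_above_summable_on) (auto intro!: bdd_aboveI2[where M = "B\<^sup>2"] S)
  hence "(\<Sum>\<^sub>\<infinity>n\<in>A. (norm (w n))\<^sup>2) \<le> B\<^sup>2"
    by (rule infsum_le_finite_sums) (rule S)
  thus ?thesis unfolding l2_norm_on_def using B real_le_lsqrt by blast
qed

lemma l2_finite_sum_le:
  assumes "u \<in> l2" "finite F"
  shows "(\<Sum>n\<in>F. (norm (u n))\<^sup>2) \<le> (l2_norm u)\<^sup>2"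
  unfolding l2_norm_square by (rule finite_sum_le_infsum[OF l2_D[OF assms(1)] assms(2)]) auto

lemma toda_solution_error_l2:
  assumes "toda_solution u"
  shows "(\<lambda>n. (u (t + h) n - u t n) /\<^sub>R h - toda_J (toda_H' (u t)) n) \<in> l2"
proof -
  have "u s \<in> l2" for s using assms by (simp add: toda_solution_def)
  thus ?thesis by (intro l2_diff l2_scaleR toda_J_l2 toda_H'_l2)
qed

text \<open>
  Evaluation at a site is dominated by the \<open>l\<^sup>2\<close> norm, so a derivative in \<open>l\<^sup>2\<close> is a derivative at every site.
\<close>

lemma toda_solution_flow:
  assumes sol: "toda_solution u"
  shows "toda_flow (\<lambda>t n. fst (u t n)) (\<lambda>t n. snd (u t n))"
proof -
  define J where "J = (\<lambda>t. toda_J (toda_H' (u t)))"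
  have lim: "((\<lambda>h. norm ((u (t + h) n - u t n) /\<^sub>R h - J t n)) \<longlongrightarrow> 0) (at 0)" for t n
  proof (rule tendsto_sandwich[OF _ _ tendsto_const])
    show "((\<lambda>h. l2_norm (\<lambda>n. (u (t + h) n - u t n) /\<^sub>R h - J t n)) \<longlongrightarrow> 0) (at 0)"
      using sol by (simp add: toda_solution_def J_def)
    show "eventually (\<lambda>h. norm ((u (t + h) n - u t n) /\<^sub>R h - J t n) \<le> l2_norm (\<lambda>n. (u (t + h) n - u t n) /\<^sub>R h - J t n)) (at 0)"
      unfolding J_def by (intro always_eventually allI norm_le_l2_norm[OF toda_solution_error_l2[OF sol]])
  qed simp
  have dq: "((\<lambda>h. (f (u (t + h) n) - f (u t n)) / h) \<longlongrightarrow> f (J t n)) (at 0)"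
    if f: "\<And>x y. f (x - y) = f x - f y" "\<And>c x. f (c *\<^sub>R x) = c * f x" "\<And>x. \<bar>f x\<bar> \<le> norm x" for f :: "real \<times> real \<Rightarrow> real" and t n
  proof (rule LIM_zero_cancel, rule Lim_null_comparison[OF always_eventually lim[of t n]])
    show "\<forall>h. norm ((f (u (t + h) n) - f (u t n)) / h - f (J t n)) \<le> norm ((u (t + h) n - u t n) /\<^sub>R h - J t n)"
    proof
      fix h
      have "(f (u (t + h) n) - f (u t n)) / h - f (J t n) = f ((u (t + h) n - u t n) /\<^sub>R h - J t n)"
        by (simp add: f(1,2) divide_inverse mult.commute)
      thus "norm ((f (u (t + h) n) - f (u t n)) / h - f (J t n)) \<le> norm ((u (t + h) n - u t n) /\<^sub>R h - J t n)"
        using f(3) by simp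
    qed
  qed
  have abs_snd: "\<bar>snd x\<bar> \<le> norm x" for x :: "real \<times> real"
    using norm_snd_le[of "snd x" "fst x"] by simp
  have "((\<lambda>t. fst (u t n)) has_real_derivative fst (J t n)) (at t)" for t n
    unfolding DERIV_def by (rule dq) (auto intro: abs_fst_le)
  moreover have "((\<lambda>t. snd (u t n)) has_real_derivative snd (J t n)) (at t)" for t n
    unfolding DERIV_def by (rule dq) (auto intro: abs_snd)
  ultimately show ?thesis
    by (simp add: toda_flow_def J_def toda_J_def toda_H'_def deriv_toda_V)
qed

text \<open>
  Differentiability in \<open>l\<^sup>2\<close> bounds the solution near every single time, and compactness of the interval does
  the rest.
\<close>

lemma toda_solution_locally_bounded:
  assumes sol: "toda_solution u"
  shows "\<exists>B. \<forall>t n. \<bar>t\<bar> \<le> T \<longrightarrow> \<bar>fst (u t n)\<bar> \<le> B \<and> \<bar>snd (u t n)\<bar> \<le> B"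
proof -
  have abs_snd: "\<bar>snd x\<bar> \<le> norm x" for x :: "real \<times> real"
    using norm_snd_le[of "snd x" "fst x"] by simp
  have ul2: "u s \<in> l2" for s using sol by (simp add: toda_solution_def)
  define P where "P = (\<lambda>a b. \<exists>B. \<forall>t n. a \<le> t \<longrightarrow> t \<le> b \<longrightarrow> norm (u t n) \<le> B)"
  have loc: "\<exists>d>0. \<forall>a b. a \<le> t \<and> t \<le> b \<and> b - a < d \<longrightarrow> P a b" for t
  proof -
    define J where "J = toda_J (toda_H' (u t))"
    have "((\<lambda>h. l2_norm (\<lambda>n. (u (t + h) n - u t n) /\<^sub>R h - J n)) \<longlongrightarrow> 0) (at 0)"
      using sol by (simp add: toda_solution_def J_def)
    hence "eventually (\<lambda>h. l2_norm (\<lambda>n. (u (t + h) n - u t n) /\<^sub>R h - J n) < 1) (at 0)"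
      by (rule order_tendstoD) simp
    then obtain d where d: "d > 0" "\<And>h. h \<noteq> 0 \<Longrightarrow> \<bar>h\<bar> < d \<Longrightarrow> l2_norm (\<lambda>n. (u (t + h) n - u t n) /\<^sub>R h - J n) < 1"
      by (auto simp: eventually_at dist_real_def)
    define d' where "d' = min d 1"
    have Jl2: "J \<in> l2" unfolding J_def by (intro toda_J_l2 toda_H'_l2 ul2)
    have bd: "norm (u (t + h) n) \<le> l2_norm (u t) + (1 + l2_norm J)" if h: "\<bar>h\<bar> < d'" for h n
    proof (cases "h = 0")
      case True
      thus ?thesis using norm_le_l2_norm[OF ul2, of t n] l2_norm_nonneg[of J] by simp
    next
      case False
      define q where "q = (u (t + h) n - u t n) /\<^sub>R h"
      have "norm (q - J n) \<le> 1"
        unfolding q_def J_def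
        by (rule order_trans[OF norm_le_l2_norm[OF toda_solution_error_l2[OF sol]]])
           (use d(2)[OF False] h in \<open>simp add: d'_def J_def\<close>)
      moreover have "norm q \<le> norm (q - J n) + norm (J n)" using norm_triangle_sub by (metis add.commute)
      moreover have "norm (J n) \<le> l2_norm J" by (rule norm_le_l2_norm[OF Jl2])
      ultimately have q: "norm q \<le> 1 + l2_norm J" by linarith
      have "u (t + h) n = u t n + h *\<^sub>R q" using False by (simp add: q_def)
      hence "norm (u (t + h) n) \<le> norm (u t n) + \<bar>h\<bar> * norm q" by (metis norm_triangle_ineq norm_scaleR)
      moreover have "\<bar>h\<bar> * norm q \<le> 1 * (1 + l2_norm J)" using q h by (intro mult_mono) (auto simp: d'_def)
      ultimately show ?thesis using norm_le_l2_norm[OF ul2, of t n] by simp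
    qed
    have "P a b" if "a \<le> t" "t \<le> b" "b - a < d'" for a b
      unfolding P_def
    proof (intro exI allI impI)
      fix s n assume "a \<le> s" "s \<le> b"
      thus "norm (u s n) \<le> l2_norm (u t) + (1 + l2_norm J)" using bd[of "s - t" n] that by simp
    qed
    moreover have "d' > 0" using d by (simp add: d'_def)
    ultimately show ?thesis by blast
  qed
  have "P (- \<bar>T\<bar>) \<bar>T\<bar>"
  proof (rule Bolzano)
    fix a b c assume ab: "P a b" and bc: "P b c"
    from ab obtain B1 where B1: "\<And>t n. a \<le> t \<Longrightarrow> t \<le> b \<Longrightarrow> norm (u t n) \<le> B1" unfolding P_def by blast
    from bc obtain B2 where B2: "\<And>t n. b \<le> t \<Longrightarrow> t \<le> c \<Longrightarrow> norm (u t n) \<le> B2" unfolding P_def by blast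
    show "P a c" unfolding P_def
    proof (intro exI allI impI)
      fix t n assume "a \<le> t" "t \<le> c"
      thus "norm (u t n) \<le> max B1 B2" using B1[of t n] B2[of t n] by (cases "t \<le> b") auto
    qed
  qed (use loc in auto)
  then obtain B where B: "\<And>t n. - \<bar>T\<bar> \<le> t \<Longrightarrow> t \<le> \<bar>T\<bar> \<Longrightarrow> norm (u t n) \<le> B" unfolding P_def by blast
  show ?thesis
  proof (intro exI allI impI)
    fix t n assume "\<bar>t\<bar> \<le> T"
    hence "norm (u t n) \<le> B" by (intro B) auto
    thus "\<bar>fst (u t n)\<bar> \<le> B \<and> \<bar>snd (u t n)\<bar> \<le> B"
      using abs_fst_le[of "u t n"] abs_snd[of "u t n"] by linarith
  qed
qed

section \<open>Stability of the soliton\<close>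

text \<open>
  With \<open>kappa_soliton_speed\<close>: every positive rate belongs to an admissible speed.
\<close>

lemma soliton_speed_gt_1:
  fixes k :: real
  assumes "0 < k"
  shows "1 < sinh k / k"
proof -
  have "\<exists>z>0. z < k \<and> sinh k - sinh 0 = (k - 0) * cosh z"
    by (rule MVT2[OF assms]) (auto intro!: derivative_eq_intros)
  then obtain z where z: "0 < z" "sinh k = k * cosh z" by auto
  hence "1 < cosh z" using cosh_real_ge_1[of z] cosh_real_one_iff[of z] by linarith
  thus ?thesis using z assms by simp
qed

lemma kappa_soliton_speed:
  fixes k :: real
  assumes "0 < k"
  shows "kappa (sinh k / k) = k"
  using kappa[OF soliton_speed_gt_1[OF assms]] kappa_ex1[OF soliton_speed_gt_1[OF assms]] assms by blast

lemma soliton_speed_lipschitz: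
  fixes k1 k2 :: real
  assumes k1: "0 < k1"
  shows "\<exists>C>0. \<forall>k \<kappa>. k1 \<le> k \<longrightarrow> k \<le> k2 \<longrightarrow> k1 \<le> \<kappa> \<longrightarrow> \<kappa> \<le> k2 \<longrightarrow>
      \<bar>sinh k / k - sinh \<kappa> / \<kappa>\<bar> \<le> C * \<bar>k - \<kappa>\<bar>"
proof -
  define M where "M = \<bar>k2\<bar> * cosh k2 + \<bar>sinh k2\<bar> + 1"
  have "0 \<le> \<bar>k2\<bar> * cosh k2" by simp
  hence M: "0 < M" unfolding M_def by linarith
  define C where "C = M / k1\<^sup>2"
  have C: "0 < C" using M k1 by (simp add: C_def)
  have lip: "\<bar>sinh k / k - sinh \<kappa> / \<kappa>\<bar> \<le> C * \<bar>k - \<kappa>\<bar>"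
    if k: "k1 \<le> k" "k \<le> k2" and \<kappa>: "k1 \<le> \<kappa>" "\<kappa> \<le> k2" for k \<kappa>
  proof -
    have "norm (sinh k / k - sinh \<kappa> / \<kappa>) \<le> C * norm (k - \<kappa>)"
    proof (rule field_differentiable_bound[where S = "{k1..k2}" and f = "\<lambda>x. sinh x / x" and f' = "\<lambda>x. (x * cosh x - sinh x) / x\<^sup>2"])
      fix x assume x: "x \<in> {k1..k2}"
      hence x0: "0 < x" using k1 by simp
      show "((\<lambda>x. sinh x / x) has_field_derivative (x * cosh x - sinh x) / x\<^sup>2) (at x within {k1..k2})"
        using x0 by (auto intro!: derivative_eq_intros simp: power2_eq_square field_simps)
      have "cosh x \<le> cosh k2" "0 \<le> sinh x" "sinh x \<le> sinh k2" using x x0 by (auto simp: cosh_real_nonneg_le_iff)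
      moreover have "x * cosh x \<le> \<bar>k2\<bar> * cosh k2" using calculation x x0 by (intro mult_mono) auto
      moreover have "0 \<le> x * cosh x" using x0 by simp
      ultimately have "\<bar>x * cosh x - sinh x\<bar> \<le> M" unfolding M_def by linarith
      moreover have "k1\<^sup>2 \<le> x\<^sup>2" using x k1 by (intro power_mono) auto
      ultimately have "\<bar>x * cosh x - sinh x\<bar> / x\<^sup>2 \<le> M / k1\<^sup>2" using M k1 by (intro frac_le) auto
      thus "norm ((x * cosh x - sinh x) / x\<^sup>2) \<le> C" by (simp add: C_def)
    qed (use k \<kappa> in auto)
    thus ?thesis by simp
  qed
  show ?thesis using C lip by blast
qed

text \<open>
  The factors are bounded by \<open>\<alpha> - p\<close> from above, being positive, and away from \<open>0\<close> because of the products
  \<open>a n * b (n + 1) = exp (- r n)\<close>.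
\<close>

lemma dressed_locally_bounded:
  fixes r p a b :: "real \<Rightarrow> int \<Rightarrow> real"
  assumes fac: "\<And>t n. 0 < a t n \<and> 0 < b t n \<and> a t n + b t n = \<alpha> - p t n \<and> a t n * b t (n + 1) = exp (- r t n)"
    and B: "\<And>T. \<exists>B. \<forall>t n. \<bar>t\<bar> \<le> T \<longrightarrow> \<bar>r t n\<bar> \<le> B \<and> \<bar>p t n\<bar> \<le> B"
  shows "\<exists>B. \<forall>t n. \<bar>t\<bar> \<le> T \<longrightarrow> \<bar>- ln (a t (n + 1) * b t (n + 1))\<bar> \<le> B \<and> \<bar>\<alpha> - a t n - b t (n + 1)\<bar> \<le> B"
proof -
  obtain B0 where B0: "\<And>t n. \<bar>t\<bar> \<le> T \<Longrightarrow> \<bar>r t n\<bar> \<le> B0 \<and> \<bar>p t n\<bar> \<le> B0" using B[of T] by blast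
  define M where "M = \<bar>\<alpha>\<bar> + \<bar>B0\<bar> + 1"
  have M: "0 < M" by (simp add: M_def add_nonneg_pos)
  define B' where "B' = 2 * (\<bar>B0\<bar> + \<bar>ln M\<bar>) + \<bar>\<alpha>\<bar> + 2 * M"
  have "\<bar>- ln (a t (n + 1) * b t (n + 1))\<bar> \<le> B' \<and> \<bar>\<alpha> - a t n - b t (n + 1)\<bar> \<le> B'" if t: "\<bar>t\<bar> \<le> T" for t n
  proof -
    have pos: "0 < a t j" "0 < b t j" for j using fac[of t j] by auto
    have up: "a t j \<le> M" "b t j \<le> M" for j
    proof -
      have "a t j + b t j \<le> M" using fac[of t j] B0[OF t, of j] unfolding M_def by (simp add: abs_le_iff) linarith
      thus "a t j \<le> M" "b t j \<le> M" using pos[of j] by linarith+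
    qed
    have lup: "ln (a t j) \<le> \<bar>ln M\<bar>" "ln (b t j) \<le> \<bar>ln M\<bar>" for j
    proof -
      have "ln (a t j) \<le> ln M" "ln (b t j) \<le> ln M" using up[of j] pos[of j] M by simp_all
      thus "ln (a t j) \<le> \<bar>ln M\<bar>" "ln (b t j) \<le> \<bar>ln M\<bar>" by linarith+
    qed
    have ls: "ln (a t j) + ln (b t (j + 1)) = - r t j" for j
    proof -
      have "ln (a t j * b t (j + 1)) = - r t j" using fac[of t j] by simp
      thus ?thesis using pos by (simp add: ln_mult_pos)
    qed
    have "\<bar>r t j\<bar> \<le> \<bar>B0\<bar>" for j using B0[OF t, of j] by linarith
    hence llow: "- \<bar>B0\<bar> - \<bar>ln M\<bar> \<le> ln (a t (n + 1))" "- \<bar>B0\<bar> - \<bar>ln M\<bar> \<le> ln (b t (n + 1))"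
      using ls[of "n + 1"] ls[of n] lup(2)[of "n + 1 + 1"] lup(1)[of n] by (smt (verit))+
    have "ln (a t (n + 1) * b t (n + 1)) = ln (a t (n + 1)) + ln (b t (n + 1))" using pos by (simp add: ln_mult_pos)
    hence "\<bar>- ln (a t (n + 1) * b t (n + 1))\<bar> \<le> 2 * (\<bar>B0\<bar> + \<bar>ln M\<bar>)"
      using llow lup(1)[of "n + 1"] lup(2)[of "n + 1"] by (smt (verit))
    moreover have "\<bar>\<alpha> - a t n - b t (n + 1)\<bar> \<le> \<bar>\<alpha>\<bar> + 2 * M"
      using up(1)[of n] up(2)[of "n + 1"] pos(1)[of n] pos(2)[of "n + 1"] by linarith
    ultimately show ?thesis using M unfolding B'_def by linarith
  qed
  thus ?thesis by blast
qed

lemma near_kink_crosses: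
  fixes a :: "int \<Rightarrow> real"
  assumes k: "0 < k1" "k1 \<le> k" and near: "\<And>n. \<bar>a n - kink k (of_int n - x0)\<bar> \<le> e"
    and e: "e < cosh k1 - 1" "e < 1 - 1 / cosh k1"
  shows "\<exists>i j. i < j \<and> 1 \<le> a i \<and> a j < 1"
proof (rule exI[of _ "\<lfloor>x0\<rfloor>"], rule exI[of _ "\<lceil>x0\<rceil> + 1"], intro conjI)
  have k0: "0 < k" using k by simp
  have c: "cosh k1 \<le> cosh k" using k by (simp add: cosh_real_nonneg_le_iff)
  have c1: "1 \<le> cosh k1" by (rule cosh_real_ge_1)
  show "\<lfloor>x0\<rfloor> < \<lceil>x0\<rceil> + 1" by linarith
  have "kink k 0 \<le> kink k (of_int \<lfloor>x0\<rfloor> - x0)" by (rule kink_antimono[OF k0]) linarith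
  moreover have "kink k 0 = cosh k" by (simp add: kink_def)
  ultimately show "1 \<le> a \<lfloor>x0\<rfloor>" using near[of "\<lfloor>x0\<rfloor>"] e c by linarith
  have "kink k (of_int (\<lceil>x0\<rceil> + 1) - x0) \<le> kink k 1" using le_of_int_ceiling[of x0] by (intro kink_antimono[OF k0]) simp
  moreover have "kink k 1 \<le> 1 / cosh k1" using c c1 by (simp add: kink_def field_simps)
  ultimately show "a (\<lceil>x0\<rceil> + 1) < 1" using near[of "\<lceil>x0\<rceil> + 1"] e by linarith
qed

text \<open>
  \<open>Y\<close> may jump, but its increments over times up to \<open>1\<close> are nearly \<open>c * s\<close>. Interpolating its values at the
  integers gives a continuously differentiable position with the same asymptotics.
\<close>

lemma position_regularization:
  fixes Y :: "real \<Rightarrow> real"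
  assumes inc: "\<And>t s. 0 \<le> s \<Longrightarrow> s \<le> 1 \<Longrightarrow> \<bar>Y (t + s) - Y t - c * s\<bar> \<le> D"
    and asym: "\<And>e. 0 < e \<Longrightarrow> \<exists>T. \<forall>t\<ge>T. \<forall>s. 0 \<le> s \<longrightarrow> s \<le> 1 \<longrightarrow> \<bar>Y (t + s) - Y t - c * s\<bar> \<le> e"
  shows "\<exists>x. x C1_differentiable_on UNIV \<and> (\<forall>t. \<bar>x t - Y t\<bar> \<le> 3 * D) \<and> (\<forall>t. \<bar>deriv x t - c\<bar> \<le> 2 * D) \<and>
      (deriv x \<longlongrightarrow> c) at_top \<and> ((\<lambda>t. x t - Y t) \<longlongrightarrow> 0) at_top"
proof -
  define h where "h = (\<lambda>j::int. Y (of_int j) - c * of_int j)"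
  obtain x g where dx: "\<And>t. (x has_real_derivative c + g t) (at t)" and gc: "continuous_on UNIV g"
    and gb: "\<And>t. \<bar>g t\<bar> \<le> 2 * \<bar>h (\<lfloor>t\<rfloor> + 1) - h \<lfloor>t\<rfloor>\<bar>"
    and xb: "\<And>t. \<bar>x t - (c * t + h \<lfloor>t\<rfloor>)\<bar> \<le> 2 * \<bar>h (\<lfloor>t\<rfloor> + 1) - h \<lfloor>t\<rfloor>\<bar>"
    using smooth_interpolation[of c h] by blast
  have dxe: "deriv x t = c + g t" for t using dx by (rule DERIV_imp_deriv)
  have hd: "h (j + 1) - h j = Y (of_int j + 1) - Y (of_int j) - c * 1" for j by (simp add: h_def algebra_simps)
  have est: "\<bar>g t\<bar> \<le> 2 * e \<and> \<bar>x t - Y t\<bar> \<le> 3 * e"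
    if E: "\<And>s. 0 \<le> s \<Longrightarrow> s \<le> 1 \<Longrightarrow> \<bar>Y (of_int \<lfloor>t\<rfloor> + s) - Y (of_int \<lfloor>t\<rfloor>) - c * s\<bar> \<le> e" for t e
  proof -
    have 1: "\<bar>h (\<lfloor>t\<rfloor> + 1) - h \<lfloor>t\<rfloor>\<bar> \<le> e" unfolding hd by (rule E) auto
    define s where "s = t - of_int \<lfloor>t\<rfloor>"
    have s: "0 \<le> s" "s \<le> 1" unfolding s_def by linarith+
    have "Y t - (c * t + h \<lfloor>t\<rfloor>) = Y (of_int \<lfloor>t\<rfloor> + s) - Y (of_int \<lfloor>t\<rfloor>) - c * s"
      by (simp add: h_def s_def algebra_simps)
    hence 2: "\<bar>Y t - (c * t + h \<lfloor>t\<rfloor>)\<bar> \<le> e" using E[OF s] by simp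
    show ?thesis using 1 2 gb[of t] xb[of t] by (smt (verit))
  qed
  have all: "\<bar>g t\<bar> \<le> 2 * D \<and> \<bar>x t - Y t\<bar> \<le> 3 * D" for t by (rule est) (rule inc)
  have ev: "eventually (\<lambda>t. \<bar>g t\<bar> < e \<and> \<bar>x t - Y t\<bar> < e) at_top" if e: "0 < e" for e
  proof -
    obtain T where T: "\<And>t s. T \<le> t \<Longrightarrow> 0 \<le> s \<Longrightarrow> s \<le> 1 \<Longrightarrow> \<bar>Y (t + s) - Y t - c * s\<bar> \<le> e / 4"
      using asym[of "e / 4"] e by auto
    show ?thesis
    proof (rule eventually_at_top_linorderI[of "T + 1"])
      fix t assume "T + 1 \<le> t"
      hence "T \<le> of_int \<lfloor>t\<rfloor>" by linarith
      hence "\<bar>g t\<bar> \<le> 2 * (e / 4) \<and> \<bar>x t - Y t\<bar> \<le> 3 * (e / 4)" by (intro est T)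
      thus "\<bar>g t\<bar> < e \<and> \<bar>x t - Y t\<bar> < e" using e by linarith
    qed
  qed
  have "x C1_differentiable_on UNIV"
    unfolding C1_differentiable_on_def
    by (rule exI[of _ "\<lambda>t. c + g t"])
       (use dx gc in \<open>auto simp: has_real_derivative_iff_has_vector_derivative intro!: continuous_intros\<close>)
  moreover have "(deriv x \<longlongrightarrow> c) at_top"
    by (rule tendstoI, rule eventually_mono[OF ev]) (auto simp: dxe dist_real_def)
  moreover have "((\<lambda>t. x t - Y t) \<longlongrightarrow> 0) at_top"
    by (rule tendstoI, rule eventually_mono[OF ev]) (auto simp: dist_real_def)
  ultimately show ?thesis using all by (intro exI[of _ x]) (simp add: dxe)
qed

lemma drift_lower_bound:
  fixes Y :: "real \<Rightarrow> real"
  assumes inc: "\<And>t s. 0 \<le> s \<Longrightarrow> s \<le> 1 \<Longrightarrow> \<bar>Y (t + s) - Y t - c * s\<bar> \<le> D" and c: "0 \<le> c" "D \<le> c" and t: "0 \<le> t"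
  shows "Y 0 + (c - D) * (t - 1) - D \<le> Y t"
proof -
  have n: "Y 0 + (c - D) * real n \<le> Y (real n)" for n
  proof (induction n)
    case (Suc n)
    thus ?case using inc[of 1 "real n"] by (simp add: algebra_simps)
  qed simp
  define j where "j = nat \<lfloor>t\<rfloor>"
  define s where "s = t - real j"
  have s: "0 \<le> s" "s \<le> 1" using t unfolding s_def j_def by linarith+
  have "0 \<le> c * s" using c s by simp
  hence "Y (real j) - D \<le> Y t" using inc[OF s, of "real j"] by (simp add: s_def)
  moreover have "(c - D) * (t - 1) \<le> (c - D) * real j" using c s by (intro mult_left_mono) (auto simp: s_def)
  ultimately show ?thesis using n[of j] by linarith
qed

lemma norm_triangle3_square:
  fixes A B C D :: "'a :: real_normed_vector"
  shows "(norm (A - D))\<^sup>2 \<le> 3 * (norm (A - B))\<^sup>2 + 3 * (norm (B - C))\<^sup>2 + 3 * (norm (C - D))\<^sup>2"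
proof -
  have "norm (A - D) \<le> norm (A - B) + norm (B - C) + norm (C - D)"
    using norm_triangle_ineq[of "A - B" "B - C"] norm_triangle_ineq[of "A - C" "C - D"] by simp
  hence "(norm (A - D))\<^sup>2 \<le> (norm (A - B) + norm (B - C) + norm (C - D))\<^sup>2" by (intro power_mono) auto
  thus ?thesis using square_add3_le by (rule order_trans)
qed

lemma norm_triangle2_square:
  fixes A B C :: "'a :: real_normed_vector"
  shows "(norm (A - C))\<^sup>2 \<le> 2 * (norm (A - B))\<^sup>2 + 2 * (norm (B - C))\<^sup>2"
proof -
  have "norm (A - C) \<le> norm (A - B) + norm (B - C)"
    using norm_triangle_ineq[of "A - B" "B - C"] by simp
  hence "(norm (A - C))\<^sup>2 \<le> (norm (A - B) + norm (B - C))\<^sup>2" by (intro power_mono) auto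
  thus ?thesis using square_add_le by (rule order_trans)
qed

text \<open>
  The main statement for the sequences themselves, with the state norm expressed by finite sums. The
  constant \<open>g\<close> separates the relevant speeds: the radiation stays behind \<open>(1 + 2 * g) * t\<close>, the state is observed
  ahead of \<open>\<sigma> * t = (1 + 3 * g) * t\<close>, the soliton is eventually beyond \<open>(1 + 4 * g) * t\<close>, and its speed is at least
  \<open>1 + 6 * g\<close>. For all this \<open>\<nu>\<close> has to be small compared with \<open>g\<close>.
\<close>

lemma stability_of_sequences:
  assumes c0: "1 < c0"
  shows "\<exists>\<delta>>0. \<exists>C>0. \<forall>\<nu> x0 r p. 0 \<le> \<nu> \<longrightarrow> \<nu> < \<delta> \<longrightarrow> toda_flow r p \<longrightarrow>
      (\<forall>T. \<exists>B. \<forall>t n. \<bar>t\<bar> \<le> T \<longrightarrow> \<bar>r t n\<bar> \<le> B \<and> \<bar>p t n\<bar> \<le> B) \<longrightarrow>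
      (\<forall>F. finite F \<longrightarrow> (\<Sum>n\<in>F. (r 0 n - fst (sol (kappa c0) (of_int n - x0)))\<^sup>2 + (p 0 n - snd (sol (kappa c0) (of_int n - x0)))\<^sup>2) \<le> \<nu>\<^sup>2) \<longrightarrow>
    (\<exists>k \<sigma> x. 0 < k \<and> 1 < \<sigma> \<and> \<sigma> < sinh k / k \<and> x C1_differentiable_on UNIV \<and>
      (\<forall>t F. finite F \<longrightarrow> (\<Sum>n\<in>F. (norm ((r t n, p t n) - sol (kappa c0) (of_int n - x t)))\<^sup>2) \<le> (C * \<nu>)\<^sup>2) \<and>
      (\<forall>e>0. \<exists>T. \<forall>t\<ge>T. \<forall>F. finite F \<longrightarrow> F \<subseteq> {n. \<sigma> * t \<le> of_int n} \<longrightarrow>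
        (\<Sum>n\<in>F. (norm ((r t n, p t n) - sol k (of_int n - x t)))\<^sup>2) \<le> e) \<and>
      \<bar>sinh k / k - c0\<bar> \<le> C * \<nu> \<and> (\<forall>t. \<bar>deriv x t - c0\<bar> \<le> C * \<nu>) \<and> (deriv x \<longlongrightarrow> sinh k / k) at_top)"
proof -
  define \<kappa>0 where "\<kappa>0 = kappa c0"
  have \<kappa>0: "0 < \<kappa>0" "sinh \<kappa>0 / \<kappa>0 = c0" using kappa[OF c0] by (auto simp: \<kappa>0_def)
  define k1 where "k1 = \<kappa>0 / 2"
  define k2 where "k2 = 2 * \<kappa>0"
  have kk: "0 < k1" "k1 < \<kappa>0" "\<kappa>0 < k2" using \<kappa>0 by (auto simp: k1_def k2_def)
  obtain \<delta>1 C1 where \<delta>1: "\<delta>1 > 0" and C1: "C1 > 0" and NF: "\<forall>x0 p r \<nu>. 0 \<le> \<nu> \<longrightarrow> \<nu> < \<delta>1 \<longrightarrow>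
      (\<forall>F. finite F \<longrightarrow> (\<Sum>n\<in>F. (r n - fst (sol \<kappa>0 (of_int n - x0)))\<^sup>2 + (p n - snd (sol \<kappa>0 (of_int n - x0)))\<^sup>2) \<le> \<nu>\<^sup>2) \<longrightarrow>
    (\<exists>k a b. k1 \<le> k \<and> k \<le> k2 \<and> \<bar>k - \<kappa>0\<bar> \<le> C1 * \<nu> \<and>
      (\<forall>n. 0 < a n \<and> 0 < b n \<and> a n + b n = 2 * cosh k - p n \<and> a n * b (n + 1) = exp (- r n)) \<and>
      (\<forall>n. \<bar>a n - kink k (of_int n - x0)\<bar> \<le> C1 * \<nu>) \<and>
      (\<forall>F. finite F \<longrightarrow> (\<Sum>n\<in>F. (ln (a (n + 1) * b (n + 1)))\<^sup>2 + (2 * cosh k - a n - b (n + 1))\<^sup>2) \<le> (C1 * \<nu>)\<^sup>2))"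
    using near_soliton_factorization[OF kk] by (elim exE conjE) (rule that; assumption)
  obtain \<eta>1 K C2 where \<eta>1: "\<eta>1 > 0" and K: "K > 0" and C2: "C2 > 0" and KT: "\<forall>k \<eta> a p r. k1 \<le> k \<longrightarrow> k \<le> k2 \<longrightarrow> \<eta> \<le> \<eta>1 \<longrightarrow>
      (\<forall>t n. 0 < a t n \<and> \<bar>p t n\<bar> \<le> \<eta> \<and> \<bar>r t n\<bar> \<le> \<eta> \<and>
        a t n + exp (- r t n) / a t (n + 1) = 2 * cosh k - p t n \<and>
        ((\<lambda>t. a t n) has_real_derivative a t n * (2 * cosh k - p t n - a t n) - exp (- r t (n - 1))) (at t)) \<longrightarrow>
      (\<exists>i j. i < j \<and> 1 \<le> a 0 i \<and> a 0 j < 1) \<longrightarrow>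
    (\<exists>m Y. (\<forall>t. Y t - 1 \<le> of_int (m t)) \<and>
      (\<forall>t N B F. N \<le> m t \<longrightarrow> (\<forall>F. finite F \<longrightarrow> F \<subseteq> {N..} \<longrightarrow> (\<Sum>n\<in>F. (\<bar>p t n\<bar> + \<bar>r t n\<bar>)\<^sup>2) \<le> B) \<longrightarrow>
            finite F \<longrightarrow> F \<subseteq> {N..} \<longrightarrow> (\<Sum>n\<in>F. (a t n - kink k (of_int n - Y t))\<^sup>2) \<le> C2 * B) \<and>
      (\<forall>t s J \<Phi>. 0 \<le> s \<longrightarrow> s \<le> 1 \<longrightarrow> J \<le> m t - 1 \<longrightarrow> J \<le> m (t + s) \<longrightarrow> \<Phi> \<le> 2 * \<eta> \<longrightarrow>
          (\<forall>\<tau> n. t \<le> \<tau> \<longrightarrow> \<tau> \<le> t + 1 \<longrightarrow> J \<le> n \<longrightarrow> \<bar>p \<tau> n\<bar> + \<bar>r \<tau> n\<bar> \<le> \<Phi>) \<longrightarrow>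
          \<bar>Y (t + s) - Y t - sinh k / k * s\<bar> \<le> K * \<Phi>))"
    using kink_trajectory[OF kk(1), of k2] by (elim exE conjE) (rule that; assumption)
  obtain C3 where C3: "C3 > 0" and SK: "\<forall>k a b p r N B y. k1 \<le> k \<longrightarrow> k \<le> k2 \<longrightarrow>
      (\<forall>n::int. 0 < a n \<and> 0 < b n \<and> \<bar>p n\<bar> \<le> 1 \<and> \<bar>r n\<bar> \<le> ln 2 \<and>
        a n + b (n + 1) = 2 * cosh k - p n \<and> a n * b n = exp (- r (n - 1))) \<longrightarrow>
      (\<forall>F. finite F \<longrightarrow> F \<subseteq> {N..} \<longrightarrow> (\<Sum>n\<in>F. (\<bar>p n\<bar> + \<bar>r n\<bar>)\<^sup>2) \<le> B) \<longrightarrow>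
      (\<forall>F. finite F \<longrightarrow> F \<subseteq> {N..} \<longrightarrow> (\<Sum>n\<in>F. (a n - kink k (of_int n - y))\<^sup>2) \<le> C2 * B) \<longrightarrow>
      (\<forall>F. finite F \<longrightarrow> F \<subseteq> {N + 1..} \<longrightarrow>
        (\<Sum>n\<in>F. (norm ((- ln (a n * b (n + 1)), 2 * cosh k - a n - b n) - sol k (of_int n - y)))\<^sup>2) \<le> C3 * B)"
    using soliton_from_kink[OF kk(1) C2, of k2] by (elim exE conjE) (rule that; assumption)
  obtain CL where CL: "CL > 0" and SL: "\<forall>k k' x x' F. k1 \<le> k \<longrightarrow> k \<le> k2 \<longrightarrow> k1 \<le> k' \<longrightarrow> k' \<le> k2 \<longrightarrow> \<bar>x - x'\<bar> \<le> 1 \<longrightarrow> finite F \<longrightarrow>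
      (\<Sum>n\<in>F. (norm (sol k' (of_int n - x') - sol k (of_int n - x)))\<^sup>2) \<le> (CL * (\<bar>k' - k\<bar> + \<bar>x' - x\<bar>))\<^sup>2"
    using sol_lipschitz_l2[OF kk(1), of k2] by (elim exE conjE) (rule that; assumption)
  obtain C9 where C9: "C9 > 0" and SP: "\<forall>k \<kappa>. k1 \<le> k \<longrightarrow> k \<le> k2 \<longrightarrow> k1 \<le> \<kappa> \<longrightarrow> \<kappa> \<le> k2 \<longrightarrow>
      \<bar>sinh k / k - sinh \<kappa> / \<kappa>\<bar> \<le> C9 * \<bar>k - \<kappa>\<bar>"
    using soliton_speed_lipschitz[OF kk(1), of k2] by (elim exE conjE) (rule that; assumption)
  define g where "g = (c0 - 1) / 8"
  have g: "0 < g" using c0 by (simp add: g_def)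
  define \<mu> where "\<mu> = ln (1 + g) / 4"
  have \<mu>: "0 < \<mu>" using g by (simp add: \<mu>_def)
  define d0 where "d0 = min (cosh k1 - 1) (1 - 1 / cosh k1)"
  have "1 < cosh k1" using kk(1) cosh_real_ge_1[of k1] cosh_real_one_iff[of k1] by linarith
  hence d0: "0 < d0" by (simp add: d0_def)
  define S where "S = {\<delta>1, 1 / (10 * C1), \<eta>1 / (5 * C1), 2 * \<mu> / (5 * C1), d0 / C1, 1 / (30 * K * C1), g / (10 * K * C1), 2 * g / (C9 * C1), ln 2 / (5 * C1)}"
  define \<delta> where "\<delta> = Min S"
  have S: "finite S" "S \<noteq> {}" by (simp_all add: S_def)
  have "\<forall>d\<in>S. 0 < d" using \<delta>1 C1 \<eta>1 \<mu> d0 K g C9 by (simp add: S_def)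
  hence \<delta>: "0 < \<delta>" unfolding \<delta>_def Min_gr_iff[OF S] .
  define C8 where "C8 = sqrt (3 * (50 * C3 * C1\<^sup>2) + 3 * (CL * (30 * K * C1))\<^sup>2 + 3 * (CL * C1)\<^sup>2)"
  define C where "C = C8 + C9 * C1 + 20 * K * C1 + 1"
  have C80: "0 \<le> C8" and C8sq: "C8\<^sup>2 = 3 * (50 * C3 * C1\<^sup>2) + 3 * (CL * (30 * K * C1))\<^sup>2 + 3 * (CL * C1)\<^sup>2"
    using C3 by (simp_all add: C8_def)
  have Cp: "0 \<le> C9 * C1" "0 \<le> 20 * K * C1" using C9 C1 K by auto
  have C: "0 < C" "C8 \<le> C" "C9 * C1 \<le> C" "C9 * C1 + 20 * K * C1 \<le> C" using C80 Cp unfolding C_def by linarith+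
  have main: "\<exists>k \<sigma> x. 0 < k \<and> 1 < \<sigma> \<and> \<sigma> < sinh k / k \<and> x C1_differentiable_on UNIV \<and>
      (\<forall>t F. finite F \<longrightarrow> (\<Sum>n\<in>F. (norm ((r t n, p t n) - sol \<kappa>0 (of_int n - x t)))\<^sup>2) \<le> (C * \<nu>)\<^sup>2) \<and>
      (\<forall>e>0. \<exists>T. \<forall>t\<ge>T. \<forall>F. finite F \<longrightarrow> F \<subseteq> {n. \<sigma> * t \<le> of_int n} \<longrightarrow>
        (\<Sum>n\<in>F. (norm ((r t n, p t n) - sol k (of_int n - x t)))\<^sup>2) \<le> e) \<and>
      \<bar>sinh k / k - c0\<bar> \<le> C * \<nu> \<and> (\<forall>t. \<bar>deriv x t - c0\<bar> \<le> C * \<nu>) \<and> (deriv x \<longlongrightarrow> sinh k / k) at_top"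
    if \<nu>: "0 \<le> \<nu>" "\<nu> < \<delta>" and flow: "toda_flow r p"
      and Bd: "\<forall>T. \<exists>B. \<forall>t n. \<bar>t\<bar> \<le> T \<longrightarrow> \<bar>r t n\<bar> \<le> B \<and> \<bar>p t n\<bar> \<le> B"
      and init: "\<forall>F. finite F \<longrightarrow> (\<Sum>n\<in>F. (r 0 n - fst (sol \<kappa>0 (of_int n - x0)))\<^sup>2 + (p 0 n - snd (sol \<kappa>0 (of_int n - x0)))\<^sup>2) \<le> \<nu>\<^sup>2"
    for \<nu> x0 r p
  proof -
    define \<eta> where "\<eta> = C1 * \<nu>"
    have \<eta>0: "0 \<le> \<eta>" using \<nu> C1 by (simp add: \<eta>_def)
    have "\<nu> < \<delta>1" "\<nu> < 1 / (10 * C1)" "\<nu> < \<eta>1 / (5 * C1)" "\<nu> < 2 * \<mu> / (5 * C1)" "\<nu> < d0 / C1" "\<nu> < 1 / (30 * K * C1)"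
      "\<nu> < g / (10 * K * C1)" "\<nu> < 2 * g / (C9 * C1)" "\<nu> < ln 2 / (5 * C1)"
      using \<nu>(2) unfolding \<delta>_def Min_gr_iff[OF S] by (simp_all only: S_def ball_simps)
    hence small: "\<nu> < \<delta>1" "\<eta> \<le> 1 / 10" "5 * \<eta> \<le> \<eta>1" "5 * \<eta> \<le> 2 * \<mu>" "\<eta> < d0" "30 * K * \<eta> \<le> 1" "10 * K * \<eta> \<le> g" "C9 * \<eta> \<le> 2 * g" "5 * \<eta> \<le> ln 2"
      using C1 K C9 by (simp_all add: \<eta>_def field_simps)
    obtain k a0 b0 where k: "k1 \<le> k" "k \<le> k2" and k\<kappa>: "\<bar>k - \<kappa>0\<bar> \<le> C1 * \<nu>"
      and fac0: "\<forall>n. 0 < a0 n \<and> 0 < b0 n \<and> a0 n + b0 n = 2 * cosh k - p 0 n \<and> a0 n * b0 (n + 1) = exp (- r 0 n)"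
      and near0: "\<forall>n. \<bar>a0 n - kink k (of_int n - x0)\<bar> \<le> C1 * \<nu>"
      and sum0: "\<forall>F. finite F \<longrightarrow> (\<Sum>n\<in>F. (ln (a0 (n + 1) * b0 (n + 1)))\<^sup>2 + (2 * cosh k - a0 n - b0 (n + 1))\<^sup>2) \<le> (C1 * \<nu>)\<^sup>2"
      using NF[THEN spec[where x = x0], THEN spec[where x = "p 0"], THEN spec[where x = "r 0"], THEN spec[where x = \<nu>],
          THEN mp, THEN mp, THEN mp, OF \<nu>(1) small(1) init]
      by (elim exE conjE) (rule that; assumption)
    have k0: "0 < k" using k kk by linarith
    define \<alpha> where "\<alpha> = 2 * cosh k"
    have Bd': "\<exists>B. \<forall>t n. \<bar>t\<bar> \<le> T \<longrightarrow> \<bar>r t n\<bar> \<le> B \<and> \<bar>p t n\<bar> \<le> B" for T using Bd by (rule spec)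
    have "\<exists>a b. a 0 = a0 \<and> b 0 = b0 \<and>
        (\<forall>t n. 0 < a t n \<and> 0 < b t n \<and> a t n + b t n = \<alpha> - p t n \<and> a t n * b t (n + 1) = exp (- r t n)) \<and>
        (\<forall>t n. ((\<lambda>t. a t n) has_real_derivative a t n * (b t (n + 1) - b t n)) (at t)) \<and>
        (\<forall>t n. ((\<lambda>t. b t n) has_real_derivative b t n * (a t n - a t (n - 1))) (at t))"
      by (rule darboux_transformation[OF flow Bd']) (use fac0 in \<open>simp add: \<alpha>_def\<close>)
    then obtain a b where ab0: "a 0 = a0" "b 0 = b0"
      and fac: "\<And>t n. 0 < a t n \<and> 0 < b t n \<and> a t n + b t n = \<alpha> - p t n \<and> a t n * b t (n + 1) = exp (- r t n)"
      and da: "\<And>t n. ((\<lambda>t. a t n) has_real_derivative a t n * (b t (n + 1) - b t n)) (at t)"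
      and db: "\<And>t n. ((\<lambda>t. b t n) has_real_derivative b t n * (a t n - a t (n - 1))) (at t)" by blast
    have pos: "0 < a t n" "0 < b t n" for t n using fac[of t n] by auto
    define r' where "r' = (\<lambda>t n. - ln (a t (n + 1) * b t (n + 1)))"
    define p' where "p' = (\<lambda>t n. \<alpha> - a t n - b t (n + 1))"
    have flow': "toda_flow r' p'" unfolding r'_def p'_def
      by (rule transformed_toda_flow) (use pos da db in auto)
    have Bd2: "\<exists>B. \<forall>t n. \<bar>t\<bar> \<le> T \<longrightarrow> \<bar>r' t n\<bar> \<le> B \<and> \<bar>p' t n\<bar> \<le> B" for T
      unfolding r'_def p'_def by (rule dressed_locally_bounded[where a = a and b = b and \<alpha> = \<alpha>, OF fac Bd'])
    have init': "\<forall>F. finite F \<longrightarrow> (\<Sum>n\<in>F. (r' 0 n)\<^sup>2 + (p' 0 n)\<^sup>2) \<le> \<eta>\<^sup>2"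
      using sum0 by (simp add: r'_def p'_def ab0 \<eta>_def \<alpha>_def)
    note sd = toda_small_data[OF flow' Bd2 init' \<eta>0 small(2)]
    have er': "exp (- r' t (n - 1)) = a t n * b t n" for t n using pos[of t n] by (simp add: r'_def)
    have er'2: "exp (- r' t n) = a t (n + 1) * b t (n + 1)" for t n using er'[of t "n + 1"] by simp
    (* Bounds the transformed solution for all times. *)
    define E where "E = 5 * \<eta>"
    have KH: "\<forall>t n. 0 < a t n \<and> \<bar>p' t n\<bar> \<le> E \<and> \<bar>r' t n\<bar> \<le> E \<and>
        a t n + exp (- r' t n) / a t (n + 1) = 2 * cosh k - p' t n \<and>
        ((\<lambda>t. a t n) has_real_derivative a t n * (2 * cosh k - p' t n - a t n) - exp (- r' t (n - 1))) (at t)"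
    proof (intro allI conjI)
      fix t n
      show "0 < a t n" by (rule pos)
      show "\<bar>p' t n\<bar> \<le> E" "\<bar>r' t n\<bar> \<le> E" unfolding E_def by (rule sd)+
      show "a t n + exp (- r' t n) / a t (n + 1) = 2 * cosh k - p' t n"
        using pos(1)[of t "n + 1"] unfolding er'2 by (simp add: p'_def \<alpha>_def)
      have "a t n * (2 * cosh k - p' t n - a t n) - exp (- r' t (n - 1)) = a t n * (b t (n + 1) - b t n)"
        unfolding er' by (simp add: p'_def \<alpha>_def algebra_simps)
      thus "((\<lambda>t. a t n) has_real_derivative a t n * (2 * cosh k - p' t n - a t n) - exp (- r' t (n - 1))) (at t)"
        using da[of n t] by simp
    qed
    have cross0: "\<exists>i j. i < j \<and> 1 \<le> a 0 i \<and> a 0 j < 1"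
      by (rule near_kink_crosses[OF kk(1) k(1), of "a 0" x0 \<eta>]) (use near0 small(5) in \<open>auto simp: ab0 \<eta>_def d0_def\<close>)
    have E1: "E \<le> \<eta>1" using small by (simp add: E_def)
    obtain m Y where low: "\<forall>t. Y t - 1 \<le> of_int (m t)"
      and Ysum: "\<forall>t N B F. N \<le> m t \<longrightarrow> (\<forall>F. finite F \<longrightarrow> F \<subseteq> {N..} \<longrightarrow> (\<Sum>n\<in>F. (\<bar>p' t n\<bar> + \<bar>r' t n\<bar>)\<^sup>2) \<le> B) \<longrightarrow>
            finite F \<longrightarrow> F \<subseteq> {N..} \<longrightarrow> (\<Sum>n\<in>F. (a t n - kink k (of_int n - Y t))\<^sup>2) \<le> C2 * B"
      and Yinc: "\<forall>t s J \<Phi>. 0 \<le> s \<longrightarrow> s \<le> 1 \<longrightarrow> J \<le> m t - 1 \<longrightarrow> J \<le> m (t + s) \<longrightarrow> \<Phi> \<le> 2 * E \<longrightarrow>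
          (\<forall>\<tau> n. t \<le> \<tau> \<longrightarrow> \<tau> \<le> t + 1 \<longrightarrow> J \<le> n \<longrightarrow> \<bar>p' \<tau> n\<bar> + \<bar>r' \<tau> n\<bar> \<le> \<Phi>) \<longrightarrow>
          \<bar>Y (t + s) - Y t - sinh k / k * s\<bar> \<le> K * \<Phi>"
      using KT[THEN spec[where x = k], THEN spec[where x = E], THEN spec[where x = a], THEN spec[where x = p'], THEN spec[where x = r'],
          THEN mp, THEN mp, THEN mp, THEN mp, THEN mp, OF k E1 KH cross0]
      by (elim exE conjE) (rule that; assumption)
    define c where "c = sinh k / k"
    (* The error of the increments of Y for all times: K times the bound 2 * E for the sum of both sequences. *)
    define D where "D = 10 * K * \<eta>"
    have D: "0 \<le> D" "3 * D \<le> 1" "D \<le> g" using small K \<eta>0 by (auto simp: D_def)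
    have inc: "\<bar>Y (t + s) - Y t - c * s\<bar> \<le> K * \<Phi>"
      if "0 \<le> s" "s \<le> 1" "J \<le> m t - 1" "J \<le> m (t + s)" "\<Phi> \<le> 2 * E"
        "\<forall>\<tau> n. t \<le> \<tau> \<longrightarrow> \<tau> \<le> t + 1 \<longrightarrow> J \<le> n \<longrightarrow> \<bar>p' \<tau> n\<bar> + \<bar>r' \<tau> n\<bar> \<le> \<Phi>" for t s J \<Phi>
      unfolding c_def
      by (rule Yinc[THEN spec[where x = t], THEN spec[where x = s], THEN spec[where x = J], THEN spec[where x = \<Phi>],
            THEN mp, THEN mp, THEN mp, THEN mp, THEN mp, THEN mp, OF that])
    have incD: "\<bar>Y (t + s) - Y t - c * s\<bar> \<le> D" if s: "0 \<le> s" "s \<le> 1" for t s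
    proof -
      have "\<bar>p' \<tau> n\<bar> + \<bar>r' \<tau> n\<bar> \<le> 2 * E" for \<tau> n using KH by (smt (verit))
      hence "\<bar>Y (t + s) - Y t - c * s\<bar> \<le> K * (2 * E)"
        by (intro inc[of s "min (m t - 1) (m (t + s))" t "2 * E"] s) auto
      thus ?thesis by (simp add: D_def E_def algebra_simps)
    qed
    have c_c0: "\<bar>c - c0\<bar> \<le> C9 * C1 * \<nu>"
    proof -
      have "\<bar>c - sinh \<kappa>0 / \<kappa>0\<bar> \<le> C9 * \<bar>k - \<kappa>0\<bar>" unfolding c_def using SP k kk by simp
      also have "\<dots> \<le> C9 * (C1 * \<nu>)" using k\<kappa> C9 by (intro mult_left_mono) auto
      finally show ?thesis unfolding \<kappa>0(2) by (simp add: mult.assoc)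
    qed
    hence "\<bar>c - c0\<bar> \<le> 2 * g" using small(8) by (simp add: \<eta>_def mult.assoc)
    moreover have "c0 = 1 + 8 * g" by (simp add: g_def field_simps)
    ultimately have cg: "1 + 6 * g \<le> c" by linarith
    define \<sigma>a where "\<sigma>a = 1 + 2 * g"
    obtain T0 where T0: "\<And>t. T0 \<le> t \<Longrightarrow> 0 \<le> t \<and> (1 + 4 * g) * t \<le> of_int (m t) \<and> 4 + 2 * g \<le> 2 * g * t \<and> 1 \<le> g * t"
    proof -
      define T0 where "T0 = max 0 ((\<bar>Y 0\<bar> + D + 10 + 10 * g) / g)"
      have "0 \<le> t \<and> (1 + 4 * g) * t \<le> of_int (m t) \<and> 4 + 2 * g \<le> 2 * g * t \<and> 1 \<le> g * t" if "T0 \<le> t" for t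
      proof -
        have t: "0 \<le> t" "(\<bar>Y 0\<bar> + D + 10 + 10 * g) / g \<le> t" using that by (auto simp: T0_def)
        hence gt: "\<bar>Y 0\<bar> + D + 10 + 10 * g \<le> g * t" using g by (simp add: field_simps)
        have "Y 0 + (c - D) * (t - 1) - D \<le> Y t"
          by (rule drift_lower_bound[OF incD]) (use cg g D t in auto)
        moreover have "(1 + 5 * g) * (t - 1) \<le> (c - D) * (t - 1)"
        proof (rule mult_right_mono)
          show "1 + 5 * g \<le> c - D" using cg D by linarith
          have "g \<le> g * t" using gt D g by linarith
          hence "1 * g \<le> t * g" by (simp only: mult.commute mult_1)
          hence "1 \<le> t" using g by (rule mult_right_le_imp_le)
          thus "0 \<le> t - 1" by simp
        qed
        moreover have "(1 + 5 * g) * (t - 1) = (1 + 4 * g) * t + g * t - 1 - 5 * g" by (simp add: algebra_simps)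
        moreover have "Y t - 1 \<le> of_int (m t)" using low by (rule spec)
        ultimately have "(1 + 4 * g) * t \<le> of_int (m t)" using gt g D by linarith
        moreover have "4 + 2 * g \<le> 2 * (g * t)" "1 \<le> g * t" using gt g D by linarith+
        ultimately show ?thesis using t by (simp add: mult.assoc)
      qed
      thus ?thesis by (rule that)
    qed
    have behind: "\<exists>T. \<forall>t\<ge>T. \<forall>F. finite F \<longrightarrow> F \<subseteq> {n. \<sigma>a * t \<le> of_int n} \<longrightarrow> (\<Sum>n\<in>F. (r' t n)\<^sup>2 + (p' t n)\<^sup>2) \<le> e"
      if "0 < e" for e
    proof -
      have "\<exists>T\<ge>0. \<forall>t\<ge>T. \<forall>F. finite F \<longrightarrow> F \<subseteq> {n. \<sigma>a * t \<le> of_int n} \<longrightarrow> (\<Sum>n\<in>F. (r' t n)\<^sup>2 + (p' t n)\<^sup>2) \<le> e"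
        by (rule small_toda_solution_left_behind[OF flow' Bd2 init' \<eta>0 small(2) \<mu> small(4), of "1 + g"])
           (use g that in \<open>auto simp: \<mu>_def \<sigma>a_def\<close>)
      thus ?thesis by blast
    qed
    have asym: "\<exists>T. \<forall>t\<ge>T. \<forall>s. 0 \<le> s \<longrightarrow> s \<le> 1 \<longrightarrow> \<bar>Y (t + s) - Y t - c * s\<bar> \<le> e" if e: "0 < e" for e
    (* The threshold \<phi> below has to be positive and at most 2 * E; for E = 0 the bound by D suffices. *)
    proof (cases "E = 0")
      case True
      hence "D = 0" by (simp add: E_def D_def)
      thus ?thesis using incD e by (metis order_trans less_imp_le)
    next
      case False
      hence E0: "0 < E" using \<eta>0 by (simp add: E_def)
      define \<phi> where "\<phi> = min (2 * E) (e / K)"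
      have \<phi>: "0 < \<phi>" "\<phi> \<le> 2 * E" "K * \<phi> \<le> e" using E0 e K by (auto simp: \<phi>_def field_simps min_def)
      obtain T1 where T1: "\<And>t F. T1 \<le> t \<Longrightarrow> finite F \<Longrightarrow> F \<subseteq> {n. \<sigma>a * t \<le> of_int n} \<Longrightarrow> (\<Sum>n\<in>F. (r' t n)\<^sup>2 + (p' t n)\<^sup>2) \<le> (\<phi> / 2)\<^sup>2"
        using behind[of "(\<phi> / 2)\<^sup>2"] \<phi> by auto
      have "\<bar>Y (t + s) - Y t - c * s\<bar> \<le> e" if t: "max T0 T1 \<le> t" and s: "0 \<le> s" "s \<le> 1" for t s
      proof -
        define J where "J = \<lceil>\<sigma>a * (t + 1)\<rceil>"
        have tt: "0 \<le> t" "(1 + 4 * g) * t \<le> of_int (m t)" "4 + 2 * g \<le> 2 * g * t" using T0[of t] t by auto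
        have ts: "(1 + 4 * g) * (t + s) \<le> of_int (m (t + s))" using T0[of "t + s"] t s by auto
        have Jb: "of_int J \<le> \<sigma>a * (t + 1) + 1" unfolding J_def by linarith
        have "\<sigma>a * (t + 1) + 1 = (1 + 4 * g) * t - 2 * g * t + 2 * g + 2" by (simp add: \<sigma>a_def algebra_simps)
        hence Jt: "of_int J \<le> (1 + 4 * g) * t - 2" using Jb tt by linarith
        have "(1 + 4 * g) * t \<le> (1 + 4 * g) * (t + s)" using g s by (intro mult_left_mono) auto
        hence J: "J \<le> m t - 1" "J \<le> m (t + s)" using Jt tt ts by linarith+
        have "\<bar>p' \<tau> n\<bar> + \<bar>r' \<tau> n\<bar> \<le> \<phi>" if \<tau>: "t \<le> \<tau>" "\<tau> \<le> t + 1" and n: "J \<le> n" for \<tau> n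
        proof -
          have "\<sigma>a * \<tau> \<le> \<sigma>a * (t + 1)" using \<tau> g by (intro mult_left_mono) (auto simp: \<sigma>a_def)
          also have "\<dots> \<le> of_int J" unfolding J_def by linarith
          also have "\<dots> \<le> of_int n" using n by simp
          finally have "(r' \<tau> n)\<^sup>2 + (p' \<tau> n)\<^sup>2 \<le> (\<phi> / 2)\<^sup>2" using T1[of \<tau> "{n}"] t \<tau> by simp
          hence "(r' \<tau> n)\<^sup>2 \<le> (\<phi> / 2)\<^sup>2" "(p' \<tau> n)\<^sup>2 \<le> (\<phi> / 2)\<^sup>2"
            using zero_le_power2[of "r' \<tau> n"] zero_le_power2[of "p' \<tau> n"] by linarith+
          hence "\<bar>r' \<tau> n\<bar> \<le> \<phi> / 2" "\<bar>p' \<tau> n\<bar> \<le> \<phi> / 2" using \<phi> by (simp_all only: power2_le_iff_abs_le[of "\<phi> / 2"] half_gt_zero less_imp_le)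
          thus ?thesis by linarith
        qed
        hence "\<bar>Y (t + s) - Y t - c * s\<bar> \<le> K * \<phi>" by (intro inc[OF s J \<phi>(2)] allI impI)
        thus ?thesis using \<phi>(3) by linarith
      qed
      thus ?thesis by blast
    qed
    obtain x where x: "x C1_differentiable_on UNIV" "\<And>t. \<bar>x t - Y t\<bar> \<le> 3 * D" "\<And>t. \<bar>deriv x t - c\<bar> \<le> 2 * D"
      "(deriv x \<longlongrightarrow> c) at_top" "((\<lambda>t. x t - Y t) \<longlongrightarrow> 0) at_top"
      using position_regularization[of Y c D, OF incD asym] by blast
    have xY: "\<bar>x t - Y t\<bar> \<le> 1" for t using x(2)[of t] D by linarith
    have SLk: "(\<Sum>n\<in>F. (norm (sol k (of_int n - Y t) - sol k (of_int n - x t)))\<^sup>2) \<le> (CL * \<bar>x t - Y t\<bar>)\<^sup>2" if "finite F" for t F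
      using SL[rule_format, OF k k xY that] by (simp add: abs_minus_commute)
    have f2: "(\<Sum>n\<in>F. (\<bar>p' t n\<bar> + \<bar>r' t n\<bar>)\<^sup>2) \<le> 2 * (\<Sum>n\<in>F. (r' t n)\<^sup>2 + (p' t n)\<^sup>2)" for t F
    proof -
      have "(\<bar>p' t n\<bar> + \<bar>r' t n\<bar>)\<^sup>2 \<le> 2 * ((r' t n)\<^sup>2 + (p' t n)\<^sup>2)" for n
        using square_add_le[of "\<bar>p' t n\<bar>" "\<bar>r' t n\<bar>"] by simp
      thus ?thesis unfolding sum_distrib_left by (rule sum_mono)
    qed
    have solY: "(\<Sum>n\<in>F. (norm ((r t n, p t n) - sol k (of_int n - Y t)))\<^sup>2) \<le> C3 * B"
      if N: "N \<le> m t" and SB: "\<forall>F. finite F \<longrightarrow> F \<subseteq> {N..} \<longrightarrow> (\<Sum>n\<in>F. (\<bar>p' t n\<bar> + \<bar>r' t n\<bar>)\<^sup>2) \<le> B"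
        and F: "finite F" "F \<subseteq> {N + 1..}" for t N B F
    proof -
      have SA: "\<forall>F. finite F \<longrightarrow> F \<subseteq> {N..} \<longrightarrow> (\<Sum>n\<in>F. (a t n - kink k (of_int n - Y t))\<^sup>2) \<le> C2 * B"
        using Ysum N SB by blast
      have KS: "\<forall>n. 0 < a t n \<and> 0 < b t n \<and> \<bar>p' t n\<bar> \<le> 1 \<and> \<bar>r' t n\<bar> \<le> ln 2 \<and>
        a t n + b t (n + 1) = 2 * cosh k - p' t n \<and> a t n * b t n = exp (- r' t (n - 1))"
      proof (intro allI conjI)
        fix n
        show "0 < a t n" "0 < b t n" by (rule pos)+
        have "\<bar>p' t n\<bar> \<le> 5 * \<eta>" by (rule sd)
        thus "\<bar>p' t n\<bar> \<le> 1" using small(2) by linarith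
        have "\<bar>r' t n\<bar> \<le> 5 * \<eta>" by (rule sd)
        thus "\<bar>r' t n\<bar> \<le> ln 2" using small(9) by linarith
        show "a t n + b t (n + 1) = 2 * cosh k - p' t n" by (simp add: p'_def \<alpha>_def)
        show "a t n * b t n = exp (- r' t (n - 1))" by (simp add: er')
      qed
      have "(\<Sum>n\<in>F. (norm ((- ln (a t n * b t (n + 1)), 2 * cosh k - a t n - b t n) - sol k (of_int n - Y t)))\<^sup>2) \<le> C3 * B"
        by (rule SK[THEN spec[where x = k], THEN spec[where x = "a t"], THEN spec[where x = "b t"], THEN spec[where x = "p' t"], THEN spec[where x = "r' t"],
            THEN spec[where x = N], THEN spec[where x = B], THEN spec[where x = "Y t"],
            THEN mp, THEN mp, THEN mp, THEN mp, THEN mp, THEN spec[where x = F], THEN mp, THEN mp, OF k KS SB SA F])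
      moreover have "- ln (a t n * b t (n + 1)) = r t n" "2 * cosh k - a t n - b t n = p t n" for n
        using fac[of t n] by (simp_all add: \<alpha>_def)
      ultimately show ?thesis by simp
    qed
    have near: "(\<Sum>n\<in>F. (norm ((r t n, p t n) - sol \<kappa>0 (of_int n - x t)))\<^sup>2) \<le> (C * \<nu>)\<^sup>2" if F: "finite F" for t F
    proof -
      (* The estimate over the whole lattice comes from half lines that start arbitrarily far to the left. *)
      define N where "N = min (m t) (Min (insert 0 F) - 1)"
      have FN: "F \<subseteq> {N + 1..}"
      proof
        fix n assume "n \<in> F"
        hence "Min (insert 0 F) \<le> n" using F by (intro Min_le) auto
        thus "n \<in> {N + 1..}" by (auto simp: N_def)
      qed
      have s1: "(\<Sum>n\<in>F. (norm ((r t n, p t n) - sol k (of_int n - Y t)))\<^sup>2) \<le> C3 * (50 * \<eta>\<^sup>2)"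
      proof (rule solY[of N t])
        show "\<forall>F. finite F \<longrightarrow> F \<subseteq> {N..} \<longrightarrow> (\<Sum>n\<in>F. (\<bar>p' t n\<bar> + \<bar>r' t n\<bar>)\<^sup>2) \<le> 50 * \<eta>\<^sup>2"
        proof (intro allI impI)
          fix G :: "int set" assume "finite G"
          from sd(2)[OF this, of t] f2[of t G] show "(\<Sum>n\<in>G. (\<bar>p' t n\<bar> + \<bar>r' t n\<bar>)\<^sup>2) \<le> 50 * \<eta>\<^sup>2"
            by (simp add: power_mult_distrib)
        qed
      qed (use F FN in \<open>auto simp: N_def\<close>)
      have "(CL * \<bar>x t - Y t\<bar>)\<^sup>2 \<le> (CL * (3 * D))\<^sup>2"
        using x(2)[of t] CL by (intro power_mono mult_left_mono) auto
      hence s2: "(\<Sum>n\<in>F. (norm (sol k (of_int n - Y t) - sol k (of_int n - x t)))\<^sup>2) \<le> (CL * (3 * D))\<^sup>2"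
        using SLk[OF F, of t] by linarith
      have "(\<Sum>n\<in>F. (norm (sol k (of_int n - x t) - sol \<kappa>0 (of_int n - x t)))\<^sup>2) \<le> (CL * (\<bar>k - \<kappa>0\<bar> + \<bar>x t - x t\<bar>))\<^sup>2"
        by (rule SL[rule_format]) (use k kk F in auto)
      also have "\<dots> \<le> (CL * \<eta>)\<^sup>2" using k\<kappa> CL by (intro power_mono mult_left_mono) (auto simp: \<eta>_def)
      finally have s3: "(\<Sum>n\<in>F. (norm (sol k (of_int n - x t) - sol \<kappa>0 (of_int n - x t)))\<^sup>2) \<le> (CL * \<eta>)\<^sup>2" .
      have "(\<Sum>n\<in>F. (norm ((r t n, p t n) - sol \<kappa>0 (of_int n - x t)))\<^sup>2)
          \<le> (\<Sum>n\<in>F. 3 * (norm ((r t n, p t n) - sol k (of_int n - Y t)))\<^sup>2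
              + 3 * (norm (sol k (of_int n - Y t) - sol k (of_int n - x t)))\<^sup>2
              + 3 * (norm (sol k (of_int n - x t) - sol \<kappa>0 (of_int n - x t)))\<^sup>2)"
        by (intro sum_mono norm_triangle3_square)
      also have "\<dots> = 3 * (\<Sum>n\<in>F. (norm ((r t n, p t n) - sol k (of_int n - Y t)))\<^sup>2)
              + 3 * (\<Sum>n\<in>F. (norm (sol k (of_int n - Y t) - sol k (of_int n - x t)))\<^sup>2)
              + 3 * (\<Sum>n\<in>F. (norm (sol k (of_int n - x t) - sol \<kappa>0 (of_int n - x t)))\<^sup>2)"
        by (simp only: sum.distrib sum_distrib_left)
      also have "\<dots> \<le> 3 * (C3 * (50 * \<eta>\<^sup>2)) + 3 * (CL * (3 * D))\<^sup>2 + 3 * (CL * \<eta>)\<^sup>2" using s1 s2 s3 by linarith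
      also have "\<dots> = C8\<^sup>2 * \<nu>\<^sup>2"
        unfolding C8sq by (simp add: D_def \<eta>_def power_mult_distrib algebra_simps)
      also have "\<dots> = (C8 * \<nu>)\<^sup>2" by (simp add: power_mult_distrib)
      also have "\<dots> \<le> (C * \<nu>)\<^sup>2" using C C80 \<nu> by (intro power_mono mult_right_mono) auto
      finally show ?thesis .
    qed
    define \<sigma> where "\<sigma> = 1 + 3 * g"
    have limit: "\<exists>T. \<forall>t\<ge>T. \<forall>F. finite F \<longrightarrow> F \<subseteq> {n. \<sigma> * t \<le> of_int n} \<longrightarrow>
        (\<Sum>n\<in>F. (norm ((r t n, p t n) - sol k (of_int n - x t)))\<^sup>2) \<le> e" if e: "0 < e" for e
    proof -
      define e1 where "e1 = e / (8 * C3)"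
      have e1: "0 < e1" using e C3 by (simp add: e1_def)
      obtain T1 where T1: "\<And>t F. T1 \<le> t \<Longrightarrow> finite F \<Longrightarrow> F \<subseteq> {n. \<sigma>a * t \<le> of_int n} \<Longrightarrow> (\<Sum>n\<in>F. (r' t n)\<^sup>2 + (p' t n)\<^sup>2) \<le> e1"
        using behind[OF e1] by auto
      define d where "d = sqrt (e / 4) / CL"
      have d: "0 < d" using e CL by (simp add: d_def)
      have "eventually (\<lambda>t. \<bar>x t - Y t\<bar> < d) at_top"
        using tendstoD[OF x(5) d] by (simp add: dist_real_def)
      then obtain T2 where T2: "\<And>t. T2 \<le> t \<Longrightarrow> \<bar>x t - Y t\<bar> < d" by (auto simp: eventually_at_top_linorder)
      have "(\<Sum>n\<in>F. (norm ((r t n, p t n) - sol k (of_int n - x t)))\<^sup>2) \<le> e"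
        if t: "max T0 (max T1 T2) \<le> t" and F: "finite F" "F \<subseteq> {n. \<sigma> * t \<le> of_int n}" for t F
      proof -
        have tt: "0 \<le> t" "(1 + 4 * g) * t \<le> of_int (m t)" "1 \<le> g * t" using T0[of t] t by auto
        have s: "\<sigma> * t = (1 + 4 * g) * t - g * t" "\<sigma>a * t = \<sigma> * t - g * t" by (simp_all add: \<sigma>_def \<sigma>a_def algebra_simps)
        define N where "N = \<lceil>\<sigma> * t\<rceil> - 1"
        have Nb: "of_int N \<le> \<sigma> * t" "\<sigma> * t - 1 \<le> of_int N" unfolding N_def by linarith+
        have Nm: "N \<le> m t" using Nb s tt by linarith
        have FN: "F \<subseteq> {N + 1..}" using F(2) by (auto simp: N_def ceiling_le_iff)
        have SB: "\<forall>G. finite G \<longrightarrow> G \<subseteq> {N..} \<longrightarrow> (\<Sum>n\<in>G. (\<bar>p' t n\<bar> + \<bar>r' t n\<bar>)\<^sup>2) \<le> 2 * e1"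
        proof (intro allI impI)
          fix G assume G: "finite G" "G \<subseteq> {N..}"
          have "G \<subseteq> {n. \<sigma>a * t \<le> of_int n}"
          proof
            fix n assume "n \<in> G"
            hence "N \<le> n" using G by auto
            thus "n \<in> {n. \<sigma>a * t \<le> of_int n}" using Nb s tt by simp
          qed
          from T1[OF _ G(1) this] t f2[of t G] show "(\<Sum>n\<in>G. (\<bar>p' t n\<bar> + \<bar>r' t n\<bar>)\<^sup>2) \<le> 2 * e1" by simp
        qed
        have s1: "(\<Sum>n\<in>F. (norm ((r t n, p t n) - sol k (of_int n - Y t)))\<^sup>2) \<le> C3 * (2 * e1)"
          by (rule solY[OF Nm SB F(1) FN])
        have "CL * \<bar>x t - Y t\<bar> \<le> sqrt (e / 4)" using T2[of t] t CL by (simp add: d_def field_simps)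
        hence "(CL * \<bar>x t - Y t\<bar>)\<^sup>2 \<le> (sqrt (e / 4))\<^sup>2" using CL by (intro power_mono) auto
        also have "\<dots> = e / 4" using e by simp
        finally have s2: "(\<Sum>n\<in>F. (norm (sol k (of_int n - Y t) - sol k (of_int n - x t)))\<^sup>2) \<le> e / 4"
          using SLk[OF F(1), of t] by linarith
        have "(\<Sum>n\<in>F. (norm ((r t n, p t n) - sol k (of_int n - x t)))\<^sup>2)
            \<le> (\<Sum>n\<in>F. 2 * (norm ((r t n, p t n) - sol k (of_int n - Y t)))\<^sup>2
                + 2 * (norm (sol k (of_int n - Y t) - sol k (of_int n - x t)))\<^sup>2)"
          by (intro sum_mono norm_triangle2_square)
        also have "\<dots> = 2 * (\<Sum>n\<in>F. (norm ((r t n, p t n) - sol k (of_int n - Y t)))\<^sup>2)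
                + 2 * (\<Sum>n\<in>F. (norm (sol k (of_int n - Y t) - sol k (of_int n - x t)))\<^sup>2)"
          by (simp only: sum.distrib sum_distrib_left)
        also have "\<dots> \<le> 2 * (C3 * (2 * e1)) + 2 * (e / 4)" using s1 s2 by linarith
        also have "\<dots> = e" using C3 by (simp add: e1_def)
        finally show ?thesis .
      qed
      thus ?thesis by blast
    qed
    have dx: "\<bar>deriv x t - c0\<bar> \<le> C * \<nu>" for t
    proof -
      have "\<bar>deriv x t - c0\<bar> \<le> 2 * D + C9 * C1 * \<nu>" using x(3)[of t] c_c0 by linarith
      also have "\<dots> = (C9 * C1 + 20 * K * C1) * \<nu>" by (simp add: D_def \<eta>_def algebra_simps)
      also have "\<dots> \<le> C * \<nu>" using C \<nu> by (intro mult_right_mono)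
      finally show ?thesis .
    qed
    have cC: "\<bar>c - c0\<bar> \<le> C * \<nu>" by (rule order_trans[OF c_c0 mult_right_mono[OF C(3) \<nu>(1)]])
    have \<sigma>: "1 < \<sigma>" "\<sigma> < c" using g cg by (auto simp: \<sigma>_def)
    show ?thesis
      by (rule exI[of _ k], rule exI[of _ \<sigma>], rule exI[of _ x], unfold c_def[symmetric])
         (intro conjI allI impI k0 \<sigma> x near limit cC dx)
  qed
  show ?thesis unfolding \<kappa>0_def[symmetric]
    by (rule exI[of _ \<delta>], rule conjI[OF \<delta>], rule exI[of _ C], rule conjI[OF C(1)], intro allI impI, rule main; assumption)
qed

theorem theorem1:
  fixes c0 \<tau>0 \<epsilon> :: real
  assumes "c0 > 1" and "\<epsilon> > 0"
  shows "\<exists>\<delta>>0. \<exists>C>0. \<forall>v0\<in>l2. l2_norm v0 < \<delta> \<longrightarrow>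
    (\<forall>u. toda_solution u \<and> u 0 = (\<lambda>n. soliton c0 \<tau>0 n + v0 n) \<longrightarrow>
      (\<exists>c_plus \<sigma> :: real. \<exists>x c :: real \<Rightarrow> real.
         c_plus > 1 \<and> 1 < \<sigma> \<and> \<sigma> < c_plus \<and>
         x C1_differentiable_on UNIV \<and> c C1_differentiable_on UNIV \<and>
         (\<forall>t. l2_norm (\<lambda>n. u t n - u_tilde c0 (real_of_int n - x t)) < \<epsilon>) \<and>
         ((\<lambda>t. l2_norm_on {n. real_of_int n \<ge> \<sigma> * t}
                 (\<lambda>n. u t n - u_tilde c_plus (real_of_int n - x t))) \<longlongrightarrow> 0) at_top \<and>
         (\<forall>t. \<bar>c t - c0\<bar> + \<bar>deriv x t - c0\<bar> \<le> C * l2_norm v0) \<and>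
         (c \<longlongrightarrow> c_plus) at_top \<and>
         (deriv x \<longlongrightarrow> c_plus) at_top))"
proof -
  obtain \<delta>1 C where \<delta>1: "\<delta>1 > 0" and C: "C > 0" and core: "\<forall>\<nu> x0 r p. 0 \<le> \<nu> \<longrightarrow> \<nu> < \<delta>1 \<longrightarrow> toda_flow r p \<longrightarrow>
      (\<forall>T. \<exists>B. \<forall>t n. \<bar>t\<bar> \<le> T \<longrightarrow> \<bar>r t n\<bar> \<le> B \<and> \<bar>p t n\<bar> \<le> B) \<longrightarrow>
      (\<forall>F. finite F \<longrightarrow> (\<Sum>n\<in>F. (r 0 n - fst (sol (kappa c0) (of_int n - x0)))\<^sup>2 + (p 0 n - snd (sol (kappa c0) (of_int n - x0)))\<^sup>2) \<le> \<nu>\<^sup>2) \<longrightarrow>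
    (\<exists>k \<sigma> x. 0 < k \<and> 1 < \<sigma> \<and> \<sigma> < sinh k / k \<and> x C1_differentiable_on UNIV \<and>
      (\<forall>t F. finite F \<longrightarrow> (\<Sum>n\<in>F. (norm ((r t n, p t n) - sol (kappa c0) (of_int n - x t)))\<^sup>2) \<le> (C * \<nu>)\<^sup>2) \<and>
      (\<forall>e>0. \<exists>T. \<forall>t\<ge>T. \<forall>F. finite F \<longrightarrow> F \<subseteq> {n. \<sigma> * t \<le> of_int n} \<longrightarrow>
        (\<Sum>n\<in>F. (norm ((r t n, p t n) - sol k (of_int n - x t)))\<^sup>2) \<le> e) \<and>
      \<bar>sinh k / k - c0\<bar> \<le> C * \<nu> \<and> (\<forall>t. \<bar>deriv x t - c0\<bar> \<le> C * \<nu>) \<and> (deriv x \<longlongrightarrow> sinh k / k) at_top)"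
    using stability_of_sequences[OF assms(1)] by (elim exE conjE) (rule that; assumption)
  define \<delta> where "\<delta> = min \<delta>1 (\<epsilon> / C)"
  have \<delta>: "0 < \<delta>" using \<delta>1 C assms by (simp add: \<delta>_def)
  have "\<exists>c_plus \<sigma> :: real. \<exists>x c :: real \<Rightarrow> real.
         c_plus > 1 \<and> 1 < \<sigma> \<and> \<sigma> < c_plus \<and>
         x C1_differentiable_on UNIV \<and> c C1_differentiable_on UNIV \<and>
         (\<forall>t. l2_norm (\<lambda>n. u t n - u_tilde c0 (real_of_int n - x t)) < \<epsilon>) \<and>
         ((\<lambda>t. l2_norm_on {n. real_of_int n \<ge> \<sigma> * t}
                 (\<lambda>n. u t n - u_tilde c_plus (real_of_int n - x t))) \<longlongrightarrow> 0) at_top \<and>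
         (\<forall>t. \<bar>c t - c0\<bar> + \<bar>deriv x t - c0\<bar> \<le> (2 * C) * l2_norm v0) \<and>
         (c \<longlongrightarrow> c_plus) at_top \<and>
         (deriv x \<longlongrightarrow> c_plus) at_top"
    if v0: "v0 \<in> l2" "l2_norm v0 < \<delta>" and sol: "toda_solution u" and u0: "u 0 = (\<lambda>n. soliton c0 \<tau>0 n + v0 n)" for v0 u
  proof -
    define r where "r = (\<lambda>t n. fst (u t n))"
    define p where "p = (\<lambda>t n. snd (u t n))"
    define \<nu> where "\<nu> = l2_norm v0"
    have \<nu>: "0 \<le> \<nu>" "\<nu> < \<delta>1" "C * \<nu> < \<epsilon>"
      using v0(2) C by (auto simp: \<nu>_def \<delta>_def l2_norm_nonneg field_simps)
    have flow: "toda_flow r p" unfolding r_def p_def by (rule toda_solution_flow[OF sol])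
    have Bd: "\<forall>T. \<exists>B. \<forall>t n. \<bar>t\<bar> \<le> T \<longrightarrow> \<bar>r t n\<bar> \<le> B \<and> \<bar>p t n\<bar> \<le> B"
      unfolding r_def p_def by (rule allI) (rule toda_solution_locally_bounded[OF sol])
    have init: "\<forall>F. finite F \<longrightarrow> (\<Sum>n\<in>F. (r 0 n - fst (sol (kappa c0) (of_int n - c0 * \<tau>0)))\<^sup>2
        + (p 0 n - snd (sol (kappa c0) (of_int n - c0 * \<tau>0)))\<^sup>2) \<le> \<nu>\<^sup>2"
      using l2_finite_sum_le[OF v0(1)]
      by (simp add: r_def p_def u0 soliton_def u_tilde_sol[OF assms(1)] \<nu>_def norm_prod_square)
    obtain k \<sigma> x where k: "0 < k" and \<sigma>: "1 < \<sigma>" "\<sigma> < sinh k / k" and x: "x C1_differentiable_on UNIV"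
      and near: "\<forall>t F. finite F \<longrightarrow> (\<Sum>n\<in>F. (norm ((r t n, p t n) - sol (kappa c0) (of_int n - x t)))\<^sup>2) \<le> (C * \<nu>)\<^sup>2"
      and lim: "\<forall>e>0. \<exists>T. \<forall>t\<ge>T. \<forall>F. finite F \<longrightarrow> F \<subseteq> {n. \<sigma> * t \<le> of_int n} \<longrightarrow>
        (\<Sum>n\<in>F. (norm ((r t n, p t n) - sol k (of_int n - x t)))\<^sup>2) \<le> e"
      and cc: "\<bar>sinh k / k - c0\<bar> \<le> C * \<nu>" and dx: "\<forall>t. \<bar>deriv x t - c0\<bar> \<le> C * \<nu>"
      and dlim: "(deriv x \<longlongrightarrow> sinh k / k) at_top"
      using core[THEN spec[where x = \<nu>], THEN spec[where x = "c0 * \<tau>0"], THEN spec[where x = r], THEN spec[where x = p],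
          THEN mp, THEN mp, THEN mp, THEN mp, THEN mp, OF \<nu>(1,2) flow Bd init]
      by (elim exE conjE) (rule that; assumption)
    (* The rate k does not depend on time, so the constant c serves as speed function and as its limit. *)
    define c where "c = sinh k / k"
    have c1: "1 < c" unfolding c_def by (rule soliton_speed_gt_1[OF k])
    have up: "(r t n, p t n) = u t n" for t n by (simp add: r_def p_def)
    have uc: "u_tilde c z = sol k z" for z
      unfolding u_tilde_sol[OF c1] by (simp add: c_def kappa_soliton_speed[OF k])
    have orbital: "l2_norm (\<lambda>n. u t n - u_tilde c0 (real_of_int n - x t)) < \<epsilon>" for t
    proof -
      have "l2_norm (\<lambda>n. u t n - u_tilde c0 (real_of_int n - x t)) \<le> C * \<nu>"
        by (rule l2_norm_on_le) (use C \<nu> near in \<open>simp_all add: u_tilde_sol[OF assms(1)] up\<close>)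
      thus ?thesis using \<nu>(3) by linarith
    qed
    have conv: "((\<lambda>t. l2_norm_on {n. real_of_int n \<ge> \<sigma> * t}
                 (\<lambda>n. u t n - u_tilde c (real_of_int n - x t))) \<longlongrightarrow> 0) at_top"
    proof (rule tendstoI)
      fix e :: real assume e: "0 < e"
      obtain T where T: "\<And>t F. T \<le> t \<Longrightarrow> finite F \<Longrightarrow> F \<subseteq> {n. \<sigma> * t \<le> of_int n} \<Longrightarrow>
        (\<Sum>n\<in>F. (norm (u t n - sol k (of_int n - x t)))\<^sup>2) \<le> (e / 2)\<^sup>2"
        using lim[THEN spec[where x = "(e / 2)\<^sup>2"]] e unfolding up by auto
      show "eventually (\<lambda>t. dist (l2_norm_on {n. real_of_int n \<ge> \<sigma> * t}
                 (\<lambda>n. u t n - u_tilde c (real_of_int n - x t))) 0 < e) at_top"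
      proof (rule eventually_at_top_linorderI[of T])
        fix t assume "T \<le> t"
        hence "l2_norm_on {n. real_of_int n \<ge> \<sigma> * t} (\<lambda>n. u t n - u_tilde c (real_of_int n - x t)) \<le> e / 2"
          using e T by (intro l2_norm_on_le) (auto simp: uc)
        moreover have "0 \<le> l2_norm_on {n. real_of_int n \<ge> \<sigma> * t} (\<lambda>n. u t n - u_tilde c (real_of_int n - x t))"
          by (simp add: l2_norm_on_def infsum_nonneg)
        ultimately show "dist (l2_norm_on {n. real_of_int n \<ge> \<sigma> * t}
                 (\<lambda>n. u t n - u_tilde c (real_of_int n - x t))) 0 < e" using e by (simp add: dist_real_def)
      qed
    qed
    have speed: "\<bar>c - c0\<bar> + \<bar>deriv x t - c0\<bar> \<le> (2 * C) * l2_norm v0" for t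
      using cc dx[THEN spec[where x = t]] unfolding c_def \<nu>_def by linarith
    show ?thesis
      by (rule exI[of _ c], rule exI[of _ \<sigma>], rule exI[of _ x], rule exI[of _ "\<lambda>_. c"])
         (use c1 \<sigma> x orbital conv speed dlim in \<open>simp add: c_def[symmetric]\<close>)
  qed
  thus ?thesis using \<delta> C by (intro exI[of _ \<delta>] conjI exI[of _ "2 * C"]) auto
qed

end
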